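(* Let $N,k\ge1$ be integers, $\rho>1$, $1\le p<\infty$ with $p>\frac{N+2k}{2}(\rho-1)$, and $u_0\in L^p(\mathbb{R}^{N+k})$. Consider $$u_t-\Delta_{\mathcal G}u=|u|^{\rho-1}u\ \text{ in }\mathbb{R}^{N+k},\ t>0,\qquad u(0)=u_0, \qquad (\ast)$$ and let $u$ be the local $L^p$-mild solution of $(\ast)$, defined on some interval $[0,T]$ with $T>0$ and unique in the class $X_\alpha\cap E$ on $[0,T]$. Then there exist $\bar T>T$ and a unique continuation of $u$ on $[0,\bar T]$ (in the class $X_\alpha\cap E$ on $[0,\bar T]$). Moreover, there exists a maximal solution of $(\ast)$, defined on $[0,T_m)$ and extending $u$ (still denoted $u$), such that if $T_m<\infty$ then $$\lim_{t\to T_m^-}\|u(t)\|_{L^{\rho p}(\mathbb{R}^{N+k})}=+\infty .$$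
   Context: Here $\Delta_{\mathcal G}=\frac12(\Delta_x+|x|^2\Delta_y)$ is the Grushin operator, with $x\in\mathbb{R}^N$, $y\in\mathbb{R}^k$. Its heat semigroup is $S_{\mathcal G}(0)=I$ and, for $t>0$, $S_{\mathcal G}(t)\varphi(x,y)=\int_{\mathbb{R}^{N+k}}K(x,w,y-z;t)\varphi(w,z)\,d(w,z)$, where $$K(x,w,y;t)=\frac{1}{(2\pi)^{\frac{N+2k}{2}}}\int_{\mathbb{R}^k}\left(\frac{|\xi|}{\sinh(|\xi|t)}\right)^{\frac N2}e^{\,i\xi\cdot y-\frac{|\xi|}{2}\left((|x|^2+|w|^2)\coth(|\xi|t)-2x\cdot w\,\operatorname{csch}(|\xi|t)\right)}\,d\xi ,\quad \operatorname{csch}=1/\sinh.$$ For an interval $[0,T]$ put $\alpha=\frac{N+2k}{2\rho p}(\rho-1)$, $E=C([0,T];L^p(\mathbb{R}^{N+k}))$, and $$X_\alpha=\Big\{u\in C((0,T];L^{\rho p}(\mathbb{R}^{N+k})):\ \|u\|_{X_\alpha}=\sup_{t\in(0,T]}t^\alpha\|u(t)\|_{L^{\rho p}}<\infty\Big\}.$$ An $L^p$-mild solution on $[0,T]$ with initial datum $u_0$ is a continuous function $u:[0,T]\to L^p(\mathbb{R}^{N+k})$ satisfying $$u(t)=S_{\mathcal G}(t)u_0+\int_0^tS_{\mathcal G}(t-s)|u(s)|^{\rho-1}u(s)\,ds,\qquad t\in[0,T].$$ Under the hypotheses of the claim, it is known that such a solution exists in $X_\alpha\cap E$ for some $T>0$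 and is unique in that class. A continuation of an $L^p$-mild solution $u:[0,T]\to L^p(\mathbb{R}^{N+k})$ on $[0,\bar T]$ is an $L^p$-mild solution $\bar u:[0,\bar T]\to L^p(\mathbb{R}^{N+k})$ with the same initial datum, with $\bar T>T$ and $\bar u(t)=u(t)$ for all $t\in[0,T]$. A maximal solution is an extension of $u$ defined on some $[0,T_m)$, $T_m\in(0,\infty]$ (a mild solution in $X_\alpha\cap E$ on every $[0,T']$ with $T'<T_m$), that cannot be extended further. *)

theory Defs
  imports "HOL-Analysis.Analysis"
begin

section \<open>Lebesgue spaces\<close>

text \<open>
  Elements of \<open>L\<^sup>p\<close> are represented by Borel functions; equality in \<open>L\<^sup>p\<close> is equality almost
  everywhere and has to be stated explicitly.
\<close>

definition Lp :: "real \<Rightarrow> ('a::euclidean_space \<Rightarrow> real) set" where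
  "Lp p = {f \<in> borel_measurable lborel. integrable lborel (\<lambda>x. \<bar>f x\<bar> powr p)}"

definition Lp_norm :: "real \<Rightarrow> ('a::euclidean_space \<Rightarrow> real) \<Rightarrow> real" where
  "Lp_norm p f = (\<integral>x. \<bar>f x\<bar> powr p \<partial>lborel) powr (1 / p)"

definition eLp_norm :: "real \<Rightarrow> ('a::euclidean_space \<Rightarrow> real) \<Rightarrow> ennreal" where
  "eLp_norm p f = (if f \<in> Lp p then ennreal (Lp_norm p f) else \<infinity>)"

definition Lp_continuous_on :: "real set \<Rightarrow> real \<Rightarrow> (real \<Rightarrow> 'a::euclidean_space \<Rightarrow> real) \<Rightarrow> bool" where
  "Lp_continuous_on S p u \<longleftrightarrow>
     (\<forall>t\<in>S. u t \<in> Lp p) \<and>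
     (\<forall>t\<in>S. ((\<lambda>s. Lp_norm p (\<lambda>x. u s x - u t x)) \<longlongrightarrow> 0) (at t within S))"


section \<open>The Bochner integral with values in a Lebesgue space\<close>

text \<open>
  The library's Bochner integral needs a Banach space that is a type, which \<open>L\<^sup>p\<close> is not, so
  the usual definition through approximation by simple functions is repeated here. A list of
  pairs \<open>(A, g)\<close> stands for the \<open>L\<^sup>p\<close>-valued simple function \<open>\<Sum> 1\<^sub>A g\<close>.
\<close>

definition Lp_simple :: "'s measure \<Rightarrow> real \<Rightarrow> ('s set \<times> ('a::euclidean_space \<Rightarrow> real)) list \<Rightarrow> bool" where
  "Lp_simple M p \<sigma> \<longleftrightarrow> (\<forall>(A, g)\<in>set \<sigma>. A \<in> sets M \<and> emeasure M A < \<infinity> \<and> g \<in> Lp p)"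

definition simple_fun :: "('s set \<times> ('a \<Rightarrow> real)) list \<Rightarrow> 's \<Rightarrow> 'a \<Rightarrow> real" where
  "simple_fun \<sigma> s x = (\<Sum>(A, g)\<leftarrow>\<sigma>. indicator A s * g x)"

definition simple_integral :: "'s measure \<Rightarrow> ('s set \<times> ('a \<Rightarrow> real)) list \<Rightarrow> 'a \<Rightarrow> real" where
  "simple_integral M \<sigma> x = (\<Sum>(A, g)\<leftarrow>\<sigma>. measure M A * g x)"

definition has_Lp_integral ::
  "'s measure \<Rightarrow> real \<Rightarrow> ('s \<Rightarrow> 'a::euclidean_space \<Rightarrow> real) \<Rightarrow> ('a \<Rightarrow> real) \<Rightarrow> bool" where
  "has_Lp_integral M p f I \<longleftrightarrow> I \<in> Lp p \<and>
     (\<exists>\<sigma>. (\<forall>n::nat. Lp_simple M p (\<sigma> n)) \<and>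
          (AE s in M. (\<lambda>n. eLp_norm p (\<lambda>x. f s x - simple_fun (\<sigma> n) s x)) \<longlonglongrightarrow> 0) \<and>
          (\<lambda>n. \<integral>\<^sup>+ s. eLp_norm p (\<lambda>x. f s x - simple_fun (\<sigma> n) s x) \<partial>M) \<longlonglongrightarrow> 0 \<and>
          (\<lambda>n. eLp_norm p (\<lambda>x. I x - simple_integral M (\<sigma> n) x)) \<longlonglongrightarrow> 0)"


section \<open>The Grushin heat semigroup\<close>

definition grushin_integrand ::
  "real^'n \<Rightarrow> real^'n \<Rightarrow> real^'k \<Rightarrow> real \<Rightarrow> real^'k \<Rightarrow> complex" where
  "grushin_integrand x w y t \<xi> =
     of_real ((norm \<xi> / sinh (norm \<xi> * t)) powr (real CARD('n) / 2)) *
     exp (\<i> * of_real (\<xi> \<bullet> y) -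
          of_real (norm \<xi> / 2 *
            (((norm x)\<^sup>2 + (norm w)\<^sup>2) * (cosh (norm \<xi> * t) / sinh (norm \<xi> * t)) -
             2 * (x \<bullet> w) * (1 / sinh (norm \<xi> * t)))))"

text \<open>
  The defining integral of the kernel is complex but its value is real, see
  \<open>of_real_grushin_kernel\<close> below.
\<close>

definition grushin_kernel :: "real^'n \<Rightarrow> real^'n \<Rightarrow> real^'k \<Rightarrow> real \<Rightarrow> real" where
  "grushin_kernel x w y t =
     Re (of_real (1 / (2 * pi) powr (real (CARD('n) + 2 * CARD('k)) / 2)) *
         (\<integral>\<xi>. grushin_integrand x w y t \<xi> \<partial>lborel))"

lemma of_real_grushin_kernel:
  fixes x w :: "real^'n" and y :: "real^'k"
  shows "complex_of_real (grushin_kernel x w y t) =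
     of_real (1 / (2 * pi) powr (real (CARD('n) + 2 * CARD('k)) / 2)) *
     (\<integral>\<xi>. grushin_integrand x w y t \<xi> \<partial>lborel)"
proof -
  let ?f = "grushin_integrand x w y t"
  have cnj: "cnj (?f \<xi>) = ?f (- \<xi>)" for \<xi>
    by (simp add: grushin_integrand_def exp_cnj)
  have meas: "?f \<in> borel_measurable borel"
    unfolding grushin_integrand_def sinh_def cosh_def by measurable
  have lb: "lborel = distr (lborel :: (real^'k) measure) borel uminus"
    using lborel_affine[of "-1" "0 :: real^'k"] by (simp add: density_1 one_ennreal_def[symmetric])
  have "cnj (\<integral>\<xi>. ?f \<xi> \<partial>lborel) = (\<integral>\<xi>. ?f (- \<xi>) \<partial>lborel)"
    by (simp flip: cnj)
  also have "\<dots> = (\<integral>\<xi>. ?f \<xi> \<partial>distr lborel borel uminus)"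
    by (rule integral_distr[symmetric]) (use meas in auto)
  also have "\<dots> = (\<integral>\<xi>. ?f \<xi> \<partial>lborel)"
    by (simp flip: lb)
  finally have "(\<integral>\<xi>. ?f \<xi> \<partial>lborel) \<in> \<real>"
    by (simp add: Reals_cnj_iff)
  then show ?thesis
    unfolding grushin_kernel_def by (intro of_real_Re Reals_mult) auto
qed

definition grushin_semigroup ::
  "real \<Rightarrow> ((real^'n) \<times> (real^'k) \<Rightarrow> real) \<Rightarrow> (real^'n) \<times> (real^'k) \<Rightarrow> real" where
  "grushin_semigroup t \<phi> =
     (if t = 0 then \<phi>
      else (\<lambda>(x, y). \<integral>v. (case v of (w, z) \<Rightarrow> grushin_kernel x w (y - z) t * \<phi> (w, z)) \<partial>lborel))"


section \<open>Mild solutions\<close>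

definition mild_solution ::
  "real \<Rightarrow> real \<Rightarrow> ((real^'n) \<times> (real^'k) \<Rightarrow> real) \<Rightarrow> real \<Rightarrow>
   (real \<Rightarrow> (real^'n) \<times> (real^'k) \<Rightarrow> real) \<Rightarrow> bool" where
  "mild_solution \<rho> p u0 T u \<longleftrightarrow>
     Lp_continuous_on {0..T} p u \<and>
     (\<forall>t\<in>{0..T}. \<exists>I.
        has_Lp_integral (restrict_space lborel {0..t}) p
          (\<lambda>s. grushin_semigroup (t - s) (\<lambda>q. \<bar>u s q\<bar> powr (\<rho> - 1) * u s q)) I \<and>
        (AE q in lborel. u t q = grushin_semigroup t u0 q + I q))"

definition grushin_alpha :: "nat \<Rightarrow> nat \<Rightarrow> real \<Rightarrow> real \<Rightarrow> real" where
  "grushin_alpha N k \<rho> p = real (N + 2 * k) / (2 * \<rho> * p) * (\<rho> - 1)"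

definition X_norm ::
  "real \<Rightarrow> real \<Rightarrow> real \<Rightarrow> (real \<Rightarrow> (real^'n) \<times> (real^'k) \<Rightarrow> real) \<Rightarrow> ennreal" where
  "X_norm \<rho> p T u =
     (SUP t\<in>{0<..T}. ennreal (t powr grushin_alpha CARD('n) CARD('k) \<rho> p) * eLp_norm (\<rho> * p) (u t))"

definition X_space ::
  "real \<Rightarrow> real \<Rightarrow> real \<Rightarrow> (real \<Rightarrow> (real^'n) \<times> (real^'k) \<Rightarrow> real) set" where
  "X_space \<rho> p T = {u. Lp_continuous_on {0<..T} (\<rho> * p) u \<and> X_norm \<rho> p T u < \<infinity>}"

definition E_space ::
  "real \<Rightarrow> real \<Rightarrow> (real \<Rightarrow> (real^'n) \<times> (real^'k) \<Rightarrow> real) set" where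
  "E_space p T = {u. Lp_continuous_on {0..T} p u}"

definition XE_solution ::
  "real \<Rightarrow> real \<Rightarrow> ((real^'n) \<times> (real^'k) \<Rightarrow> real) \<Rightarrow> real \<Rightarrow>
   (real \<Rightarrow> (real^'n) \<times> (real^'k) \<Rightarrow> real) \<Rightarrow> bool" where
  "XE_solution \<rho> p u0 T u \<longleftrightarrow> mild_solution \<rho> p u0 T u \<and> u \<in> X_space \<rho> p T \<inter> E_space p T"

definition agree_on :: "real set \<Rightarrow> (real \<Rightarrow> 'a::euclidean_space \<Rightarrow> real) \<Rightarrow> (real \<Rightarrow> 'a \<Rightarrow> real) \<Rightarrow> bool" where
  "agree_on S u v \<longleftrightarrow> (\<forall>t\<in>S. AE q in lborel. u t q = v t q)"

definition continuation ::
  "real \<Rightarrow> real \<Rightarrow> ((real^'n) \<times> (real^'k) \<Rightarrow> real) \<Rightarrow> real \<Rightarrow>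
   (real \<Rightarrow> (real^'n) \<times> (real^'k) \<Rightarrow> real) \<Rightarrow> real \<Rightarrow>
   (real \<Rightarrow> (real^'n) \<times> (real^'k) \<Rightarrow> real) \<Rightarrow> bool" where
  "continuation \<rho> p u0 T u T' u' \<longleftrightarrow>
     T < T' \<and> mild_solution \<rho> p u0 T' u' \<and> agree_on {0..T} u' u"

text \<open>
  A solution on \<open>[0, T\<^sub>m)\<close> is maximal if it has no extension to any interval that is strictly
  larger than \<open>[0, T\<^sub>m)\<close>. Every such interval contains a compact one \<open>[0, T']\<close> with
  \<open>T\<^sub>m \<le> T' < \<infinity>\<close>, so it suffices to exclude the latter.
\<close>

definition maximal_solution ::
  "real \<Rightarrow> real \<Rightarrow> ((real^'n) \<times> (real^'k) \<Rightarrow> real) \<Rightarrow> ereal \<Rightarrow>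
   (real \<Rightarrow> (real^'n) \<times> (real^'k) \<Rightarrow> real) \<Rightarrow> bool" where
  "maximal_solution \<rho> p u0 Tm u \<longleftrightarrow>
     0 < Tm \<and>
     (\<forall>T'>0. ereal T' < Tm \<longrightarrow> XE_solution \<rho> p u0 T' u) \<and>
     \<not> (\<exists>T' v. Tm \<le> ereal T' \<and> XE_solution \<rho> p u0 T' v \<and>
               agree_on {t. 0 \<le> t \<and> ereal t < Tm} v u)"

end

theory Submission
  imports Defs "HOL-Probability.Probability" "HOL-Real_Asymp.Real_Asymp"
begin

text \<open>
  The partial Fourier transform in \<open>y\<close> turns the Grushin kernel into the Mehler kernel of the
  oscillator with frequency \<open>|\<xi>|\<close>. Gaussian integrals give the semigroup law for the latter, and a
  Trotter product shows that it is positive definite in \<open>\<xi>\<close>. Hence the Grushin kernel is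
  nonnegative, has mass one, satisfies the Chapman-Kolmogorov equation and, by scaling, is bounded by
  a multiple of \<open>t powr -(N + 2k)/2\<close>. Interpolation yields
  \<open>\<parallel>S(t)\<phi>\<parallel>\<^sub>q \<le> C t powr -\<alpha> \<parallel>\<phi>\<parallel>\<^sub>p\<close> for \<open>q = \<rho>p\<close>, with \<open>\<alpha>\<rho> < 1\<close> by the assumption on \<open>p\<close>.

  By the semigroup law a mild solution may be restarted at any time \<open>a > 0\<close> with initial datum \<open>u(a)\<close>.
  The restarted equation is solved by a contraction in the supremum norm of \<open>L\<^sup>q\<close> on a time step that
  depends only on \<open>\<parallel>u(a)\<parallel>\<^sub>q\<close>; this gives unique continuation. Gluing all continuations produces a maximal
  solution, and since the time step is controlled by \<open>\<parallel>u(a)\<parallel>\<^sub>q\<close> alone, this norm must tend to infinity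
  at a finite maximal time. Continuity in time at positive times only uses that the kernels are
  continuous in \<open>L\<^sup>1\<close> away from \<open>t = 0\<close>; at \<open>t = 0\<close> it is inherited from the given solution.

  Paths in \<open>L\<^sup>p\<close> are replaced by jointly measurable representatives, for which the Bochner integral
  is a pointwise integral and Minkowski's inequality holds.
\<close>

text \<open>The inverse Fourier integral of the kernel oscillates in \<open>y\<close>, so neither
  its sign nor its integrability in \<open>y\<close> can be read off the formula. Without them there
  is no L^p contraction and no exchange of integrals in the semigroup law, which is why positive
  definiteness of the symbol comes before everything else. The time exponent (N + 2k)/2 is N/2 from
  the prefactor of the Mehler kernel plus k from rescaling \<xi> by t. A function in X_\<alpha> has
  a source whose L^p norm is of order s powr -(\<alpha> \<rho>) at time zero, so \<alpha> \<rho> < 1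
  is integrability at the lower end of the Duhamel integral; smoothing from L^p to L^q costs (t - s)
  powr -\<alpha>, integrable at the upper end. No fixed point is solved from time zero: every
  competitor agrees with the given u on [0, T] and T > 0, so comparison and extension take place
  where the L^q norms are bounded, and unweighted norms suffice there.\<close>

abbreviation jointly_measurable :: "(real \<Rightarrow> 'a::euclidean_space \<Rightarrow> real) \<Rightarrow> bool" where
  "jointly_measurable g \<equiv> case_prod g \<in> borel_measurable (borel \<Otimes>\<^sub>M borel)"

section \<open>Bounds in Lebesgue spaces\<close>

text \<open>One predicate carries measurability, finiteness and the norm bound, so that estimates
  chain without separate integrability goals. The conjunct \<open>0 \<le> a\<close> lets
  \<open>a\<close> be recovered from \<open>a powr p\<close>.\<close>

definition Lp_le :: "real \<Rightarrow> ('a::euclidean_space \<Rightarrow> real) \<Rightarrow> real \<Rightarrow> bool" where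
  "Lp_le p f a \<longleftrightarrow> f \<in> borel_measurable borel \<and> 0 \<le> a \<and>
     (\<integral>\<^sup>+x. ennreal (\<bar>f x\<bar> powr p) \<partial>lborel) \<le> ennreal (a powr p)"

lemma Lp_le_measurable: "Lp_le p f a \<Longrightarrow> f \<in> borel_measurable borel"
  and Lp_le_nonneg: "Lp_le p f a \<Longrightarrow> 0 \<le> a"
  by (auto simp: Lp_le_def)

lemma Lp_le_imp_Lp:
  assumes "Lp_le p f a" "0 < p"
  shows "f \<in> Lp p" "Lp_norm p f \<le> a"
proof -
  have [measurable]: "f \<in> borel_measurable borel" and a: "0 \<le> a"
    and le: "(\<integral>\<^sup>+x. ennreal (\<bar>f x\<bar> powr p) \<partial>lborel) \<le> ennreal (a powr p)"
    using assms by (auto simp: Lp_le_def)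
  have int: "integrable lborel (\<lambda>x. \<bar>f x\<bar> powr p)"
    using le by (intro integrableI_bounded) (auto simp: top.extremum_strict order.strict_trans1)
  then show "f \<in> Lp p" by (simp add: Lp_def)
  have "ennreal (\<integral>x. \<bar>f x\<bar> powr p \<partial>lborel) \<le> ennreal (a powr p)"
    using le int by (subst nn_integral_eq_integral[symmetric]) auto
  then have "(\<integral>x. \<bar>f x\<bar> powr p \<partial>lborel) \<le> a powr p" by (simp add: ennreal_le_iff)
  then have "Lp_norm p f \<le> (a powr p) powr (1 / p)"
    unfolding Lp_norm_def using \<open>0 < p\<close> by (intro powr_mono2) auto
  then show "Lp_norm p f \<le> a"
    using a \<open>0 < p\<close> by (simp add: powr_powr)
qed

lemma Lp_norm_nonneg: "0 \<le> Lp_norm p f"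
  by (simp add: Lp_norm_def)

lemma Lp_le_Lp_norm:
  assumes "f \<in> Lp p" "0 < p"
  shows "Lp_le p f (Lp_norm p f)"
proof -
  have int: "integrable lborel (\<lambda>x. \<bar>f x\<bar> powr p)" and [measurable]: "f \<in> borel_measurable borel"
    using assms by (auto simp: Lp_def)
  have "0 \<le> (\<integral>x. \<bar>f x\<bar> powr p \<partial>lborel)" by simp
  then show ?thesis
    unfolding Lp_le_def Lp_norm_def using int assms(2)
    by (simp add: nn_integral_eq_integral powr_powr)
qed

lemma Lp_le_iff: "0 < p \<Longrightarrow> Lp_le p f a \<longleftrightarrow> f \<in> Lp p \<and> Lp_norm p f \<le> a"
proof
  assume *: "0 < p" "f \<in> Lp p \<and> Lp_norm p f \<le> a"
  have "Lp_norm p f powr p \<le> a powr p"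
    using * Lp_norm_nonneg[of p f] by (intro powr_mono2) auto
  then show "Lp_le p f a"
    using Lp_le_Lp_norm[of f p] Lp_norm_nonneg[of p f] *
    unfolding Lp_le_def by (meson ennreal_leI order_trans)
qed (use Lp_le_imp_Lp in auto)

lemma Lp_le_mono: "Lp_le p f a \<Longrightarrow> a \<le> b \<Longrightarrow> 0 < p \<Longrightarrow> Lp_le p f b"
  by (auto simp: Lp_le_iff)

lemma Lp_le_dominated:
  assumes "Lp_le p g a" "AE x in lborel. \<bar>f x\<bar> \<le> \<bar>g x\<bar>" "f \<in> borel_measurable borel" "0 < p"
  shows "Lp_le p f a"
proof -
  have "(\<integral>\<^sup>+x. ennreal (\<bar>f x\<bar> powr p) \<partial>lborel) \<le> (\<integral>\<^sup>+x. ennreal (\<bar>g x\<bar> powr p) \<partial>lborel)"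
    using assms(2) by (intro nn_integral_mono_AE) (use \<open>0 < p\<close> in \<open>auto elim!: eventually_mono intro!: powr_mono2\<close>)
  then show ?thesis using assms by (auto simp: Lp_le_def)
qed

lemma Lp_le_cong_AE:
  assumes "Lp_le p g a" "AE x in lborel. f x = g x" "f \<in> borel_measurable borel" "0 < p"
  shows "Lp_le p f a"
  by (rule Lp_le_dominated[OF assms(1) _ assms(3,4)]) (use assms(2) in auto)

lemma Lp_le_0_iff:
  assumes "0 < p"
  shows "Lp_le p f 0 \<longleftrightarrow> f \<in> borel_measurable borel \<and> (AE x in lborel. f x = 0)"
proof
  assume L: "Lp_le p f 0"
  then have [measurable]: "f \<in> borel_measurable borel" by (rule Lp_le_measurable)
  have "(\<integral>\<^sup>+x. ennreal (\<bar>f x\<bar> powr p) \<partial>lborel) = 0"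
    using L by (simp add: Lp_le_def)
  then have "AE x in lborel. ennreal (\<bar>f x\<bar> powr p) = 0"
    by (subst (asm) nn_integral_0_iff_AE) auto
  then show "f \<in> borel_measurable borel \<and> (AE x in lborel. f x = 0)"
    by (auto elim!: eventually_mono)
next
  assume *: "f \<in> borel_measurable borel \<and> (AE x in lborel. f x = 0)"
  have "Lp_le p (\<lambda>x. 0) 0" by (simp add: Lp_le_def)
  then show "Lp_le p f 0" by (rule Lp_le_cong_AE) (use * assms in simp_all)
qed

lemma Lp_le_cmult:
  assumes "Lp_le p f a" "0 < p"
  shows "Lp_le p (\<lambda>x. c * f x) (\<bar>c\<bar> * a)"
proof -
  have [measurable]: "f \<in> borel_measurable borel" and a: "0 \<le> a"
    and le: "(\<integral>\<^sup>+x. ennreal (\<bar>f x\<bar> powr p) \<partial>lborel) \<le> ennreal (a powr p)"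
    using assms by (auto simp: Lp_le_def)
  have "(\<integral>\<^sup>+x. ennreal (\<bar>c * f x\<bar> powr p) \<partial>lborel) =
        ennreal (\<bar>c\<bar> powr p) * (\<integral>\<^sup>+x. ennreal (\<bar>f x\<bar> powr p) \<partial>lborel)"
    by (simp add: abs_mult powr_mult ennreal_mult nn_integral_cmult)
  also have "\<dots> \<le> ennreal (\<bar>c\<bar> powr p) * ennreal (a powr p)"
    by (intro mult_left_mono le) auto
  also have "\<dots> = ennreal ((\<bar>c\<bar> * a) powr p)"
    using a by (simp add: powr_mult ennreal_mult)
  finally show ?thesis using a by (auto simp: Lp_le_def)
qed

text \<open>The graph of x powr p lies above its tangent at \<open>c\<close>. Minkowski's and
  Jensen's inequalities and the Lipschitz bound for the nonlinearity all rest on this.\<close>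

lemma young_powr:
  assumes "1 \<le> (p::real)" "0 \<le> x" "0 \<le> c"
  shows "p * x * c powr (p - 1) \<le> x powr p + (p - 1) * c powr p"
proof (cases "p = 1 \<or> x = 0 \<or> c = 0")
  case True
  then show ?thesis using assms by auto
next
  case False
  then have "(x powr p) powr (1 / p) * (c powr p) powr (1 - 1 / p) \<le> 1 / p * x powr p + (1 - 1 / p) * c powr p"
    using assms by (intro Youngs_inequality_0) auto
  moreover have "p * (1 - 1 / p) = p - 1" using assms by (simp add: field_simps)
  ultimately have "x * c powr (p - 1) \<le> 1 / p * x powr p + (1 - 1 / p) * c powr p"
    using assms False by (simp add: powr_powr)
  then have "p * (x * c powr (p - 1)) \<le> p * (1 / p * x powr p + (1 - 1 / p) * c powr p)"
    using assms by (intro mult_left_mono) auto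
  also have "\<dots> = x powr p + (p - 1) * c powr p"
    using assms by (simp add: field_simps)
  finally show ?thesis by (simp add: algebra_simps)
qed

text \<open>Convexity at the mean of x / a and y / b with weights proportional to \<open>a\<close>
  and \<open>b\<close>. If these are the L^p bounds of two functions, the integrated right-hand side
  collapses to (a + b) powr p.\<close>

lemma powr_add_le_weighted:
  assumes "1 \<le> (p::real)" "0 \<le> x" "0 \<le> y" "0 < a" "0 < b"
  shows "(x + y) powr p \<le> (a + b) powr (p - 1) * (a powr (1 - p) * x powr p + b powr (1 - p) * y powr p)"
proof -
  define c where "c = (x + y) / (a + b)"
  have c: "0 \<le> c" "x + y = c * (a + b)" using assms by (auto simp: c_def)
  have eq: "d * (z / d) powr p = d powr (1 - p) * z powr p" if "0 < d" "0 \<le> z" for d z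
    using that by (simp add: powr_divide powr_diff field_simps)
  have "a * (p * (x / a) * c powr (p - 1)) \<le> a * ((x / a) powr p + (p - 1) * c powr p)"
    using assms c by (intro mult_left_mono young_powr) auto
  moreover have "b * (p * (y / b) * c powr (p - 1)) \<le> b * ((y / b) powr p + (p - 1) * c powr p)"
    using assms c by (intro mult_left_mono young_powr) auto
  ultimately have "p * (x + y) * c powr (p - 1) \<le> a powr (1 - p) * x powr p + b powr (1 - p) * y powr p + (p - 1) * (a + b) * c powr p"
    using assms eq[of a x] eq[of b y] by (simp add: algebra_simps)
  moreover have "c * c powr (p - 1) = c powr p"
    using c by (cases "c = 0") (auto simp: powr_diff)
  then have "p * (x + y) * c powr (p - 1) = p * (a + b) * c powr p"
    by (simp add: c(2) ac_simps)
  ultimately have "(a + b) * c powr p \<le> a powr (1 - p) * x powr p + b powr (1 - p) * y powr p"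
    using assms by (auto simp: algebra_simps)
  then have "(a + b) powr (p - 1) * ((a + b) * c powr p) \<le> (a + b) powr (p - 1) * (a powr (1 - p) * x powr p + b powr (1 - p) * y powr p)"
    by (intro mult_left_mono) auto
  moreover have "(a + b) powr (p - 1) * ((a + b) * c powr p) = (x + y) powr p"
    using assms c by (simp add: powr_mult powr_diff)
  ultimately show ?thesis by simp
qed

lemma Lp_le_add:
  assumes f: "Lp_le p f a" and g: "Lp_le p g b" and p: "1 \<le> p"
  shows "Lp_le p (\<lambda>x. f x + g x) (a + b)"
proof -
  have [measurable]: "f \<in> borel_measurable borel" "g \<in> borel_measurable borel"
    and a: "0 \<le> a" and b: "0 \<le> b"
    using f g by (auto simp: Lp_le_def)
  \<comment> \<open>The weights \<open>a powr (1 - p)\<close> and \<open>b powr (1 - p)\<close> need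
    positive bounds; a function with bound zero vanishes almost everywhere and drops out of the
    sum.\<close>
  consider "a = 0" | "b = 0" | "0 < a" "0 < b" using a b by linarith
  then show ?thesis
  proof cases
    case 1
    then have "AE x in lborel. f x = 0" using f p by (auto simp: Lp_le_0_iff)
    then have "AE x in lborel. f x + g x = g x" by eventually_elim simp
    then show ?thesis using 1 p g by (intro Lp_le_cong_AE[OF g, THEN Lp_le_mono]) simp_all
  next
    case 2
    then have "AE x in lborel. g x = 0" using g p by (auto simp: Lp_le_0_iff)
    then have "AE x in lborel. f x + g x = f x" by eventually_elim simp
    then show ?thesis using 2 p f by (intro Lp_le_cong_AE[OF f, THEN Lp_le_mono]) simp_all
  next
    case 3
    have "(\<integral>\<^sup>+x. ennreal (\<bar>f x + g x\<bar> powr p) \<partial>lborel) \<le>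
      (\<integral>\<^sup>+x. ennreal ((a + b) powr (p - 1)) * (ennreal (a powr (1 - p)) * ennreal (\<bar>f x\<bar> powr p)
         + ennreal (b powr (1 - p)) * ennreal (\<bar>g x\<bar> powr p)) \<partial>lborel)"
    proof (intro nn_integral_mono)
      fix x
      have "\<bar>f x + g x\<bar> powr p \<le> (\<bar>f x\<bar> + \<bar>g x\<bar>) powr p"
        using p by (intro powr_mono2) auto
      also have "\<dots> \<le> (a + b) powr (p - 1) * (a powr (1 - p) * \<bar>f x\<bar> powr p + b powr (1 - p) * \<bar>g x\<bar> powr p)"
        using 3 p by (intro powr_add_le_weighted) auto
      finally show "ennreal (\<bar>f x + g x\<bar> powr p) \<le> ennreal ((a + b) powr (p - 1)) * (ennreal (a powr (1 - p)) * ennreal (\<bar>f x\<bar> powr p)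
         + ennreal (b powr (1 - p)) * ennreal (\<bar>g x\<bar> powr p))"
        by (simp flip: ennreal_mult ennreal_plus)
    qed
    also have "\<dots> = ennreal ((a + b) powr (p - 1)) * (ennreal (a powr (1 - p)) * (\<integral>\<^sup>+x. ennreal (\<bar>f x\<bar> powr p) \<partial>lborel)
         + ennreal (b powr (1 - p)) * (\<integral>\<^sup>+x. ennreal (\<bar>g x\<bar> powr p) \<partial>lborel))"
      by (simp add: nn_integral_cmult nn_integral_add)
    also have "\<dots> \<le> ennreal ((a + b) powr (p - 1)) * (ennreal (a powr (1 - p)) * ennreal (a powr p)
         + ennreal (b powr (1 - p)) * ennreal (b powr p))"
      using f g by (intro mult_left_mono add_mono) (auto simp: Lp_le_def)
    also have "\<dots> = ennreal ((a + b) powr p)"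
      using 3 by (simp flip: ennreal_mult ennreal_plus powr_add add: powr_diff)
    finally show ?thesis using 3 by (auto simp: Lp_le_def)
  qed
qed

lemma Lp_le_diff:
  assumes "Lp_le p f a" "Lp_le p g b" "1 \<le> p"
  shows "Lp_le p (\<lambda>x. f x - g x) (a + b)"
  using Lp_le_add[OF assms(1) Lp_le_cmult[OF assms(2), of "-1"]] assms(3) by simp

lemma Lp_le_uminus_commute:
  assumes "Lp_le p (\<lambda>x. f x - g x) a" "1 \<le> p"
  shows "Lp_le p (\<lambda>x. g x - f x) a"
  using Lp_le_cmult[OF assms(1), of "-1"] assms(2) by simp

lemma Lp_le_triangle:
  assumes "Lp_le p (\<lambda>x. f x - g x) a" "Lp_le p (\<lambda>x. g x - h x) b" "1 \<le> p"
  shows "Lp_le p (\<lambda>x. f x - h x) (a + b)"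
  using Lp_le_add[OF assms] by simp

lemma Lp_le_tendsto_bound:
  assumes "\<And>n. Lp_le p f (b n)" "b \<longlonglongrightarrow> a" "0 < p"
  shows "Lp_le p f a"
proof -
  have "Lp_norm p f \<le> a"
    using assms by (intro tendsto_lowerbound[OF assms(2)]) (auto simp: Lp_le_iff)
  then show ?thesis using assms by (auto simp: Lp_le_iff)
qed

lemma Lp_le_eps:
  assumes "\<And>e. 0 < e \<Longrightarrow> Lp_le p f (a + e)" "0 < p"
  shows "Lp_le p f a"
proof -
  have "Lp_norm p f \<le> a + e" if "0 < e" for e
    using assms that by (auto simp: Lp_le_iff)
  then have "Lp_norm p f \<le> a" by (rule field_le_epsilon)
  then show ?thesis using assms(1)[of 1] assms(2) by (auto simp: Lp_le_iff)
qed

lemma Lp_le_Fatou: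
  assumes f: "\<And>n. Lp_le p (f n) a" and lim: "AE x in lborel. (\<lambda>n. f n x) \<longlonglongrightarrow> g x"
    and [measurable]: "g \<in> borel_measurable borel" and p: "0 < p"
  shows "Lp_le p g a"
proof -
  have [measurable]: "\<And>n. f n \<in> borel_measurable borel" using f by (auto simp: Lp_le_def)
  have "(\<integral>\<^sup>+x. ennreal (\<bar>g x\<bar> powr p) \<partial>lborel) = (\<integral>\<^sup>+x. liminf (\<lambda>n. ennreal (\<bar>f n x\<bar> powr p)) \<partial>lborel)"
  proof (rule nn_integral_cong_AE, use lim in eventually_elim)
    fix x assume "(\<lambda>n. f n x) \<longlonglongrightarrow> g x"
    then have "(\<lambda>n. ennreal (\<bar>f n x\<bar> powr p)) \<longlonglongrightarrow> ennreal (\<bar>g x\<bar> powr p)"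
      using p by (intro tendsto_ennrealI tendsto_powr2 tendsto_rabs tendsto_const) auto
    then show "ennreal (\<bar>g x\<bar> powr p) = liminf (\<lambda>n. ennreal (\<bar>f n x\<bar> powr p))"
      by (intro lim_imp_Liminf[symmetric]) auto
  qed
  also have "\<dots> \<le> liminf (\<lambda>n. \<integral>\<^sup>+x. ennreal (\<bar>f n x\<bar> powr p) \<partial>lborel)"
    by (intro nn_integral_liminf) auto
  also have "\<dots> \<le> liminf (\<lambda>n::nat. ennreal (a powr p))"
    using f by (intro Liminf_mono) (auto simp: Lp_le_def)
  finally show ?thesis using f[of 0] by (simp add: Lp_le_def Liminf_const)
qed

text \<open>The tangent inequality at the constant c = H / A is integrated over \<open>M\<close>.
  Only an upper bound \<open>A\<close> of the total mass is given, and it suffices because the mass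
  enters with the nonnegative factor (p - 1) * c powr p.\<close>

lemma jensen_powr:
  fixes \<phi> :: "'b \<Rightarrow> real"
  assumes p: "1 \<le> p" and [measurable]: "\<phi> \<in> borel_measurable M"
    and A: "emeasure M (space M) \<le> ennreal A" "0 \<le> A"
    and B: "(\<integral>\<^sup>+x. ennreal (\<bar>\<phi> x\<bar> powr p) \<partial>M) \<le> ennreal B" "0 \<le> B"
  shows "integrable M \<phi>" "(\<integral>x. \<bar>\<phi> x\<bar> \<partial>M) powr p \<le> A powr (p - 1) * B"
proof -
  interpret finite_measure M
    using A by (intro finite_measureI) (auto simp: top_unique)
  have int: "integrable M (\<lambda>x. \<bar>\<phi> x\<bar> powr p)"
    using B(1) by (intro integrableI_bounded) (auto simp: top.extremum_strict order.strict_trans1)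
  have "(\<integral>x. \<bar>\<phi> x\<bar> powr p \<partial>M) \<le> B"
    using B int by (subst (asm) nn_integral_eq_integral) (auto simp: ennreal_le_iff)
  note B' = this
  have mA: "measure M (space M) \<le> A"
    using A by (simp add: emeasure_eq_measure ennreal_le_iff)
  show i: "integrable M \<phi>"
  proof (rule Bochner_Integration.integrable_bound)
    show "integrable M (\<lambda>x. 1 + \<bar>\<phi> x\<bar> powr p)" using int by simp
    \<comment> \<open>On a finite measure space this puts L^p inside L^1.\<close>
    have "t \<le> 1 + t powr p" if "0 \<le> t" for t :: real
    proof (cases "t \<le> 1")
      case False
      then have "t powr 1 \<le> t powr p" using p by (intro powr_mono) auto
      then show ?thesis using that by simp
    qed (smt (verit) powr_ge_zero)
    then show "AE x in M. norm (\<phi> x) \<le> norm (1 + \<bar>\<phi> x\<bar> powr p)"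
      by (auto simp: abs_if intro!: AE_I2) (smt (verit) powr_ge_zero)+
  qed auto
  define H where "H = (\<integral>x. \<bar>\<phi> x\<bar> \<partial>M)"
  have H0: "0 \<le> H" by (simp add: H_def)
  show "(\<integral>x. \<bar>\<phi> x\<bar> \<partial>M) powr p \<le> A powr (p - 1) * B"
  proof (cases "A = 0")
    case True
    then have "measure M (space M) = 0" using mA by (simp add: measure_le_0_iff)
    then have "AE x in M. False" by (simp add: AE_iff_measurable[OF sets.top] emeasure_eq_measure)
    then have "H = 0" unfolding H_def by (intro integral_eq_zero_AE) auto
    then show ?thesis using True by (simp add: H_def)
  next
    case False
    then have A0: "0 < A" using A by simp
    define c where "c = H / A"
    have c: "0 \<le> c" "H = c * A" using H0 A0 by (auto simp: c_def)
    have "p * H * c powr (p - 1) = (\<integral>x. p * \<bar>\<phi> x\<bar> * c powr (p - 1) \<partial>M)"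
      by (simp add: H_def)
    also have "\<dots> \<le> (\<integral>x. \<bar>\<phi> x\<bar> powr p + (p - 1) * c powr p \<partial>M)"
      using i int p c by (intro integral_mono young_powr) auto
    also have "\<dots> = (\<integral>x. \<bar>\<phi> x\<bar> powr p \<partial>M) + (p - 1) * c powr p * measure M (space M)"
      using int by simp
    also have "\<dots> \<le> B + (p - 1) * c powr p * A"
      using p mA B' by (intro add_mono mult_left_mono) auto
    finally have "p * H * c powr (p - 1) \<le> B + (p - 1) * c powr p * A" .
    moreover have "c * c powr (p - 1) = c powr p"
      using c by (cases "c = 0") (auto simp: powr_diff)
    then have "p * H * c powr (p - 1) = p * A * c powr p"
      by (simp add: c(2) ac_simps)
    moreover have "(p - 1) * c powr p * A = p * A * c powr p - A * c powr p"
      by (simp add: algebra_simps)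
    ultimately have "A * c powr p \<le> B" by linarith
    then have "A powr (p - 1) * (A * c powr p) \<le> A powr (p - 1) * B"
      by (intro mult_left_mono) auto
    moreover have "A powr (p - 1) * (A * c powr p) = H powr p"
      using A0 c by (simp add: powr_mult powr_diff)
    ultimately show ?thesis by (simp add: H_def)
  qed
qed

text \<open>Jensen for the measure with density \<open>k\<close>. It serves a heat kernel with A =
  1, the difference of two heat kernels with A = 2, and Minkowski's integral inequality with the
  weight \<open>m\<close>.\<close>

lemma jensen_kernel:
  fixes \<phi> k :: "'b \<Rightarrow> real"
  assumes p: "1 \<le> p" and [measurable]: "\<phi> \<in> borel_measurable M" "k \<in> borel_measurable M"
    and k: "\<And>x. 0 \<le> k x"
    and A: "(\<integral>\<^sup>+x. ennreal (k x) \<partial>M) \<le> ennreal A" "0 \<le> A"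
    and B: "(\<integral>\<^sup>+x. ennreal (k x) * ennreal (\<bar>\<phi> x\<bar> powr p) \<partial>M) \<le> ennreal B" "0 \<le> B"
  shows "integrable M (\<lambda>x. k x * \<phi> x)" "(\<integral>x. k x * \<bar>\<phi> x\<bar> \<partial>M) powr p \<le> A powr (p - 1) * B"
    "\<bar>\<integral>x. k x * \<phi> x \<partial>M\<bar> powr p \<le> A powr (p - 1) * B"
proof -
  let ?D = "density M (\<lambda>x. ennreal (k x))"
  have 1: "emeasure ?D (space ?D) \<le> ennreal A"
    using A by (simp add: emeasure_density cong: nn_integral_cong)
  have 2: "(\<integral>\<^sup>+x. ennreal (\<bar>\<phi> x\<bar> powr p) \<partial>?D) \<le> ennreal B"
    using B by (simp add: nn_integral_density)
  have 3: "\<phi> \<in> borel_measurable ?D" by simp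
  note J = jensen_powr[OF p 3 1 A(2) 2 B(2)]
  show i: "integrable M (\<lambda>x. k x * \<phi> x)"
    using J(1) k by (subst (asm) integrable_density) auto
  show le: "(\<integral>x. k x * \<bar>\<phi> x\<bar> \<partial>M) powr p \<le> A powr (p - 1) * B"
    using J(2) k by (subst (asm) integral_density) auto
  have "\<bar>\<integral>x. k x * \<phi> x \<partial>M\<bar> \<le> (\<integral>x. k x * \<bar>\<phi> x\<bar> \<partial>M)"
    using integral_abs_bound[of M "\<lambda>x. k x * \<phi> x"] k by (simp add: abs_mult)
  then show "\<bar>\<integral>x. k x * \<phi> x \<partial>M\<bar> powr p \<le> A powr (p - 1) * B"
    using le p by (intro order.trans[OF powr_mono2 le]) auto
qed

text \<open>This is Jensen's inequality for the measure \<open>m s ds\<close> and the function \<open>h s z / m s\<close>.\<close>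

lemma minkowski_integral_pos:
  fixes h :: "real \<Rightarrow> 'a::euclidean_space \<Rightarrow> real"
  assumes p: "1 \<le> p" and h[measurable]: "jointly_measurable h"
    and m: "integrable lborel m" "\<And>s. 0 < m s"
    and le: "AE s in lborel. Lp_le p (h s) (m s)"
  shows "AE z in lborel. integrable lborel (\<lambda>s. h s z)"
    "Lp_le p (\<lambda>z. \<integral>s. h s z \<partial>lborel) (\<integral>s. m s \<partial>lborel)"
proof -
  let ?A = "\<integral>s. m s \<partial>lborel"
  have [measurable]: "m \<in> borel_measurable borel" using m by simp
  have h'[measurable]: "(\<lambda>(z, s). h s z) \<in> borel_measurable (borel \<Otimes>\<^sub>M borel)"
    using measurable_compose[OF measurable_pair_swap' h] by (simp add: case_prod_unfold)
  have A0: "0 \<le> ?A" using m by (intro integral_nonneg_AE) (auto intro: less_imp_le)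
  have Am: "(\<integral>\<^sup>+s. ennreal (m s) \<partial>lborel) = ennreal ?A"
    using m by (intro nn_integral_eq_integral) (auto intro: less_imp_le)
  let ?B = "\<lambda>z. \<integral>\<^sup>+s. ennreal (m s) * ennreal (\<bar>h s z / m s\<bar> powr p) \<partial>lborel"
  have hz[measurable]: "(\<lambda>s. h s z) \<in> borel_measurable borel" for z by measurable
  have [measurable]: "?B \<in> borel_measurable borel" by measurable
  have "(\<integral>\<^sup>+z. ?B z \<partial>lborel) = (\<integral>\<^sup>+s. (\<integral>\<^sup>+z. ennreal (m s) * ennreal (\<bar>h s z / m s\<bar> powr p) \<partial>lborel) \<partial>lborel)"
    by (rule lborel_pair.Fubini') measurable
  also have "\<dots> \<le> (\<integral>\<^sup>+s. ennreal (m s) \<partial>lborel)"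
  proof (rule nn_integral_mono_AE, use le in eventually_elim)
    fix s assume L: "Lp_le p (h s) (m s)"
    have "(\<integral>\<^sup>+z. ennreal (m s) * ennreal (\<bar>h s z / m s\<bar> powr p) \<partial>lborel) =
      ennreal (m s * inverse (m s powr p)) * (\<integral>\<^sup>+z. ennreal (\<bar>h s z\<bar> powr p) \<partial>lborel)"
      using Lp_le_measurable[OF L] m(2)[of s]
      by (subst nn_integral_cmult[symmetric]) (auto simp: powr_divide field_simps simp flip: ennreal_mult intro!: nn_integral_cong)
    also have "\<dots> \<le> ennreal (m s * inverse (m s powr p)) * ennreal (m s powr p)"
      using L by (intro mult_left_mono) (auto simp: Lp_le_def)
    also have "\<dots> = ennreal (m s)"
      using m(2)[of s] by (simp flip: ennreal_mult)
    finally show "(\<integral>\<^sup>+z. ennreal (m s) * ennreal (\<bar>h s z / m s\<bar> powr p) \<partial>lborel) \<le> ennreal (m s)" .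
  qed
  finally have BA: "(\<integral>\<^sup>+z. ?B z \<partial>lborel) \<le> ennreal ?A" by (simp add: Am)
  then have fin: "AE z in lborel. ?B z \<noteq> \<infinity>"
    by (intro nn_integral_PInf_AE) (auto simp: top_unique)
  have key: "integrable lborel (\<lambda>s. h s z) \<and>
      \<bar>\<integral>s. h s z \<partial>lborel\<bar> powr p \<le> ?A powr (p - 1) * enn2real (?B z)" if "?B z \<noteq> \<infinity>" for z
  proof -
    have eq: "m s * (h s z / m s) = h s z" for s using m(2)[of s] by simp
    have 1: "?B z \<le> ennreal (enn2real (?B z))" using that by (simp add: less_top)
    have 2: "(\<integral>\<^sup>+s. ennreal (m s) \<partial>lborel) \<le> ennreal ?A" using Am by simp
    have "integrable lborel (\<lambda>s. m s * (h s z / m s))"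
      "\<bar>\<integral>s. m s * (h s z / m s) \<partial>lborel\<bar> powr p \<le> ?A powr (p - 1) * enn2real (?B z)"
      using jensen_kernel(1,3)[OF p _ _ _ 2 A0 1] m(2) by (auto simp: less_imp_le)
    then show ?thesis by (simp only: eq)
  qed
  show "AE z in lborel. integrable lborel (\<lambda>s. h s z)"
    using fin key by (auto elim!: eventually_mono)
  have "(\<integral>\<^sup>+z. ennreal (\<bar>\<integral>s. h s z \<partial>lborel\<bar> powr p) \<partial>lborel) \<le> (\<integral>\<^sup>+z. ennreal (?A powr (p - 1)) * ?B z \<partial>lborel)"
  proof (rule nn_integral_mono_AE, use fin in eventually_elim)
    fix z assume "?B z \<noteq> \<infinity>"
    then have "ennreal (\<bar>\<integral>s. h s z \<partial>lborel\<bar> powr p) \<le> ennreal (?A powr (p - 1) * enn2real (?B z))"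
      using key by (intro ennreal_leI) auto
    also have "\<dots> = ennreal (?A powr (p - 1)) * ?B z"
      using \<open>?B z \<noteq> \<infinity>\<close> by (simp add: ennreal_mult less_top)
    finally show "ennreal (\<bar>\<integral>s. h s z \<partial>lborel\<bar> powr p) \<le> ennreal (?A powr (p - 1)) * ?B z" .
  qed
  also have "\<dots> = ennreal (?A powr (p - 1)) * (\<integral>\<^sup>+z. ?B z \<partial>lborel)"
    by (intro nn_integral_cmult) auto
  also have "\<dots> \<le> ennreal (?A powr (p - 1)) * ennreal ?A"
    by (intro mult_left_mono BA) auto
  also have "\<dots> = ennreal (?A powr p)"
    using A0 by (cases "?A = 0") (auto simp: powr_diff simp flip: ennreal_mult)
  finally show "Lp_le p (\<lambda>z. \<integral>s. h s z \<partial>lborel) ?A"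
    using A0 by (auto simp: Lp_le_def)
qed

text \<open>The previous form divides by \<open>m\<close> and so needs it strictly positive. Here
  \<open>m\<close> is replaced by its positive part plus e times the Gaussian density, which raises
  the integral by exactly e, and e tends to zero.\<close>

lemma minkowski_integral:
  fixes h :: "real \<Rightarrow> 'a::euclidean_space \<Rightarrow> real"
  assumes p: "1 \<le> p" and h[measurable]: "jointly_measurable h"
    and m: "integrable lborel m"
    and le: "AE s in lborel. Lp_le p (h s) (m s)"
  shows "AE z in lborel. integrable lborel (\<lambda>s. h s z)"
    "Lp_le p (\<lambda>z. \<integral>s. h s z \<partial>lborel) (\<integral>s. m s \<partial>lborel)"
proof -
  have m0: "AE s in lborel. 0 \<le> m s" using le by eventually_elim (rule Lp_le_nonneg)
  define m' where "m' = (\<lambda>e s. max (m s) 0 + e * std_normal_density s)"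
  have [measurable]: "m \<in> borel_measurable borel" using m by simp
  have int0: "integrable lborel (\<lambda>s. max (m s) 0)"
    using m m0 by (subst integrable_cong_AE[where g=m]) (auto elim!: eventually_mono)
  have "(\<integral>s. max (m s) 0 \<partial>lborel) = (\<integral>s. m s \<partial>lborel)"
    using m0 by (intro integral_cong_AE) (auto elim!: eventually_mono)
  then have int: "(\<integral>s. m' e s \<partial>lborel) = (\<integral>s. m s \<partial>lborel) + e" for e
    using int0 by (simp add: m'_def)
  have 1: "integrable lborel (m' e)" for e using int0 by (simp add: m'_def)
  have 2: "0 < m' e s" if "0 < e" for e s
    unfolding m'_def using that by (intro add_nonneg_pos mult_pos_pos normal_density_pos) auto
  have 3: "AE s in lborel. Lp_le p (h s) (m' e s)" if "0 < e" for e
    using le m0 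
  proof eventually_elim
    fix s assume "Lp_le p (h s) (m s)" "0 \<le> m s"
    moreover have "m s \<le> m' e s"
      using that by (auto simp: m'_def normal_density_nonneg le_max_iff_disj intro!: add_increasing2)
    ultimately show "Lp_le p (h s) (m' e s)"
      using p by (auto intro: Lp_le_mono)
  qed
  show "AE z in lborel. integrable lborel (\<lambda>s. h s z)"
    using minkowski_integral_pos(1)[OF p h 1 2 3] by (metis zero_less_one)
  show "Lp_le p (\<lambda>z. \<integral>s. h s z \<partial>lborel) (\<integral>s. m s \<partial>lborel)"
  proof (rule Lp_le_eps)
    fix e :: real assume "0 < e"
    then show "Lp_le p (\<lambda>z. \<integral>s. h s z \<partial>lborel) ((\<integral>s. m s \<partial>lborel) + e)"
      using minkowski_integral_pos(2)[OF p h 1 2 3] int by metis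
  qed (use p in simp)
qed


text \<open>The increments are multiplied by sqrt 2 ^ n. The p-th powers of the weighted increments
  still have summable integrals, so almost everywhere they are bounded in n, and the increments
  themselves decay like (1 / sqrt 2) ^ n. Summing p-th powers needs only additivity of the integral,
  not Minkowski's inequality for series.\<close>

lemma Lp_fast_Cauchy:
  fixes f :: "nat \<Rightarrow> 'a::euclidean_space \<Rightarrow> real"
  assumes d: "\<And>n. Lp_le p (\<lambda>x. f (Suc n) x - f n x) (c * (1 / 2) ^ n)" and p: "1 \<le> p"
    and [measurable]: "\<And>n. f n \<in> borel_measurable borel"
  shows "AE x in lborel. (\<lambda>n. f n x) \<longlonglongrightarrow> lim (\<lambda>n. f n x)"
    "Lp_le p (\<lambda>x. lim (\<lambda>n. f n x) - f n x) (2 * c * (1 / 2) ^ n)"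
proof -
  have c0: "0 \<le> c" using Lp_le_nonneg[OF d[of 0]] by simp
  define r where "r = 1 / sqrt (2::real)"
  have r: "0 < r" "r < 1" by (auto simp: r_def)
  have sq: "sqrt 2 ^ n * (c * (1 / 2) ^ n) = c * r ^ n" for n
    by (simp add: r_def power_divide power_mult_distrib[symmetric] flip: real_sqrt_power)
       (simp add: power_one_over field_simps real_sqrt_power flip: power_mult_distrib)
  define e where "e = (\<lambda>n x. sqrt 2 ^ n * (f (Suc n) x - f n x))"
  have e: "Lp_le p (e n) (c * r ^ n)" for n
    using Lp_le_cmult[OF d[of n], of "sqrt 2 ^ n"] p by (simp add: e_def sq)
  have [measurable]: "e n \<in> borel_measurable borel" for n unfolding e_def by measurable
  have pw: "(c * r ^ n) powr p = c powr p * (r powr p) ^ n" for n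
    using r c0 by (simp add: powr_mult powr_powr mult.commute flip: powr_realpow)
  have rp: "r powr p < 1" using powr_less_mono2[of p r 1] r p by simp
  have summ: "summable (\<lambda>n. (c * r ^ n) powr p)"
    unfolding pw using rp by (intro summable_mult summable_geometric) auto
  have "(\<integral>\<^sup>+x. (\<Sum>n. ennreal (\<bar>e n x\<bar> powr p)) \<partial>lborel) = (\<Sum>n. \<integral>\<^sup>+x. ennreal (\<bar>e n x\<bar> powr p) \<partial>lborel)"
    by (intro nn_integral_suminf) auto
  also have "\<dots> \<le> (\<Sum>n. ennreal ((c * r ^ n) powr p))"
    using e by (intro suminf_le) (auto simp: Lp_le_def)
  also have "\<dots> = ennreal (\<Sum>n. (c * r ^ n) powr p)"
    using summ by (intro suminf_ennreal2) auto
  finally have "(\<integral>\<^sup>+x. (\<Sum>n. ennreal (\<bar>e n x\<bar> powr p)) \<partial>lborel) \<noteq> \<infinity>"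
    by (auto simp: top_unique)
  then have "AE x in lborel. (\<Sum>n. ennreal (\<bar>e n x\<bar> powr p)) \<noteq> \<infinity>"
    by (intro nn_integral_PInf_AE) auto
  then show lim: "AE x in lborel. (\<lambda>n. f n x) \<longlonglongrightarrow> lim (\<lambda>n. f n x)"
  proof eventually_elim
    fix x assume fin: "(\<Sum>n. ennreal (\<bar>e n x\<bar> powr p)) \<noteq> \<infinity>"
    then obtain K where K: "0 \<le> K" "(\<Sum>n. ennreal (\<bar>e n x\<bar> powr p)) = ennreal K"
      by (metis ennreal_cases infinity_ennreal_def)
    have le: "\<bar>f (Suc n) x - f n x\<bar> \<le> K powr (1 / p) * r ^ n" for n
    proof -
      have "ennreal (\<bar>e n x\<bar> powr p) = (\<Sum>i\<in>{n}. ennreal (\<bar>e i x\<bar> powr p))" by simp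
      also have "\<dots> \<le> (\<Sum>n. ennreal (\<bar>e n x\<bar> powr p))"
        by (intro sum_le_suminf) auto
      finally have "\<bar>e n x\<bar> powr p \<le> K" using K by (simp add: ennreal_le_iff)
      then have "(\<bar>e n x\<bar> powr p) powr (1 / p) \<le> K powr (1 / p)"
        using p by (intro powr_mono2) auto
      then have "\<bar>e n x\<bar> \<le> K powr (1 / p)" using p by (simp add: powr_powr)
      then have "\<bar>e n x\<bar> * r ^ n \<le> K powr (1 / p) * r ^ n" using r by (intro mult_right_mono) auto
      moreover have "\<bar>e n x\<bar> * r ^ n = \<bar>f (Suc n) x - f n x\<bar>"
        by (simp add: e_def r_def abs_mult power_divide)
      ultimately show ?thesis by simp
    qed
    have "summable (\<lambda>n. f (Suc n) x - f n x)"
    proof (rule summable_comparison_test')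
      show "summable (\<lambda>n. K powr (1 / p) * r ^ n)"
        using r by (intro summable_mult summable_geometric) auto
      show "norm (f (Suc n) x - f n x) \<le> K powr (1 / p) * r ^ n" if "0 \<le> n" for n
        using le by simp
    qed
    then have "convergent (\<lambda>n. \<Sum>i<n. f (Suc i) x - f i x)"
      by (simp add: summable_iff_convergent)
    then have "convergent (\<lambda>n. f n x - f 0 x)"
      by (simp only: sum_lessThan_telescope[of "\<lambda>i. f i x"])
    then have "convergent (\<lambda>n. (f n x - f 0 x) + f 0 x)"
      by (intro convergent_add convergent_const)
    then show "(\<lambda>n. f n x) \<longlonglongrightarrow> lim (\<lambda>n. f n x)"
      by (simp add: convergent_LIMSEQ_iff)
  qed
  \<comment> \<open>Telescoping: the bounds c * (1 / 2) ^ i for n \<le> i < n + k add up to exactly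
    this constant.\<close>
  have part: "Lp_le p (\<lambda>x. f (n + k) x - f n x) (2 * c * (1 / 2) ^ n * (1 - (1 / 2) ^ k))" for k
  proof (induction k)
    case 0
    show ?case using p by (simp add: Lp_le_0_iff)
  next
    case (Suc k)
    have "2 * c * (1 / 2) ^ n * (1 - (1 / 2) ^ Suc k) = c * (1 / 2) ^ (n + k) + 2 * c * (1 / 2) ^ n * (1 - (1 / 2) ^ k)"
      by (simp add: power_add algebra_simps)
    then show ?case using Lp_le_triangle[OF d[of "n + k"] Suc p] by simp
  qed
  show "Lp_le p (\<lambda>x. lim (\<lambda>n. f n x) - f n x) (2 * c * (1 / 2) ^ n)"
  proof (rule Lp_le_Fatou)
    show "Lp_le p (\<lambda>x. f (n + k) x - f n x) (2 * c * (1 / 2) ^ n)" for k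
      using part[of k] p c0 by (rule_tac Lp_le_mono) (auto intro!: mult_left_le)
    show "AE x in lborel. (\<lambda>k. f (n + k) x - f n x) \<longlonglongrightarrow> lim (\<lambda>n. f n x) - f n x"
      using lim
    proof eventually_elim
      fix x assume "(\<lambda>n. f n x) \<longlonglongrightarrow> lim (\<lambda>n. f n x)"
      from LIMSEQ_ignore_initial_segment[OF this, of n]
      show "(\<lambda>k. f (n + k) x - f n x) \<longlonglongrightarrow> lim (\<lambda>n. f n x) - f n x"
        by (intro tendsto_diff tendsto_const) (simp add: add.commute)
    qed
    show "(\<lambda>x. lim (\<lambda>n. f n x) - f n x) \<in> borel_measurable borel"
      by measurable
  qed (use p in simp)
qed

text \<open>Holder's inequality with exponents \<rho> / (\<rho> - 1) and \<rho>. Young's inequality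
  is applied pointwise to the normalised functions G / A and d / D, whose q-th powers, q = \<rho> p,
  have integral at most one.\<close>

lemma Lp_le_Holder:
  assumes G: "Lp_le (\<rho> * p) G A" and d: "Lp_le (\<rho> * p) d D" and \<rho>: "1 < \<rho>" and p: "1 \<le> p"
  shows "Lp_le p (\<lambda>x. \<bar>G x\<bar> powr (\<rho> - 1) * d x) (A powr (\<rho> - 1) * D)"
proof -
  have [measurable]: "G \<in> borel_measurable borel" "d \<in> borel_measurable borel"
    and A: "0 \<le> A" and D: "0 \<le> D" and q: "0 < \<rho> * p"
    using G d \<rho> p by (auto simp: Lp_le_def)
  consider "A = 0" | "D = 0" | "0 < A" "0 < D" using A D by linarith
  then show ?thesis
  proof cases
    case 1
    then have "AE x in lborel. G x = 0" using G q by (auto simp: Lp_le_0_iff)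
    then have "AE x in lborel. \<bar>G x\<bar> powr (\<rho> - 1) * d x = 0" by eventually_elim simp
    then show ?thesis using 1 p \<rho> by (simp add: Lp_le_0_iff)
  next
    case 2
    then have "AE x in lborel. d x = 0" using d q by (auto simp: Lp_le_0_iff)
    then have "AE x in lborel. \<bar>G x\<bar> powr (\<rho> - 1) * d x = 0" by eventually_elim simp
    then show ?thesis using 2 p \<rho> by (simp add: Lp_le_0_iff)
  next
    case 3
    let ?C = "(A powr (\<rho> - 1) * D) powr p"
    let ?q = "\<rho> * p"
    have pt: "(x powr (\<rho> - 1) * y) powr p \<le> ?C * ((1 - 1 / \<rho>) * (inverse (A powr ?q) * x powr ?q) + 1 / \<rho> * (inverse (D powr ?q) * y powr ?q))"
      if xy: "0 \<le> x" "0 \<le> y" for x y :: real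
    proof (cases "x = 0 \<or> y = 0")
      case True
      have "0 \<le> ?C * ((1 - 1 / \<rho>) * (inverse (A powr ?q) * x powr ?q) + 1 / \<rho> * (inverse (D powr ?q) * y powr ?q))"
        using \<rho> by (intro mult_nonneg_nonneg add_nonneg_nonneg) auto
      moreover have "(x powr (\<rho> - 1) * y) powr p = 0" using True by auto
      ultimately show ?thesis by (simp only:)
    next
      case False
      then have xy: "0 < x" "0 < y" using xy by auto
      have "((x / A) powr ?q) powr (1 - 1 / \<rho>) * ((y / D) powr ?q) powr (1 / \<rho>)
          \<le> (1 - 1 / \<rho>) * (x / A) powr ?q + 1 / \<rho> * (y / D) powr ?q"
        using xy 3 \<rho> by (intro Youngs_inequality_0) auto
      moreover have "?q * (1 - 1 / \<rho>) = (\<rho> - 1) * p" "?q * (1 / \<rho>) = p"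
        using \<rho> by (simp_all add: field_simps)
      then have "((x / A) powr ?q) powr (1 - 1 / \<rho>) * ((y / D) powr ?q) powr (1 / \<rho>)
          = (x powr (\<rho> - 1) * y) powr p / ?C"
        using xy 3 by (simp only: powr_powr) (simp add: powr_divide powr_mult powr_powr)
      ultimately have "(x powr (\<rho> - 1) * y) powr p / ?C \<le> (1 - 1 / \<rho>) * (x / A) powr ?q + 1 / \<rho> * (y / D) powr ?q"
        by simp
      then have "(x powr (\<rho> - 1) * y) powr p \<le> ?C * ((1 - 1 / \<rho>) * (x / A) powr ?q + 1 / \<rho> * (y / D) powr ?q)"
        using 3 by (simp add: pos_divide_le_eq mult.commute)
      moreover have "(x / A) powr ?q = inverse (A powr ?q) * x powr ?q" "(y / D) powr ?q = inverse (D powr ?q) * y powr ?q"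
        using xy 3 by (simp_all add: powr_divide field_simps)
      ultimately show ?thesis by (simp only:)
    qed
    have "(\<integral>\<^sup>+x. ennreal (\<bar>\<bar>G x\<bar> powr (\<rho> - 1) * d x\<bar> powr p) \<partial>lborel) \<le>
      (\<integral>\<^sup>+x. ennreal ?C * (ennreal ((1 - 1 / \<rho>) * inverse (A powr ?q)) * ennreal (\<bar>G x\<bar> powr ?q)
        + ennreal (1 / \<rho> * inverse (D powr ?q)) * ennreal (\<bar>d x\<bar> powr ?q)) \<partial>lborel)"
    proof (intro nn_integral_mono)
      fix x
      show "ennreal (\<bar>\<bar>G x\<bar> powr (\<rho> - 1) * d x\<bar> powr p) \<le> ennreal ?C * (ennreal ((1 - 1 / \<rho>) * inverse (A powr ?q)) * ennreal (\<bar>G x\<bar> powr ?q)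
        + ennreal (1 / \<rho> * inverse (D powr ?q)) * ennreal (\<bar>d x\<bar> powr ?q))"
        using pt[of "\<bar>G x\<bar>" "\<bar>d x\<bar>"] \<rho>
        by (simp add: abs_mult mult.assoc flip: ennreal_mult ennreal_plus)
    qed
    also have "\<dots> = ennreal ?C * (ennreal ((1 - 1 / \<rho>) * inverse (A powr ?q)) * (\<integral>\<^sup>+x. ennreal (\<bar>G x\<bar> powr ?q) \<partial>lborel)
        + ennreal (1 / \<rho> * inverse (D powr ?q)) * (\<integral>\<^sup>+x. ennreal (\<bar>d x\<bar> powr ?q) \<partial>lborel))"
      by (simp add: nn_integral_cmult nn_integral_add)
    also have "\<dots> \<le> ennreal ?C * (ennreal ((1 - 1 / \<rho>) * inverse (A powr ?q)) * ennreal (A powr ?q)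
        + ennreal (1 / \<rho> * inverse (D powr ?q)) * ennreal (D powr ?q))"
      using G d by (intro mult_left_mono add_mono) (auto simp: Lp_le_def)
    also have "\<dots> = ennreal (?C * ((1 - 1 / \<rho>) * inverse (A powr ?q) * (A powr ?q) + 1 / \<rho> * inverse (D powr ?q) * (D powr ?q)))"
      using \<rho> by (simp flip: ennreal_mult ennreal_plus)
    also have "\<dots> = ennreal ?C" using 3 \<rho> by (simp add: mult.assoc)
    finally show ?thesis using A D by (auto simp: Lp_le_def)
  qed
qed

section \<open>The power nonlinearity in Lebesgue spaces\<close>

definition signed_powr :: "real \<Rightarrow> real \<Rightarrow> real" where
  "signed_powr \<rho> a = \<bar>a\<bar> powr (\<rho> - 1) * a"

lemma signed_powr_measurable[measurable]: "signed_powr \<rho> \<in> borel_measurable borel"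
  unfolding signed_powr_def by measurable

lemma abs_signed_powr: "1 < \<rho> \<Longrightarrow> \<bar>signed_powr \<rho> a\<bar> = \<bar>a\<bar> powr \<rho>"
  by (cases "a = 0") (auto simp: signed_powr_def abs_mult powr_diff)

lemma signed_powr_minus: "signed_powr \<rho> (- a) = - signed_powr \<rho> a"
  by (simp add: signed_powr_def)

text \<open>Both sides are invariant under exchanging \<open>a\<close> and \<open>b\<close> and
  under changing both signs, so |b| \<le> a may be assumed. For b \<ge> 0 the tangent inequality for
  x powr \<rho> applies; for b < 0 the moduli of the values add up on the left and those of the
  arguments on the right.\<close>

lemma signed_powr_diff_le:
  assumes \<rho>: "1 < \<rho>"
  shows "\<bar>signed_powr \<rho> a - signed_powr \<rho> b\<bar> \<le> \<rho> * ((\<bar>a\<bar> + \<bar>b\<bar>) powr (\<rho> - 1) * \<bar>a - b\<bar>)"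
proof -
  have pos: "\<bar>signed_powr \<rho> a - signed_powr \<rho> b\<bar> \<le> \<rho> * ((\<bar>a\<bar> + \<bar>b\<bar>) powr (\<rho> - 1) * \<bar>a - b\<bar>)"
    if le: "\<bar>b\<bar> \<le> a" for a b
  proof -
    have a: "0 \<le> a" using le by linarith
    have m: "a powr (\<rho> - 1) \<le> (\<bar>a\<bar> + \<bar>b\<bar>) powr (\<rho> - 1)"
      using a \<rho> by (intro powr_mono2) auto
    have ap: "a powr (\<rho> - 1) * a = a powr \<rho>"
      using a by (cases "a = 0") (auto simp: powr_diff)
    have "\<bar>signed_powr \<rho> a - signed_powr \<rho> b\<bar> \<le> \<rho> * (a powr (\<rho> - 1) * \<bar>a - b\<bar>)"
    proof (cases "0 \<le> b")
      case True
      have "b powr \<rho> \<le> a powr \<rho>" using True le \<rho> by (intro powr_mono2) auto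
      moreover have "b powr (\<rho> - 1) * b = b powr \<rho>"
        using True by (cases "b = 0") (auto simp: powr_diff)
      moreover have "\<rho> * b * a powr (\<rho> - 1) \<le> b powr \<rho> + (\<rho> - 1) * a powr \<rho>"
        using True a \<rho> by (intro young_powr) auto
      moreover have "\<rho> * (a powr (\<rho> - 1) * (a - b)) = \<rho> * (a powr (\<rho> - 1) * a) - \<rho> * b * a powr (\<rho> - 1)"
        by (simp add: algebra_simps)
      ultimately show ?thesis using True le a ap by (simp add: signed_powr_def algebra_simps)
    next
      case False
      have "\<bar>b\<bar> powr (\<rho> - 1) \<le> a powr (\<rho> - 1)" using False le \<rho> by (intro powr_mono2) auto
      then have "\<bar>b\<bar> powr (\<rho> - 1) * \<bar>b\<bar> \<le> a powr (\<rho> - 1) * \<bar>b\<bar>" by (intro mult_right_mono) auto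
      moreover have "0 \<le> a powr (\<rho> - 1) * a" "0 \<le> \<bar>b\<bar> powr (\<rho> - 1) * \<bar>b\<bar>" using a by simp_all
      moreover have "signed_powr \<rho> a - signed_powr \<rho> b = a powr (\<rho> - 1) * a + \<bar>b\<bar> powr (\<rho> - 1) * \<bar>b\<bar>"
        using False a by (simp add: signed_powr_def)
      ultimately have "\<bar>signed_powr \<rho> a - signed_powr \<rho> b\<bar> \<le> a powr (\<rho> - 1) * a + a powr (\<rho> - 1) * \<bar>b\<bar>"
        by linarith
      moreover have "\<bar>a - b\<bar> = a + \<bar>b\<bar>" using False a by simp
      ultimately have "\<bar>signed_powr \<rho> a - signed_powr \<rho> b\<bar> \<le> 1 * (a powr (\<rho> - 1) * \<bar>a - b\<bar>)"
        by (simp only: distrib_left mult_1_left)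
      also have "\<dots> \<le> \<rho> * (a powr (\<rho> - 1) * \<bar>a - b\<bar>)"
        using \<rho> by (intro mult_right_mono) auto
      finally show ?thesis .
    qed
    also have "\<dots> \<le> \<rho> * ((\<bar>a\<bar> + \<bar>b\<bar>) powr (\<rho> - 1) * \<bar>a - b\<bar>)"
      using \<rho> m by (intro mult_left_mono mult_right_mono) auto
    finally show ?thesis .
  qed
  consider "\<bar>b\<bar> \<le> a" | "\<bar>- b\<bar> \<le> - a" | "\<bar>a\<bar> \<le> b" | "\<bar>- a\<bar> \<le> - b" by linarith
  then show ?thesis
    by cases (use pos[of b a] pos[of "-b" "-a"] pos[of a b] pos[of "-a" "-b"] in
      \<open>auto simp: signed_powr_minus abs_minus_commute add.commute\<close>)
qed

lemma Lp_le_signed_powr: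
  assumes "Lp_le (\<rho> * p) f A" "1 < \<rho>" "1 \<le> p"
  shows "Lp_le p (\<lambda>x. signed_powr \<rho> (f x)) (A powr \<rho>)"
  using assms by (auto simp: Lp_le_def abs_signed_powr powr_powr)

text \<open>The local Lipschitz bound from L^q to L^p with q = \<rho> p. This exponent is the one
  for which Holder's inequality places both the weight |f| + |g| and the difference in the same
  space L^q.\<close>

lemma Lp_le_signed_powr_diff:
  assumes f: "Lp_le (\<rho> * p) f A" and g: "Lp_le (\<rho> * p) g B"
    and d: "Lp_le (\<rho> * p) (\<lambda>x. f x - g x) D" and \<rho>: "1 < \<rho>" and p: "1 \<le> p"
  shows "Lp_le p (\<lambda>x. signed_powr \<rho> (f x) - signed_powr \<rho> (g x)) (\<rho> * ((A + B) powr (\<rho> - 1) * D))"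
proof -
  have [measurable]: "f \<in> borel_measurable borel" "g \<in> borel_measurable borel"
    using f g by (auto simp: Lp_le_def)
  have "1 * 1 \<le> \<rho> * p" using \<rho> p by (intro mult_mono) auto
  then have q: "1 \<le> \<rho> * p" by simp
  have *: "Lp_le (\<rho> * p) (\<lambda>x. \<bar>h x\<bar>) C" if "Lp_le (\<rho> * p) h C" for h :: "'a \<Rightarrow> real" and C
    using that by (auto simp: Lp_le_def)
  have "Lp_le (\<rho> * p) (\<lambda>x. \<bar>f x\<bar> + \<bar>g x\<bar>) (A + B)"
    using f g q by (intro Lp_le_add *) auto
  from Lp_le_cmult[OF Lp_le_Holder[OF this d \<rho> p], of \<rho>] p \<rho>
  have "Lp_le p (\<lambda>x. \<rho> * (\<bar>\<bar>f x\<bar> + \<bar>g x\<bar>\<bar> powr (\<rho> - 1) * (f x - g x))) (\<rho> * ((A + B) powr (\<rho> - 1) * D))"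
    by simp
  then show ?thesis
    by (rule Lp_le_dominated) (use p \<rho> signed_powr_diff_le[OF \<rho>] in \<open>auto simp: abs_mult\<close>)
qed

section \<open>Jointly measurable versions of continuous paths\<close>

lemma Lp_continuous_onD:
  assumes "Lp_continuous_on S p u" "t \<in> S"
  shows "u t \<in> Lp p" "((\<lambda>s. Lp_norm p (\<lambda>x. u s x - u t x)) \<longlongrightarrow> 0) (at t within S)"
  using assms by (auto simp: Lp_continuous_on_def)

lemma Lp_continuous_on_sequentially:
  assumes u: "Lp_continuous_on S p u" "t \<in> S" and s: "\<And>n. s n \<in> S" "s \<longlonglongrightarrow> t" and p: "0 < p"
  shows "(\<lambda>n. Lp_norm p (\<lambda>x. u (s n) x - u t x)) \<longlonglongrightarrow> 0"
proof -
  let ?g = "\<lambda>s. Lp_norm p (\<lambda>x. u s x - u t x)"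
  have "?g t = 0" by (simp add: Lp_norm_def)
  then have "continuous (at t within S) ?g"
    using Lp_continuous_onD(2)[OF u] by (simp add: continuous_within)
  then show ?thesis
    using s \<open>?g t = 0\<close> by (auto simp: continuous_within_sequentially o_def dest!: spec[of _ s])
qed

lemma Lp_le_path_diff:
  assumes "Lp_continuous_on S p u" "s \<in> S" "t \<in> S" "1 \<le> p"
  shows "Lp_le p (\<lambda>x. u s x - u t x) (Lp_norm p (\<lambda>x. u s x - u t x))"
  using Lp_le_diff[OF Lp_le_Lp_norm Lp_le_Lp_norm, of "u s" p "u t"] assms
  by (intro Lp_le_Lp_norm) (auto simp: Lp_le_iff Lp_continuous_on_def)

text \<open>Heine-Cantor by sequences: pairs of ever closer times violating the bound have a common
  limit point \<open>l\<close>, and continuity at \<open>l\<close> makes both distances to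
  \<open>u l\<close> small.\<close>

lemma Lp_continuous_on_uniform:
  assumes u: "Lp_continuous_on S p u" and S: "compact S" and p: "1 \<le> p" and e: "0 < e"
  shows "\<exists>d>0. \<forall>s\<in>S. \<forall>t\<in>S. \<bar>s - t\<bar> < d \<longrightarrow> Lp_norm p (\<lambda>x. u s x - u t x) \<le> e"
proof (rule ccontr)
  assume "\<not> ?thesis"
  then have "\<forall>n. \<exists>s t. s \<in> S \<and> t \<in> S \<and> \<bar>s - t\<bar> < inverse (real (Suc n)) \<and> \<not> Lp_norm p (\<lambda>x. u s x - u t x) \<le> e"
    by (metis inverse_positive_iff_positive of_nat_0_less_iff zero_less_Suc)
  then obtain s t where st: "\<And>n. s n \<in> S" "\<And>n. t n \<in> S" "\<And>n. \<bar>s n - t n\<bar> < inverse (real (Suc n))"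
    "\<And>n. \<not> Lp_norm p (\<lambda>x. u (s n) x - u (t n) x) \<le> e"
    by metis
  obtain l r where l: "l \<in> S" "strict_mono r" "(s \<circ> r) \<longlonglongrightarrow> l"
    using S st(1) unfolding compact_eq_seq_compact_metric seq_compact_def by metis
  have "(\<lambda>n. s n - t n) \<longlonglongrightarrow> 0"
  proof (rule Lim_null_comparison[OF _ LIMSEQ_inverse_real_of_nat])
    show "\<forall>\<^sub>F n in sequentially. norm (s n - t n) \<le> inverse (real (Suc n))"
      using less_imp_le[OF st(3)] by (intro always_eventually allI) (simp only: real_norm_def)
  qed
  then have "((\<lambda>n. s n - t n) \<circ> r) \<longlonglongrightarrow> 0" using l(2) by (rule LIMSEQ_subseq_LIMSEQ)
  from tendsto_diff[OF l(3) this] have t: "(t \<circ> r) \<longlonglongrightarrow> l" by (simp add: o_def)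
  have "(\<lambda>n. Lp_norm p (\<lambda>x. u ((s \<circ> r) n) x - u l x) + Lp_norm p (\<lambda>x. u ((t \<circ> r) n) x - u l x)) \<longlonglongrightarrow> 0 + 0"
    using Lp_continuous_on_sequentially[OF u l(1) _ l(3)] Lp_continuous_on_sequentially[OF u l(1) _ t] st p
    by (intro tendsto_add) auto
  then have "eventually (\<lambda>n. Lp_norm p (\<lambda>x. u ((s \<circ> r) n) x - u l x) + Lp_norm p (\<lambda>x. u ((t \<circ> r) n) x - u l x) < e) sequentially"
    using e by (intro order_tendstoD(2)) auto
  then obtain n where n: "Lp_norm p (\<lambda>x. u (s (r n)) x - u l x) + Lp_norm p (\<lambda>x. u (t (r n)) x - u l x) < e"
    unfolding eventually_sequentially by auto
  have "Lp_le p (\<lambda>x. u (s (r n)) x - u (t (r n)) x) (Lp_norm p (\<lambda>x. u (s (r n)) x - u l x) + Lp_norm p (\<lambda>x. u (t (r n)) x - u l x))"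
    by (rule Lp_le_triangle[OF Lp_le_path_diff[OF u st(1) l(1) p]
      Lp_le_uminus_commute[OF Lp_le_path_diff[OF u st(2) l(1) p] p] p])
  then have "Lp_norm p (\<lambda>x. u (s (r n)) x - u (t (r n)) x) \<le> e"
    using n p by (auto simp: Lp_le_iff)
  then show False using st(4) by blast
qed

text \<open>The path is sampled at left grid points i / N j, with \<open>N j\<close> chosen by
  uniform continuity so that the error is at most (1 / 2) ^ j at every time. A sample runs through
  countably many functions and is therefore jointly measurable. At each fixed time the samples
  converge fast, so their pointwise limit is a version of the path.\<close>

lemma Lp_path_joint_version:
  fixes u :: "real \<Rightarrow> 'a::euclidean_space \<Rightarrow> real"
  assumes u: "Lp_continuous_on {0..T} p u" and p: "1 \<le> p"
  shows "\<exists>U. jointly_measurable U \<and> (\<forall>t\<in>{0..T}. AE z in lborel. U t z = u t z)"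
proof -
  have "\<exists>N. 0 < (N::nat) \<and> (\<forall>s\<in>{0..T}. \<forall>t\<in>{0..T}. \<bar>s - t\<bar> < 1 / N \<longrightarrow> Lp_norm p (\<lambda>x. u s x - u t x) \<le> (1 / 2) ^ j)" for j :: nat
  proof -
    obtain d where "d > 0" and d: "\<forall>s\<in>{0..T}. \<forall>t\<in>{0..T}. \<bar>s - t\<bar> < d \<longrightarrow> Lp_norm p (\<lambda>x. u s x - u t x) \<le> (1 / 2) ^ j"
      using Lp_continuous_on_uniform[OF u compact_Icc p, of "(1/2)^j"] by auto
    obtain n :: nat where "0 < n" "inverse (real n) < d" using \<open>d > 0\<close> ex_inverse_of_nat_less by blast
    then show ?thesis using d by (intro exI[of _ n]) (auto simp: inverse_eq_divide)
  qed
  then have "\<exists>N. \<forall>j. 0 < (N j :: nat) \<and> (\<forall>s\<in>{0..T}. \<forall>t\<in>{0..T}. \<bar>s - t\<bar> < 1 / N j \<longrightarrow> Lp_norm p (\<lambda>x. u s x - u t x) \<le> (1 / 2) ^ j)"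
    by (intro choice allI)
  then obtain N :: "nat \<Rightarrow> nat" where N: "\<And>j. 0 < N j"
    "\<And>j s t. s \<in> {0..T} \<Longrightarrow> t \<in> {0..T} \<Longrightarrow> \<bar>s - t\<bar> < 1 / N j \<Longrightarrow> Lp_norm p (\<lambda>x. u s x - u t x) \<le> (1 / 2) ^ j"
    by blast
  define c where "c = (\<lambda>j (i::int). real_of_int i / real (N j))"
  define u' where "u' = (\<lambda>t z. if t \<in> {0..T} then u t z else 0)"
  have [measurable]: "u' t \<in> borel_measurable borel" for t
    using u by (cases "t \<in> {0..T}") (auto simp: u'_def Lp_continuous_on_def Lp_def)
  define v where "v = (\<lambda>j s z. u' (c j \<lfloor>s * real (N j)\<rfloor>) z)"
  have v_meas[measurable]: "(\<lambda>(s, z). v j s z) \<in> borel_measurable (borel \<Otimes>\<^sub>M borel)" for j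
  proof -
    have "(\<lambda>x. (\<lambda>i x. u' (c j i) (snd x)) \<lfloor>fst x * real (N j)\<rfloor> x) \<in> borel_measurable (borel \<Otimes>\<^sub>M borel)"
    proof (rule measurable_compose_countable[where f="\<lambda>i x. u' (c j i) (snd x)" and g="\<lambda>x. \<lfloor>fst x * real (N j)\<rfloor>"])
      show "(\<lambda>x. \<lfloor>fst x * real (N j)\<rfloor>) \<in> borel \<Otimes>\<^sub>M borel \<rightarrow>\<^sub>M count_space UNIV"
        by (rule measurable_compose[OF _ measurable_real_floor]) measurable
      show "(\<lambda>x. u' (c j i) (snd x)) \<in> borel_measurable (borel \<Otimes>\<^sub>M borel)" for i
        by (rule measurable_compose[OF measurable_snd]) measurable
    qed
    then show ?thesis by (simp add: v_def case_prod_unfold)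
  qed
  have v_le: "Lp_le p (\<lambda>z. v j s z - u s z) ((1 / 2) ^ j)" if s: "s \<in> {0..T}" for j s
  proof -
    let ?c = "c j \<lfloor>s * real (N j)\<rfloor>"
    have "real_of_int \<lfloor>s * real (N j)\<rfloor> \<le> s * real (N j)" "s * real (N j) < real_of_int \<lfloor>s * real (N j)\<rfloor> + 1" by linarith+
    then have c: "?c \<le> s" "s < ?c + 1 / N j" "0 \<le> ?c"
      using N(1)[of j] s by (auto simp: c_def field_simps)
    then have "Lp_norm p (\<lambda>x. u ?c x - u s x) \<le> (1 / 2) ^ j"
      using s by (intro N(2)) auto
    moreover have "Lp_le p (\<lambda>x. u ?c x - u s x) (Lp_norm p (\<lambda>x. u ?c x - u s x))"
      using u c s p by (intro Lp_le_path_diff[OF u]) auto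
    moreover have "v j s = u ?c" using c s by (auto simp: v_def u'_def fun_eq_iff)
    ultimately show ?thesis using p by (auto intro: Lp_le_mono)
  qed
  define U where "U = (\<lambda>s z. lim (\<lambda>j. v j s z))"
  have "jointly_measurable U"
    unfolding U_def case_prod_unfold using v_meas by (intro borel_measurable_lim_metric) (simp add: case_prod_unfold)
  moreover have "AE z in lborel. U t z = u t z" if t: "t \<in> {0..T}" for t
  proof -
    have [measurable]: "v j t \<in> borel_measurable borel" for j by measurable
    have ut[measurable]: "u t \<in> borel_measurable borel" using u t by (auto simp: Lp_continuous_on_def Lp_def)
    have d: "Lp_le p (\<lambda>z. v (Suc j) t z - v j t z) (2 * (1 / 2) ^ j)" for j
      using Lp_le_triangle[OF v_le[OF t, of "Suc j"] Lp_le_uminus_commute[OF v_le[OF t, of j] p] p] p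
      by (auto elim: Lp_le_mono)
    \<comment> \<open>Fast convergence with c = 2 contributes 4 * (1 / 2) ^ j, the sampling error
      one more.\<close>
    have "Lp_le p (\<lambda>z. U t z - u t z) (5 * (1 / 2) ^ j)" for j
    proof -
      have 1: "Lp_le p (\<lambda>z. U t z - v j t z) (2 * 2 * (1 / 2) ^ j)"
        unfolding U_def by (rule Lp_fast_Cauchy(2)[OF d p]) simp
      show ?thesis using Lp_le_triangle[OF 1 v_le[OF t, of j] p] p by (auto elim: Lp_le_mono)
    qed
    moreover have "(\<lambda>j. 5 * (1 / 2) ^ j :: real) \<longlonglongrightarrow> 5 * 0"
      by (intro tendsto_mult tendsto_const LIMSEQ_realpow_zero) auto
    ultimately have "Lp_le p (\<lambda>z. U t z - u t z) (5 * 0)"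
      by (rule Lp_le_tendsto_bound) (use p in simp)
    then show ?thesis using p by (simp add: Lp_le_0_iff)
  qed
  ultimately show ?thesis by blast
qed

section \<open>Gaussian integrals\<close>

lemma integral_lborel_prod:
  fixes f :: "'a::euclidean_space \<Rightarrow> real \<Rightarrow> 'b::{real_normed_field, banach, second_countable_topology}"
  assumes f: "\<And>b. b \<in> Basis \<Longrightarrow> integrable lborel (f b)"
  shows "(\<integral>x. (\<Prod>b\<in>Basis. f b (x \<bullet> b)) \<partial>lborel) = (\<Prod>b\<in>Basis. \<integral>x. f b x \<partial>lborel)"
proof -
  interpret product_sigma_finite "\<lambda>b::'a. lborel :: real measure" ..
  have [measurable]: "\<And>b. b \<in> Basis \<Longrightarrow> f b \<in> borel_measurable borel" using f by auto
  have eq: "(\<Prod>b\<in>Basis. f b ((\<Sum>c\<in>Basis. x c *\<^sub>R c) \<bullet> b)) = (\<Prod>b\<in>Basis. f b (x b))" for x :: "'a \<Rightarrow> real"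
    by (intro prod.cong) auto
  have "(\<integral>x. (\<Prod>b\<in>Basis. f b (x \<bullet> b)) \<partial>lborel) = (\<integral>x. (\<Prod>b\<in>Basis. f b (x b)) \<partial>(\<Pi>\<^sub>M b\<in>Basis. lborel))"
    by (subst lborel_eq, subst integral_distr) (auto simp: eq)
  also have "\<dots> = (\<Prod>b\<in>Basis. \<integral>x. f b x \<partial>lborel)"
    by (intro product_integral_prod f) auto
  finally show ?thesis .
qed

lemma nn_integral_gaussian_1:
  fixes A b :: real
  assumes "0 < A"
  shows "(\<integral>\<^sup>+x. ennreal (exp (- (A / 2) * x\<^sup>2 + b * x)) \<partial>lborel) = ennreal (sqrt (2 * pi / A) * exp (b\<^sup>2 / (2 * A)))"
proof -
  let ?c = "sqrt (2 * pi / A) * exp (b\<^sup>2 / (2 * A))"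
  have A: "(1 / sqrt A)\<^sup>2 = 1 / A" using assms by (simp add: power_divide)
  have eq: "exp (- (A / 2) * x\<^sup>2 + b * x) = ?c * normal_density (b / A) (1 / sqrt A) x" for x
  proof -
    have "- (A / 2) * x\<^sup>2 + b * x = b\<^sup>2 / (2 * A) + - (x - b / A)\<^sup>2 / (2 * (1 / A))"
      using assms by (simp add: field_simps power2_eq_square)
    then show ?thesis using assms by (simp add: normal_density_def A mult_exp_exp)
  qed
  have "(\<integral>\<^sup>+x. ennreal (exp (- (A / 2) * x\<^sup>2 + b * x)) \<partial>lborel) =
    (\<integral>\<^sup>+x. ennreal ?c * ennreal (normal_density (b / A) (1 / sqrt A) x) \<partial>lborel)"
    unfolding eq using assms by (intro nn_integral_cong ennreal_mult) auto
  also have "\<dots> = ennreal ?c * (\<integral>\<^sup>+x. ennreal (normal_density (b / A) (1 / sqrt A) x) \<partial>lborel)"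
    by (intro nn_integral_cmult) auto
  also have "(\<integral>\<^sup>+x. ennreal (normal_density (b / A) (1 / sqrt A) x) \<partial>lborel) = 1"
    using assms by (subst nn_integral_eq_integral) (auto)
  finally show ?thesis by simp
qed

lemma sqrt_power_powr: "0 < x \<Longrightarrow> sqrt x ^ n = x powr (real n / 2)"
  by (simp add: powr_half_sqrt[symmetric] powr_powr flip: powr_realpow)

lemma norm_square_sum_Basis: "(norm w)\<^sup>2 = (\<Sum>i\<in>Basis. (w \<bullet> i)\<^sup>2)"
  unfolding power2_norm_eq_inner by (subst euclidean_inner) (simp add: power2_eq_square)

text \<open>The coordinates separate, and in each of them the square is completed.\<close>

lemma nn_integral_gaussian:
  fixes b :: "'a::euclidean_space"
  assumes "0 < A"
  shows "(\<integral>\<^sup>+w. ennreal (exp (- (A / 2) * (norm w)\<^sup>2 + b \<bullet> w)) \<partial>lborel) =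
    ennreal ((2 * pi / A) powr (real DIM('a) / 2) * exp ((norm b)\<^sup>2 / (2 * A)))"
proof -
  have eq: "exp (- (A / 2) * (norm w)\<^sup>2 + b \<bullet> w) = (\<Prod>i\<in>Basis. exp (- (A / 2) * (w \<bullet> i)\<^sup>2 + (b \<bullet> i) * (w \<bullet> i)))" for w
    unfolding norm_square_sum_Basis exp_sum[OF finite_Basis, symmetric] euclidean_inner[of b w]
    by (simp add: sum_subtractf sum_distrib_left sum_negf)
  have "(\<integral>\<^sup>+w. ennreal (exp (- (A / 2) * (norm w)\<^sup>2 + b \<bullet> w)) \<partial>lborel) =
    (\<integral>\<^sup>+w. (\<Prod>i\<in>Basis. ennreal (exp (- (A / 2) * (w \<bullet> i)\<^sup>2 + (b \<bullet> i) * (w \<bullet> i)))) \<partial>lborel)"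
    unfolding eq by (intro nn_integral_cong) (simp add: prod_ennreal)
  also have "\<dots> = (\<Prod>i\<in>Basis. \<integral>\<^sup>+x. ennreal (exp (- (A / 2) * x\<^sup>2 + (b \<bullet> i) * x)) \<partial>lborel)"
    by (rule nn_integral_lborel_prod) auto
  also have "\<dots> = (\<Prod>i\<in>Basis. ennreal (sqrt (2 * pi / A) * exp ((b \<bullet> i)\<^sup>2 / (2 * A))))"
    unfolding nn_integral_gaussian_1[OF assms] ..
  also have "\<dots> = ennreal (\<Prod>i\<in>(Basis::'a set). sqrt (2 * pi / A) * exp ((b \<bullet> i)\<^sup>2 / (2 * A)))"
    using assms by (intro prod_ennreal) auto
  also have "(\<Prod>i\<in>(Basis::'a set). sqrt (2 * pi / A) * exp ((b \<bullet> i)\<^sup>2 / (2 * A))) =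
    sqrt (2 * pi / A) ^ DIM('a) * exp ((norm b)\<^sup>2 / (2 * A))"
    by (simp add: prod.distrib exp_sum[symmetric] sum_divide_distrib[symmetric]
        norm_square_sum_Basis[of b])
  finally show ?thesis using assms by (simp add: sqrt_power_powr)
qed

lemma gaussian_integrable:
  assumes "0 < s"
  shows "integrable lborel (\<lambda>\<xi>::'a::euclidean_space. exp (- s * (norm \<xi>)\<^sup>2))"
    "(\<integral>\<xi>. exp (- s * (norm \<xi>)\<^sup>2) \<partial>(lborel :: 'a measure)) = (pi / s) powr (real DIM('a) / 2)"
proof -
  have eq: "(\<integral>\<^sup>+w. ennreal (exp (- s * (norm (w::'a))\<^sup>2)) \<partial>lborel) = ennreal ((pi / s) powr (real DIM('a) / 2))"
    using nn_integral_gaussian[of "2 * s" "0::'a"] assms by simp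
  show "integrable lborel (\<lambda>\<xi>::'a. exp (- s * (norm \<xi>)\<^sup>2))"
    using eq by (intro integrableI_nonneg) auto
  show "(\<integral>\<xi>. exp (- s * (norm \<xi>)\<^sup>2) \<partial>(lborel :: 'a measure)) = (pi / s) powr (real DIM('a) / 2)"
    using eq by (subst integral_eq_nn_integral) auto
qed

text \<open>This is the characteristic function of the standard normal law at t / sqrt (2 * s),
  after rescaling the variable by sqrt (2 * s).\<close>

lemma gaussian_fourier_1:
  assumes "0 < s"
  shows "(\<integral>x. of_real (exp (- s * x\<^sup>2)) * iexp (t * x) \<partial>lborel) = complex_of_real (sqrt (pi / s) * exp (- t\<^sup>2 / (4 * s)))"
proof -
  let ?c = "sqrt (2 * s)"
  have c: "?c \<noteq> 0" "0 < ?c" using assms by auto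
  have "complex_of_real (exp (- (t / ?c)\<^sup>2 / 2)) = char std_normal_distribution (t / ?c)"
    by (simp add: char_std_normal_distribution)
  also have "\<dots> = (\<integral>x. of_real (std_normal_density x) * iexp (t / ?c * x) \<partial>lborel)"
    unfolding char_def by (subst integral_density) (auto simp: scaleR_conv_of_real)
  also have "\<dots> = \<bar>?c\<bar> *\<^sub>R (\<integral>x. of_real (std_normal_density (0 + ?c * x)) * iexp (t / ?c * (0 + ?c * x)) \<partial>lborel)"
    by (rule lborel_integral_real_affine[OF c(1)])
  also have "(\<lambda>x. of_real (std_normal_density (0 + ?c * x)) * iexp (t / ?c * (0 + ?c * x))) =
     (\<lambda>x. of_real (1 / sqrt (2 * pi)) * (of_real (exp (- s * x\<^sup>2)) * iexp (t * x)))"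
  proof
    fix x
    have "t / ?c * (0 + ?c * x) = t * x" using c by simp
    moreover have "std_normal_density (0 + ?c * x) = 1 / sqrt (2 * pi) * exp (- s * x\<^sup>2)"
      using assms by (simp add: std_normal_density_def power_mult_distrib)
    ultimately show "of_real (std_normal_density (0 + ?c * x)) * iexp (t / ?c * (0 + ?c * x)) =
      of_real (1 / sqrt (2 * pi)) * (of_real (exp (- s * x\<^sup>2)) * iexp (t * x))"
      by (simp only: of_real_mult mult.assoc)
  qed
  also have "\<bar>?c\<bar> *\<^sub>R (\<integral>x. of_real (1 / sqrt (2 * pi)) * (of_real (exp (- s * x\<^sup>2)) * iexp (t * x)) \<partial>lborel) =
     of_real (?c / sqrt (2 * pi)) * (\<integral>x. of_real (exp (- s * x\<^sup>2)) * iexp (t * x) \<partial>lborel)"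
    using c(2) by (simp add: scaleR_conv_of_real)
  also have "?c / sqrt (2 * pi) = inverse (sqrt (pi / s))"
    using assms by (simp add: real_sqrt_divide[symmetric] real_sqrt_inverse[symmetric])
  finally have "(\<integral>x. of_real (exp (- s * x\<^sup>2)) * iexp (t * x) \<partial>lborel) =
    complex_of_real (sqrt (pi / s)) * complex_of_real (exp (- (t / ?c)\<^sup>2 / 2))"
    using assms by (simp add: field_simps)
  also have "- (t / ?c)\<^sup>2 / 2 = - t\<^sup>2 / (4 * s)"
    using assms by (simp add: power_divide)
  finally show ?thesis by (simp only: of_real_mult)
qed

lemma gaussian_fourier:
  fixes y :: "'a::euclidean_space"
  assumes "0 < s"
  shows "(\<integral>\<xi>. exp (- s * (norm \<xi>)\<^sup>2) * cos (\<xi> \<bullet> y) \<partial>lborel) =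
    (pi / s) powr (real DIM('a) / 2) * exp (- (norm y)\<^sup>2 / (4 * s))"
proof -
  let ?f = "\<lambda>\<xi>::'a. complex_of_real (exp (- s * (norm \<xi>)\<^sup>2)) * iexp (\<xi> \<bullet> y)"
  have int1: "integrable lborel (\<lambda>x::real. complex_of_real (exp (- s * x\<^sup>2)) * iexp (t * x))" for t
    by (rule Bochner_Integration.integrable_bound[OF gaussian_integrable(1)[OF assms, where 'a=real]])
       (auto simp: norm_mult)
  have int: "integrable lborel ?f"
    by (rule Bochner_Integration.integrable_bound[OF gaussian_integrable(1)[OF assms]])
       (auto simp: norm_mult)
  have eq: "?f \<xi> = (\<Prod>i\<in>Basis. of_real (exp (- s * (\<xi> \<bullet> i)\<^sup>2)) * iexp ((y \<bullet> i) * (\<xi> \<bullet> i)))" for \<xi>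
  proof -
    have "complex_of_real (exp (- s * (norm \<xi>)\<^sup>2)) = (\<Prod>i\<in>Basis. complex_of_real (exp (- s * (\<xi> \<bullet> i)\<^sup>2)))"
      unfolding norm_square_sum_Basis of_real_prod[symmetric] exp_sum[OF finite_Basis, symmetric]
      by (simp add: sum_distrib_left sum_negf)
    moreover have "iexp (\<xi> \<bullet> y) = (\<Prod>i\<in>Basis. iexp ((y \<bullet> i) * (\<xi> \<bullet> i)))"
      by (simp add: exp_sum[symmetric] euclidean_inner[of \<xi> y] sum_distrib_left mult.commute)
    ultimately show ?thesis by (simp add: prod.distrib)
  qed
  have "(\<integral>\<xi>. ?f \<xi> \<partial>lborel) = (\<Prod>i\<in>Basis. \<integral>x. of_real (exp (- s * x\<^sup>2)) * iexp ((y \<bullet> i) * x) \<partial>lborel)"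
    unfolding eq by (rule integral_lborel_prod[OF int1])
  also have "\<dots> = (\<Prod>i\<in>Basis. complex_of_real (sqrt (pi / s) * exp (- (y \<bullet> i)\<^sup>2 / (4 * s))))"
    by (simp only: gaussian_fourier_1[OF assms])
  also have "\<dots> = complex_of_real (\<Prod>i\<in>(Basis::'a set). sqrt (pi / s) * exp (- (y \<bullet> i)\<^sup>2 / (4 * s)))"
    by simp
  also have "(\<Prod>i\<in>(Basis::'a set). sqrt (pi / s) * exp (- (y \<bullet> i)\<^sup>2 / (4 * s))) =
    (pi / s) powr (real DIM('a) / 2) * exp (- (norm y)\<^sup>2 / (4 * s))"
    using assms by (simp add: prod.distrib exp_sum[symmetric] sum_divide_distrib[symmetric] sum_negf
        norm_square_sum_Basis[of y] sqrt_power_powr)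
  finally have "(\<integral>\<xi>. ?f \<xi> \<partial>lborel) = complex_of_real ((pi / s) powr (real DIM('a) / 2) * exp (- (norm y)\<^sup>2 / (4 * s)))" .
  then have "Re (\<integral>\<xi>. ?f \<xi> \<partial>lborel) = (pi / s) powr (real DIM('a) / 2) * exp (- (norm y)\<^sup>2 / (4 * s))"
    by (simp only: Re_complex_of_real)
  moreover have "Re (\<integral>\<xi>. ?f \<xi> \<partial>lborel) = (\<integral>\<xi>. Re (?f \<xi>) \<partial>lborel)"
    using int by (rule integral_Re[symmetric])
  moreover have "Re (?f \<xi>) = exp (- s * (norm \<xi>)\<^sup>2) * cos (\<xi> \<bullet> y)" for \<xi>
    by (simp add: Re_exp)
  ultimately show ?thesis by simp
qed

section \<open>The Mehler kernel\<close>

text \<open>Up to the factor (2 pi) powr -(N / 2), N the dimension, this is the kernel of exp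
  (-\<tau> (-Laplacian + \<omega>^2 |x|^2) / 2) with \<theta> = \<omega> \<tau>. Frequency and angle
  are independent arguments so that the Trotter products below fit the same formula.\<close>

definition mehler :: "real \<Rightarrow> real \<Rightarrow> 'a::euclidean_space \<Rightarrow> 'a \<Rightarrow> real" where
  "mehler \<omega> \<theta> x v = (\<omega> / sinh \<theta>) powr (real DIM('a) / 2) *
     exp (- (\<omega> / 2 * (((norm x)\<^sup>2 + (norm v)\<^sup>2) * (cosh \<theta> / sinh \<theta>) - 2 * (x \<bullet> v) * (1 / sinh \<theta>))))"

lemma mehler_nonneg: "0 \<le> mehler \<omega> \<theta> x v"
  by (simp add: mehler_def)

lemma mehler_commute: "mehler \<omega> \<theta> x v = mehler \<omega> \<theta> v x"
  by (simp add: mehler_def inner_commute add.commute)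

lemma mehler_measurable[measurable]:
  "(\<lambda>p. mehler (f p) (g p) (h p) (k p)) \<in> borel_measurable M"
  if [measurable]: "f \<in> borel_measurable M" "g \<in> borel_measurable M" "h \<in> borel_measurable M" "k \<in> borel_measurable M"
  unfolding mehler_def sinh_def cosh_def by measurable

lemma two_inner_le: "2 * (x \<bullet> v) \<le> (norm x)\<^sup>2 + (norm v)\<^sup>2" for x v :: "'a::euclidean_space"
proof -
  have "0 \<le> (norm (x - v))\<^sup>2" by simp
  also have "\<dots> = (norm x)\<^sup>2 + (norm v)\<^sup>2 - 2 * (x \<bullet> v)"
    by (simp add: power2_norm_eq_inner inner_diff inner_commute)
  finally show ?thesis by simp
qed

text \<open>The exponent is nonpositive, since 2 x . v is at most |x|^2 + |v|^2 and cosh is at least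
  1.\<close>

lemma mehler_le:
  fixes x v :: "'a::euclidean_space"
  assumes "0 \<le> \<omega>" "0 < \<theta>"
  shows "mehler \<omega> \<theta> x v \<le> (\<omega> / sinh \<theta>) powr (real DIM('a) / 2)"
proof -
  have "2 * (x \<bullet> v) \<le> (norm x)\<^sup>2 + (norm v)\<^sup>2" by (rule two_inner_le)
  also have "\<dots> \<le> ((norm x)\<^sup>2 + (norm v)\<^sup>2) * cosh \<theta>"
    using mult_left_mono[OF cosh_real_ge_1[of \<theta>], of "(norm x)\<^sup>2 + (norm v)\<^sup>2"] by simp
  finally have "0 \<le> (((norm x)\<^sup>2 + (norm v)\<^sup>2) * cosh \<theta> - 2 * (x \<bullet> v)) / sinh \<theta>"
    using assms by (intro divide_nonneg_pos) auto
  then have "0 \<le> ((norm x)\<^sup>2 + (norm v)\<^sup>2) * (cosh \<theta> / sinh \<theta>) - 2 * (x \<bullet> v) * (1 / sinh \<theta>)"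
    by (simp add: diff_divide_distrib)
  then have "exp (- (\<omega> / 2 * (((norm x)\<^sup>2 + (norm v)\<^sup>2) * (cosh \<theta> / sinh \<theta>) - 2 * (x \<bullet> v) * (1 / sinh \<theta>)))) \<le> 1"
    using assms by simp
  then show ?thesis unfolding mehler_def by (rule mult_left_le) simp
qed

text \<open>The integrand is a Gaussian in \<open>v\<close>, so the integral is explicit. What
  remains are identities between hyperbolic functions, from the addition theorems and cosh^2 -
  sinh^2 = 1. The factor in front is the normalisation omitted from \<open>mehler\<close>.\<close>

lemma mehler_composition:
  fixes x y :: "'a::euclidean_space"
  assumes "0 < \<omega>" "0 < \<theta>" "0 < \<theta>'"
  shows "(\<integral>\<^sup>+v. ennreal (mehler \<omega> \<theta> x v * mehler \<omega> \<theta>' v y) \<partial>lborel) =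
    ennreal ((2 * pi) powr (real DIM('a) / 2) * mehler \<omega> (\<theta> + \<theta>') x y)"
proof -
  let ?N = "real DIM('a) / 2"
  define s c s' c' S C where "s = sinh \<theta>" "c = cosh \<theta>" "s' = sinh \<theta>'" "c' = cosh \<theta>'"
    "S = sinh (\<theta> + \<theta>')" "C = cosh (\<theta> + \<theta>')"
  note defs = this
  have pos: "0 < s" "0 < s'" "0 < S" using assms by (auto simp: defs)
  have S: "S = s * c' + c * s'" and C: "C = c * c' + s * s'"
    by (simp_all add: defs sinh_add cosh_add)
  have c2: "c * c = 1 + s * s" "c' * c' = 1 + s' * s'"
    using cosh_square_eq[of \<theta>] cosh_square_eq[of \<theta>'] by (simp_all add: defs power2_eq_square)
  \<comment> \<open>The quadratic coefficient in \<open>v\<close>; by the addition theorem it equals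
    \<omega> (coth \<theta> + coth \<theta>').\<close>
  define A where "A = \<omega> * S / (s * s')"
  define b where "b = \<omega> *\<^sub>R ((1 / s) *\<^sub>R x + (1 / s') *\<^sub>R y)"
  define R where "R = (\<omega> / s) powr ?N * (\<omega> / s') powr ?N * exp (- (\<omega> / 2 * ((norm x)\<^sup>2 * (c / s) + (norm y)\<^sup>2 * (c' / s'))))"
  have A: "0 < A" using assms pos by (simp add: A_def)
  have A': "A = \<omega> * (c / s + c' / s')" using pos by (simp add: A_def S field_simps)
  have "mehler \<omega> \<theta> x v * mehler \<omega> \<theta>' v y = R * exp (- (A / 2) * (norm v)\<^sup>2 + b \<bullet> v)" for v
  proof -
    have "- (\<omega> / 2 * (((norm x)\<^sup>2 + (norm v)\<^sup>2) * (c / s) - 2 * (x \<bullet> v) * (1 / s))) +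
          - (\<omega> / 2 * (((norm v)\<^sup>2 + (norm y)\<^sup>2) * (c' / s') - 2 * (v \<bullet> y) * (1 / s'))) =
          - (\<omega> / 2 * ((norm x)\<^sup>2 * (c / s) + (norm y)\<^sup>2 * (c' / s'))) + (- (A / 2) * (norm v)\<^sup>2 + b \<bullet> v)"
      unfolding A' b_def by (simp add: inner_simps inner_commute algebra_simps add_divide_distrib)
    then show ?thesis
      unfolding mehler_def R_def defs(1-4)[symmetric] by (simp add: mult_exp_exp mult_ac)
  qed
  then have "(\<integral>\<^sup>+v. ennreal (mehler \<omega> \<theta> x v * mehler \<omega> \<theta>' v y) \<partial>lborel) =
    (\<integral>\<^sup>+v. ennreal R * ennreal (exp (- (A / 2) * (norm v)\<^sup>2 + b \<bullet> v)) \<partial>lborel)"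
    by (simp add: ennreal_mult R_def)
  also have "\<dots> = ennreal R * ennreal ((2 * pi / A) powr ?N * exp ((norm b)\<^sup>2 / (2 * A)))"
    by (subst nn_integral_gaussian[OF A, symmetric], rule nn_integral_cmult) measurable
  also have "\<dots> = ennreal (R * ((2 * pi / A) powr ?N * exp ((norm b)\<^sup>2 / (2 * A))))"
    by (simp add: ennreal_mult R_def)
  also have "R * ((2 * pi / A) powr ?N * exp ((norm b)\<^sup>2 / (2 * A))) = (2 * pi) powr ?N * mehler \<omega> (\<theta> + \<theta>') x y"
  proof -
    have "(\<omega> / s) powr ?N * (\<omega> / s') powr ?N * (2 * pi / A) powr ?N = ((\<omega> / s) * (\<omega> / s') * (2 * pi / A)) powr ?N"
      using assms pos A by (simp add: powr_mult powr_divide)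
    also have "(\<omega> / s) * (\<omega> / s') * (2 * pi / A) = 2 * pi * (\<omega> / S)"
      using assms pos by (simp add: A_def field_simps)
    also have "(2 * pi * (\<omega> / S)) powr ?N = (2 * pi) powr ?N * (\<omega> / S) powr ?N"
      using assms pos by (intro powr_mult)
    finally have pre: "(\<omega> / s) powr ?N * (\<omega> / s') powr ?N * (2 * pi / A) powr ?N = (2 * pi) powr ?N * (\<omega> / S) powr ?N" .
    have nb: "(norm b)\<^sup>2 = \<omega>\<^sup>2 * ((norm x)\<^sup>2 / s\<^sup>2 + (norm y)\<^sup>2 / s'\<^sup>2 + 2 * (x \<bullet> y) / (s * s'))"
      unfolding b_def power2_norm_eq_inner
      by (simp add: inner_simps inner_commute power2_eq_square algebra_simps)
    \<comment> \<open>Completing the square lowers the coefficient of |x|^2 from coth \<theta> to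
      coth (\<theta> + \<theta>'); \<open>i2\<close> does the same for \<open>y\<close>.\<close>
    have i1: "c / s - s' / (s * S) = C / S"
    proof -
      have "c * S - s' = c * (s * c') + (c * c) * s' - s'" by (simp add: S algebra_simps)
      also have "\<dots> = C * s" unfolding c2 by (simp add: C algebra_simps)
      finally show ?thesis using pos by (simp add: field_simps)
    qed
    have i2: "c' / s' - s / (s' * S) = C / S"
    proof -
      have "c' * S - s = c * (s' * c') + (c' * c') * s - s" by (simp add: S algebra_simps)
      also have "\<dots> = C * s'" unfolding c2 by (simp add: C algebra_simps)
      finally show ?thesis using pos by (simp add: field_simps)
    qed
    have "(norm b)\<^sup>2 / (2 * A) = \<omega> / 2 * ((norm x)\<^sup>2 * (s' / (s * S)) + (norm y)\<^sup>2 * (s / (s' * S)) + 2 * (x \<bullet> y) * (1 / S))"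
      unfolding nb A_def using assms pos by (simp add: field_simps power2_eq_square)
    then have "- (\<omega> / 2 * ((norm x)\<^sup>2 * (c / s) + (norm y)\<^sup>2 * (c' / s'))) + (norm b)\<^sup>2 / (2 * A) =
       - (\<omega> / 2 * ((norm x)\<^sup>2 * (c / s - s' / (s * S)) + (norm y)\<^sup>2 * (c' / s' - s / (s' * S)) - 2 * (x \<bullet> y) * (1 / S)))"
      by (simp add: algebra_simps)
    also have "\<dots> = - (\<omega> / 2 * (((norm x)\<^sup>2 + (norm y)\<^sup>2) * (C / S) - 2 * (x \<bullet> y) * (1 / S)))"
      unfolding i1 i2 by (simp add: algebra_simps)
    finally have ex: "exp (- (\<omega> / 2 * ((norm x)\<^sup>2 * (c / s) + (norm y)\<^sup>2 * (c' / s')))) * exp ((norm b)\<^sup>2 / (2 * A)) =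
       exp (- (\<omega> / 2 * (((norm x)\<^sup>2 + (norm y)\<^sup>2) * (C / S) - 2 * (x \<bullet> y) * (1 / S))))"
      by (simp only: mult_exp_exp)
    have "R * ((2 * pi / A) powr ?N * exp ((norm b)\<^sup>2 / (2 * A))) =
      ((\<omega> / s) powr ?N * (\<omega> / s') powr ?N * (2 * pi / A) powr ?N) *
      (exp (- (\<omega> / 2 * ((norm x)\<^sup>2 * (c / s) + (norm y)\<^sup>2 * (c' / s')))) * exp ((norm b)\<^sup>2 / (2 * A)))"
      by (simp add: R_def mult_ac)
    then show ?thesis unfolding pre ex mehler_def defs(5,6)[symmetric] by (simp add: mult_ac)
  qed
  finally show ?thesis .
qed

section \<open>Fourier inversion by Gaussian regularisation\<close>

lemma nn_integral_lborel_affine: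
  fixes f :: "'a::euclidean_space \<Rightarrow> ennreal"
  assumes [measurable]: "f \<in> borel_measurable borel" and c: "c \<noteq> 0"
  shows "(\<integral>\<^sup>+x. f x \<partial>lborel) = ennreal (\<bar>c\<bar> ^ DIM('a)) * (\<integral>\<^sup>+x. f (t + c *\<^sub>R x) \<partial>lborel)"
  by (subst lborel_affine[OF c, of t])
     (simp add: nn_integral_density nn_integral_distr nn_integral_cmult)

lemma integral_lborel_affine:
  fixes f :: "'a::euclidean_space \<Rightarrow> real"
  assumes [measurable]: "f \<in> borel_measurable borel" and c: "c \<noteq> 0"
  shows "(\<integral>x. f x \<partial>lborel) = \<bar>c\<bar> ^ DIM('a) * (\<integral>x. f (t + c *\<^sub>R x) \<partial>lborel)"
  by (subst lborel_affine[OF c, of t])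
     (simp add: integral_density integral_distr)

lemma integral_lborel_uminus:
  fixes f :: "'a::euclidean_space \<Rightarrow> real"
  assumes "f \<in> borel_measurable borel"
  shows "(\<integral>x. f (- x) \<partial>lborel) = (\<integral>x. f x \<partial>lborel)"
  using integral_lborel_affine[OF assms, of "-1" 0] by simp

lemma integrable_pair_mult:
  fixes f :: "'a::euclidean_space \<Rightarrow> real" and g :: "'b::euclidean_space \<Rightarrow> real"
  assumes f: "integrable lborel f" and g: "integrable lborel g"
  shows "integrable (lborel \<Otimes>\<^sub>M lborel) (\<lambda>(x, y). f x * g y)"
proof (rule lborel_pair.Fubini_integrable)
  have [measurable]: "f \<in> borel_measurable borel" "g \<in> borel_measurable borel" using f g by auto
  show "(\<lambda>(x, y). f x * g y) \<in> borel_measurable (lborel \<Otimes>\<^sub>M lborel)" by measurable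
  show "integrable lborel (\<lambda>x. \<integral>y. norm (case (x, y) of (x, y) \<Rightarrow> f x * g y) \<partial>lborel)"
    using f by (simp add: abs_mult)
  show "AE x in lborel. integrable lborel (\<lambda>y. case (x, y) of (x, y) \<Rightarrow> f x * g y)"
    using g by simp
qed

text \<open>The cosine transform of \<open>g\<close> is not yet known to be integrable, so a
  Gaussian factor is inserted to allow Fubini. On the other side it becomes an average of
  \<open>g\<close> around \<eta> whose width is proportional to sqrt e.\<close>

lemma cos_transform_regularised:
  fixes g :: "'a::euclidean_space \<Rightarrow> real"
  assumes g: "integrable lborel g" and even: "\<And>\<xi>. g (- \<xi>) = g \<xi>" and e: "0 < e"
  shows "(\<integral>y. (\<integral>\<xi>. g \<xi> * cos (\<xi> \<bullet> y) \<partial>lborel) * (exp (- e * (norm y)\<^sup>2) * cos (y \<bullet> \<eta>)) \<partial>lborel) =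
    (\<integral>\<xi>. g \<xi> * ((pi / e) powr (real DIM('a) / 2) * exp (- (norm (\<xi> - \<eta>))\<^sup>2 / (4 * e))) \<partial>lborel)"
proof -
  have [measurable]: "g \<in> borel_measurable borel" using g by auto
  let ?G = "\<lambda>\<zeta>::'a. (pi / e) powr (real DIM('a) / 2) * exp (- (norm \<zeta>)\<^sup>2 / (4 * e))"
  let ?F = "\<lambda>\<xi> y. g \<xi> * cos (\<xi> \<bullet> y) * (exp (- e * (norm y)\<^sup>2) * cos (y \<bullet> \<eta>))"
  have F: "integrable (lborel \<Otimes>\<^sub>M lborel) (\<lambda>(\<xi>, y). ?F \<xi> y)"
  proof (rule Bochner_Integration.integrable_bound[OF integrable_pair_mult[OF g gaussian_integrable(1)[OF e]]])
    show "AE p in lborel \<Otimes>\<^sub>M lborel. norm (case p of (\<xi>, y) \<Rightarrow> ?F \<xi> y) \<le>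
        norm (case p of (\<xi>, y::'a) \<Rightarrow> g \<xi> * exp (- e * (norm y)\<^sup>2))"
    proof (rule AE_I2, clarify)
      fix \<xi> y :: 'a
      have "\<bar>cos (\<xi> \<bullet> y)\<bar> * \<bar>cos (y \<bullet> \<eta>)\<bar> \<le> 1 * 1" by (intro mult_mono) auto
      then have "(\<bar>g \<xi>\<bar> * exp (- e * (norm y)\<^sup>2)) * (\<bar>cos (\<xi> \<bullet> y)\<bar> * \<bar>cos (y \<bullet> \<eta>)\<bar>) \<le> (\<bar>g \<xi>\<bar> * exp (- e * (norm y)\<^sup>2)) * 1"
        by (intro mult_left_mono) auto
      then show "norm (?F \<xi> y) \<le> norm (g \<xi> * exp (- e * (norm y)\<^sup>2))"
        by (simp add: abs_mult mult_ac)
    qed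
  qed measurable
  have gint: "integrable lborel (\<lambda>\<xi>. g \<xi> * h \<xi>)" if "\<And>\<xi>. \<bar>h \<xi>\<bar> \<le> B" "h \<in> borel_measurable borel" for h :: "'a \<Rightarrow> real" and B
  proof (rule Bochner_Integration.integrable_bound[of _ "\<lambda>\<xi>. B * g \<xi>"])
    show "integrable lborel (\<lambda>\<xi>. B * g \<xi>)" using g by simp
    have "0 \<le> B" using that(1)[of 0] by linarith
    then show "AE x in lborel. norm (g x * h x) \<le> norm (B * g x)"
      using mult_right_mono[OF that(1) abs_ge_zero[of "g _"]] by (auto simp: abs_mult mult.commute intro!: AE_I2)
  qed (use that in measurable)
  have Gb: "\<bar>?G (\<xi> - z)\<bar> \<le> (pi / e) powr (real DIM('a) / 2)" for \<xi> z
    using e by (auto simp: abs_mult intro!: mult_left_le)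
  \<comment> \<open>The product of two cosines produces bumps centred at \<eta> and at -\<eta>; at
    the end the second is reflected onto the first, which uses that \<open>g\<close> is
    even.\<close>
  have inner: "(\<integral>y. ?F \<xi> y \<partial>lborel) = g \<xi> * ((?G (\<xi> - \<eta>) + ?G (\<xi> + \<eta>)) / 2)" for \<xi>
  proof -
    have gi: "integrable lborel (\<lambda>y::'a. exp (- e * (norm y)\<^sup>2) * cos (y \<bullet> z))" for z
      by (rule Bochner_Integration.integrable_bound[OF gaussian_integrable(1)[OF e]])
         (auto simp: abs_mult intro!: mult_left_le)
    have eq: "?F \<xi> y = g \<xi> * ((exp (- e * (norm y)\<^sup>2) * cos (y \<bullet> (\<xi> - \<eta>)) + exp (- e * (norm y)\<^sup>2) * cos (y \<bullet> (\<xi> + \<eta>))) / 2)" for y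
    proof -
      have cc: "cos (\<xi> \<bullet> y) * cos (y \<bullet> \<eta>) = (cos (y \<bullet> (\<xi> - \<eta>)) + cos (y \<bullet> (\<xi> + \<eta>))) / 2"
        by (simp add: cos_times_cos inner_simps inner_commute)
      have "?F \<xi> y = g \<xi> * (exp (- e * (norm y)\<^sup>2) * (cos (\<xi> \<bullet> y) * cos (y \<bullet> \<eta>)))" by simp
      then show ?thesis unfolding cc by (simp add: field_simps)
    qed
    have "(\<integral>y. ?F \<xi> y \<partial>lborel) = g \<xi> * (((\<integral>y. exp (- e * (norm y)\<^sup>2) * cos (y \<bullet> (\<xi> - \<eta>)) \<partial>lborel) + (\<integral>y. exp (- e * (norm y)\<^sup>2) * cos (y \<bullet> (\<xi> + \<eta>)) \<partial>lborel)) / 2)"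
      unfolding eq using gi by simp
    then show ?thesis unfolding gaussian_fourier[OF e] .
  qed
  have i1: "integrable lborel (\<lambda>\<xi>. g \<xi> * ?G (\<xi> - \<eta>))"
    by (rule gint[OF Gb]) measurable
  have i2: "integrable lborel (\<lambda>\<xi>. g \<xi> * ?G (\<xi> + \<eta>))"
    by (rule gint[OF Gb[of _ "- \<eta>", unfolded diff_minus_eq_add]]) measurable
  have "(\<integral>y. (\<integral>\<xi>. g \<xi> * cos (\<xi> \<bullet> y) \<partial>lborel) * (exp (- e * (norm y)\<^sup>2) * cos (y \<bullet> \<eta>)) \<partial>lborel) =
      (\<integral>y. (\<integral>\<xi>. ?F \<xi> y \<partial>lborel) \<partial>lborel)" by simp
  also have "\<dots> = (\<integral>\<xi>. (\<integral>y. ?F \<xi> y \<partial>lborel) \<partial>lborel)"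
    by (rule lborel_pair.Fubini_integral[OF F])
  also have "\<dots> = (\<integral>\<xi>. (g \<xi> * ?G (\<xi> - \<eta>) + g \<xi> * ?G (\<xi> + \<eta>)) / 2 \<partial>lborel)"
    unfolding inner by (simp add: algebra_simps)
  also have "\<dots> = ((\<integral>\<xi>. g \<xi> * ?G (\<xi> - \<eta>) \<partial>lborel) + (\<integral>\<xi>. g \<xi> * ?G (\<xi> + \<eta>) \<partial>lborel)) / 2"
    by (simp only: integral_divide_zero Bochner_Integration.integral_add[OF i1 i2])
  also have "(\<integral>\<xi>. g \<xi> * ?G (\<xi> + \<eta>) \<partial>lborel) = (\<integral>\<xi>. g (- \<xi>) * ?G (- \<xi> + \<eta>) \<partial>lborel)"
    by (rule integral_lborel_uminus[symmetric]) measurable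
  also have "\<dots> = (\<integral>\<xi>. g \<xi> * ?G (\<xi> - \<eta>) \<partial>lborel)"
    by (simp add: even norm_minus_commute)
  finally show ?thesis by simp
qed

text \<open>Only the limit of \<open>g\<close> at \<eta> enters, never its value there. The symbol
  of the kernel requires this: at frequency zero its formula returns 0 by the conventions for
  division and \<open>powr\<close>, whereas its limit is a Euclidean heat kernel.\<close>

lemma gaussian_approximate_identity:
  fixes g :: "'a::euclidean_space \<Rightarrow> real"
  assumes [measurable]: "g \<in> borel_measurable borel" and B: "\<And>\<xi>. \<bar>g \<xi>\<bar> \<le> B"
    and L: "(g \<longlongrightarrow> L) (at \<eta>)"
  defines "\<delta> \<equiv> \<lambda>n. inverse (real (Suc n))"
  shows "(\<lambda>n. \<integral>\<xi>. g \<xi> * ((pi / (\<delta> n)\<^sup>2) powr (real DIM('a) / 2) * exp (- (norm (\<xi> - \<eta>))\<^sup>2 / (4 * (\<delta> n)\<^sup>2))) \<partial>lborel)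
    \<longlonglongrightarrow> (2 * pi) ^ DIM('a) * L"
proof -
  let ?n = "real DIM('a) / 2"
  have \<delta>: "0 < \<delta> n" for n by (simp add: \<delta>_def)
  have \<delta>0: "\<delta> \<longlonglongrightarrow> 0" unfolding \<delta>_def by (rule LIMSEQ_inverse_real_of_nat)
  have eq: "(\<integral>\<xi>. g \<xi> * ((pi / (\<delta> n)\<^sup>2) powr ?n * exp (- (norm (\<xi> - \<eta>))\<^sup>2 / (4 * (\<delta> n)\<^sup>2))) \<partial>lborel) =
     pi powr ?n * (\<integral>\<zeta>. g (\<eta> + \<delta> n *\<^sub>R \<zeta>) * exp (- (1 / 4) * (norm \<zeta>)\<^sup>2) \<partial>lborel)" (is "?l = _") for n
  proof -
    have "?l = \<bar>\<delta> n\<bar> ^ DIM('a) * (\<integral>\<zeta>. g (\<eta> + \<delta> n *\<^sub>R \<zeta>) * ((pi / (\<delta> n)\<^sup>2) powr ?n * exp (- (norm ((\<eta> + \<delta> n *\<^sub>R \<zeta>) - \<eta>))\<^sup>2 / (4 * (\<delta> n)\<^sup>2))) \<partial>lborel)"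
      using \<delta>[of n] by (intro integral_lborel_affine) auto
    also have "\<dots> = \<bar>\<delta> n\<bar> ^ DIM('a) * (\<integral>\<zeta>. (pi / (\<delta> n)\<^sup>2) powr ?n * (g (\<eta> + \<delta> n *\<^sub>R \<zeta>) * exp (- (1 / 4) * (norm \<zeta>)\<^sup>2)) \<partial>lborel)"
      using \<delta>[of n] by (simp add: power_mult_distrib mult_ac)
    also have "\<dots> = \<bar>\<delta> n\<bar> ^ DIM('a) * (pi / (\<delta> n)\<^sup>2) powr ?n * (\<integral>\<zeta>. g (\<eta> + \<delta> n *\<^sub>R \<zeta>) * exp (- (1 / 4) * (norm \<zeta>)\<^sup>2) \<partial>lborel)"
      by simp
    also have "\<bar>\<delta> n\<bar> ^ DIM('a) * (pi / (\<delta> n)\<^sup>2) powr ?n = pi powr ?n"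
    proof -
      have "((\<delta> n)\<^sup>2) powr ?n = \<bar>\<delta> n\<bar> ^ DIM('a)"
        using sqrt_power_powr[of "(\<delta> n)\<^sup>2" "DIM('a)"] \<delta>[of n] by simp
      then show ?thesis using \<delta>[of n] by (simp add: powr_divide)
    qed
    finally show ?thesis .
  qed
  have "(\<lambda>n. \<integral>\<zeta>. g (\<eta> + \<delta> n *\<^sub>R \<zeta>) * exp (- (1 / 4) * (norm \<zeta>)\<^sup>2) \<partial>lborel) \<longlonglongrightarrow>
     (\<integral>\<zeta>. L * exp (- (1 / 4) * (norm (\<zeta>::'a))\<^sup>2) \<partial>lborel)"
  proof (rule integral_dominated_convergence)
    show "integrable lborel (\<lambda>\<zeta>::'a. B * exp (- (1 / 4) * (norm \<zeta>)\<^sup>2))"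
      using gaussian_integrable(1)[of "1/4", where 'a='a] by simp
    show "AE \<zeta> in lborel. (\<lambda>n. g (\<eta> + \<delta> n *\<^sub>R \<zeta>) * exp (- (1 / 4) * (norm \<zeta>)\<^sup>2)) \<longlonglongrightarrow> L * exp (- (1 / 4) * (norm \<zeta>)\<^sup>2)"
      using AE_lborel_singleton[of 0]
    proof eventually_elim
      fix \<zeta> :: 'a assume z: "\<zeta> \<noteq> 0"
      have "(\<lambda>n. \<eta> + \<delta> n *\<^sub>R \<zeta>) \<longlonglongrightarrow> \<eta> + 0 *\<^sub>R \<zeta>" by (intro tendsto_intros \<delta>0)
      then have "filterlim (\<lambda>n. \<eta> + \<delta> n *\<^sub>R \<zeta>) (at \<eta>) sequentially"
        using z less_imp_neq[OF \<delta>] by (auto simp: filterlim_at intro!: always_eventually)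
      from filterlim_compose[OF L this] show "(\<lambda>n. g (\<eta> + \<delta> n *\<^sub>R \<zeta>) * exp (- (1 / 4) * (norm \<zeta>)\<^sup>2)) \<longlonglongrightarrow> L * exp (- (1 / 4) * (norm \<zeta>)\<^sup>2)"
        by (intro tendsto_intros)
    qed
    show "AE \<zeta> in lborel. norm (g (\<eta> + \<delta> n *\<^sub>R \<zeta>) * exp (- (1 / 4) * (norm \<zeta>)\<^sup>2)) \<le> B * exp (- (1 / 4) * (norm \<zeta>)\<^sup>2)" for n
      using B by (auto simp: abs_mult intro!: mult_right_mono)
  qed auto
  then have "(\<lambda>n. pi powr ?n * (\<integral>\<zeta>. g (\<eta> + \<delta> n *\<^sub>R \<zeta>) * exp (- (1 / 4) * (norm \<zeta>)\<^sup>2) \<partial>lborel)) \<longlonglongrightarrow>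
     pi powr ?n * (\<integral>\<zeta>. L * exp (- (1 / 4) * (norm (\<zeta>::'a))\<^sup>2) \<partial>lborel)"
    by (intro tendsto_mult tendsto_const)
  moreover have "pi powr ?n * (\<integral>\<zeta>. L * exp (- (1 / 4) * (norm (\<zeta>::'a))\<^sup>2) \<partial>lborel) = (2 * pi) ^ DIM('a) * L"
  proof -
    have "pi powr ?n * (4 * pi) powr ?n = (pi * (4 * pi)) powr ?n" by (intro powr_mult[symmetric])
    also have "\<dots> = sqrt (pi * (4 * pi)) ^ DIM('a)" by (simp add: sqrt_power_powr)
    also have "pi * (4 * pi) = (2 * pi)\<^sup>2" by (simp add: power2_eq_square)
    also have "sqrt ((2 * pi)\<^sup>2) = 2 * pi" by (subst real_sqrt_abs) simp
    finally show ?thesis using gaussian_integrable(2)[of "1/4", where 'a='a] by (simp add: mult_ac)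
  qed
  ultimately show ?thesis unfolding eq by (simp only:)
qed

lemma cos_transform_measurable:
  fixes g :: "'a::euclidean_space \<Rightarrow> real"
  assumes [measurable]: "g \<in> borel_measurable borel"
  shows "(\<lambda>y. \<integral>\<xi>. g \<xi> * cos (\<xi> \<bullet> y) \<partial>lborel) \<in> borel_measurable borel"
  by (rule lborel.borel_measurable_lebesgue_integral) measurable

text \<open>The Gaussian regularisations of a nonnegative cosine transform have bounded integrals; this
  gives integrability and with it the inversion formula.\<close>

lemma
  fixes g :: "'a::euclidean_space \<Rightarrow> real"
  assumes g: "integrable lborel g" and even: "\<And>\<xi>. g (- \<xi>) = g \<xi>" and B: "\<And>\<xi>. \<bar>g \<xi>\<bar> \<le> B"
    and L0: "(g \<longlongrightarrow> L0) (at 0)"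
    and nonneg: "\<And>y. 0 \<le> (\<integral>\<xi>. g \<xi> * cos (\<xi> \<bullet> y) \<partial>lborel)"
  shows cos_transform_integrable: "integrable lborel (\<lambda>y. \<integral>\<xi>. g \<xi> * cos (\<xi> \<bullet> y) \<partial>lborel)"
    and cos_transform_inversion: "(g \<longlongrightarrow> L) (at \<eta>) \<Longrightarrow>
      (\<integral>y. (\<integral>\<xi>. g \<xi> * cos (\<xi> \<bullet> y) \<partial>lborel) * cos (y \<bullet> \<eta>) \<partial>lborel) = (2 * pi) ^ DIM('a) * L"
proof -
  have gm[measurable]: "g \<in> borel_measurable borel" using g by auto
  define K where "K = (\<lambda>y. \<integral>\<xi>. g \<xi> * cos (\<xi> \<bullet> y) \<partial>lborel)"
  have [measurable]: "K \<in> borel_measurable borel" unfolding K_def by (rule cos_transform_measurable[OF gm])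
  have K0: "0 \<le> K y" for y using nonneg by (simp add: K_def)
  define \<delta> where "\<delta> = (\<lambda>n. inverse (real (Suc n)))"
  have \<delta>: "0 < \<delta> n" for n by (simp add: \<delta>_def)
  have \<delta>0: "\<delta> \<longlonglongrightarrow> 0" unfolding \<delta>_def by (rule LIMSEQ_inverse_real_of_nat)
  have \<delta>2: "0 < (\<delta> n)\<^sup>2" for n using \<delta>[of n] by simp
  have J: "(\<lambda>n. \<integral>y. K y * (exp (- (\<delta> n)\<^sup>2 * (norm y)\<^sup>2) * cos (y \<bullet> \<eta>)) \<partial>lborel) \<longlonglongrightarrow> (2 * pi) ^ DIM('a) * L"
    if "(g \<longlongrightarrow> L) (at \<eta>)" for L \<eta>
    unfolding K_def cos_transform_regularised[OF g even \<delta>2]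
    using gaussian_approximate_identity[OF gm B that] by (simp add: \<delta>_def)
  have e1: "(\<lambda>n. exp (- (\<delta> n)\<^sup>2 * (norm y)\<^sup>2)) \<longlonglongrightarrow> 1" for y :: 'a
  proof -
    have "(\<lambda>n. exp (- (\<delta> n)\<^sup>2 * (norm y)\<^sup>2)) \<longlonglongrightarrow> exp (- 0\<^sup>2 * (norm y)\<^sup>2)"
      by (intro tendsto_intros \<delta>0)
    then show ?thesis by simp
  qed
  have Kb: "\<bar>K y\<bar> \<le> (\<integral>\<xi>. \<bar>g \<xi>\<bar> \<partial>lborel)" for y
    unfolding K_def
  proof (rule order.trans[OF integral_abs_bound integral_mono])
    show "integrable lborel (\<lambda>\<xi>. \<bar>g \<xi> * cos (\<xi> \<bullet> y)\<bar>)"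
      by (rule Bochner_Integration.integrable_bound[OF g]) (auto simp: abs_mult intro!: mult_left_le)
  qed (use g in \<open>auto simp: abs_mult intro!: mult_left_le\<close>)
  have Ki: "integrable lborel (\<lambda>y. K y * exp (- (\<delta> n)\<^sup>2 * (norm y)\<^sup>2))" for n
  proof (rule Bochner_Integration.integrable_bound)
    show "integrable lborel (\<lambda>y::'a. (\<integral>\<xi>. \<bar>g \<xi>\<bar> \<partial>lborel) * exp (- (\<delta> n)\<^sup>2 * (norm y)\<^sup>2))"
      by (intro integrable_mult_right gaussian_integrable(1)[OF \<delta>2])
    show "AE y in lborel. norm (K y * exp (- (\<delta> n)\<^sup>2 * (norm y)\<^sup>2)) \<le> norm ((\<integral>\<xi>. \<bar>g \<xi>\<bar> \<partial>lborel) * exp (- (\<delta> n)\<^sup>2 * (norm y)\<^sup>2))"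
      using Kb by (auto simp: abs_mult intro!: mult_right_mono)
  qed auto
  \<comment> \<open>Fatou's lemma; the regularised integrals converge by \<open>J\<close> at
    frequency zero, and this is where \<open>L0\<close> comes in.\<close>
  have "(\<integral>\<^sup>+y. ennreal (K y) \<partial>lborel) = (\<integral>\<^sup>+y. liminf (\<lambda>n. ennreal (K y * exp (- (\<delta> n)\<^sup>2 * (norm y)\<^sup>2))) \<partial>lborel)"
  proof (intro nn_integral_cong lim_imp_Liminf[symmetric] tendsto_ennrealI)
    fix y
    show "(\<lambda>n. K y * exp (- (\<delta> n)\<^sup>2 * (norm y)\<^sup>2)) \<longlonglongrightarrow> K y"
      using tendsto_mult[OF tendsto_const[of "K y"] e1[of y]] by simp
  qed auto
  also have "\<dots> \<le> liminf (\<lambda>n. \<integral>\<^sup>+y. ennreal (K y * exp (- (\<delta> n)\<^sup>2 * (norm y)\<^sup>2)) \<partial>lborel)"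
    by (intro nn_integral_liminf) auto
  also have "\<dots> = liminf (\<lambda>n. ennreal (\<integral>y. K y * exp (- (\<delta> n)\<^sup>2 * (norm y)\<^sup>2) \<partial>lborel))"
    using Ki K0 by (subst nn_integral_eq_integral) auto
  also have "\<dots> = ennreal ((2 * pi) ^ DIM('a) * L0)"
    using J[OF L0] by (intro lim_imp_Liminf tendsto_ennrealI) auto
  finally have K: "integrable lborel K"
    using K0 by (intro integrableI_nonneg) (auto simp: top_unique less_top[symmetric])
  then show "integrable lborel (\<lambda>y. \<integral>\<xi>. g \<xi> * cos (\<xi> \<bullet> y) \<partial>lborel)" by (simp add: K_def)
  assume L: "(g \<longlongrightarrow> L) (at \<eta>)"
  have "(\<lambda>n. \<integral>y. K y * (exp (- (\<delta> n)\<^sup>2 * (norm y)\<^sup>2) * cos (y \<bullet> \<eta>)) \<partial>lborel) \<longlonglongrightarrow> (\<integral>y. K y * cos (y \<bullet> \<eta>) \<partial>lborel)"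
  proof (rule integral_dominated_convergence[OF _ _ K])
    show "AE y in lborel. (\<lambda>n. K y * (exp (- (\<delta> n)\<^sup>2 * (norm y)\<^sup>2) * cos (y \<bullet> \<eta>))) \<longlonglongrightarrow> K y * cos (y \<bullet> \<eta>)"
    proof (rule AE_I2)
      fix y
      show "(\<lambda>n. K y * (exp (- (\<delta> n)\<^sup>2 * (norm y)\<^sup>2) * cos (y \<bullet> \<eta>))) \<longlonglongrightarrow> K y * cos (y \<bullet> \<eta>)"
        using tendsto_mult[OF tendsto_const[of "K y"] tendsto_mult[OF e1[of y] tendsto_const[of "cos (y \<bullet> \<eta>)"]]] by simp
    qed
    show "AE y in lborel. norm (K y * (exp (- (\<delta> n)\<^sup>2 * (norm y)\<^sup>2) * cos (y \<bullet> \<eta>))) \<le> K y" for n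
      using K0 by (auto simp: abs_mult intro!: mult_left_le mult_le_one)
  qed auto
  with J[OF L] show "(\<integral>y. (\<integral>\<xi>. g \<xi> * cos (\<xi> \<bullet> y) \<partial>lborel) * cos (y \<bullet> \<eta>) \<partial>lborel) = (2 * pi) ^ DIM('a) * L"
    unfolding K_def by (rule LIMSEQ_unique[rotated])
qed

text \<open>The addition formula splits cos (\<xi> . (Y - z)). Its sine part integrates to zero
  because the transform of \<open>g2\<close> is even, and its cosine part is the inversion formula
  for \<open>g2\<close> at \<xi>. Integrability of that transform, a consequence of its sign,
  justifies Fubini.\<close>

lemma cos_transform_convolution:
  fixes g1 g2 :: "'a::euclidean_space \<Rightarrow> real"
  assumes g1: "integrable lborel g1"
    and g2: "integrable lborel g2" "\<And>\<xi>. g2 (- \<xi>) = g2 \<xi>" "\<And>\<xi>. \<bar>g2 \<xi>\<bar> \<le> B" "(g2 \<longlongrightarrow> L0) (at 0)"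
      "\<And>\<eta>. \<eta> \<noteq> 0 \<Longrightarrow> (g2 \<longlongrightarrow> g2 \<eta>) (at \<eta>)"
    and nonneg: "\<And>y. 0 \<le> (\<integral>\<xi>. g2 \<xi> * cos (\<xi> \<bullet> y) \<partial>lborel)"
  shows "integrable lborel (\<lambda>z. (\<integral>\<xi>. g1 \<xi> * cos (\<xi> \<bullet> (Y - z)) \<partial>lborel) * (\<integral>\<xi>. g2 \<xi> * cos (\<xi> \<bullet> z) \<partial>lborel))"
    "(\<integral>z. (\<integral>\<xi>. g1 \<xi> * cos (\<xi> \<bullet> (Y - z)) \<partial>lborel) * (\<integral>\<xi>. g2 \<xi> * cos (\<xi> \<bullet> z) \<partial>lborel) \<partial>lborel) =
      (2 * pi) ^ DIM('a) * (\<integral>\<xi>. g1 \<xi> * g2 \<xi> * cos (\<xi> \<bullet> Y) \<partial>lborel)"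
proof -
  have gm[measurable]: "g1 \<in> borel_measurable borel" "g2 \<in> borel_measurable borel" using g1 g2 by auto
  define K where "K = (\<lambda>y. \<integral>\<xi>. g2 \<xi> * cos (\<xi> \<bullet> y) \<partial>lborel)"
  have K: "integrable lborel K" unfolding K_def by (rule cos_transform_integrable[OF g2(1-4) nonneg])
  have [measurable]: "K \<in> borel_measurable borel" using K by auto
  have Ke: "K (- y) = K y" for y by (simp add: K_def)
  let ?F = "\<lambda>\<xi> z. g1 \<xi> * cos (\<xi> \<bullet> (Y - z)) * K z"
  have F: "integrable (lborel \<Otimes>\<^sub>M lborel) (\<lambda>(\<xi>, z). ?F \<xi> z)"
  proof (rule Bochner_Integration.integrable_bound[OF integrable_pair_mult[OF g1 K]])
    show "AE p in lborel \<Otimes>\<^sub>M lborel. norm (case p of (\<xi>, y) \<Rightarrow> ?F \<xi> y) \<le> norm (case p of (\<xi>, y) \<Rightarrow> g1 \<xi> * K y)"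
      by (auto simp: abs_mult intro!: AE_I2 mult_right_mono mult_left_le)
  qed measurable
  have F': "integrable (lborel \<Otimes>\<^sub>M lborel) (\<lambda>(z, \<xi>). ?F \<xi> z)"
    using lborel_pair.integrable_product_swap[OF F] by (simp add: case_prod_unfold)
  show "integrable lborel (\<lambda>z. (\<integral>\<xi>. g1 \<xi> * cos (\<xi> \<bullet> (Y - z)) \<partial>lborel) * (\<integral>\<xi>. g2 \<xi> * cos (\<xi> \<bullet> z) \<partial>lborel))"
    using lborel_pair.integrable_fst'[OF F'] by (simp add: K_def)
  have Kc: "integrable lborel (\<lambda>z. K z * cos (z \<bullet> \<xi>))" "integrable lborel (\<lambda>z. K z * sin (z \<bullet> \<xi>))" for \<xi>
    by (rule Bochner_Integration.integrable_bound[OF K]; auto simp: abs_mult intro!: mult_left_le)+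
  have Ks: "(\<integral>z. K z * sin (z \<bullet> \<xi>) \<partial>lborel) = 0" for \<xi>
  proof -
    have "(\<integral>z. K z * sin (z \<bullet> \<xi>) \<partial>lborel) = (\<integral>z. K (- z) * sin (- z \<bullet> \<xi>) \<partial>lborel)"
      by (rule integral_lborel_uminus[symmetric]) measurable
    then show ?thesis by (simp add: Ke)
  qed
  \<comment> \<open>Inversion returns the limit of \<open>g2\<close> at \<xi>, which is the value of
    \<open>g2\<close> only away from zero; the excluded point is a null set for the outer
    integral.\<close>
  have inner: "(\<integral>z. ?F \<xi> z \<partial>lborel) = g1 \<xi> * cos (\<xi> \<bullet> Y) * ((2 * pi) ^ DIM('a) * g2 \<xi>)" if "\<xi> \<noteq> 0" for \<xi>
  proof -
    have eq: "?F \<xi> z = g1 \<xi> * cos (\<xi> \<bullet> Y) * (K z * cos (z \<bullet> \<xi>)) + g1 \<xi> * sin (\<xi> \<bullet> Y) * (K z * sin (z \<bullet> \<xi>))" for z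
      by (simp add: inner_diff_right cos_diff inner_commute algebra_simps)
    have "(\<integral>z. ?F \<xi> z \<partial>lborel) = g1 \<xi> * cos (\<xi> \<bullet> Y) * (\<integral>z. K z * cos (z \<bullet> \<xi>) \<partial>lborel) + g1 \<xi> * sin (\<xi> \<bullet> Y) * (\<integral>z. K z * sin (z \<bullet> \<xi>) \<partial>lborel)"
      unfolding eq using Kc by simp
    also have "(\<integral>z. K z * cos (z \<bullet> \<xi>) \<partial>lborel) = (2 * pi) ^ DIM('a) * g2 \<xi>"
      unfolding K_def by (rule cos_transform_inversion[OF g2(1-4) nonneg g2(5)[OF that]])
    finally show ?thesis by (simp add: Ks)
  qed
  have "(\<integral>z. (\<integral>\<xi>. g1 \<xi> * cos (\<xi> \<bullet> (Y - z)) \<partial>lborel) * K z \<partial>lborel) = (\<integral>z. (\<integral>\<xi>. ?F \<xi> z \<partial>lborel) \<partial>lborel)" by simp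
  also have "\<dots> = (\<integral>\<xi>. (\<integral>z. ?F \<xi> z \<partial>lborel) \<partial>lborel)"
    by (rule lborel_pair.Fubini_integral[OF F])
  also have "\<dots> = (\<integral>\<xi>. (2 * pi) ^ DIM('a) * (g1 \<xi> * g2 \<xi> * cos (\<xi> \<bullet> Y)) \<partial>lborel)"
  proof (rule integral_cong_AE)
    show "(\<lambda>\<xi>. \<integral>z. ?F \<xi> z \<partial>lborel) \<in> borel_measurable lborel"
      using lborel_pair.integrable_fst'[OF F] by auto
    show "AE \<xi> in lborel. (\<integral>z. ?F \<xi> z \<partial>lborel) = (2 * pi) ^ DIM('a) * (g1 \<xi> * g2 \<xi> * cos (\<xi> \<bullet> Y))"
      using AE_lborel_singleton[of 0] by eventually_elim (subst inner, simp_all)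
  qed measurable
  finally show "(\<integral>z. (\<integral>\<xi>. g1 \<xi> * cos (\<xi> \<bullet> (Y - z)) \<partial>lborel) * (\<integral>\<xi>. g2 \<xi> * cos (\<xi> \<bullet> z) \<partial>lborel) \<partial>lborel) =
      (2 * pi) ^ DIM('a) * (\<integral>\<xi>. g1 \<xi> * g2 \<xi> * cos (\<xi> \<bullet> Y) \<partial>lborel)"
    unfolding K_def by simp
qed

section \<open>Positivity by discretisation\<close>

lemma exp_abs_nn_integral_finite:
  assumes "0 < (a::real)"
  shows "(\<integral>\<^sup>+x. ennreal (exp (- a * \<bar>x\<bar>)) \<partial>lborel) < \<infinity>"
proof -
  have "has_bochner_integral lborel (\<lambda>x. indicator {0..} x *\<^sub>R exp (- \<bar>x\<bar>)) (1::real)"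
  proof -
    have "has_bochner_integral lborel (\<lambda>x. indicator {0..} x *\<^sub>R (x ^ 0 * exp (- x))) (real (fact 0))"
      using nn_intergal_power_times_exp_Ici[of 0]
      by (intro has_bochner_integral_nn_integral) (auto simp: nn_integral_set_ennreal mult.commute split: split_indicator)
    then show ?thesis
      by (rule has_bochner_integral_cong[THEN iffD1, rotated 3]) (auto split: split_indicator)
  qed
  from has_bochner_integral_even_function[OF this]
  have "integrable lborel (\<lambda>x::real. exp (- \<bar>x\<bar>))" by (auto simp: has_bochner_integral_iff)
  from lborel_integrable_real_affine[OF this, of a 0] assms
  have "integrable lborel (\<lambda>x::real. exp (- a * \<bar>x\<bar>))" by (simp add: abs_mult)
  then show ?thesis by (simp add: integrable_iff_bounded)
qed

text \<open>The norm dominates the mean of the moduli of the coordinates, so the integrand is at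
  most a product of one-dimensional exponentials.\<close>

lemma integrable_exp_norm:
  assumes "0 < (a::real)"
  shows "integrable lborel (\<lambda>\<xi>::'a::euclidean_space. exp (- a * norm \<xi>))"
proof (rule integrableI_nonneg)
  let ?c = "a / real DIM('a)"
  have c: "0 < ?c" using assms by simp
  have "(\<integral>\<^sup>+\<xi>. ennreal (exp (- a * norm (\<xi>::'a))) \<partial>lborel) \<le>
    (\<integral>\<^sup>+\<xi>. (\<Prod>b\<in>(Basis::'a set). ennreal (exp (- ?c * \<bar>\<xi> \<bullet> b\<bar>))) \<partial>lborel)"
  proof (rule nn_integral_mono)
    fix \<xi> :: 'a
    have "(\<Sum>b\<in>(Basis::'a set). \<bar>\<xi> \<bullet> b\<bar>) \<le> (\<Sum>b\<in>(Basis::'a set). norm \<xi>)"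
      by (intro sum_mono) (simp add: Basis_le_norm)
    then have "?c * (\<Sum>b\<in>(Basis::'a set). \<bar>\<xi> \<bullet> b\<bar>) \<le> ?c * (real DIM('a) * norm \<xi>)"
      using c by (intro mult_left_mono) auto
    then have "exp (- a * norm \<xi>) \<le> exp (\<Sum>b\<in>(Basis::'a set). - ?c * \<bar>\<xi> \<bullet> b\<bar>)"
      by (simp add: sum_distrib_left[symmetric] sum_negf sum_divide_distrib[symmetric])
    then show "ennreal (exp (- a * norm \<xi>)) \<le> (\<Prod>b\<in>(Basis::'a set). ennreal (exp (- ?c * \<bar>\<xi> \<bullet> b\<bar>)))"
      by (subst prod_ennreal) (auto simp: exp_sum[symmetric] intro!: ennreal_leI)
  qed
  also have "\<dots> = (\<Prod>b\<in>(Basis::'a set). \<integral>\<^sup>+x. ennreal (exp (- ?c * \<bar>x\<bar>)) \<partial>lborel)"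
    by (rule nn_integral_lborel_prod) auto
  also have "\<dots> < \<infinity>"
    using exp_abs_nn_integral_finite[OF c]
    by (cases "\<integral>\<^sup>+x. ennreal (exp (- ?c * \<bar>x\<bar>)) \<partial>lborel" rule: ennreal_cases) (auto simp: ennreal_power)
  finally show "(\<integral>\<^sup>+\<xi>. ennreal (exp (- a * norm (\<xi>::'a))) \<partial>lborel) < \<infinity>" .
qed auto

lemma sinh_ge_self: "0 \<le> (x::real) \<Longrightarrow> x \<le> sinh x"
proof -
  assume "0 \<le> x"
  have der: "(sinh has_real_derivative cosh z) (at z)" for z :: real
    by (auto intro!: derivative_eq_intros)
  show ?thesis
  proof (cases "x = 0")
    case False
    then obtain z where "sinh x - sinh 0 = (x - 0) * cosh z"
      using MVT2[of 0 x sinh cosh] der \<open>0 \<le> x\<close> by auto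
    then show ?thesis using mult_left_mono[OF cosh_real_ge_1[of z] \<open>0 \<le> x\<close>] by simp
  qed simp
qed

text \<open>By the addition theorem and cosh \<ge> 1. It makes the bound on the Trotter kernels
  depend on n and \<tau> only through n \<tau>.\<close>

lemma sinh_mult_ge: "0 \<le> (x::real) \<Longrightarrow> real n * sinh x \<le> sinh (real n * x)"
proof (induction n)
  case (Suc n)
  have "sinh (real (Suc n) * x) = sinh (real n * x) * cosh x + cosh (real n * x) * sinh x"
    by (simp add: algebra_simps sinh_add)
  moreover have "sinh (real n * x) * 1 \<le> sinh (real n * x) * cosh x"
    using Suc by (intro mult_left_mono cosh_real_ge_1) auto
  moreover have "1 * sinh x \<le> cosh (real n * x) * sinh x"
    using Suc by (intro mult_right_mono cosh_real_ge_1) auto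
  ultimately show ?case using Suc by (simp add: algebra_simps)
qed simp

text \<open>The \<open>n\<close>-th power of the Trotter factor \<open>exp (-\<tau>V/2) exp (\<tau>\<Delta>/2) exp (-\<tau>V/2)\<close> for the oscillator
  potential \<open>V = r\<^sup>2 |x|\<^sup>2 / 2\<close> is again a Mehler kernel, with \<open>cosh \<theta> = 1 + \<tau>\<^sup>2 r\<^sup>2 / 2\<close> and
  \<open>\<omega> = sinh \<theta> / \<tau>\<close>. For \<open>r = |\<xi>|\<close> a single factor is a positive multiple of a Gaussian in \<open>\<xi>\<close>, so
  the power has a nonnegative cosine transform.\<close>

definition trotter_angle :: "real \<Rightarrow> real \<Rightarrow> real" where
  "trotter_angle \<tau> r = 2 * arsinh (\<tau> * r / 2)"

definition trotter_freq :: "real \<Rightarrow> real \<Rightarrow> real" where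
  "trotter_freq \<tau> r = sinh (trotter_angle \<tau> r) / \<tau>"

definition trotter :: "real \<Rightarrow> nat \<Rightarrow> 'a::euclidean_space \<Rightarrow> 'a \<Rightarrow> 'b::euclidean_space \<Rightarrow> real" where
  "trotter \<tau> n x v \<xi> = mehler (trotter_freq \<tau> (norm \<xi>)) (real n * trotter_angle \<tau> (norm \<xi>)) x v"

lemma trotter_angle_measurable[measurable]: "trotter_angle \<tau> \<in> borel_measurable borel"
  unfolding trotter_angle_def arsinh_real_def by measurable

lemma trotter_measurable[measurable]:
  "(\<lambda>p. trotter \<tau> n (h p) (f p) (g p)) \<in> borel_measurable M"
  if [measurable]: "h \<in> borel_measurable M" "f \<in> borel_measurable M" "g \<in> borel_measurable M"
  unfolding trotter_def trotter_freq_def sinh_def by measurable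

lemma trotter_angle_pos: "0 < \<tau> \<Longrightarrow> 0 < r \<Longrightarrow> 0 < trotter_angle \<tau> r"
  by (simp add: trotter_angle_def)

lemma trotter_freq_pos: "0 < \<tau> \<Longrightarrow> 0 < r \<Longrightarrow> 0 < trotter_freq \<tau> r"
  using trotter_angle_pos[of \<tau> r] by (simp add: trotter_freq_def)

lemma trotter_nonneg: "0 \<le> trotter \<tau> n x v \<xi>"
  by (simp add: trotter_def mehler_nonneg)

text \<open>For n \<tau> = t the bound depends on t alone, which supplies the dominating function
  for the limit in n.\<close>

lemma trotter_le:
  fixes x v :: "'a::euclidean_space"
  assumes "0 < \<tau>" "0 < n" "\<xi> \<noteq> 0"
  shows "trotter \<tau> n x v \<xi> \<le> (1 / (real n * \<tau>)) powr (real DIM('a) / 2)"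
proof -
  let ?\<theta> = "trotter_angle \<tau> (norm \<xi>)"
  have \<theta>: "0 < ?\<theta>" using assms by (simp add: trotter_angle_pos)
  have "trotter \<tau> n x v \<xi> \<le> (trotter_freq \<tau> (norm \<xi>) / sinh (real n * ?\<theta>)) powr (real DIM('a) / 2)"
    unfolding trotter_def using assms \<theta> trotter_freq_pos[of \<tau> "norm \<xi>"] by (intro mehler_le) auto
  also have "\<dots> \<le> (1 / (real n * \<tau>)) powr (real DIM('a) / 2)"
  proof (rule powr_mono2)
    have "real n * sinh ?\<theta> \<le> sinh (real n * ?\<theta>)" using \<theta> by (intro sinh_mult_ge) auto
    moreover have "0 < sinh (real n * ?\<theta>)" using \<theta> assms by simp
    ultimately show "trotter_freq \<tau> (norm \<xi>) / sinh (real n * ?\<theta>) \<le> 1 / (real n * \<tau>)"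
      using assms by (simp add: trotter_freq_def field_simps)
    show "0 \<le> trotter_freq \<tau> (norm \<xi>) / sinh (real n * ?\<theta>)"
      using assms \<theta> trotter_freq_pos[of \<tau> "norm \<xi>"] by simp
  qed simp
  finally show ?thesis .
qed

text \<open>Frequency and angle are tied by \<omega> / sinh \<theta> = 1 / \<tau>, and \<omega> coth
  \<theta> = (1 + \<tau>^2 r^2 / 2) / \<tau>. Hence |\<xi>| survives only as a square in the
  exponent, in contrast to the exact Mehler kernel.\<close>

lemma trotter_1:
  fixes v w :: "'a::euclidean_space"
  assumes "0 < \<tau>" "\<xi> \<noteq> 0"
  shows "trotter \<tau> 1 v w \<xi> = (1 / \<tau>) powr (real DIM('a) / 2) * exp (- (norm (v - w))\<^sup>2 / (2 * \<tau>)) *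
     exp (- (\<tau> / 4 * ((norm v)\<^sup>2 + (norm w)\<^sup>2)) * (norm \<xi>)\<^sup>2)"
proof -
  let ?r = "norm \<xi>"
  let ?\<theta> = "trotter_angle \<tau> ?r"
  define s c where "s = sinh ?\<theta>" "c = cosh ?\<theta>"
  have s: "0 < s" using trotter_angle_pos[of \<tau> ?r] assms by (simp add: s_c_def)
  have c: "c = 1 + \<tau>\<^sup>2 * ?r\<^sup>2 / 2"
  proof -
    \<comment> \<open>The factor 2 in the definition of the angle is there for this half-angle
      identity.\<close>
    have "c = 1 + 2 * (sinh (arsinh (\<tau> * ?r / 2)))\<^sup>2"
      unfolding s_c_def trotter_angle_def cosh_double by (simp add: cosh_square_eq)
    then show ?thesis by (simp add: power_divide power_mult_distrib)
  qed
  have d: "(norm (v - w))\<^sup>2 = (norm v)\<^sup>2 + (norm w)\<^sup>2 - 2 * (v \<bullet> w)"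
    by (simp add: power2_norm_eq_inner inner_diff inner_commute)
  have "- (s / \<tau> / 2 * (((norm v)\<^sup>2 + (norm w)\<^sup>2) * (c / s) - 2 * (v \<bullet> w) * (1 / s))) =
      - (norm (v - w))\<^sup>2 / (2 * \<tau>) + - (\<tau> / 4 * ((norm v)\<^sup>2 + (norm w)\<^sup>2)) * ?r\<^sup>2"
    unfolding c d using s assms by (simp add: field_simps power2_eq_square)
  moreover have "s / \<tau> / s = 1 / \<tau>" using s by simp
  ultimately show ?thesis
    unfolding trotter_def mehler_def trotter_freq_def of_nat_1 mult_1_left s_c_def[symmetric]
    by (simp only: exp_add mult.assoc)
qed

lemma trotter_Suc:
  fixes x w :: "'a::euclidean_space"
  assumes "0 < \<tau>" "\<xi> \<noteq> 0" "0 < n"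
  shows "(\<integral>\<^sup>+v. ennreal (trotter \<tau> n x v \<xi> * trotter \<tau> 1 v w \<xi>) \<partial>lborel) =
    ennreal ((2 * pi) powr (real DIM('a) / 2) * trotter \<tau> (Suc n) x w \<xi>)"
proof -
  have eq: "real n * trotter_angle \<tau> (norm \<xi>) + real 1 * trotter_angle \<tau> (norm \<xi>) = real (Suc n) * trotter_angle \<tau> (norm \<xi>)"
    by (simp add: algebra_simps)
  show ?thesis
    unfolding trotter_def eq[symmetric]
    using assms trotter_angle_pos[of \<tau> "norm \<xi>"] trotter_freq_pos[of \<tau> "norm \<xi>"]
    by (intro mehler_composition) auto
qed

text \<open>Induction on the number of factors, with a Gaussian weight built into the claim. For
  fixed \<open>v\<close> the last factor is a constant times a Gaussian in \<xi> of rate (\<tau> /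
  4) (|v|^2 + |w|^2), so it merely raises \<open>e\<close>, and the induction hypothesis applies
  before the integral over \<open>v\<close> is taken. A strictly positive \<open>e\<close> keeps the
  rate positive even when both points are zero, and it makes the double integral absolutely
  convergent.\<close>

lemma trotter_cos_transform_nonneg:
  fixes x w :: "'a::euclidean_space" and y :: "'b::euclidean_space"
  assumes \<tau>: "0 < \<tau>" and "0 < n" "0 < e"
  shows "0 \<le> (\<integral>\<xi>. trotter \<tau> n x w \<xi> * (exp (- e * (norm \<xi>)\<^sup>2) * cos (\<xi> \<bullet> y)) \<partial>lborel)"
  using assms(2,3)
proof (induction n arbitrary: w e rule: nat_induct_non_zero)
  case 1
  let ?d = "\<tau> / 4 * ((norm x)\<^sup>2 + (norm w)\<^sup>2)"
  let ?C = "(1 / \<tau>) powr (real DIM('a) / 2) * exp (- (norm (x - w))\<^sup>2 / (2 * \<tau>))"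
  have d: "0 < ?d + e" using 1 \<tau> by (intro add_nonneg_pos mult_nonneg_nonneg) auto
  have "(\<integral>\<xi>. trotter \<tau> 1 x w \<xi> * (exp (- e * (norm \<xi>)\<^sup>2) * cos (\<xi> \<bullet> y)) \<partial>lborel) =
    (\<integral>\<xi>. ?C * (exp (- (?d + e) * (norm \<xi>)\<^sup>2) * cos (\<xi> \<bullet> y)) \<partial>lborel)"
  proof (rule integral_cong_AE)
    show "AE \<xi> in lborel. trotter \<tau> 1 x w \<xi> * (exp (- e * (norm \<xi>)\<^sup>2) * cos (\<xi> \<bullet> y)) = ?C * (exp (- (?d + e) * (norm \<xi>)\<^sup>2) * cos (\<xi> \<bullet> y))"
      using AE_lborel_singleton[of 0]
    proof eventually_elim
      fix \<xi> :: 'b assume "\<xi> \<noteq> 0"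
      have "exp (- (?d + e) * (norm \<xi>)\<^sup>2) = exp (- ?d * (norm \<xi>)\<^sup>2) * exp (- e * (norm \<xi>)\<^sup>2)"
        by (simp add: mult_exp_exp algebra_simps)
      then show "trotter \<tau> 1 x w \<xi> * (exp (- e * (norm \<xi>)\<^sup>2) * cos (\<xi> \<bullet> y)) = ?C * (exp (- (?d + e) * (norm \<xi>)\<^sup>2) * cos (\<xi> \<bullet> y))"
        unfolding trotter_1[OF \<tau> \<open>\<xi> \<noteq> 0\<close>] by (simp only: mult_ac)
    qed
  qed measurable
  also have "\<dots> = ?C * ((pi / (?d + e)) powr (real DIM('b) / 2) * exp (- (norm y)\<^sup>2 / (4 * (?d + e))))"
    by (simp only: integral_mult_right_zero gaussian_fourier[OF d])
  also have "0 \<le> \<dots>" by (intro mult_nonneg_nonneg) auto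
  finally show ?case .
next
  case (Suc n)
  let ?N = "(2 * pi) powr (real DIM('a) / 2)"
  let ?E = "\<lambda>\<xi>::'b. exp (- e * (norm \<xi>)\<^sup>2) * cos (\<xi> \<bullet> y)"
  let ?F = "\<lambda>\<xi> v. trotter \<tau> n x v \<xi> * trotter \<tau> 1 v w \<xi> * ?E \<xi>"
  have n: "0 < n" using Suc by simp
  have F: "integrable (lborel \<Otimes>\<^sub>M lborel) (\<lambda>(\<xi>, v). ?F \<xi> v)"
  proof (rule integrableI_bounded)
    show "(\<lambda>(\<xi>, v). ?F \<xi> v) \<in> borel_measurable (lborel \<Otimes>\<^sub>M lborel)" by measurable
    have "(\<integral>\<^sup>+p. ennreal (norm (case p of (\<xi>, v) \<Rightarrow> ?F \<xi> v)) \<partial>(lborel \<Otimes>\<^sub>M lborel)) =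
      (\<integral>\<^sup>+\<xi>. \<integral>\<^sup>+v. ennreal (norm (?F \<xi> v)) \<partial>lborel \<partial>lborel)"
      by (subst lborel.nn_integral_fst[symmetric]) auto
    also have "\<dots> \<le> (\<integral>\<^sup>+\<xi>. ennreal (?N * (1 / (real (Suc n) * \<tau>)) powr (real DIM('a) / 2) * exp (- e * (norm (\<xi>::'b))\<^sup>2)) \<partial>lborel)"
    proof (rule nn_integral_mono_AE, use AE_lborel_singleton[of 0] in eventually_elim)
      fix \<xi> :: 'b assume \<xi>: "\<xi> \<noteq> 0"
      have "(\<integral>\<^sup>+v. ennreal (norm (?F \<xi> v)) \<partial>lborel) \<le> (\<integral>\<^sup>+v. ennreal (exp (- e * (norm \<xi>)\<^sup>2)) * ennreal (trotter \<tau> n x v \<xi> * trotter \<tau> 1 v w \<xi>) \<partial>lborel)"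
      proof (intro nn_integral_mono)
        fix v
        let ?T = "exp (- e * (norm \<xi>)\<^sup>2) * (trotter \<tau> n x v \<xi> * trotter \<tau> 1 v w \<xi>)"
        have "norm (?F \<xi> v) = \<bar>cos (\<xi> \<bullet> y)\<bar> * ?T" by (simp add: abs_mult trotter_nonneg)
        also have "\<dots> \<le> 1 * ?T" by (intro mult_right_mono mult_nonneg_nonneg trotter_nonneg) auto
        finally have "ennreal (norm (?F \<xi> v)) \<le> ennreal ?T" by (intro ennreal_leI) simp
        then show "ennreal (norm (?F \<xi> v)) \<le> ennreal (exp (- e * (norm \<xi>)\<^sup>2)) * ennreal (trotter \<tau> n x v \<xi> * trotter \<tau> 1 v w \<xi>)"
          by (subst (asm) ennreal_mult) (auto simp: trotter_nonneg)
      qed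
      also have "\<dots> = ennreal (exp (- e * (norm \<xi>)\<^sup>2)) * ennreal (?N * trotter \<tau> (Suc n) x w \<xi>)"
        by (subst trotter_Suc[OF \<tau> \<xi> n, symmetric], rule nn_integral_cmult) measurable
      also have "\<dots> = ennreal (?N * trotter \<tau> (Suc n) x w \<xi> * exp (- e * (norm \<xi>)\<^sup>2))"
        by (simp add: trotter_nonneg mult_ac flip: ennreal_mult)
      also have "\<dots> \<le> ennreal (?N * (1 / (real (Suc n) * \<tau>)) powr (real DIM('a) / 2) * exp (- e * (norm \<xi>)\<^sup>2))"
        using \<tau> \<xi> by (intro ennreal_leI mult_right_mono mult_left_mono trotter_le) auto
      finally show "(\<integral>\<^sup>+v. ennreal (norm (?F \<xi> v)) \<partial>lborel) \<le> ennreal (?N * (1 / (real (Suc n) * \<tau>)) powr (real DIM('a) / 2) * exp (- e * (norm \<xi>)\<^sup>2))" .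
    qed
    also have "\<dots> < \<infinity>"
      using integrable_mult_right[OF gaussian_integrable(1)[OF Suc.prems, where 'a='b], of "?N * (1 / (real (Suc n) * \<tau>)) powr (real DIM('a) / 2)"]
      by (subst nn_integral_eq_integral) auto
    finally show "(\<integral>\<^sup>+p. ennreal (norm (case p of (\<xi>, v) \<Rightarrow> ?F \<xi> v)) \<partial>(lborel \<Otimes>\<^sub>M lborel)) < \<infinity>" .
  qed
  have nn: "0 \<le> (\<integral>\<xi>. ?F \<xi> v \<partial>lborel)" for v
  proof -
    let ?d = "\<tau> / 4 * ((norm v)\<^sup>2 + (norm w)\<^sup>2)"
    let ?C = "(1 / \<tau>) powr (real DIM('a) / 2) * exp (- (norm (v - w))\<^sup>2 / (2 * \<tau>))"
    have d: "0 < ?d + e" using Suc.prems \<tau> by (intro add_nonneg_pos mult_nonneg_nonneg) auto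
    have "(\<integral>\<xi>. ?F \<xi> v \<partial>lborel) = (\<integral>\<xi>. ?C * (trotter \<tau> n x v \<xi> * (exp (- (?d + e) * (norm \<xi>)\<^sup>2) * cos (\<xi> \<bullet> y))) \<partial>lborel)"
    proof (rule integral_cong_AE)
      show "AE \<xi> in lborel. ?F \<xi> v = ?C * (trotter \<tau> n x v \<xi> * (exp (- (?d + e) * (norm \<xi>)\<^sup>2) * cos (\<xi> \<bullet> y)))"
        using AE_lborel_singleton[of 0]
      proof eventually_elim
        fix \<xi> :: 'b assume "\<xi> \<noteq> 0"
        have "exp (- (?d + e) * (norm \<xi>)\<^sup>2) = exp (- ?d * (norm \<xi>)\<^sup>2) * exp (- e * (norm \<xi>)\<^sup>2)"
          by (simp add: mult_exp_exp algebra_simps)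
        then show "?F \<xi> v = ?C * (trotter \<tau> n x v \<xi> * (exp (- (?d + e) * (norm \<xi>)\<^sup>2) * cos (\<xi> \<bullet> y)))"
          unfolding trotter_1[OF \<tau> \<open>\<xi> \<noteq> 0\<close>] by (simp only: mult_ac)
      qed
    qed measurable
    also have "\<dots> = ?C * (\<integral>\<xi>. trotter \<tau> n x v \<xi> * (exp (- (?d + e) * (norm \<xi>)\<^sup>2) * cos (\<xi> \<bullet> y)) \<partial>lborel)"
      by (rule integral_mult_right_zero)
    also have "0 \<le> \<dots>" using Suc.IH[OF d] by (intro mult_nonneg_nonneg) auto
    finally show ?thesis .
  qed
  have "(\<integral>\<xi>. ?N * (trotter \<tau> (Suc n) x w \<xi> * ?E \<xi>) \<partial>lborel) = (\<integral>\<xi>. \<integral>v. ?F \<xi> v \<partial>lborel \<partial>lborel)"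
  proof (rule integral_cong_AE)
    show "(\<lambda>\<xi>. \<integral>v. ?F \<xi> v \<partial>lborel) \<in> borel_measurable lborel"
      using lborel_pair.integrable_fst'[OF F] by auto
    show "AE \<xi> in lborel. ?N * (trotter \<tau> (Suc n) x w \<xi> * ?E \<xi>) = (\<integral>v. ?F \<xi> v \<partial>lborel)"
      using AE_lborel_singleton[of 0]
    proof eventually_elim
      fix \<xi> :: 'b assume \<xi>: "\<xi> \<noteq> 0"
      have "(\<integral>v. trotter \<tau> n x v \<xi> * trotter \<tau> 1 v w \<xi> \<partial>lborel) = ?N * trotter \<tau> (Suc n) x w \<xi>"
        using trotter_Suc[OF \<tau> \<xi> n, of x w]
        by (subst integral_eq_nn_integral) (auto simp: trotter_nonneg)
      moreover have "(\<integral>v. ?F \<xi> v \<partial>lborel) = (\<integral>v. trotter \<tau> n x v \<xi> * trotter \<tau> 1 v w \<xi> \<partial>lborel) * ?E \<xi>"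
        by (rule integral_mult_left_zero)
      ultimately show "?N * (trotter \<tau> (Suc n) x w \<xi> * ?E \<xi>) = (\<integral>v. ?F \<xi> v \<partial>lborel)"
        by (simp only: mult.assoc)
    qed
  qed measurable
  also have "\<dots> = (\<integral>v. \<integral>\<xi>. ?F \<xi> v \<partial>lborel \<partial>lborel)"
    by (rule lborel_pair.Fubini_integral[OF F, symmetric])
  also have "0 \<le> \<dots>" by (rule integral_nonneg_AE, rule AE_I2) (rule nn)
  finally have "0 \<le> ?N * (\<integral>\<xi>. trotter \<tau> (Suc n) x w \<xi> * ?E \<xi> \<partial>lborel)"
    by (simp only: integral_mult_right_zero)
  then show ?case by (simp add: zero_le_mult_iff)
qed

text \<open>With n + 1 factors of step t / (n + 1) the frequency tends to r and the total angle to r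
  t. The Mehler formula is continuous at these values because sinh (r t) is not zero.\<close>

lemma trotter_limit:
  assumes "0 < t" "\<xi> \<noteq> 0"
  shows "(\<lambda>n. trotter (t / real (Suc n)) (Suc n) x w \<xi>) \<longlonglongrightarrow> mehler (norm \<xi>) (norm \<xi> * t) x w"
proof -
  define r where "r = norm \<xi>"
  have r: "0 < r" using assms by (simp add: r_def)
  have 1: "(\<lambda>n. trotter_freq (t / real (Suc n)) r) \<longlonglongrightarrow> r"
    unfolding trotter_freq_def trotter_angle_def arsinh_real_def sinh_field_def using r assms(1) by real_asymp
  have 2: "(\<lambda>n. real (Suc n) * trotter_angle (t / real (Suc n)) r) \<longlonglongrightarrow> r * t"
    unfolding trotter_angle_def arsinh_real_def using r assms(1) by real_asymp
  have lim: "(\<lambda>n. mehler (f n) (g n) x w) \<longlonglongrightarrow> mehler r (r * t) x w"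
    if "f \<longlonglongrightarrow> r" "g \<longlonglongrightarrow> r * t" for f g
  proof -
    have s: "sinh (r * t) \<noteq> 0" "r / sinh (r * t) \<noteq> 0" using r assms(1) by simp_all
    show ?thesis unfolding mehler_def
      by (intro tendsto_mult tendsto_powr tendsto_exp tendsto_minus tendsto_divide tendsto_diff tendsto_sinh tendsto_cosh tendsto_const that s) simp_all
  qed
  show ?thesis unfolding trotter_def r_def[symmetric] by (rule lim[OF 1 2])
qed


section \<open>The Fourier symbol of the Grushin kernel\<close>

text \<open>Up to a constant, the partial Fourier transform of the Grushin kernel in
  \<open>y\<close>: at frequency \<xi> the operator is an oscillator of frequency |\<xi>|, run for
  time t.\<close>

definition grushin_symbol :: "real \<Rightarrow> 'a::euclidean_space \<Rightarrow> 'a \<Rightarrow> 'b::euclidean_space \<Rightarrow> real" where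
  "grushin_symbol t x w \<xi> = mehler (norm \<xi>) (norm \<xi> * t) x w"

lemma grushin_symbol_measurable[measurable]:
  "(\<lambda>p. grushin_symbol (f p) (g p) (h p) (k p)) \<in> borel_measurable M"
  if [measurable]: "f \<in> borel_measurable M" "g \<in> borel_measurable M" "h \<in> borel_measurable M" "k \<in> borel_measurable M"
  unfolding grushin_symbol_def by measurable

lemma grushin_symbol_nonneg: "0 \<le> grushin_symbol t x w \<xi>"
  by (simp add: grushin_symbol_def mehler_nonneg)

lemma grushin_symbol_even: "grushin_symbol t x w (- \<xi>) = grushin_symbol t x w \<xi>"
  by (simp add: grushin_symbol_def)

text \<open>With x = r t, the doubling formula is combined with sinh (x / 2) \<ge> x / 2 and 2 cosh
  (x / 2) \<ge> exp (x / 2). The exponential makes the symbol integrable, and the factor 1 / t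
  carries the singularity in time.\<close>

lemma div_sinh_le:
  fixes r t :: real
  assumes "0 < r" "0 < t"
  shows "r / sinh (r * t) \<le> 2 / t * exp (- (r * t / 2))"
proof -
  let ?x = "r * t"
  have "?x / 2 * exp (?x / 2) \<le> sinh (?x / 2) * (2 * cosh (?x / 2))"
    using assms sinh_ge_self[of "?x / 2"]
    by (intro mult_mono) (auto simp: cosh_field_def)
  also have "\<dots> = sinh ?x" using sinh_double[of "?x / 2"] by simp
  finally have "?x / 2 * exp (?x / 2) \<le> sinh ?x" .
  then have "r / sinh ?x \<le> r / (?x / 2 * exp (?x / 2))"
    using assms by (intro divide_left_mono mult_pos_pos) auto
  also have "\<dots> = 2 / t * exp (- (?x / 2))"
    using assms by (simp add: exp_minus field_simps)
  finally show ?thesis .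
qed

lemma grushin_symbol_le_exp:
  fixes x w :: "'a::euclidean_space"
  assumes "0 < t"
  shows "grushin_symbol t x w \<xi> \<le> (2 / t) powr (real DIM('a) / 2) * exp (- (real DIM('a) / 4 * t) * norm \<xi>)"
proof (cases "\<xi> = 0")
  case True
  then show ?thesis by (simp add: grushin_symbol_def mehler_def)
next
  case False
  let ?r = "norm \<xi>"
  have r: "0 < ?r" using False by simp
  have "grushin_symbol t x w \<xi> \<le> (?r / sinh (?r * t)) powr (real DIM('a) / 2)"
    unfolding grushin_symbol_def using r assms by (intro mehler_le) auto
  also have "\<dots> \<le> (2 / t * exp (- (?r * t / 2))) powr (real DIM('a) / 2)"
    using r assms div_sinh_le[OF r assms] by (intro powr_mono2) auto
  also have "\<dots> = (2 / t) powr (real DIM('a) / 2) * exp (- (real DIM('a) / 4 * t) * ?r)"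
    unfolding powr_mult exp_powr_real by (simp add: field_simps)
  finally show ?thesis .
qed

lemma grushin_symbol_le:
  fixes x w :: "'a::euclidean_space"
  assumes "0 < t"
  shows "\<bar>grushin_symbol t x w \<xi>\<bar> \<le> (2 / t) powr (real DIM('a) / 2)"
proof -
  have "(2 / t) powr (real DIM('a) / 2) * exp (- (real DIM('a) / 4 * t) * norm \<xi>) \<le> (2 / t) powr (real DIM('a) / 2)"
    using assms by (intro mult_left_le) auto
  then show ?thesis
    using grushin_symbol_le_exp[OF assms, of x w \<xi>] grushin_symbol_nonneg[of t x w \<xi>] by linarith
qed

lemma grushin_symbol_integrable:
  assumes "0 < t"
  shows "integrable lborel (grushin_symbol t x w :: 'b::euclidean_space \<Rightarrow> real)"
proof (rule Bochner_Integration.integrable_bound)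
  let ?N = "real DIM('a)"
  show "integrable lborel (\<lambda>\<xi>::'b. (2 / t) powr (?N / 2) * exp (- (?N / 4 * t) * norm \<xi>))"
    using assms by (intro integrable_mult_right integrable_exp_norm) auto
  show "AE \<xi> in lborel. norm (grushin_symbol t x w \<xi>) \<le> norm ((2 / t) powr (?N / 2) * exp (- (?N / 4 * t) * norm (\<xi>::'b)))"
    using grushin_symbol_le_exp[OF assms, of x w] by (auto simp: grushin_symbol_nonneg intro!: AE_I2)
qed measurable

lemma grushin_symbol_tendsto:
  assumes "0 < t" "\<eta> \<noteq> 0"
  shows "(grushin_symbol t x w \<longlongrightarrow> grushin_symbol t x w \<eta>) (at \<eta>)"
proof -
  have s: "sinh (norm \<eta> * t) \<noteq> 0" "norm \<eta> / sinh (norm \<eta> * t) \<noteq> 0" using assms by simp_all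
  show ?thesis unfolding grushin_symbol_def mehler_def
    by (intro tendsto_mult tendsto_powr tendsto_exp tendsto_minus tendsto_divide tendsto_diff tendsto_sinh tendsto_cosh tendsto_const tendsto_norm tendsto_ident_at s) simp_all
qed

text \<open>The heat kernel of half the Laplacian, without the factor (2 pi) powr -(N / 2) that
  \<open>mehler\<close> omits as well.\<close>

definition heat_kernel :: "real \<Rightarrow> 'a::euclidean_space \<Rightarrow> 'a \<Rightarrow> real" where
  "heat_kernel t x w = (1 / t) powr (real DIM('a) / 2) * exp (- (norm (x - w))\<^sup>2 / (2 * t))"

text \<open>The Mehler kernel is rewritten so that r occurs only in r / sinh (r t), which tends to 1
  / t, and in cosh (r t), which tends to 1.\<close>

lemma grushin_symbol_tendsto_0:
  assumes "0 < t"
  shows "((grushin_symbol t x w :: 'b::euclidean_space \<Rightarrow> real) \<longlongrightarrow> heat_kernel t x w) (at 0)"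
proof -
  have d: "(norm (x - w))\<^sup>2 = (norm x)\<^sup>2 + (norm w)\<^sup>2 - 2 * (x \<bullet> w)"
    by (simp add: power2_norm_eq_inner inner_diff inner_commute)
  have eq: "mehler r (r * t) x w = (r / sinh (r * t)) powr (real DIM('a) / 2) *
      exp (- ((r / sinh (r * t)) / 2 * (((norm x)\<^sup>2 + (norm w)\<^sup>2) * cosh (r * t) - 2 * (x \<bullet> w))))" for r
    by (simp add: mehler_def diff_divide_distrib algebra_simps)
  have l1: "((\<lambda>r. r / sinh (r * t)) \<longlongrightarrow> 1 / t) (at_right 0)"
  proof -
    have "((\<lambda>r. r / sinh (r * t)) \<longlongrightarrow> inverse t) (at_right 0)"
      unfolding sinh_field_def using assms by real_asymp
    then show ?thesis by (simp add: inverse_eq_divide)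
  qed
  have l2: "((\<lambda>r. cosh (r * t)) \<longlongrightarrow> 1) (at_right 0)"
    unfolding cosh_field_def using assms by real_asymp
  have "((\<lambda>r. mehler r (r * t) x w) \<longlongrightarrow> (1 / t) powr (real DIM('a) / 2) *
      exp (- ((1 / t) / 2 * (((norm x)\<^sup>2 + (norm w)\<^sup>2) * 1 - 2 * (x \<bullet> w))))) (at_right 0)"
    unfolding eq using assms
    by (intro tendsto_mult tendsto_powr tendsto_exp tendsto_minus tendsto_divide tendsto_diff tendsto_const l1 l2) simp_all
  moreover have "filterlim (norm :: 'b \<Rightarrow> real) (at_right 0) (at 0)"
    unfolding filterlim_at
    by (auto simp: eventually_at_filter intro!: tendsto_eq_intros always_eventually)
  ultimately have "((\<lambda>\<xi>::'b. mehler (norm \<xi>) (norm \<xi> * t) x w) \<longlongrightarrow> (1 / t) powr (real DIM('a) / 2) *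
      exp (- ((1 / t) / 2 * (((norm x)\<^sup>2 + (norm w)\<^sup>2) * 1 - 2 * (x \<bullet> w))))) (at 0)"
    by (rule filterlim_compose)
  moreover have "- ((1 / t) / 2 * (((norm x)\<^sup>2 + (norm w)\<^sup>2) * 1 - 2 * (x \<bullet> w))) = - ((norm x)\<^sup>2 + (norm w)\<^sup>2 - 2 * (x \<bullet> w)) / (2 * t)"
  proof -
    have "- ((1 / t) / 2 * X) = - X / (2 * t)" for X by simp
    then show ?thesis by (simp only: mult_1_right)
  qed
  ultimately show ?thesis unfolding grushin_symbol_def heat_kernel_def d by (simp only:)
qed

text \<open>Nonnegativity passes through two limits. The number of Trotter factors goes to infinity
  under a fixed Gaussian weight, which dominates because the Trotter bound has no decay in \<xi> of
  its own. After that the weight is removed, dominated by the integrable symbol.\<close>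

lemma grushin_cos_transform_nonneg:
  fixes x w :: "'a::euclidean_space" and y :: "'b::euclidean_space"
  assumes t: "0 < t"
  shows "0 \<le> (\<integral>\<xi>. grushin_symbol t x w \<xi> * cos (\<xi> \<bullet> y) \<partial>lborel)"
proof -
  have reg: "0 \<le> (\<integral>\<xi>. grushin_symbol t x w \<xi> * (exp (- e * (norm \<xi>)\<^sup>2) * cos (\<xi> \<bullet> y)) \<partial>lborel)" if e: "0 < e" for e
  proof (rule LIMSEQ_le_const)
    let ?s = "\<lambda>n \<xi>. trotter (t / real (Suc n)) (Suc n) x w \<xi> * (exp (- e * (norm \<xi>)\<^sup>2) * cos (\<xi> \<bullet> y))"
    show "\<exists>N. \<forall>n\<ge>N. 0 \<le> (\<integral>\<xi>. ?s n \<xi> \<partial>lborel)"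
      using t e by (intro exI allI impI trotter_cos_transform_nonneg) auto
    show "(\<lambda>n. \<integral>\<xi>. ?s n \<xi> \<partial>lborel) \<longlonglongrightarrow> (\<integral>\<xi>. grushin_symbol t x w \<xi> * (exp (- e * (norm \<xi>)\<^sup>2) * cos (\<xi> \<bullet> y)) \<partial>lborel)"
    proof (rule integral_dominated_convergence)
      show "integrable lborel (\<lambda>\<xi>::'b. (1 / t) powr (real DIM('a) / 2) * exp (- e * (norm \<xi>)\<^sup>2))"
        by (intro integrable_mult_right gaussian_integrable(1)[OF e])
      show "AE \<xi> in lborel. (\<lambda>n. ?s n \<xi>) \<longlonglongrightarrow> grushin_symbol t x w \<xi> * (exp (- e * (norm \<xi>)\<^sup>2) * cos (\<xi> \<bullet> y))"
        using AE_lborel_singleton[of 0]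
      proof eventually_elim
        fix \<xi> :: 'b assume "\<xi> \<noteq> 0"
        then show "(\<lambda>n. ?s n \<xi>) \<longlonglongrightarrow> grushin_symbol t x w \<xi> * (exp (- e * (norm \<xi>)\<^sup>2) * cos (\<xi> \<bullet> y))"
          unfolding grushin_symbol_def by (intro tendsto_mult tendsto_const trotter_limit t)
      qed
      show "AE \<xi> in lborel. norm (?s n \<xi>) \<le> (1 / t) powr (real DIM('a) / 2) * exp (- e * (norm \<xi>)\<^sup>2)" for n
        using AE_lborel_singleton[of 0]
      proof eventually_elim
        fix \<xi> :: 'b assume \<xi>: "\<xi> \<noteq> 0"
        have "trotter (t / real (Suc n)) (Suc n) x w \<xi> \<le> (1 / t) powr (real DIM('a) / 2)"
          using trotter_le[of "t / real (Suc n)" "Suc n" \<xi> x w] t \<xi> by simp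
        moreover have "exp (- e * (norm \<xi>)\<^sup>2) * \<bar>cos (\<xi> \<bullet> y)\<bar> \<le> exp (- e * (norm \<xi>)\<^sup>2)"
          by (intro mult_left_le) auto
        ultimately have "trotter (t / real (Suc n)) (Suc n) x w \<xi> * (exp (- e * (norm \<xi>)\<^sup>2) * \<bar>cos (\<xi> \<bullet> y)\<bar>) \<le> (1 / t) powr (real DIM('a) / 2) * exp (- e * (norm \<xi>)\<^sup>2)"
          by (intro mult_mono) auto
        then show "norm (?s n \<xi>) \<le> (1 / t) powr (real DIM('a) / 2) * exp (- e * (norm \<xi>)\<^sup>2)"
          by (simp add: abs_mult trotter_nonneg del: of_nat_Suc)
      qed
    qed measurable
  qed
  show ?thesis
  proof (rule LIMSEQ_le_const)
    let ?s = "\<lambda>n \<xi>. grushin_symbol t x w \<xi> * (exp (- inverse (real (Suc n)) * (norm \<xi>)\<^sup>2) * cos (\<xi> \<bullet> y))"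
    show "\<exists>N. \<forall>n\<ge>N. 0 \<le> (\<integral>\<xi>. ?s n \<xi> \<partial>lborel)"
      by (intro exI allI impI reg) auto
    show "(\<lambda>n. \<integral>\<xi>. ?s n \<xi> \<partial>lborel) \<longlonglongrightarrow> (\<integral>\<xi>. grushin_symbol t x w \<xi> * cos (\<xi> \<bullet> y) \<partial>lborel)"
    proof (rule integral_dominated_convergence[OF _ _ grushin_symbol_integrable[OF t, of x w]])
      show "AE \<xi> in lborel. (\<lambda>n. ?s n \<xi>) \<longlonglongrightarrow> grushin_symbol t x w \<xi> * cos (\<xi> \<bullet> y)"
      proof (rule AE_I2)
        fix \<xi> :: 'b
        have "(\<lambda>n. ?s n \<xi>) \<longlonglongrightarrow> grushin_symbol t x w \<xi> * (exp (- 0 * (norm \<xi>)\<^sup>2) * cos (\<xi> \<bullet> y))"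
          by (intro tendsto_intros LIMSEQ_inverse_real_of_nat)
        then show "(\<lambda>n. ?s n \<xi>) \<longlonglongrightarrow> grushin_symbol t x w \<xi> * cos (\<xi> \<bullet> y)" by simp
      qed
      show "AE \<xi> in lborel. norm (?s n \<xi>) \<le> grushin_symbol t x w \<xi>" for n
        by (auto simp: abs_mult grushin_symbol_nonneg intro!: AE_I2 mult_left_le mult_le_one)
    qed measurable
  qed
qed

section \<open>The unnormalised kernel: pointwise bound, mass, Chapman-Kolmogorov equation,
  continuity in time\<close>

definition grushin_cos :: "real \<Rightarrow> 'a::euclidean_space \<Rightarrow> 'a \<Rightarrow> 'b::euclidean_space \<Rightarrow> real" where
  "grushin_cos t x w y = (\<integral>\<xi>. grushin_symbol t x w \<xi> * cos (\<xi> \<bullet> y) \<partial>lborel)"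

lemma grushin_cos_measurable[measurable]:
  "(\<lambda>p. grushin_cos (f p) (g p) (h p) (k p)) \<in> borel_measurable M"
  if [measurable]: "f \<in> borel_measurable M" "g \<in> borel_measurable M" "h \<in> borel_measurable M" "k \<in> borel_measurable M"
  unfolding grushin_cos_def by measurable

lemma grushin_cos_nonneg: "0 < t \<Longrightarrow> 0 \<le> grushin_cos t x w y"
  by (simp add: grushin_cos_def grushin_cos_transform_nonneg)

lemma grushin_cos_commute: "grushin_cos t x w y = grushin_cos t w x (- y)"
  by (simp add: grushin_cos_def grushin_symbol_def mehler_commute)

lemma grushin_symbol_cos_integrable:
  "0 < t \<Longrightarrow> integrable lborel (\<lambda>\<xi>. grushin_symbol t x w \<xi> * cos (\<xi> \<bullet> y))"
  by (rule Bochner_Integration.integrable_bound[OF grushin_symbol_integrable[of t x w]])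
     (auto simp: abs_mult intro!: mult_left_le)

text \<open>The prefactor of the symbol gives half the dimension of \<open>x\<close> in the
  exponent, and rescaling \<xi> by t gives the full dimension of \<open>y\<close>.\<close>

lemma grushin_cos_le:
  fixes x w :: "'a::euclidean_space" and y :: "'b::euclidean_space"
  assumes "0 < t"
  shows "grushin_cos t x w y \<le>
    2 powr (real DIM('a) / 2) * (\<integral>\<xi>. exp (- (real DIM('a) / 4) * norm \<xi>) \<partial>(lborel :: 'b measure)) *
    t powr - (real DIM('a) / 2 + real DIM('b))"
proof -
  let ?N = "real DIM('a)"
  have int: "integrable lborel (\<lambda>\<xi>::'b. exp (- (?N / 4 * t) * norm \<xi>))"
    using assms by (intro integrable_exp_norm) auto
  have "grushin_cos t x w y \<le> (\<integral>\<xi>. (2 / t) powr (?N / 2) * exp (- (?N / 4 * t) * norm (\<xi>::'b)) \<partial>lborel)"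
    unfolding grushin_cos_def
  proof (rule integral_mono)
    show "integrable lborel (\<lambda>\<xi>::'b. (2 / t) powr (?N / 2) * exp (- (?N / 4 * t) * norm \<xi>))"
      using int by (rule integrable_mult_right)
    fix \<xi> :: 'b
    have "grushin_symbol t x w \<xi> * cos (\<xi> \<bullet> y) \<le> grushin_symbol t x w \<xi>"
      by (intro mult_left_le) (auto simp: grushin_symbol_nonneg)
    also note grushin_symbol_le_exp[OF assms, of x w \<xi>]
    finally show "grushin_symbol t x w \<xi> * cos (\<xi> \<bullet> y) \<le> (2 / t) powr (?N / 2) * exp (- (?N / 4 * t) * norm \<xi>)" .
  qed (rule grushin_symbol_cos_integrable[OF assms])
  also have "\<dots> = (2 / t) powr (?N / 2) * (\<integral>\<xi>. exp (- (?N / 4 * t) * norm (\<xi>::'b)) \<partial>lborel)"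
    by (rule integral_mult_right_zero)
  also have "(\<integral>\<xi>. exp (- (?N / 4 * t) * norm (\<xi>::'b)) \<partial>lborel) = t powr - real DIM('b) * (\<integral>\<xi>. exp (- (?N / 4) * norm (\<xi>::'b)) \<partial>lborel)"
  proof -
    have "(\<integral>\<xi>. exp (- (?N / 4) * norm (\<xi>::'b)) \<partial>lborel) = \<bar>t\<bar> ^ DIM('b) * (\<integral>\<xi>. exp (- (?N / 4) * norm (0 + t *\<^sub>R \<xi>::'b)) \<partial>lborel)"
      using assms by (intro integral_lborel_affine) auto
    then show ?thesis using assms by (simp add: powr_minus powr_realpow mult.assoc)
  qed
  also have "(2 / t) powr (?N / 2) = 2 powr (?N / 2) * t powr - (?N / 2)"
    using assms by (simp add: powr_divide powr_minus_divide)
  also have "2 powr (?N / 2) * t powr - (?N / 2) * (t powr - real DIM('b) * (\<integral>\<xi>. exp (- (?N / 4) * norm (\<xi>::'b)) \<partial>lborel)) =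
     2 powr (?N / 2) * (\<integral>\<xi>. exp (- (?N / 4) * norm (\<xi>::'b)) \<partial>lborel) * (t powr - (?N / 2) * t powr - real DIM('b))"
    by (simp only: mult_ac)
  also have "t powr - (?N / 2) * t powr - real DIM('b) = t powr - (?N / 2 + real DIM('b))"
    by (simp flip: powr_add)
  finally show ?thesis .
qed

text \<open>Integrating out \<open>y\<close> takes the limit of the symbol at frequency zero, where
  the oscillator degenerates to the free heat equation in \<open>x\<close>.\<close>

lemma grushin_cos_mass_y:
  fixes x w :: "'a::euclidean_space"
  assumes t: "0 < t"
  shows "(\<integral>\<^sup>+y. ennreal (grushin_cos t x w y) \<partial>(lborel :: 'b::euclidean_space measure)) =
    ennreal ((2 * pi) ^ DIM('b) * heat_kernel t x w)"
proof -
  note g = grushin_symbol_integrable[OF t, of x w, where 'b='b] grushin_symbol_even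
    grushin_symbol_le[OF t] grushin_symbol_tendsto_0[OF t] grushin_cos_transform_nonneg[OF t]
  have "integrable lborel (\<lambda>y::'b. grushin_cos t x w y)"
    unfolding grushin_cos_def by (rule cos_transform_integrable[OF g])
  moreover have "(\<integral>y. grushin_cos t x w (y::'b) \<partial>lborel) = (2 * pi) ^ DIM('b) * heat_kernel t x w"
    using cos_transform_inversion[OF g grushin_symbol_tendsto_0[OF t]] unfolding grushin_cos_def by simp
  ultimately show ?thesis using t by (subst nn_integral_eq_integral) (auto simp: grushin_cos_nonneg)
qed

lemma heat_kernel_mass:
  fixes x :: "'a::euclidean_space"
  assumes t: "0 < t"
  shows "(\<integral>\<^sup>+w. ennreal (heat_kernel t x w) \<partial>lborel) = ennreal ((2 * pi) powr (real DIM('a) / 2))"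
proof -
  let ?N = "real DIM('a) / 2"
  let ?R = "(1 / t) powr ?N * exp (- (norm x)\<^sup>2 / (2 * t))"
  have eq: "heat_kernel t x w = ?R * exp (- (1 / t / 2) * (norm w)\<^sup>2 + ((1 / t) *\<^sub>R x) \<bullet> w)" for w
  proof -
    have d: "(norm (x - w))\<^sup>2 = (norm x)\<^sup>2 + (norm w)\<^sup>2 - 2 * (x \<bullet> w)"
      by (simp add: power2_norm_eq_inner inner_diff inner_commute)
    have "- (norm (x - w))\<^sup>2 / (2 * t) = - (norm x)\<^sup>2 / (2 * t) + (- (1 / t / 2) * (norm w)\<^sup>2 + ((1 / t) *\<^sub>R x) \<bullet> w)"
      unfolding d using t by (simp add: field_simps)
    then show ?thesis unfolding heat_kernel_def by (simp only: exp_add mult.assoc)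
  qed
  have A: "0 < 1 / t" using t by simp
  have "(\<integral>\<^sup>+w. ennreal (heat_kernel t x w) \<partial>lborel) =
     (\<integral>\<^sup>+w. ennreal ?R * ennreal (exp (- (1 / t / 2) * (norm w)\<^sup>2 + ((1 / t) *\<^sub>R x) \<bullet> w)) \<partial>lborel)"
    unfolding eq by (intro nn_integral_cong ennreal_mult) auto
  also have "\<dots> = ennreal ?R * ennreal ((2 * pi / (1 / t)) powr ?N * exp ((norm ((1 / t) *\<^sub>R x))\<^sup>2 / (2 * (1 / t))))"
    by (subst nn_integral_gaussian[OF A, symmetric], rule nn_integral_cmult) measurable
  also have "\<dots> = ennreal (?R * ((2 * pi / (1 / t)) powr ?N * exp ((norm ((1 / t) *\<^sub>R x))\<^sup>2 / (2 * (1 / t)))))"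
    by (intro ennreal_mult[symmetric]) auto
  also have "(norm ((1 / t) *\<^sub>R x))\<^sup>2 / (2 * (1 / t)) = (norm x)\<^sup>2 / (2 * t)"
    using t by (simp add: power_divide field_simps power2_eq_square)
  also have "?R * ((2 * pi / (1 / t)) powr ?N * exp ((norm x)\<^sup>2 / (2 * t))) = ((1 / t) powr ?N * (2 * pi / (1 / t)) powr ?N) * (exp (- (norm x)\<^sup>2 / (2 * t)) * exp ((norm x)\<^sup>2 / (2 * t)))"
    by (simp only: mult_ac)
  also have "exp (- (norm x)\<^sup>2 / (2 * t)) * exp ((norm x)\<^sup>2 / (2 * t)) = 1"
    by (simp add: mult_exp_exp)
  also have "(1 / t) powr ?N * (2 * pi / (1 / t)) powr ?N = ((1 / t) * (2 * pi / (1 / t))) powr ?N"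
    using t by (intro powr_mult[symmetric])
  also have "(1 / t) * (2 * pi / (1 / t)) = 2 * pi" using t by simp
  finally show ?thesis by simp
qed

text \<open>The integral over \<open>z\<close> is a convolution and multiplies the symbols. The
  integral over \<open>w\<close> then composes two Mehler kernels of the same frequency, whose
  angles |\<xi>| t and |\<xi>| s add. The two powers of 2 pi come from Fourier inversion and from
  the normalisation of \<open>mehler\<close>.\<close>

lemma grushin_cos_chapman_kolmogorov:
  fixes x w' :: "'a::euclidean_space" and Y :: "'b::euclidean_space"
  assumes t: "0 < t" and s: "0 < s"
  shows "(\<integral>\<^sup>+w. \<integral>\<^sup>+z. ennreal (grushin_cos t x w (Y - z) * grushin_cos s w w' z) \<partial>lborel \<partial>lborel) =
    ennreal ((2 * pi) ^ DIM('b) * (2 * pi) powr (real DIM('a) / 2) * grushin_cos (t + s) x w' Y)"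
proof -
  let ?P = "(2 * pi) ^ DIM('b)" and ?N = "(2 * pi) powr (real DIM('a) / 2)"
  let ?F = "\<lambda>\<xi> w. grushin_symbol t x w \<xi> * grushin_symbol s w w' \<xi> * cos (\<xi> \<bullet> Y)"
  have comp: "(\<integral>\<^sup>+w. ennreal (grushin_symbol t x w \<xi> * grushin_symbol s w w' \<xi>) \<partial>lborel) = ennreal (?N * grushin_symbol (t + s) x w' \<xi>)" if "\<xi> \<noteq> 0" for \<xi> :: 'b
    using mehler_composition[of "norm \<xi>" "norm \<xi> * t" "norm \<xi> * s" x w'] that t s
    by (simp add: grushin_symbol_def distrib_left)
  have F: "integrable (lborel \<Otimes>\<^sub>M lborel) (\<lambda>(\<xi>, w). ?F \<xi> w)"
  proof (rule integrableI_bounded)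
    show "(\<lambda>(\<xi>, w). ?F \<xi> w) \<in> borel_measurable (lborel \<Otimes>\<^sub>M lborel)" by measurable
    have "(\<integral>\<^sup>+p. ennreal (norm (case p of (\<xi>, w) \<Rightarrow> ?F \<xi> w)) \<partial>(lborel \<Otimes>\<^sub>M lborel)) =
      (\<integral>\<^sup>+\<xi>. \<integral>\<^sup>+w. ennreal (norm (?F \<xi> w)) \<partial>lborel \<partial>lborel)"
      by (subst lborel.nn_integral_fst[symmetric]) auto
    also have "\<dots> \<le> (\<integral>\<^sup>+\<xi>. ennreal (?N * grushin_symbol (t + s) x w' (\<xi>::'b)) \<partial>lborel)"
    proof (rule nn_integral_mono_AE, use AE_lborel_singleton[of 0] in eventually_elim)
      fix \<xi> :: 'b assume \<xi>: "\<xi> \<noteq> 0"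
      have "(\<integral>\<^sup>+w. ennreal (norm (?F \<xi> w)) \<partial>lborel) \<le> (\<integral>\<^sup>+w. ennreal (grushin_symbol t x w \<xi> * grushin_symbol s w w' \<xi>) \<partial>lborel)"
        by (intro nn_integral_mono ennreal_leI) (simp add: abs_mult grushin_symbol_nonneg mult_left_le)
      then show "(\<integral>\<^sup>+w. ennreal (norm (?F \<xi> w)) \<partial>lborel) \<le> ennreal (?N * grushin_symbol (t + s) x w' \<xi>)"
        unfolding comp[OF \<xi>] .
    qed
    also have "\<dots> < \<infinity>"
      using t s integrable_mult_right[OF grushin_symbol_integrable[of "t + s" x w', where 'b='b], of ?N]
      by (subst nn_integral_eq_integral) (auto simp: grushin_symbol_nonneg)
    finally show "(\<integral>\<^sup>+p. ennreal (norm (case p of (\<xi>, w) \<Rightarrow> ?F \<xi> w)) \<partial>(lborel \<Otimes>\<^sub>M lborel)) < \<infinity>" .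
  qed
  define J where "J = (\<lambda>w. ?P * (\<integral>\<xi>. ?F \<xi> w \<partial>lborel))"
  have Jw: "(\<integral>\<^sup>+z. ennreal (grushin_cos t x w (Y - z) * grushin_cos s w w' z) \<partial>lborel) = ennreal (J w)" "0 \<le> J w" for w
  proof -
    note c = cos_transform_convolution[OF grushin_symbol_integrable[OF t, of x w, where 'b='b]
      grushin_symbol_integrable[OF s, of w w'] grushin_symbol_even grushin_symbol_le[OF s]
      grushin_symbol_tendsto_0[OF s] grushin_symbol_tendsto[OF s] grushin_cos_transform_nonneg[OF s], of Y]
    have nn: "0 \<le> grushin_cos t x w (Y - z) * grushin_cos s w w' z" for z :: 'b
      using t s by (simp add: grushin_cos_nonneg)
    have Ji: "J w = (\<integral>z. grushin_cos t x w (Y - z) * grushin_cos s w w' z \<partial>lborel)"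
      unfolding J_def grushin_cos_def by (rule c(2)[symmetric])
    show "(\<integral>\<^sup>+z. ennreal (grushin_cos t x w (Y - z) * grushin_cos s w w' z) \<partial>lborel) = ennreal (J w)"
      unfolding Ji using nn c(1) by (intro nn_integral_eq_integral) (auto simp: grushin_cos_def)
    show "0 \<le> J w" unfolding Ji using nn by simp
  qed
  have F': "integrable (lborel \<Otimes>\<^sub>M lborel) (\<lambda>(w, \<xi>). ?F \<xi> w)"
    using lborel_pair.integrable_product_swap[OF F] by (simp add: case_prod_unfold)
  have JI: "integrable lborel J"
    using lborel_pair.integrable_fst'[OF F'] unfolding J_def by simp
  have "(\<integral>\<^sup>+w. \<integral>\<^sup>+z. ennreal (grushin_cos t x w (Y - z) * grushin_cos s w w' z) \<partial>lborel \<partial>lborel) = ennreal (\<integral>w. J w \<partial>lborel)"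
    unfolding Jw(1) using JI Jw(2) by (intro nn_integral_eq_integral) auto
  also have "(\<integral>w. J w \<partial>lborel) = ?P * (\<integral>w. \<integral>\<xi>. ?F \<xi> w \<partial>lborel \<partial>lborel)"
    unfolding J_def by (rule integral_mult_right_zero)
  also have "(\<integral>w. \<integral>\<xi>. ?F \<xi> w \<partial>lborel \<partial>lborel) = (\<integral>\<xi>. \<integral>w. ?F \<xi> w \<partial>lborel \<partial>lborel)"
    by (rule lborel_pair.Fubini_integral[OF F])
  also have "\<dots> = (\<integral>\<xi>. ?N * (grushin_symbol (t + s) x w' \<xi> * cos (\<xi> \<bullet> Y)) \<partial>lborel)"
  proof (rule integral_cong_AE)
    show "(\<lambda>\<xi>. \<integral>w. ?F \<xi> w \<partial>lborel) \<in> borel_measurable lborel"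
      using lborel_pair.integrable_fst'[OF F] by auto
    show "AE \<xi> in lborel. (\<integral>w. ?F \<xi> w \<partial>lborel) = ?N * (grushin_symbol (t + s) x w' \<xi> * cos (\<xi> \<bullet> Y))"
      using AE_lborel_singleton[of 0]
    proof eventually_elim
      fix \<xi> :: 'b assume \<xi>: "\<xi> \<noteq> 0"
      have "(\<integral>w. grushin_symbol t x w \<xi> * grushin_symbol s w w' \<xi> \<partial>lborel) = ?N * grushin_symbol (t + s) x w' \<xi>"
        using comp[OF \<xi>] by (subst integral_eq_nn_integral) (auto simp: grushin_symbol_nonneg)
      moreover have "(\<integral>w. ?F \<xi> w \<partial>lborel) = (\<integral>w. grushin_symbol t x w \<xi> * grushin_symbol s w w' \<xi> \<partial>lborel) * cos (\<xi> \<bullet> Y)"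
        by (rule integral_mult_left_zero)
      ultimately show "(\<integral>w. ?F \<xi> w \<partial>lborel) = ?N * (grushin_symbol (t + s) x w' \<xi> * cos (\<xi> \<bullet> Y))"
        by (simp only: mult.assoc)
    qed
  qed measurable
  also have "\<dots> = ?N * grushin_cos (t + s) x w' Y"
    unfolding grushin_cos_def by (rule integral_mult_right_zero)
  finally show ?thesis by (simp only: mult.assoc)
qed

text \<open>Times above t / 2 share the exponential decay belonging to t / 2, so one function
  dominates all symbols from some index on.\<close>

lemma grushin_cos_continuous:
  fixes x w :: "'a::euclidean_space" and y :: "'b::euclidean_space"
  assumes t: "0 < t" and s: "s \<longlonglongrightarrow> t"
  shows "(\<lambda>n. grushin_cos (s n) x w y) \<longlonglongrightarrow> grushin_cos t x w y"
proof -
  let ?N = "real DIM('a)"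
  have "eventually (\<lambda>n. t / 2 < s n) sequentially"
    using t by (intro order_tendstoD(1)[OF s]) auto
  then obtain n0 where n0: "\<And>n. n0 \<le> n \<Longrightarrow> t / 2 < s n" by (auto simp: eventually_sequentially)
  define s' where "s' = (\<lambda>n. s (n + n0))"
  have s': "s' \<longlonglongrightarrow> t" "\<And>n. t / 2 < s' n"
    unfolding s'_def using n0 by (auto intro: LIMSEQ_ignore_initial_segment[OF s])
  have "(\<lambda>n. grushin_cos (s' n) x w y) \<longlonglongrightarrow> grushin_cos t x w y"
    unfolding grushin_cos_def
  proof (rule integral_dominated_convergence)
    let ?d = "\<lambda>\<xi>::'b. (4 / t) powr (?N / 2) * exp (- (?N / 4 * (t / 2)) * norm \<xi>)"
    show "integrable lborel ?d"
      using t by (intro integrable_mult_right integrable_exp_norm) auto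
    show "AE \<xi> in lborel. (\<lambda>n. grushin_symbol (s' n) x w \<xi> * cos (\<xi> \<bullet> y)) \<longlonglongrightarrow> grushin_symbol t x w \<xi> * cos (\<xi> \<bullet> y)"
      using AE_lborel_singleton[of 0]
    proof eventually_elim
      fix \<xi> :: 'b assume "\<xi> \<noteq> 0"
      then have "sinh (norm \<xi> * t) \<noteq> 0" "norm \<xi> / sinh (norm \<xi> * t) \<noteq> 0" using t by simp_all
      then show "(\<lambda>n. grushin_symbol (s' n) x w \<xi> * cos (\<xi> \<bullet> y)) \<longlonglongrightarrow> grushin_symbol t x w \<xi> * cos (\<xi> \<bullet> y)"
        unfolding grushin_symbol_def mehler_def
        by (intro tendsto_mult tendsto_powr tendsto_exp tendsto_minus tendsto_divide tendsto_diff tendsto_sinh tendsto_cosh tendsto_const s') simp_all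
    qed
    show "AE \<xi> in lborel. norm (grushin_symbol (s' n) x w \<xi> * cos (\<xi> \<bullet> y)) \<le> ?d \<xi>" for n
    proof (rule AE_I2)
      fix \<xi> :: 'b
      have s0: "0 < s' n" using s'(2)[of n] t by simp
      have "norm (grushin_symbol (s' n) x w \<xi> * cos (\<xi> \<bullet> y)) \<le> grushin_symbol (s' n) x w \<xi>"
        by (auto simp: abs_mult grushin_symbol_nonneg intro!: mult_left_le)
      also have "\<dots> \<le> (2 / s' n) powr (?N / 2) * exp (- (?N / 4 * s' n) * norm \<xi>)"
        by (rule grushin_symbol_le_exp[OF s0])
      also have "\<dots> \<le> ?d \<xi>"
      proof (rule mult_mono)
        show "(2 / s' n) powr (?N / 2) \<le> (4 / t) powr (?N / 2)"
          using s0 t s'(2)[of n] by (intro powr_mono2) (auto simp: field_simps)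
        have "?N / 4 * (t / 2) * norm \<xi> \<le> ?N / 4 * s' n * norm \<xi>"
          using s'(2)[of n] by (intro mult_right_mono mult_left_mono) auto
        then show "exp (- (?N / 4 * s' n) * norm \<xi>) \<le> exp (- (?N / 4 * (t / 2)) * norm \<xi>)" by simp
      qed auto
      finally show "norm (grushin_symbol (s' n) x w \<xi> * cos (\<xi> \<bullet> y)) \<le> ?d \<xi>" .
    qed
  qed measurable
  then show ?thesis unfolding s'_def by (rule LIMSEQ_offset)
qed

section \<open>Symmetric Markov kernels with ultracontractive bounds\<close>

lemma integrable_powr_kernel:
  fixes a b t :: real
  assumes a: "a < 1" and b: "b \<le> t"
  shows "integrable lborel (\<lambda>s. indicator {b<..<t} s * (t - s) powr - a)"
    "(\<integral>s. indicator {b<..<t} s * (t - s) powr - a \<partial>lborel) = (t - b) powr (1 - a) / (1 - a)"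
    "integrable lborel (\<lambda>s. indicator {0<..<t} s * s powr - a)"
proof -
  define F where "F = (\<lambda>c x. indicator {0..c} x * x powr - a)"
  have F: "integrable lborel (F c)" "(\<integral>x. F c x \<partial>lborel) = c powr (1 - a) / (1 - a)" if "0 \<le> c" for c :: real
  proof -
    have "((\<lambda>x. x powr - a) has_integral (c powr (- a + 1) / (- a + 1))) {0..c}"
      using a that by (intro has_integral_powr_from_0) auto
    then have "(\<integral>\<^sup>+x. ennreal (x powr - a) * indicator {0..c} x \<partial>lborel) = ennreal (c powr (- a + 1) / (- a + 1))"
      by (intro nn_integral_has_integral_lebesgue') auto
    then have nn: "(\<integral>\<^sup>+x. ennreal (F c x) \<partial>lborel) = ennreal (c powr (1 - a) / (1 - a))"
      by (simp add: F_def nn_integral_set_ennreal mult.commute)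
    have [measurable]: "F c \<in> borel_measurable borel" unfolding F_def by measurable
    show "integrable lborel (F c)" by (rule integrableI_nonneg) (auto simp: nn, simp add: F_def)
    show "(\<integral>x. F c x \<partial>lborel) = c powr (1 - a) / (1 - a)"
      using a by (subst integral_eq_nn_integral) (auto simp: nn, auto simp: F_def)
  qed
  have c: "0 \<le> t - b" using b by simp
  have ae: "AE s in lborel. indicator {b<..<t} s * (t - s) powr - a = F (t - b) (t + (- 1) * s)"
    using AE_lborel_singleton[of b] by eventually_elim (auto simp: F_def split: split_indicator)
  have i: "integrable lborel (\<lambda>s. F (t - b) (t + (- 1) * s))"
    by (rule lborel_integrable_real_affine[OF F(1)[OF c]]) simp
  show "integrable lborel (\<lambda>s. indicator {b<..<t} s * (t - s) powr - a)"
    by (rule integrable_cong_AE_imp[OF i]) (use ae in \<open>auto elim!: eventually_mono\<close>)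
  have "(\<integral>s. indicator {b<..<t} s * (t - s) powr - a \<partial>lborel) = (\<integral>s. F (t - b) (t + (- 1) * s) \<partial>lborel)"
    by (rule integral_cong_AE) (use i ae in \<open>auto dest: borel_measurable_integrable\<close>)
  also have "\<dots> = (\<integral>s. F (t - b) s \<partial>lborel)"
    using lborel_integral_real_affine[of "-1" "F (t - b)" t] by simp
  finally show "(\<integral>s. indicator {b<..<t} s * (t - s) powr - a \<partial>lborel) = (t - b) powr (1 - a) / (1 - a)"
    using F(2)[OF c] by simp
  show "integrable lborel (\<lambda>s. indicator {0<..<t} s * s powr - a)"
  proof (cases "0 \<le> t")
    case True
    have "AE s in lborel. F t s = indicator {0<..<t} s * s powr - a"
      using AE_lborel_singleton[of t] by eventually_elim (auto simp: F_def split: split_indicator)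
    then show ?thesis by (intro integrable_cong_AE_imp[OF F(1)[OF True]]) (auto elim!: eventually_mono)
  qed simp
qed

text \<open>Everything the nonlinear theory takes from the Grushin kernel; the geometry enters only
  through \<delta>, which is (N + 2k) / 2 there. Continuity in time is asked pointwise, since
  conservation of mass upgrades it to L^1.\<close>

locale heat_kernel_space =
  fixes K :: "real \<Rightarrow> 'a::euclidean_space \<Rightarrow> 'a \<Rightarrow> real" and \<delta> \<kappa> :: real
  assumes kernel_measurable: "(\<lambda>(t, z, v). K t z v) \<in> borel_measurable (borel \<Otimes>\<^sub>M borel \<Otimes>\<^sub>M borel)"
    and kernel_nonneg: "0 < t \<Longrightarrow> 0 \<le> K t z v"
    and kernel_commute: "0 < t \<Longrightarrow> K t z v = K t v z"
    and kernel_mass: "0 < t \<Longrightarrow> (\<integral>\<^sup>+v. ennreal (K t z v) \<partial>lborel) = 1"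
    and kernel_le: "0 < t \<Longrightarrow> K t z v \<le> \<kappa> * t powr - \<delta>"
    and chapman_kolmogorov: "0 < t \<Longrightarrow> 0 < s \<Longrightarrow>
      (\<integral>\<^sup>+v. ennreal (K t z v * K s v z') \<partial>lborel) = ennreal (K (t + s) z z')"
    and kernel_tendsto: "0 < t \<Longrightarrow> f \<longlonglongrightarrow> t \<Longrightarrow> (\<lambda>n. K (f n) z v) \<longlonglongrightarrow> K t z v"
    and exponent_pos: "0 < \<delta>"
begin

lemma measurable_kernel[measurable (raw)]:
  assumes [measurable]: "f \<in> borel_measurable M" "g \<in> borel_measurable M" "h \<in> borel_measurable M"
  shows "(\<lambda>p. K (f p) (g p) (h p)) \<in> borel_measurable M"
proof -
  have "(\<lambda>p. (f p, g p, h p)) \<in> M \<rightarrow>\<^sub>M borel \<Otimes>\<^sub>M borel \<Otimes>\<^sub>M borel" by measurable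
  from measurable_compose[OF this kernel_measurable] show ?thesis by simp
qed

lemma bound_nonneg: "0 \<le> \<kappa>"
  using kernel_nonneg[of 1 0 0] kernel_le[of 1 0 0] by simp

definition S :: "real \<Rightarrow> ('a \<Rightarrow> real) \<Rightarrow> 'a \<Rightarrow> real" where
  "S t \<phi> z = (\<integral>v. K t z v * \<phi> v \<partial>lborel)"

lemma measurable_S[measurable (raw)]:
  assumes [measurable]: "f \<in> borel_measurable M" "g \<in> borel_measurable M"
    and [measurable]: "(\<lambda>(p, v). \<phi> p v) \<in> borel_measurable (M \<Otimes>\<^sub>M borel)"
  shows "(\<lambda>p. S (f p) (\<phi> p) (g p)) \<in> borel_measurable M"
proof -
  have "(\<lambda>(p, v). K (f p) (g p) v * \<phi> p v) \<in> borel_measurable (M \<Otimes>\<^sub>M lborel)"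
    by measurable
  then show ?thesis unfolding S_def by (rule lborel.borel_measurable_lebesgue_integral)
qed

lemma S_measurable:
  assumes [measurable]: "\<phi> \<in> borel_measurable borel"
  shows "S t \<phi> \<in> borel_measurable borel"
  by (rule measurable_S[of "\<lambda>_. t" borel "\<lambda>z. z" "\<lambda>_. \<phi>"]) measurable

lemma kernel_weighted_le:
  assumes t: "0 < t" and \<phi>: "Lp_le r \<phi> a"
  shows "(\<integral>\<^sup>+v. ennreal (K t z v) * ennreal (\<bar>\<phi> v\<bar> powr r) \<partial>lborel) \<le> ennreal (\<kappa> * t powr - \<delta> * a powr r)"
proof -
  have [measurable]: "\<phi> \<in> borel_measurable borel" using \<phi> by (rule Lp_le_measurable)
  have "(\<integral>\<^sup>+v. ennreal (K t z v) * ennreal (\<bar>\<phi> v\<bar> powr r) \<partial>lborel) \<le>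
    (\<integral>\<^sup>+v. ennreal (\<kappa> * t powr - \<delta>) * ennreal (\<bar>\<phi> v\<bar> powr r) \<partial>lborel)"
    using kernel_le[OF t] by (intro nn_integral_mono mult_right_mono ennreal_leI) auto
  also have "\<dots> = ennreal (\<kappa> * t powr - \<delta>) * (\<integral>\<^sup>+v. ennreal (\<bar>\<phi> v\<bar> powr r) \<partial>lborel)"
    by (intro nn_integral_cmult) auto
  also have "\<dots> \<le> ennreal (\<kappa> * t powr - \<delta>) * ennreal (a powr r)"
    using \<phi> by (intro mult_left_mono) (auto simp: Lp_le_def)
  finally show ?thesis using bound_nonneg by (simp add: ennreal_mult)
qed

text \<open>Jensen for the probability measure with density \<open>K t z\<close> bounds |S t
  \<phi>|^r by S t applied to |\<phi>|^r, and the pointwise kernel bound turns this into a constant.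
  All four claims hold at every \<open>z\<close>, not just almost everywhere.\<close>

lemma
  assumes t: "0 < t" and \<phi>: "Lp_le r \<phi> a" and r: "1 \<le> r"
  shows S_integrable: "integrable lborel (\<lambda>v. K t z v * \<phi> v)"
    and S_abs_le: "(\<integral>v. K t z v * \<bar>\<phi> v\<bar> \<partial>lborel) \<le> (\<kappa> * t powr - \<delta>) powr (1 / r) * a"
    and S_le: "\<bar>S t \<phi> z\<bar> \<le> (\<kappa> * t powr - \<delta>) powr (1 / r) * a"
    and S_powr_le: "ennreal (\<bar>S t \<phi> z\<bar> powr r) \<le> (\<integral>\<^sup>+v. ennreal (K t z v) * ennreal (\<bar>\<phi> v\<bar> powr r) \<partial>lborel)"
proof -
  have [measurable]: "\<phi> \<in> borel_measurable borel" using \<phi> by (rule Lp_le_measurable)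
  have a: "0 \<le> a" using \<phi> by (rule Lp_le_nonneg)
  define B where "B = enn2real (\<integral>\<^sup>+v. ennreal (K t z v) * ennreal (\<bar>\<phi> v\<bar> powr r) \<partial>lborel)"
  have fin: "(\<integral>\<^sup>+v. ennreal (K t z v) * ennreal (\<bar>\<phi> v\<bar> powr r) \<partial>lborel) = ennreal B"
    using kernel_weighted_le[OF t \<phi>, of z] unfolding B_def
    by (intro ennreal_enn2real[symmetric]) (auto simp: less_top[symmetric] top_unique)
  have B: "B \<le> \<kappa> * t powr - \<delta> * a powr r" "0 \<le> B"
    using kernel_weighted_le[OF t \<phi>, of z] bound_nonneg unfolding fin by (auto simp: ennreal_le_iff B_def)
  note J = jensen_kernel[where A=1, OF r _ _ kernel_nonneg[OF t] _ _ eq_refl[OF fin] B(2), simplified]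
  show "integrable lborel (\<lambda>v. K t z v * \<phi> v)"
    by (rule J(1)) (auto simp: kernel_mass[OF t])
  have root: "x \<le> (\<kappa> * t powr - \<delta>) powr (1 / r) * a" if "x powr r \<le> B" "0 \<le> x" for x
  proof -
    have "x = (x powr r) powr (1 / r)" using that r by (simp add: powr_powr)
    also have "\<dots> \<le> (\<kappa> * t powr - \<delta> * a powr r) powr (1 / r)"
      using that B r by (intro powr_mono2) auto
    also have "\<dots> = (\<kappa> * t powr - \<delta>) powr (1 / r) * (a powr r) powr (1 / r)"
      by (rule powr_mult)
    finally show ?thesis using a r by (simp add: powr_powr)
  qed
  show "(\<integral>v. K t z v * \<bar>\<phi> v\<bar> \<partial>lborel) \<le> (\<kappa> * t powr - \<delta>) powr (1 / r) * a"
    by (rule root, rule J(2)) (auto simp: kernel_mass[OF t] kernel_nonneg[OF t])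
  have 3: "\<bar>S t \<phi> z\<bar> powr r \<le> B"
    unfolding S_def by (rule J(3)) (auto simp: kernel_mass[OF t])
  then show "\<bar>S t \<phi> z\<bar> \<le> (\<kappa> * t powr - \<delta>) powr (1 / r) * a"
    by (rule root) simp
  show "ennreal (\<bar>S t \<phi> z\<bar> powr r) \<le> (\<integral>\<^sup>+v. ennreal (K t z v) * ennreal (\<bar>\<phi> v\<bar> powr r) \<partial>lborel)"
    unfolding fin using 3 by (rule ennreal_leI)
qed

lemma kernel_mass_left:
  assumes "0 < t"
  shows "(\<integral>\<^sup>+z. ennreal (K t z v) \<partial>lborel) = 1"
  using kernel_mass[OF assms, of v] by (subst kernel_commute[OF assms])

text \<open>Jensen's bound is integrated in \<open>z\<close>, and by symmetry the kernel has mass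
  one in that variable too.\<close>

lemma S_Lp:
  assumes t: "0 < t" and \<phi>: "Lp_le r \<phi> a" and r: "1 \<le> r"
  shows "Lp_le r (S t \<phi>) a"
proof -
  have [measurable]: "\<phi> \<in> borel_measurable borel" using \<phi> by (rule Lp_le_measurable)
  have "(\<integral>\<^sup>+z. ennreal (\<bar>S t \<phi> z\<bar> powr r) \<partial>lborel) \<le>
    (\<integral>\<^sup>+z. \<integral>\<^sup>+v. ennreal (K t z v) * ennreal (\<bar>\<phi> v\<bar> powr r) \<partial>lborel \<partial>lborel)"
    by (intro nn_integral_mono S_powr_le[OF t \<phi> r])
  also have "\<dots> = (\<integral>\<^sup>+v. \<integral>\<^sup>+z. ennreal (K t z v) * ennreal (\<bar>\<phi> v\<bar> powr r) \<partial>lborel \<partial>lborel)"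
    by (rule lborel_pair.Fubini') measurable
  also have "\<dots> = (\<integral>\<^sup>+v. ennreal (\<bar>\<phi> v\<bar> powr r) \<partial>lborel)"
    by (simp add: nn_integral_multc kernel_mass_left[OF t])
  finally show ?thesis
    using \<phi> S_measurable[of \<phi> t] by (auto simp: Lp_le_def)
qed

text \<open>Interpolation between the contraction in \<open>L\<^sup>p\<close> and the pointwise bound.\<close>

lemma S_Lp_Lq:
  assumes t: "0 < t" and \<phi>: "Lp_le p \<phi> a" and p: "1 \<le> p" and q: "p \<le> q"
  shows "Lp_le q (S t \<phi>) ((\<kappa> * t powr - \<delta>) powr (1 / p - 1 / q) * a)"
proof -
  have [measurable]: "\<phi> \<in> borel_measurable borel" using \<phi> by (rule Lp_le_measurable)
  note [measurable] = S_measurable[of \<phi> t]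
  have a: "0 \<le> a" using \<phi> by (rule Lp_le_nonneg)
  define X where "X = \<kappa> * t powr - \<delta>"
  have X: "0 \<le> X" using bound_nonneg by (simp add: X_def)
  \<comment> \<open>\<open>Y\<close> bounds |S t \<phi>| everywhere, so the power q - p is estimated
    by \<open>Y\<close> and the remaining power p by the L^p contraction.\<close>
  define Y where "Y = X powr (1 / p) * a"
  have Y: "0 \<le> Y" using a by (simp add: Y_def)
  have "(\<integral>\<^sup>+z. ennreal (\<bar>S t \<phi> z\<bar> powr q) \<partial>lborel) \<le> (\<integral>\<^sup>+z. ennreal (Y powr (q - p)) * ennreal (\<bar>S t \<phi> z\<bar> powr p) \<partial>lborel)"
  proof (rule nn_integral_mono)
    fix z
    have "\<bar>S t \<phi> z\<bar> powr q = \<bar>S t \<phi> z\<bar> powr (q - p) * \<bar>S t \<phi> z\<bar> powr p"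
      by (simp flip: powr_add)
    also have "\<dots> \<le> Y powr (q - p) * \<bar>S t \<phi> z\<bar> powr p"
      using S_le[OF t \<phi> p, of z] q by (intro mult_right_mono powr_mono2) (auto simp: Y_def X_def)
    finally show "ennreal (\<bar>S t \<phi> z\<bar> powr q) \<le> ennreal (Y powr (q - p)) * ennreal (\<bar>S t \<phi> z\<bar> powr p)"
      by (simp flip: ennreal_mult)
  qed
  also have "\<dots> = ennreal (Y powr (q - p)) * (\<integral>\<^sup>+z. ennreal (\<bar>S t \<phi> z\<bar> powr p) \<partial>lborel)"
    by (intro nn_integral_cmult) auto
  also have "\<dots> \<le> ennreal (Y powr (q - p)) * ennreal (a powr p)"
    using S_Lp[OF t \<phi> p] by (intro mult_left_mono) (auto simp: Lp_le_def)
  also have "\<dots> = ennreal (Y powr (q - p) * a powr p)" by (simp add: ennreal_mult)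
  also have "Y powr (q - p) * a powr p = (X powr (1 / p - 1 / q) * a) powr q"
  proof -
    have "Y powr (q - p) * a powr p = (X powr (1 / p)) powr (q - p) * (a powr (q - p) * a powr p)"
      by (simp add: Y_def powr_mult)
    also have "(X powr (1 / p)) powr (q - p) = (X powr (1 / p - 1 / q)) powr q"
    proof -
      have "1 / p * (q - p) = (1 / p - 1 / q) * q" using p q by (simp add: field_simps)
      then show ?thesis by (simp only: powr_powr)
    qed
    also have "a powr (q - p) * a powr p = a powr q" by (simp flip: powr_add)
    finally show ?thesis by (simp add: powr_mult)
  qed
  finally show ?thesis using a by (auto simp: Lp_le_def X_def)
qed

lemma S_cong_AE:
  assumes "AE v in lborel. \<phi> v = \<psi> v" "\<phi> \<in> borel_measurable borel" "\<psi> \<in> borel_measurable borel"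
  shows "S t \<phi> z = S t \<psi> z"
  unfolding S_def by (rule integral_cong_AE) (use assms in \<open>auto elim!: eventually_mono\<close>)

lemma S_diff:
  assumes "0 < t" "Lp_le r \<phi> a" "Lp_le r \<psi> b" "1 \<le> r"
  shows "S t (\<lambda>v. \<phi> v - \<psi> v) z = S t \<phi> z - S t \<psi> z"
  unfolding S_def using S_integrable[OF assms(1,2,4), of z] S_integrable[OF assms(1,3,4), of z]
  by (simp add: right_diff_distrib)

lemma S_add:
  assumes "0 < t" "Lp_le r \<phi> a" "Lp_le r \<psi> b" "1 \<le> r"
  shows "S t (\<lambda>v. \<phi> v + \<psi> v) z = S t \<phi> z + S t \<psi> z"
  unfolding S_def using S_integrable[OF assms(1,2,4), of z] S_integrable[OF assms(1,3,4), of z]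
  by (simp add: distrib_left)

lemma S_S:
  assumes t: "0 < t" and s: "0 < s" and \<phi>: "Lp_le r \<phi> a" and r: "1 \<le> r"
  shows "S t (S s \<phi>) z = S (t + s) \<phi> z"
proof -
  have [measurable]: "\<phi> \<in> borel_measurable borel" using \<phi> by (rule Lp_le_measurable)
  let ?F = "\<lambda>v w. K t z v * (K s v w * \<phi> w)"
  have ck: "(\<integral>v. K t z v * K s v w \<partial>lborel) = K (t + s) z w" for w
    using t s chapman_kolmogorov[OF t s, of z w]
    by (subst integral_eq_nn_integral) (auto simp: kernel_nonneg)
  have F: "integrable (lborel \<Otimes>\<^sub>M lborel) (\<lambda>(v, w). ?F v w)"
  proof (rule integrableI_bounded)
    show "(\<lambda>(v, w). ?F v w) \<in> borel_measurable (lborel \<Otimes>\<^sub>M lborel)" by measurable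
    have "(\<integral>\<^sup>+x. ennreal (norm (case x of (v, w) \<Rightarrow> ?F v w)) \<partial>(lborel \<Otimes>\<^sub>M lborel)) =
       (\<integral>\<^sup>+w. \<integral>\<^sup>+v. ennreal (norm (?F v w)) \<partial>lborel \<partial>lborel)"
      by (subst lborel_pair.nn_integral_snd[symmetric]) auto
    also have "\<dots> = (\<integral>\<^sup>+w. ennreal (norm (K (t + s) z w * \<phi> w)) \<partial>lborel)"
    proof (rule nn_integral_cong)
      fix w
      have "(\<integral>\<^sup>+v. ennreal (norm (?F v w)) \<partial>lborel) = (\<integral>\<^sup>+v. ennreal (K t z v * K s v w) * ennreal \<bar>\<phi> w\<bar> \<partial>lborel)"
        using t s by (intro nn_integral_cong) (simp add: abs_mult kernel_nonneg mult.assoc flip: ennreal_mult)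
      also have "\<dots> = ennreal (K (t + s) z w) * ennreal \<bar>\<phi> w\<bar>"
        by (subst nn_integral_multc) (auto simp: chapman_kolmogorov[OF t s])
      finally show "(\<integral>\<^sup>+v. ennreal (norm (?F v w)) \<partial>lborel) = ennreal (norm (K (t + s) z w * \<phi> w))"
        using t s by (simp add: abs_mult kernel_nonneg ennreal_mult)
    qed
    also have "\<dots> < \<infinity>"
      using S_integrable[OF _ \<phi> r, of "t + s" z] t s by (simp add: integrable_iff_bounded)
    finally show "(\<integral>\<^sup>+x. ennreal (norm (case x of (v, w) \<Rightarrow> ?F v w)) \<partial>(lborel \<Otimes>\<^sub>M lborel)) < \<infinity>" .
  qed
  have "S t (S s \<phi>) z = (\<integral>v. \<integral>w. ?F v w \<partial>lborel \<partial>lborel)"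
    unfolding S_def by simp
  also have "\<dots> = (\<integral>w. \<integral>v. ?F v w \<partial>lborel \<partial>lborel)"
    by (rule lborel_pair.Fubini_integral[OF F, symmetric])
  also have "\<dots> = (\<integral>w. (\<integral>v. K t z v * K s v w \<partial>lborel) * \<phi> w \<partial>lborel)"
    by (subst integral_mult_left_zero[symmetric]) (simp add: mult.assoc)
  finally show ?thesis by (simp add: ck S_def)
qed

text \<open>Scheffe's lemma for the kernels: \<open>|a - b| = a + b - 2 min a b\<close> and the masses agree.\<close>

lemma kernel_tendsto_L1:
  assumes t: "0 < t" and s: "s \<longlonglongrightarrow> t" "\<And>n. 0 < s n"
  shows "(\<lambda>n. \<integral>v. \<bar>K (s n) z v - K t z v\<bar> \<partial>lborel) \<longlonglongrightarrow> 0"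
    "integrable lborel (\<lambda>v. K (s n) z v - K t z v)"
    "(\<integral>v. \<bar>K (s n) z v - K t z v\<bar> \<partial>lborel) \<le> 2"
proof -
  have Ki: "integrable lborel (K t z)" "(\<integral>v. K t z v \<partial>lborel) = 1" if "0 < t" for t
    using kernel_mass[OF that, of z] kernel_nonneg[OF that]
    by (auto intro!: integrableI_nonneg simp: integral_eq_nn_integral)
  have mi: "integrable lborel (\<lambda>v. min (K (s n) z v) (K t z v))" for n
    using Ki[OF t] Ki[OF s(2)] by (intro integrable_min) auto
  have "(\<lambda>n. \<integral>v. min (K (s n) z v) (K t z v) \<partial>lborel) \<longlonglongrightarrow> (\<integral>v. min (K t z v) (K t z v) \<partial>lborel)"
  proof (rule integral_dominated_convergence[OF _ _ Ki(1)[OF t]])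
    show "AE v in lborel. (\<lambda>n. min (K (s n) z v) (K t z v)) \<longlonglongrightarrow> min (K t z v) (K t z v)"
      by (intro AE_I2 tendsto_min tendsto_const kernel_tendsto t s)
    show "AE v in lborel. norm (min (K (s n) z v) (K t z v)) \<le> K t z v" for n
      using kernel_nonneg[OF t] kernel_nonneg[OF s(2)] by (auto intro!: AE_I2)
  qed measurable
  then have lim: "(\<lambda>n. \<integral>v. min (K (s n) z v) (K t z v) \<partial>lborel) \<longlonglongrightarrow> 1"
    using Ki[OF t] by simp
  show "integrable lborel (\<lambda>v. K (s n) z v - K t z v)" for n
    using Ki[OF t] Ki[OF s(2)] by simp
  have eq: "(\<integral>v. \<bar>K (s n) z v - K t z v\<bar> \<partial>lborel) = 2 - 2 * (\<integral>v. min (K (s n) z v) (K t z v) \<partial>lborel)" for n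
  proof -
    have "(\<integral>v. \<bar>K (s n) z v - K t z v\<bar> \<partial>lborel) = (\<integral>v. K (s n) z v + K t z v - 2 * min (K (s n) z v) (K t z v) \<partial>lborel)"
      by (intro Bochner_Integration.integral_cong) (auto simp: min_def)
    then show ?thesis using Ki[OF t] Ki[OF s(2)] mi by simp
  qed
  have "(\<lambda>n. 2 - 2 * (\<integral>v. min (K (s n) z v) (K t z v) \<partial>lborel)) \<longlonglongrightarrow> 2 - 2 * 1"
    by (intro tendsto_intros lim)
  then show "(\<lambda>n. \<integral>v. \<bar>K (s n) z v - K t z v\<bar> \<partial>lborel) \<longlonglongrightarrow> 0" unfolding eq by simp
  have "0 \<le> (\<integral>v. min (K (s n) z v) (K t z v) \<partial>lborel)"
    using kernel_nonneg[OF t] kernel_nonneg[OF s(2)] by simp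
  then show "(\<integral>v. \<bar>K (s n) z v - K t z v\<bar> \<partial>lborel) \<le> 2" unfolding eq by simp
qed

text \<open>Jensen is used for the density |K (s n) - K t|, of mass at most 2. Integration in
  \<open>z\<close> leaves the integral of |\<phi>|^r against \<open>d n\<close>, the L^1 distance of
  the two kernels, which is bounded and tends to zero pointwise. Dominated convergence then treats
  every \<phi> directly, without approximation by smoother functions.\<close>

lemma S_tendsto:
  assumes t: "0 < t" and s: "s \<longlonglongrightarrow> t" "\<And>n. 0 < s n" and \<phi>: "Lp_le r \<phi> a" and r: "1 \<le> r"
  shows "\<exists>b. (\<forall>n. Lp_le r (\<lambda>z. S (s n) \<phi> z - S t \<phi> z) (b n)) \<and> b \<longlonglongrightarrow> 0"
proof -
  have [measurable]: "\<phi> \<in> borel_measurable borel" using \<phi> by (rule Lp_le_measurable)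
  have \<phi>i: "integrable lborel (\<lambda>v. \<bar>\<phi> v\<bar> powr r)"
    using Lp_le_imp_Lp(1)[OF \<phi>] r by (simp add: Lp_def)
  let ?D = "\<lambda>n z v. \<bar>K (s n) z v - K t z v\<bar>"
  define d where "d = (\<lambda>n v. \<integral>z. ?D n v z \<partial>lborel)"
  note L1 = kernel_tendsto_L1[OF t s]
  have d: "(\<lambda>n. d n v) \<longlonglongrightarrow> 0" "0 \<le> d n v" "d n v \<le> 2" for n v
    unfolding d_def using L1 by auto
  have [measurable]: "d n \<in> borel_measurable borel" for n unfolding d_def by measurable
  have dn: "(\<integral>\<^sup>+v. ennreal (?D n z v) \<partial>lborel) = ennreal (d n z)" for n z
    unfolding d_def using L1(2) by (intro nn_integral_eq_integral) auto
  have dn': "(\<integral>\<^sup>+z. ennreal (?D n z v) \<partial>lborel) = ennreal (d n v)" for n v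
    using dn[of n v] by (subst kernel_commute[OF t], subst kernel_commute[OF s(2)])
  define I where "I = (\<lambda>n. \<integral>v. \<bar>\<phi> v\<bar> powr r * d n v \<partial>lborel)"
  have Ii: "integrable lborel (\<lambda>v. \<bar>\<phi> v\<bar> powr r * d n v)" for n
  proof (rule Bochner_Integration.integrable_bound[OF integrable_mult_right[OF \<phi>i, of 2]])
    show "AE v in lborel. norm (\<bar>\<phi> v\<bar> powr r * d n v) \<le> norm (2 * \<bar>\<phi> v\<bar> powr r)"
      using d(2,3) by (auto intro!: AE_I2 simp: abs_mult mult.commute mult_right_mono)
  qed measurable
  have "I \<longlonglongrightarrow> (\<integral>v. \<bar>\<phi> v\<bar> powr r * 0 \<partial>lborel)"
    unfolding I_def
  proof (rule integral_dominated_convergence)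
    show "integrable lborel (\<lambda>v. 2 * \<bar>\<phi> v\<bar> powr r)" using \<phi>i by simp
    show "AE v in lborel. (\<lambda>n. \<bar>\<phi> v\<bar> powr r * d n v) \<longlonglongrightarrow> \<bar>\<phi> v\<bar> powr r * 0"
      by (intro AE_I2 tendsto_mult tendsto_const d)
    show "AE v in lborel. norm (\<bar>\<phi> v\<bar> powr r * d n v) \<le> 2 * \<bar>\<phi> v\<bar> powr r" for n
      using d(2,3) by (auto intro!: AE_I2 simp: abs_mult mult.commute mult_right_mono)
  qed measurable
  then have I: "I \<longlonglongrightarrow> 0" by simp
  have I0: "0 \<le> I n" for n unfolding I_def using d by simp
  define b where "b = (\<lambda>n. (2 powr (r - 1) * I n) powr (1 / r))"
  have "b \<longlonglongrightarrow> (2 powr (r - 1) * 0) powr (1 / r)"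
    unfolding b_def using r I0 by (intro tendsto_powr2 tendsto_mult tendsto_const I) auto
  then have "b \<longlonglongrightarrow> 0" by simp
  moreover have "Lp_le r (\<lambda>z. S (s n) \<phi> z - S t \<phi> z) (b n)" for n
  proof -
    have meas: "(\<lambda>z. S (s n) \<phi> z - S t \<phi> z) \<in> borel_measurable borel"
      using S_measurable by (intro borel_measurable_diff) auto
    let ?B = "\<lambda>z. \<integral>\<^sup>+v. ennreal (?D n z v) * ennreal (\<bar>\<phi> v\<bar> powr r) \<partial>lborel"
    have pt: "ennreal (\<bar>S (s n) \<phi> z - S t \<phi> z\<bar> powr r) \<le> ennreal (2 powr (r - 1)) * ?B z" for z
    proof (cases "?B z = \<infinity>")
      case True
      have "ennreal (2 powr (r - 1)) * ?B z = top"
        unfolding True infinity_ennreal_def by (simp add: ennreal_mult_top)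
      then show ?thesis by (rule ord_le_eq_trans[OF top_greatest sym])
    next
      case False
      then obtain B where B: "?B z = ennreal B" "0 \<le> B"
        by (cases "?B z" rule: ennreal_cases) auto
      have A: "(\<integral>\<^sup>+v. ennreal (?D n z v) \<partial>lborel) \<le> ennreal 2"
        unfolding dn using d(3) by (rule ennreal_leI)
      have "\<bar>S (s n) \<phi> z - S t \<phi> z\<bar> = \<bar>\<integral>v. (K (s n) z v - K t z v) * \<phi> v \<partial>lborel\<bar>"
        unfolding S_def using S_integrable[OF t \<phi> r, of z] S_integrable[OF s(2) \<phi> r, of n z]
        by (simp add: left_diff_distrib)
      also have "\<dots> \<le> (\<integral>v. ?D n z v * \<bar>\<phi> v\<bar> \<partial>lborel)"
        using integral_abs_bound[of lborel "\<lambda>v. (K (s n) z v - K t z v) * \<phi> v"] by (simp add: abs_mult)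
      finally have "\<bar>S (s n) \<phi> z - S t \<phi> z\<bar> powr r \<le> (\<integral>v. ?D n z v * \<bar>\<phi> v\<bar> \<partial>lborel) powr r"
        using r by (intro powr_mono2) auto
      also have "\<dots> \<le> 2 powr (r - 1) * B"
        by (rule jensen_kernel(2)[OF r _ _ _ A _ eq_refl[OF B(1)] B(2)]) auto
      finally show ?thesis unfolding B(1) using B(2) by (simp flip: ennreal_mult)
    qed
    have "(\<integral>\<^sup>+z. ennreal (\<bar>S (s n) \<phi> z - S t \<phi> z\<bar> powr r) \<partial>lborel) \<le> (\<integral>\<^sup>+z. ennreal (2 powr (r - 1)) * ?B z \<partial>lborel)"
      by (intro nn_integral_mono pt)
    also have "\<dots> = ennreal (2 powr (r - 1)) * (\<integral>\<^sup>+z. ?B z \<partial>lborel)"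
      by (intro nn_integral_cmult) measurable
    also have "(\<integral>\<^sup>+z. ?B z \<partial>lborel) = (\<integral>\<^sup>+v. \<integral>\<^sup>+z. ennreal (?D n z v) * ennreal (\<bar>\<phi> v\<bar> powr r) \<partial>lborel \<partial>lborel)"
      by (rule lborel_pair.Fubini') measurable
    also have "\<dots> = (\<integral>\<^sup>+v. ennreal (\<bar>\<phi> v\<bar> powr r * d n v) \<partial>lborel)"
    proof (rule nn_integral_cong)
      fix v
      have "(\<integral>\<^sup>+z. ennreal (?D n z v) * ennreal (\<bar>\<phi> v\<bar> powr r) \<partial>lborel) = (\<integral>\<^sup>+z. ennreal (?D n z v) \<partial>lborel) * ennreal (\<bar>\<phi> v\<bar> powr r)"
        by (rule nn_integral_multc) measurable
      then show "(\<integral>\<^sup>+z. ennreal (?D n z v) * ennreal (\<bar>\<phi> v\<bar> powr r) \<partial>lborel) = ennreal (\<bar>\<phi> v\<bar> powr r * d n v)"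
        unfolding dn' using d(2) by (simp add: ennreal_mult mult.commute)
    qed
    also have "\<dots> = ennreal (I n)"
      unfolding I_def using Ii d(2) by (intro nn_integral_eq_integral) auto
    also have "ennreal (2 powr (r - 1)) * ennreal (I n) = ennreal (b n powr r)"
      using I0 r by (simp add: b_def powr_powr flip: ennreal_mult)
    finally show ?thesis using meas by (auto simp: Lp_le_def b_def)
  qed
  ultimately show ?thesis by blast
qed

end

section \<open>The semilinear problem\<close>

lemma jointly_measurable_section: "jointly_measurable g \<Longrightarrow> g s \<in> borel_measurable borel"
  using measurable_compose[of "\<lambda>z. (s, z)" borel "borel \<Otimes>\<^sub>M borel" "case_prod g" borel] by simp

locale semilinear_heat = heat_kernel_space K \<delta> \<kappa>
  for K :: "real \<Rightarrow> 'a::euclidean_space \<Rightarrow> 'a \<Rightarrow> real" and \<delta> \<kappa> +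
  fixes \<rho> p :: real
  assumes rho: "1 < \<rho>" and p: "1 \<le> p" and subcritical: "\<delta> * (\<rho> - 1) < p"
begin

definition q :: real where "q = \<rho> * p"
text \<open>The order of the singularity of the source in L^p at time zero;
  \<open>subcritical\<close> says that it is below 1. In turn \<alpha> equals \<delta> (1 / p - 1 /
  q), the smoothing exponent from L^p to L^q.\<close>

definition \<beta> :: real where "\<beta> = \<delta> * (\<rho> - 1) / p"
definition \<alpha> :: real where "\<alpha> = \<beta> / \<rho>"
definition smoothing_const :: real where "smoothing_const = \<kappa> powr (1 / p - 1 / q)"

lemma exponents: "1 \<le> q" "p \<le> q" "0 < q" "0 < \<beta>" "\<beta> < 1" "0 < \<alpha>" "\<alpha> < 1" "\<alpha> * \<rho> = \<beta>" "0 \<le> smoothing_const"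
proof -
  show pq: "p \<le> q" using rho p by (simp add: q_def)
  show "1 \<le> q" "0 < q" using pq p by auto
  show b0: "0 < \<beta>" using rho p exponent_pos by (simp add: \<beta>_def)
  show b1: "\<beta> < 1" using p subcritical by (simp add: \<beta>_def)
  show "0 < \<alpha>" using rho b0 by (simp add: \<alpha>_def)
  have "\<beta> < \<rho>" using b1 rho by simp
  then show "\<alpha> < 1" using rho by (simp add: \<alpha>_def)
  show "\<alpha> * \<rho> = \<beta>" using rho by (simp add: \<alpha>_def)
  show "0 \<le> smoothing_const" by (simp add: smoothing_const_def)
qed

section \<open>Smoothing and Duhamel integrals of singular sources\<close>

lemma S_smoothing:
  assumes t: "0 < t" and \<phi>: "Lp_le p \<phi> a"
  shows "Lp_le q (S t \<phi>) (smoothing_const * t powr - \<alpha> * a)"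
proof -
  have "- \<delta> * (1 / p - 1 / q) = - \<alpha>"
    using rho p by (simp add: \<alpha>_def \<beta>_def q_def field_simps)
  then have "(\<kappa> * t powr - \<delta>) powr (1 / p - 1 / q) = smoothing_const * t powr - \<alpha>"
    unfolding powr_mult powr_powr smoothing_const_def by simp
  then show ?thesis using S_Lp_Lq[OF t \<phi> p exponents(2)] by simp
qed

text \<open>Three times are kept apart: sources active in (b, a), observed at t. For a < t this is
  the past of a solution carried forward, as restarting requires. The open interval avoids
  \<open>S\<close> at time zero, which need not be the identity here.\<close>

definition duhamel :: "real \<Rightarrow> real \<Rightarrow> real \<Rightarrow> (real \<Rightarrow> 'a \<Rightarrow> real) \<Rightarrow> 'a \<Rightarrow> real" where
  "duhamel b a t g z = (\<integral>s. indicator {b<..<a} s * S (t - s) (g s) z \<partial>lborel)"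

lemma jointly_measurable_S:
  assumes [measurable]: "jointly_measurable g"
  shows "jointly_measurable (\<lambda>s z. indicator {b<..<a} s * S (t - s) (g s) z)"
proof -
  have [measurable]: "(\<lambda>(x, v). g (fst x) v) \<in> borel_measurable ((borel \<Otimes>\<^sub>M borel) \<Otimes>\<^sub>M borel)"
    using measurable_compose[of "\<lambda>x. (fst (fst x), snd x)" "(borel \<Otimes>\<^sub>M borel) \<Otimes>\<^sub>M borel" "borel \<Otimes>\<^sub>M borel" "case_prod g" borel]
    by (simp add: case_prod_unfold)
  have "(\<lambda>x. S (t - fst x) (g (fst x)) (snd x)) \<in> borel_measurable (borel \<Otimes>\<^sub>M borel)"
    by (rule measurable_S) measurable
  then show ?thesis by (simp add: case_prod_unfold)
qed

lemma measurable_duhamel: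
  assumes [measurable]: "jointly_measurable g"
  shows "jointly_measurable (\<lambda>t. duhamel b t t g)"
proof -
  have [measurable]: "(\<lambda>(x, v). g (snd x) v) \<in> borel_measurable (((borel \<Otimes>\<^sub>M borel) \<Otimes>\<^sub>M borel) \<Otimes>\<^sub>M borel)"
    using measurable_compose[of "\<lambda>x. (snd (fst x), snd x)" "((borel \<Otimes>\<^sub>M borel) \<Otimes>\<^sub>M borel) \<Otimes>\<^sub>M borel" "borel \<Otimes>\<^sub>M borel" "case_prod g" borel]
    by (simp add: case_prod_unfold)
  have [measurable]: "(\<lambda>x. S (fst (fst x) - snd x) (g (snd x)) (snd (fst x))) \<in> borel_measurable ((borel \<Otimes>\<^sub>M borel) \<Otimes>\<^sub>M borel)"
    by (rule measurable_S) measurable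
  have "(\<lambda>(x, s). (if b < s \<and> s < fst x then 1 else 0) * S (fst x - s) (g s) (snd x)) \<in> borel_measurable ((borel \<Otimes>\<^sub>M borel) \<Otimes>\<^sub>M lborel)"
    unfolding case_prod_unfold by measurable
  from lborel.borel_measurable_lebesgue_integral[OF this]
  have "(\<lambda>x. \<integral>s. (if b < s \<and> s < fst x then 1 else 0) * S (fst x - s) (g s) (snd x) \<partial>lborel) \<in> borel_measurable (borel \<Otimes>\<^sub>M borel)"
    by simp
  moreover have "indicator {b<..<t} s = (if b < s \<and> s < t then 1 else 0 :: real)" for s t
    by (simp add: indicator_def)
  ultimately show ?thesis by (simp add: duhamel_def case_prod_unfold)
qed

lemma
  assumes g: "jointly_measurable g" and r: "1 \<le> r"
    and le: "\<And>s. b < s \<Longrightarrow> s < a \<Longrightarrow> Lp_le r (S (t - s) (g s)) (m s)"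
    and m: "integrable lborel (\<lambda>s. indicator {b<..<a} s * m s)"
  shows duhamel_integrable: "AE z in lborel. integrable lborel (\<lambda>s. indicator {b<..<a} s * S (t - s) (g s) z)"
    and duhamel_le: "Lp_le r (duhamel b a t g) (\<integral>s. indicator {b<..<a} s * m s \<partial>lborel)"
proof -
  have ae: "AE s in lborel. Lp_le r (\<lambda>z. indicator {b<..<a} s * S (t - s) (g s) z) (indicator {b<..<a} s * m s)"
  proof (rule AE_I2)
    fix s
    show "Lp_le r (\<lambda>z. indicator {b<..<a} s * S (t - s) (g s) z) (indicator {b<..<a} s * m s)"
      using le[of s] r by (cases "b < s \<and> s < a") (auto simp: Lp_le_0_iff)
  qed
  note M = minkowski_integral[OF r jointly_measurable_S[OF g] m ae]
  show "AE z in lborel. integrable lborel (\<lambda>s. indicator {b<..<a} s * S (t - s) (g s) z)" by (rule M(1))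
  show "Lp_le r (duhamel b a t g) (\<integral>s. indicator {b<..<a} s * m s \<partial>lborel)"
    using M(2) by (simp add: duhamel_def[abs_def])
qed

text \<open>Smoothing into L^q costs (t - s) powr -\<alpha>, which is integrable because \<alpha> <
  1; inside L^p the semigroup is a contraction and costs nothing.\<close>

lemma
  assumes g: "jointly_measurable g" and b: "b \<le> t"
    and le: "\<And>s. b < s \<Longrightarrow> s < t \<Longrightarrow> Lp_le p (g s) G"
  shows duhamel_bounded_le: "Lp_le q (duhamel b t t g) (smoothing_const * G * ((t - b) powr (1 - \<alpha>) / (1 - \<alpha>)))"
    and duhamel_bounded_le_p: "Lp_le p (duhamel b t t g) (G * (t - b))"
proof -
  have eq: "indicator {b<..<t} s * (smoothing_const * (t - s) powr - \<alpha> * G) = smoothing_const * G * (indicator {b<..<t} s * (t - s) powr - \<alpha>)" for s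
    by simp
  note I = integrable_powr_kernel(1,2)[OF exponents(7) b]
  have m: "integrable lborel (\<lambda>s. indicator {b<..<t} s * (smoothing_const * (t - s) powr - \<alpha> * G))"
    unfolding eq using I(1) by (rule integrable_mult_right)
  have S: "Lp_le q (S (t - s) (g s)) (smoothing_const * (t - s) powr - \<alpha> * G)" if "b < s" "s < t" for s
    using S_smoothing[of "t - s" "g s" G] le[OF that] that by simp
  show "Lp_le q (duhamel b t t g) (smoothing_const * G * ((t - b) powr (1 - \<alpha>) / (1 - \<alpha>)))"
    using duhamel_le[OF g exponents(1) S m] unfolding eq integral_mult_right_zero I(2) .
  have m': "integrable lborel (\<lambda>s. indicator {b<..<t} s * G)"
    by (intro integrable_mult_left integrable_real_indicator) (use b in auto)
  have S': "Lp_le p (S (t - s) (g s)) G" if "b < s" "s < t" for s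
    using S_Lp[of "t - s" p "g s" G] le[OF that] that p by simp
  show "Lp_le p (duhamel b t t g) (G * (t - b))"
    using duhamel_le[OF g p S' m'] b by (simp add: mult.commute)
qed

text \<open>The sources generated by functions in X_\<alpha>: a bound M s powr -\<alpha> in L^q
  becomes, after the power \<rho>, a bound of order \<alpha> \<rho> = \<beta> in L^p.\<close>

definition singular_source :: "real \<Rightarrow> (real \<Rightarrow> 'a \<Rightarrow> real) \<Rightarrow> bool" where
  "singular_source \<tau> g \<longleftrightarrow> jointly_measurable g \<and> (\<exists>M. \<forall>s\<in>{0<..<\<tau>}. Lp_le p (g s) (M * s powr - \<beta>))"

lemma singular_sourceE:
  assumes "singular_source \<tau> g"
  obtains M where "jointly_measurable g" "\<And>s. 0 < s \<Longrightarrow> s < \<tau> \<Longrightarrow> Lp_le p (g s) (M * s powr - \<beta>)"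
  using assms unfolding singular_source_def by (meson greaterThanLessThan_iff)

lemma singular_source_mono: "singular_source \<tau> g \<Longrightarrow> \<sigma> \<le> \<tau> \<Longrightarrow> singular_source \<sigma> g"
  by (fastforce simp: singular_source_def)

lemma
  assumes g: "singular_source \<tau> g" and b: "0 \<le> b" "a \<le> \<tau>" "a \<le> t"
  shows singular_duhamel_integrable: "AE z in lborel. integrable lborel (\<lambda>s. indicator {b<..<a} s * S (t - s) (g s) z)"
    and singular_duhamel_Lp: "\<exists>c. Lp_le p (duhamel b a t g) c"
proof -
  obtain M where g': "jointly_measurable g" and M: "\<And>s. 0 < s \<Longrightarrow> s < \<tau> \<Longrightarrow> Lp_le p (g s) (M * s powr - \<beta>)"
    using singular_sourceE[OF g] by blast
  have i: "integrable lborel (\<lambda>s. indicator {0<..<a} s * s powr - \<beta>)"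
  proof (cases "0 \<le> a")
    case True
    then show ?thesis using integrable_powr_kernel(3)[OF exponents(5), of 0 a] by simp
  qed simp
  have m: "integrable lborel (\<lambda>s. indicator {b<..<a} s * (M * s powr - \<beta>))"
  proof (rule Bochner_Integration.integrable_bound[OF integrable_mult_right[OF i, of M]])
    show "AE s in lborel. norm (indicator {b<..<a} s * (M * s powr - \<beta>)) \<le> norm (M * (indicator {0<..<a} s * s powr - \<beta>))"
      using b by (auto intro!: AE_I2 split: split_indicator)
  qed measurable
  have S: "Lp_le p (S (t - s) (g s)) (M * s powr - \<beta>)" if "b < s" "s < a" for s
    using S_Lp[of "t - s" p "g s"] M that b p by simp
  show "AE z in lborel. integrable lborel (\<lambda>s. indicator {b<..<a} s * S (t - s) (g s) z)"
    by (rule duhamel_integrable[OF g' p S m])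
  show "\<exists>c. Lp_le p (duhamel b a t g) c"
    using duhamel_le[OF g' p S m] by blast
qed

lemma duhamel_split:
  assumes g: "singular_source t g" and b: "0 < b" "b < t"
  shows "AE z in lborel. duhamel 0 t t g z = duhamel 0 b t g z + duhamel b t t g z"
proof -
  have 1: "AE z in lborel. integrable lborel (\<lambda>s. indicator {0<..<b} s * S (t - s) (g s) z)"
    by (rule singular_duhamel_integrable[OF g]) (use b in auto)
  have 2: "AE z in lborel. integrable lborel (\<lambda>s. indicator {b<..<t} s * S (t - s) (g s) z)"
    by (rule singular_duhamel_integrable[OF g]) (use b in auto)
  have 3: "AE z in lborel. integrable lborel (\<lambda>s. indicator {0<..<t} s * S (t - s) (g s) z)"
    by (rule singular_duhamel_integrable[OF g]) auto
  show ?thesis using 1 2 3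
  proof eventually_elim
    case (elim z)
    have "duhamel 0 t t g z = (\<integral>s. indicator {0<..<b} s * S (t - s) (g s) z + indicator {b<..<t} s * S (t - s) (g s) z \<partial>lborel)"
      unfolding duhamel_def
    proof (rule integral_cong_AE)
      show "AE s in lborel. indicator {0<..<t} s * S (t - s) (g s) z = indicator {0<..<b} s * S (t - s) (g s) z + indicator {b<..<t} s * S (t - s) (g s) z"
        using AE_lborel_singleton[of b] by eventually_elim (use b in \<open>auto split: split_indicator\<close>)
    qed (use elim in \<open>auto dest: borel_measurable_integrable\<close>)
    then show ?case unfolding duhamel_def using elim by simp
  qed
qed

lemma duhamel_diff:
  assumes g: "singular_source t g" and h: "singular_source t h" and b: "0 < b" "b < t"
  shows "AE z in lborel. duhamel b t t g z - duhamel b t t h z = duhamel b t t (\<lambda>s z. g s z - h s z) z"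
proof -
  obtain M where g': "\<And>s. 0 < s \<Longrightarrow> s < t \<Longrightarrow> Lp_le p (g s) (M * s powr - \<beta>)"
    using singular_sourceE[OF g] by blast
  obtain N where h': "\<And>s. 0 < s \<Longrightarrow> s < t \<Longrightarrow> Lp_le p (h s) (N * s powr - \<beta>)"
    using singular_sourceE[OF h] by blast
  have 1: "AE z in lborel. integrable lborel (\<lambda>s. indicator {b<..<t} s * S (t - s) (g s) z)"
    by (rule singular_duhamel_integrable[OF g]) (use b in auto)
  have 2: "AE z in lborel. integrable lborel (\<lambda>s. indicator {b<..<t} s * S (t - s) (h s) z)"
    by (rule singular_duhamel_integrable[OF h]) (use b in auto)
  show ?thesis using 1 2
  proof eventually_elim
    case (elim z)
    have "indicator {b<..<t} s * S (t - s) (\<lambda>z. g s z - h s z) z = indicator {b<..<t} s * S (t - s) (g s) z - indicator {b<..<t} s * S (t - s) (h s) z" for s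
      using S_diff[of "t - s" p "g s" _ "h s"] g'[of s] h'[of s] b p
      by (auto simp: right_diff_distrib split: split_indicator)
    then show ?case unfolding duhamel_def using elim by simp
  qed
qed

text \<open>The semigroup property turns the mild formula into its restarted form.\<close>

lemma S_duhamel:
  assumes g: "singular_source a g" and a: "0 < a" "a < t"
  shows "S (t - a) (duhamel 0 a a g) z = duhamel 0 a t g z"
proof -
  obtain M where g'[measurable]: "jointly_measurable g" and M: "\<And>s. 0 < s \<Longrightarrow> s < a \<Longrightarrow> Lp_le p (g s) (M * s powr - \<beta>)"
    using singular_sourceE[OF g] by blast
  have ta: "0 < t - a" using a by simp
  \<comment> \<open>The operator norm bound of \<open>S (t - a)\<close> from L^p to bounded
    functions. Since t - a > 0 it controls the integrand at each \<open>z\<close>, so Fubini and the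
    conclusion hold at every point.\<close>
  define X where "X = (\<kappa> * (t - a) powr - \<delta>) powr (1 / p)"
  have X: "0 \<le> X" by (simp add: X_def)
  let ?F = "\<lambda>s v. K (t - a) z v * (indicator {0<..<a} s * S (a - s) (g s) v)"
  note [measurable] = jointly_measurable_S[OF g', of 0 a a]
  have F: "integrable (lborel \<Otimes>\<^sub>M lborel) (\<lambda>(s, v). ?F s v)"
  proof (rule lborel_pair.Fubini_integrable)
    have K': "(\<lambda>x. K (t - a) z (snd x)) \<in> borel_measurable (borel \<Otimes>\<^sub>M borel)" by measurable
    show "(\<lambda>(s, v). ?F s v) \<in> borel_measurable (lborel \<Otimes>\<^sub>M lborel)"
      using borel_measurable_times[OF K' jointly_measurable_S[OF g', of 0 a a, unfolded case_prod_unfold]]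
      by (simp add: case_prod_unfold)
    have Sg: "Lp_le p (S (a - s) (g s)) (M * s powr - \<beta>)" if "0 < s" "s < a" for s
      using S_Lp[of "a - s" p "g s"] M that p by simp
    show "AE s in lborel. integrable lborel (\<lambda>v. case (s, v) of (s, v) \<Rightarrow> ?F s v)"
      using S_integrable[OF ta Sg p, of _ z]
      by (auto intro!: AE_I2 split: split_indicator)
    show "integrable lborel (\<lambda>s. \<integral>v. norm (case (s, v) of (s, v) \<Rightarrow> ?F s v) \<partial>lborel)"
    proof (rule Bochner_Integration.integrable_bound[of _ "\<lambda>s. X * M * (indicator {0<..<a} s * s powr - \<beta>)"])
      show "integrable lborel (\<lambda>s. X * M * (indicator {0<..<a} s * s powr - \<beta>))"
        using integrable_powr_kernel(3)[OF exponents(5), of 0 a] a by (intro integrable_mult_right) auto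
      have "(\<lambda>s. \<integral>v. norm (?F s v) \<partial>lborel) \<in> borel_measurable borel"
        using borel_measurable_times[OF K' jointly_measurable_S[OF g', of 0 a a, unfolded case_prod_unfold]]
        by (intro lborel.borel_measurable_lebesgue_integral) (simp add: case_prod_unfold)
      then show "(\<lambda>s. \<integral>v. norm (case (s, v) of (s, v) \<Rightarrow> ?F s v) \<partial>lborel) \<in> borel_measurable lborel" by simp
      show "AE s in lborel. norm (\<integral>v. norm (case (s, v) of (s, v) \<Rightarrow> ?F s v) \<partial>lborel) \<le> norm (X * M * (indicator {0<..<a} s * s powr - \<beta>))"
      proof (rule AE_I2)
        fix s
        show "norm (\<integral>v. norm (case (s, v) of (s, v) \<Rightarrow> ?F s v) \<partial>lborel) \<le> norm (X * M * (indicator {0<..<a} s * s powr - \<beta>))"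
        proof (cases "0 < s \<and> s < a")
          case True
          have "(\<integral>v. norm (?F s v) \<partial>lborel) = (\<integral>v. K (t - a) z v * \<bar>S (a - s) (g s) v\<bar> \<partial>lborel)"
            using True kernel_nonneg[OF ta] by (simp add: abs_mult)
          also have "\<dots> \<le> X * (M * s powr - \<beta>)"
            unfolding X_def using True by (intro S_abs_le[OF ta Sg p]) auto
          also have "\<dots> \<le> \<bar>X * (M * s powr - \<beta>)\<bar>" by simp
          finally show ?thesis using True by (simp add: mult.assoc)
        qed auto
      qed
    qed
  qed
  have "S (t - a) (duhamel 0 a a g) z = (\<integral>v. \<integral>s. ?F s v \<partial>lborel \<partial>lborel)"
    unfolding S_def[of "t - a"] duhamel_def by simp
  also have "\<dots> = (\<integral>s. \<integral>v. ?F s v \<partial>lborel \<partial>lborel)"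
    by (rule lborel_pair.Fubini_integral[OF F])
  also have "\<dots> = duhamel 0 a t g z"
    unfolding duhamel_def
  proof (rule Bochner_Integration.integral_cong[OF refl])
    fix s
    show "(\<integral>v. ?F s v \<partial>lborel) = indicator {0<..<a} s * S (t - s) (g s) z"
    proof (cases "0 < s \<and> s < a")
      case True
      then have "S (t - a) (S (a - s) (g s)) z = S (t - a + (a - s)) (g s) z"
        using M by (intro S_S[OF ta _ _ p]) auto
      then show ?thesis using True by (simp add: S_def[of "t - a"])
    qed auto
  qed
  finally show ?thesis .
qed

text \<open>The equation with pointwise time integrals. Joint measurability takes the place of
  Bochner measurability, nothing is asked at time zero, and continuity in time is left to be deduced
  from the equation.\<close>

definition mild :: "('a \<Rightarrow> real) \<Rightarrow> real \<Rightarrow> (real \<Rightarrow> 'a \<Rightarrow> real) \<Rightarrow> bool" where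
  "mild u0 \<tau> U \<longleftrightarrow> jointly_measurable U \<and>
     (\<exists>M. \<forall>t\<in>{0<..\<tau>}. Lp_le q (U t) (M * t powr - \<alpha>)) \<and>
     (\<forall>t\<in>{0<..\<tau>}. AE z in lborel. U t z = S t u0 z + duhamel 0 t t (\<lambda>s z. signed_powr \<rho> (U s z)) z)"

lemma mildE:
  assumes "mild u0 \<tau> U"
  obtains M where "jointly_measurable U" "\<And>t. 0 < t \<Longrightarrow> t \<le> \<tau> \<Longrightarrow> Lp_le q (U t) (M * t powr - \<alpha>)"
  using assms unfolding mild_def by (meson greaterThanAtMost_iff)

abbreviation source :: "(real \<Rightarrow> 'a \<Rightarrow> real) \<Rightarrow> real \<Rightarrow> 'a \<Rightarrow> real" where
  "source U \<equiv> \<lambda>s z. signed_powr \<rho> (U s z)"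

section \<open>Integral solutions and restarting\<close>

lemma jointly_measurable_source:
  assumes [measurable]: "jointly_measurable U"
  shows "jointly_measurable (source U)"
  using measurable_compose[OF assms signed_powr_measurable[of \<rho>]] by (simp add: case_prod_unfold)

lemma source_Lp: "Lp_le q w A \<Longrightarrow> Lp_le p (\<lambda>z. signed_powr \<rho> (w z)) (A powr \<rho>)"
  unfolding q_def using rho p by (intro Lp_le_signed_powr)

lemma bounded_singular_source:
  assumes U: "jointly_measurable U" and M: "\<And>t. 0 < t \<Longrightarrow> t \<le> \<tau> \<Longrightarrow> Lp_le q (U t) (M * t powr - \<alpha>)"
  shows "singular_source \<tau> (source U)"
proof -
  have "Lp_le p (source U s) (M powr \<rho> * s powr - \<beta>)" if "0 < s" "s < \<tau>" for s
  proof -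
    have "(M * s powr - \<alpha>) powr \<rho> = M powr \<rho> * s powr - \<beta>"
      unfolding powr_mult powr_powr using exponents(8) by simp
    then show ?thesis using source_Lp[OF M[of s]] that by simp
  qed
  then show ?thesis using jointly_measurable_source[OF U]
    unfolding singular_source_def by (meson greaterThanLessThan_iff)
qed

lemma mild_singular_source: "mild u0 \<tau> U \<Longrightarrow> singular_source \<tau> (source U)"
  using mildE bounded_singular_source by metis

lemma mild_mono: "mild u0 \<tau> U \<Longrightarrow> \<sigma> \<le> \<tau> \<Longrightarrow> mild u0 \<sigma> U"
  by (fastforce simp: mild_def)

lemma mild_bound:
  assumes "mild u0 \<tau> U" "0 < b"
  shows "\<exists>R>0. \<forall>t\<in>{b..\<tau>}. Lp_le q (U t) R"
proof -
  obtain M where M: "\<And>t. 0 < t \<Longrightarrow> t \<le> \<tau> \<Longrightarrow> Lp_le q (U t) (M * t powr - \<alpha>)"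
    using mildE[OF assms(1)] by blast
  have "Lp_le q (U t) (\<bar>M\<bar> * b powr - \<alpha> + 1)" if "t \<in> {b..\<tau>}" for t
  proof (rule Lp_le_mono[OF M])
    have "M * t powr - \<alpha> \<le> \<bar>M\<bar> * t powr - \<alpha>" by (intro mult_right_mono) auto
    also have "\<dots> \<le> \<bar>M\<bar> * b powr - \<alpha>"
      using that assms exponents by (intro mult_left_mono powr_mono2') auto
    finally show "M * t powr - \<alpha> \<le> \<bar>M\<bar> * b powr - \<alpha> + 1" by simp
  qed (use that assms exponents in auto)
  moreover have "0 < \<bar>M\<bar> * b powr - \<alpha> + 1"
    by (intro add_nonneg_pos mult_nonneg_nonneg) auto
  ultimately show ?thesis by blast
qed

lemma mild_Lp:
  assumes U: "mild u0 \<tau> U" and t: "0 < t" "t \<le> \<tau>" and u0: "Lp_le p u0 a"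
  shows "\<exists>c. Lp_le p (U t) c"
proof -
  have g: "singular_source t (source U)" using singular_source_mono[OF mild_singular_source[OF U] t(2)] .
  obtain c where "Lp_le p (duhamel 0 t t (source U)) c"
    using singular_duhamel_Lp[OF g, of 0 t t] by auto
  from Lp_le_add[OF S_Lp[OF t(1) u0 p] this p]
  have "Lp_le p (\<lambda>z. S t u0 z + duhamel 0 t t (source U) z) (a + c)" .
  moreover have "AE z in lborel. U t z = S t u0 z + duhamel 0 t t (source U) z"
    using U t by (auto simp: mild_def)
  moreover have "U t \<in> borel_measurable borel"
    using U by (auto simp: mild_def intro: jointly_measurable_section)
  ultimately have "Lp_le p (U t) (a + c)" by (rule Lp_le_cong_AE) (use p in simp)
  then show ?thesis by blast
qed

text \<open>\<open>S (t - a)\<close> carries both terms of the formula at time \<open>a\<close>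
  forward: the free term by the semigroup law, the past of the source by \<open>S_duhamel\<close>.
  It is used to restart a solution and also to glue an extension onto it.\<close>

lemma restart_source:
  assumes u0: "Lp_le p u0 c" and g: "singular_source a g" and a: "0 < a" "a < t"
    and w: "w \<in> borel_measurable borel" "AE z in lborel. w z = S a u0 z + duhamel 0 a a g z"
  shows "S (t - a) w z = S t u0 z + duhamel 0 a t g z"
proof -
  obtain d where d: "Lp_le p (duhamel 0 a a g) d"
    using singular_duhamel_Lp[OF g, of 0 a a] by auto
  have [measurable]: "S a u0 \<in> borel_measurable borel" "duhamel 0 a a g \<in> borel_measurable borel"
    using Lp_le_measurable[OF S_Lp[OF a(1) u0 p]] Lp_le_measurable[OF d] by auto
  have "S (t - a) w z = S (t - a) (\<lambda>z. S a u0 z + duhamel 0 a a g z) z"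
    by (rule S_cong_AE[OF w(2) w(1)]) measurable
  also have "\<dots> = S (t - a) (S a u0) z + S (t - a) (duhamel 0 a a g) z"
    using a by (intro S_add[OF _ S_Lp[OF a(1) u0 p] d p]) auto
  also have "S (t - a) (S a u0) z = S t u0 z"
    using S_S[OF _ a(1) u0 p, of "t - a" z] a by simp
  finally show ?thesis using S_duhamel[OF g a] by simp
qed

text \<open>The Duhamel integral is split at \<open>b\<close>; its part before \<open>b\<close> and
  the free term together are \<open>S (t - b) (U b)\<close>.\<close>

lemma mild_restart:
  assumes U: "mild u0 \<tau> U" and u0: "Lp_le p u0 c" and b: "0 < b" "b < t" "t \<le> \<tau>"
  shows "AE z in lborel. U t z = S (t - b) (U b) z + duhamel b t t (source U) z"
proof -
  have Ub: "U b \<in> borel_measurable borel" using U by (auto simp: mild_def intro: jointly_measurable_section)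
  have g: "singular_source t (source U)" "singular_source b (source U)"
    using singular_source_mono[OF mild_singular_source[OF U]] b by auto
  have "AE z in lborel. U b z = S b u0 z + duhamel 0 b b (source U) z"
    using U b by (auto simp: mild_def)
  note R = restart_source[OF u0 g(2) b(1,2) Ub this]
  have "AE z in lborel. U t z = S t u0 z + duhamel 0 t t (source U) z"
    using U b by (auto simp: mild_def)
  then show ?thesis using duhamel_split[OF g(1) b(1,2)]
    by eventually_elim (simp add: R)
qed

end

section \<open>Contraction, continuity in time, uniqueness and extension by one time step\<close>

context semilinear_heat
begin

text \<open>Lipschitz constant of the Duhamel map on the ball of radius \<open>R\<close> in L^q over
  a time span \<open>h\<close>. The factors are the smoothing constant, the Lipschitz constant of
  the source on that ball, and the time integral of (t - s) powr -\<alpha>.\<close>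

definition contraction_factor :: "real \<Rightarrow> real \<Rightarrow> real" where
  "contraction_factor R h = smoothing_const * (\<rho> * (R + R) powr (\<rho> - 1)) * (h powr (1 - \<alpha>) / (1 - \<alpha>))"

lemma contraction_step: "\<exists>h>0. \<forall>x. 0 \<le> x \<longrightarrow> x \<le> h \<longrightarrow> contraction_factor R x \<le> 1 / 2"
proof -
  define c where "c = smoothing_const * (\<rho> * (R + R) powr (\<rho> - 1)) / (1 - \<alpha>)"
  have c: "0 \<le> c" using exponents rho by (simp add: c_def)
  \<comment> \<open>Chosen so that c h powr (1 - \<alpha>) = c / (2 (c + 1)), which is at most 1 /
    2; the summand 1 covers the case c = 0.\<close>
  define h where "h = (1 / (2 * (c + 1))) powr (1 / (1 - \<alpha>))"
  have h: "0 < h" "h powr (1 - \<alpha>) = 1 / (2 * (c + 1))"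
    using c exponents by (simp_all add: h_def powr_powr)
  have "contraction_factor R x \<le> 1 / 2" if "0 \<le> x" "x \<le> h" for x
  proof -
    have "contraction_factor R x = c * x powr (1 - \<alpha>)" by (simp add: contraction_factor_def c_def)
    also have "\<dots> \<le> c * h powr (1 - \<alpha>)"
      using that c exponents by (intro mult_left_mono powr_mono2) auto
    also have "\<dots> \<le> 1 / 2" unfolding h(2) using c by (simp add: field_simps)
    finally show ?thesis .
  qed
  then show ?thesis using h(1) by blast
qed

lemma duhamel_measurable: "jointly_measurable g \<Longrightarrow> duhamel b t t g \<in> borel_measurable borel"
  using jointly_measurable_section[OF measurable_duhamel] .

text \<open>The singular bounds allow the two Duhamel integrals to be subtracted under the integral
  sign; the estimate is then smoothing combined with the Lipschitz bound on (b, t).\<close>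

lemma duhamel_contract:
  assumes U: "singular_source t (source U)" and V: "singular_source t (source V)" and b: "0 < b" "b < t"
    and le: "\<And>s. b < s \<Longrightarrow> s < t \<Longrightarrow> Lp_le q (U s) R" "\<And>s. b < s \<Longrightarrow> s < t \<Longrightarrow> Lp_le q (V s) R"
      "\<And>s. b < s \<Longrightarrow> s < t \<Longrightarrow> Lp_le q (\<lambda>z. U s z - V s z) D"
  shows "Lp_le q (\<lambda>z. duhamel b t t (source U) z - duhamel b t t (source V) z) (contraction_factor R (t - b) * D)"
proof -
  have jm: "jointly_measurable (source U)" "jointly_measurable (source V)"
    using U V by (auto simp: singular_source_def)
  let ?g = "\<lambda>s z. source U s z - source V s z"
  have jg: "jointly_measurable ?g"
    using borel_measurable_diff[OF jm] by (simp add: case_prod_unfold)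
  have "Lp_le p (?g s) (\<rho> * ((R + R) powr (\<rho> - 1) * D))" if "b < s" "s < t" for s
    using Lp_le_signed_powr_diff[OF le(1)[OF that, unfolded q_def] le(2)[OF that, unfolded q_def] le(3)[OF that, unfolded q_def] rho p] .
  from duhamel_bounded_le[OF jg less_imp_le[OF b(2)] this]
  have "Lp_le q (duhamel b t t ?g) (contraction_factor R (t - b) * D)"
    by (simp add: contraction_factor_def mult_ac)
  then show ?thesis
    by (rule Lp_le_cong_AE[OF _ duhamel_diff[OF U V b]])
       (use jm exponents in \<open>auto intro!: borel_measurable_diff duhamel_measurable\<close>)
qed

lemma duhamel_cong:
  assumes "\<And>s. b < s \<Longrightarrow> s < a \<Longrightarrow> g s = h s"
  shows "duhamel b a t g = duhamel b a t h"
proof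
  fix z
  show "duhamel b a t g z = duhamel b a t h z"
    unfolding duhamel_def by (rule Bochner_Integration.integral_cong[OF refl]) (use assms in \<open>auto split: split_indicator\<close>)
qed

text \<open>Restarting shortly before \<open>t\<close> leaves a Duhamel term that is uniformly small.\<close>

lemma path_tendsto_restart:
  assumes U: "\<And>b s. 0 < b \<Longrightarrow> b < s \<Longrightarrow> s \<le> \<tau> \<Longrightarrow>
      AE z in lborel. U s z = S (s - b) (U b) z + D b s z"
    and Um: "\<And>s. U s \<in> borel_measurable borel"
    and Ur: "\<And>b. 0 < b \<Longrightarrow> b \<le> \<tau> \<Longrightarrow> \<exists>a. Lp_le r (U b) a"
    and t: "0 < t" "t \<le> \<tau>" and D: "\<And>b s. t / 2 \<le> b \<Longrightarrow> b < s \<Longrightarrow> s \<le> \<tau> \<Longrightarrow> Lp_le r (D b s) (E * (s - b) powr \<theta>)"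
    and \<theta>: "0 < \<theta>" and r: "1 \<le> r" and E: "0 \<le> E"
    and f: "\<And>n. 0 < f n" "\<And>n. f n \<le> \<tau>" "f \<longlonglongrightarrow> t"
  shows "(\<lambda>n. Lp_norm r (\<lambda>z. U (f n) z - U t z)) \<longlonglongrightarrow> 0"
proof (rule LIMSEQ_I)
  fix e :: real assume e: "0 < e"
  \<comment> \<open>The restart time will be t - \<eta> and the neighbouring times lie below t +
    \<eta>, so each Duhamel term runs over a span of at most 2 \<eta>.\<close>
  have "((\<lambda>x. E * (2 * x) powr \<theta>) \<longlongrightarrow> E * (2 * 0) powr \<theta>) (at_right 0)"
    using \<theta> by (intro tendsto_mult tendsto_const tendsto_powr2 tendsto_ident_at)
      (auto simp: eventually_at_filter)
  then have "eventually (\<lambda>x. E * (2 * x) powr \<theta> < e / 4) (at_right 0)"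
    using e by (intro order_tendstoD(2)) auto
  moreover have "eventually (\<lambda>x. 0 < x \<and> x < t / 2) (at_right (0::real))"
    using t by (auto simp: eventually_at_right_field intro!: exI[of _ "t / 2"])
  ultimately have small: "eventually (\<lambda>x. E * (2 * x) powr \<theta> < e / 4 \<and> 0 < x \<and> x < t / 2) (at_right (0::real))"
    by (rule eventually_conj)
  obtain \<eta> where \<eta>: "E * (2 * \<eta>) powr \<theta> < e / 4" "0 < \<eta>" "\<eta> < t / 2"
    using eventually_happens[OF small] by auto
  define b where "b = t - \<eta>"
  have b: "0 < b" "b < t" "t / 2 \<le> b" "b \<le> \<tau>" using \<eta> t by (auto simp: b_def)
  obtain a where a: "Lp_le r (U b) a" using Ur[OF b(1,4)] by blast
  \<comment> \<open>The default t - b occurs for finitely many n only and keeps all times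
    positive.\<close>
  define s where "s = (\<lambda>n. if b < f n then f n - b else t - b)"
  have ev: "eventually (\<lambda>n. b < f n) sequentially" "eventually (\<lambda>n. f n < t + \<eta>) sequentially"
    using b \<eta> by (auto intro!: order_tendstoD[OF f(3)])
  have "(\<lambda>n. f n - b) \<longlonglongrightarrow> t - b" by (intro tendsto_intros f)
  then have s: "s \<longlonglongrightarrow> t - b"
    by (rule Lim_transform_eventually) (use ev(1) in \<open>auto elim!: eventually_mono simp: s_def\<close>)
  have s0: "0 < s n" for n using b by (simp add: s_def)
  have tb: "0 < t - b" using b by simp
  obtain c where c: "\<And>n. Lp_le r (\<lambda>z. S (s n) (U b) z - S (t - b) (U b) z) (c n)" "c \<longlonglongrightarrow> 0"
    using S_tendsto[OF tb s s0 a r] by blast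
  have "eventually (\<lambda>n. c n < e / 4) sequentially"
    using e by (intro order_tendstoD(2)[OF c(2)]) auto
  with ev have "eventually (\<lambda>n. norm (Lp_norm r (\<lambda>z. U (f n) z - U t z) - 0) < e) sequentially"
  proof eventually_elim
    case (elim n)
    have sn: "s n = f n - b" using elim by (simp add: s_def)
    have D1: "Lp_le r (D b (f n)) (e / 4)"
    proof (rule Lp_le_mono[OF D])
      have "(f n - b) powr \<theta> \<le> (2 * \<eta>) powr \<theta>"
        using elim \<theta> by (intro powr_mono2) (auto simp: b_def)
      then have "E * (f n - b) powr \<theta> \<le> E * (2 * \<eta>) powr \<theta>" using E by (intro mult_left_mono)
      then show "E * (f n - b) powr \<theta> \<le> e / 4" using \<eta> by simp
    qed (use elim b f r in auto)
    have D2: "Lp_le r (D b t) (e / 4)"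
    proof (rule Lp_le_mono[OF D])
      have "(t - b) powr \<theta> \<le> (2 * \<eta>) powr \<theta>"
        using \<eta> \<theta> by (intro powr_mono2) (auto simp: b_def)
      then have "E * (t - b) powr \<theta> \<le> E * (2 * \<eta>) powr \<theta>" using E by (intro mult_left_mono)
      then show "E * (t - b) powr \<theta> \<le> e / 4" using \<eta> by simp
    qed (use b t r in auto)
    have "Lp_le r (\<lambda>z. (S (s n) (U b) z - S (t - b) (U b) z) + (D b (f n) z - D b t z)) (c n + (e / 4 + e / 4))"
      by (intro Lp_le_add Lp_le_diff c D1 D2 r)
    moreover have "AE z in lborel. U (f n) z - U t z = (S (s n) (U b) z - S (t - b) (U b) z) + (D b (f n) z - D b t z)"
      using U[OF b(1) elim(1) f(2)] U[OF b(1,2) t(2)] by eventually_elim (simp add: sn)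
    ultimately have "Lp_le r (\<lambda>z. U (f n) z - U t z) (c n + (e / 4 + e / 4))"
      by (rule Lp_le_cong_AE) (use r Um in auto)
    then have "Lp_norm r (\<lambda>z. U (f n) z - U t z) \<le> c n + (e / 4 + e / 4)"
      using r by (simp add: Lp_le_iff)
    then show ?case using elim e Lp_norm_nonneg[of r "\<lambda>z. U (f n) z - U t z"] by simp
  qed
  then show "\<exists>no. \<forall>n\<ge>no. norm (Lp_norm r (\<lambda>z. U (f n) z - U t z) - 0) < e"
    by (simp add: eventually_sequentially)
qed

text \<open>From t / 2 on the L^q norm is bounded, so the restarted Duhamel terms are of order (s -
  b) powr (1 - \<alpha>) in L^q and of order s - b in L^p.\<close>

lemma
  assumes U: "mild u0 \<tau> U" and u0: "Lp_le p u0 c" and t: "0 < t" "t \<le> \<tau>"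
    and f: "\<And>n. 0 < f n" "\<And>n. f n \<le> \<tau>" "f \<longlonglongrightarrow> t"
  shows mild_tendsto_q: "(\<lambda>n. Lp_norm q (\<lambda>z. U (f n) z - U t z)) \<longlonglongrightarrow> 0"
    and mild_tendsto_p: "(\<lambda>n. Lp_norm p (\<lambda>z. U (f n) z - U t z)) \<longlonglongrightarrow> 0"
proof -
  have jm: "jointly_measurable U" using U by (auto simp: mild_def)
  obtain R where R: "0 < R" "\<And>s. t / 2 \<le> s \<Longrightarrow> s \<le> \<tau> \<Longrightarrow> Lp_le q (U s) R"
    using mild_bound[OF U, of "t / 2"] t by auto
  have src: "Lp_le p (source U s) (R powr \<rho>)" if "t / 2 \<le> s" "s \<le> \<tau>" for s
    using source_Lp[OF R(2)[OF that]] .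
  have "\<exists>a. Lp_le q (U b) a" if "0 < b" "b \<le> \<tau>" for b
    using mildE[OF U] that by blast
  moreover have "Lp_le q (duhamel b s s (source U)) (smoothing_const * (R powr \<rho>) / (1 - \<alpha>) * (s - b) powr (1 - \<alpha>))"
    if "t / 2 \<le> b" "b < s" "s \<le> \<tau>" for b s
    using duhamel_bounded_le[OF jointly_measurable_source[OF jm], of b s "R powr \<rho>"] src that by simp
  ultimately show "(\<lambda>n. Lp_norm q (\<lambda>z. U (f n) z - U t z)) \<longlonglongrightarrow> 0"
    using mild_restart[OF U u0] jointly_measurable_section[OF jm] t exponents f
    by (intro path_tendsto_restart[where D="\<lambda>b s. duhamel b s s (source U)" and \<theta>="1 - \<alpha>" and E="smoothing_const * (R powr \<rho>) / (1 - \<alpha>)" and \<tau>=\<tau>]) auto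
  have "\<exists>a. Lp_le p (U b) a" if "0 < b" "b \<le> \<tau>" for b
    using mild_Lp[OF U that u0] .
  moreover have "Lp_le p (duhamel b s s (source U)) (R powr \<rho> * (s - b) powr 1)"
    if "t / 2 \<le> b" "b < s" "s \<le> \<tau>" for b s
    using duhamel_bounded_le_p[OF jointly_measurable_source[OF jm], of b s "R powr \<rho>"] src that by simp
  ultimately show "(\<lambda>n. Lp_norm p (\<lambda>z. U (f n) z - U t z)) \<longlonglongrightarrow> 0"
    using mild_restart[OF U u0] jointly_measurable_section[OF jm] t p f
    by (intro path_tendsto_restart[where D="\<lambda>b s. duhamel b s s (source U)" and \<theta>=1 and E="R powr \<rho>" and \<tau>=\<tau>]) auto
qed

text \<open>Agreement on (0, a] disposes of the singularity at time zero: beyond \<open>a\<close>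
  both solutions stay in one ball of L^q. The radius fixes a step \<open>h\<close> over which the
  Duhamel map halves distances, and finitely many steps reach any time.\<close>

lemma mild_unique:
  assumes U: "mild u0 \<tau> U" and V: "mild u0 \<tau> V" and u0: "Lp_le p u0 c" and a: "0 < a"
    and eq: "\<And>t. 0 < t \<Longrightarrow> t \<le> a \<Longrightarrow> t \<le> \<tau> \<Longrightarrow> AE z in lborel. U t z = V t z"
    and t: "0 < t" "t \<le> \<tau>"
  shows "AE z in lborel. U t z = V t z"
proof -
  obtain R1 where R1: "0 < R1" "\<And>s. a \<le> s \<Longrightarrow> s \<le> \<tau> \<Longrightarrow> Lp_le q (U s) R1"
    using mild_bound[OF U a] by auto
  obtain R2 where R2: "0 < R2" "\<And>s. a \<le> s \<Longrightarrow> s \<le> \<tau> \<Longrightarrow> Lp_le q (V s) R2"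
    using mild_bound[OF V a] by auto
  define R where "R = max R1 R2"
  have R: "0 < R" "\<And>s. a \<le> s \<Longrightarrow> s \<le> \<tau> \<Longrightarrow> Lp_le q (U s) R" "\<And>s. a \<le> s \<Longrightarrow> s \<le> \<tau> \<Longrightarrow> Lp_le q (V s) R"
    using R1(1) Lp_le_mono[OF R1(2), of _ R] Lp_le_mono[OF R2(2), of _ R] exponents(3) by (auto simp: R_def)
  obtain h where h: "0 < h" "\<And>x. 0 \<le> x \<Longrightarrow> x \<le> h \<Longrightarrow> contraction_factor R x \<le> 1 / 2"
    using contraction_step[of R] by blast
  have meas: "U s \<in> borel_measurable borel" "V s \<in> borel_measurable borel" for s
    using U V by (auto simp: mild_def intro: jointly_measurable_section)
  have step: "AE z in lborel. U t z = V t z" if t: "0 < t" "t \<le> \<tau>" "t \<le> a + real n * h" for n t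
    using t
  proof (induction n arbitrary: t)
    case 0
    then show ?case using eq by simp
  next
    case (Suc n)
    define b where "b = a + real n * h"
    show ?case
    proof (cases "t \<le> b")
      case True
      then show ?thesis using Suc by (auto simp: b_def)
    next
      case False
      have b: "0 < b" "a \<le> b" "b \<le> \<tau>" using a h False Suc.prems by (auto simp: b_def intro!: add_pos_nonneg)
      have Ub: "AE z in lborel. U b z = V b z" using Suc.IH[of b] b by (simp add: b_def)
      \<comment> \<open>Inserting a bound valid at all times of the step into the restarted equation
        halves it; the iteration starts from the trivial bound R + R.\<close>
      have key: "Lp_le q (\<lambda>z. U s z - V s z) (2 * R * (1 / 2) ^ k)" if "b < s" "s \<le> b + h" "s \<le> \<tau>" for s k
        using that
      proof (induction k arbitrary: s)
        case 0
        have "Lp_le q (\<lambda>z. U s z - V s z) (R + R)"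
          using 0 b R exponents(1) by (intro Lp_le_diff) auto
        then show ?case by simp
      next
        case (Suc k)
        have sing: "singular_source s (source U)" "singular_source s (source V)"
          using singular_source_mono[OF mild_singular_source[OF U]] singular_source_mono[OF mild_singular_source[OF V]] Suc.prems by auto
        have "Lp_le q (\<lambda>z. duhamel b s s (source U) z - duhamel b s s (source V) z) (contraction_factor R (s - b) * (2 * R * (1 / 2) ^ k))"
          using Suc.prems b by (intro duhamel_contract sing Suc.IH R) auto
        moreover have "AE z in lborel. U s z - V s z = duhamel b s s (source U) z - duhamel b s s (source V) z"
        proof -
          have Seq: "S (s - b) (U b) z = S (s - b) (V b) z" for z
            by (rule S_cong_AE[OF Ub]) (use meas in auto)
          show ?thesis
            using mild_restart[OF U u0 b(1) Suc.prems(1,3)] mild_restart[OF V u0 b(1) Suc.prems(1,3)]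
            by eventually_elim (simp add: Seq)
        qed
        ultimately have "Lp_le q (\<lambda>z. U s z - V s z) (contraction_factor R (s - b) * (2 * R * (1 / 2) ^ k))"
          by (rule Lp_le_cong_AE) (use meas exponents in auto)
        moreover have "contraction_factor R (s - b) * (2 * R * (1 / 2) ^ k) \<le> 1 / 2 * (2 * R * (1 / 2) ^ k)"
          using Suc.prems R(1) by (intro mult_right_mono h(2)) auto
        ultimately show ?case using exponents(3) by (auto elim: Lp_le_mono)
      qed
      have "(\<lambda>k. 2 * R * (1 / 2) ^ k) \<longlonglongrightarrow> 2 * R * 0"
        by (intro tendsto_intros LIMSEQ_realpow_zero) auto
      then have lim: "(\<lambda>k. 2 * R * (1 / 2) ^ k) \<longlonglongrightarrow> 0" by simp
      have "Lp_le q (\<lambda>z. U t z - V t z) (2 * R * (1 / 2) ^ k)" for k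
        using False Suc.prems by (intro key) (auto simp: b_def algebra_simps)
      then have "Lp_le q (\<lambda>z. U t z - V t z) 0"
        by (rule Lp_le_tendsto_bound[OF _ lim exponents(3)])
      then show ?thesis using exponents(3) by (simp add: Lp_le_0_iff)
    qed
  qed
  obtain n :: nat where "(t - a) / h < n" using reals_Archimedean2 by blast
  then have "t \<le> a + real n * h" using h by (simp add: field_simps)
  then show ?thesis using step t by blast
qed

text \<open>Picard iteration for the restarted equation; the length of the time step depends on the
  \<open>L\<^sup>q\<close> bound only.\<close>

lemma mild_extend:
  assumes u0: "Lp_le p u0 c" and A: "0 < A"
  shows "\<exists>h>0. \<forall>a U. 0 < a \<longrightarrow> mild u0 a U \<longrightarrow> Lp_le q (U a) A \<longrightarrow>
    (\<exists>V. mild u0 (a + h) V \<and> (\<forall>t\<in>{0<..a}. V t = U t))"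
proof -
  \<comment> \<open>One \<open>A\<close> is for the free term and one for the Duhamel term.\<close>
  define R where "R = 2 * A"
  have R: "0 < R" using A by (simp add: R_def)
  obtain h where h: "0 < h" "\<And>x. 0 \<le> x \<Longrightarrow> x \<le> h \<Longrightarrow> contraction_factor R x \<le> 1 / 2"
    using contraction_step[of R] by blast
  have "\<exists>V. mild u0 (a + h) V \<and> (\<forall>t\<in>{0<..a}. V t = U t)"
    if a: "0 < a" and U: "mild u0 a U" and Ua: "Lp_le q (U a) A" for a U
  proof -
    obtain M where jU[measurable]: "jointly_measurable U" and M: "\<And>t. 0 < t \<Longrightarrow> t \<le> a \<Longrightarrow> Lp_le q (U t) (M * t powr - \<alpha>)"
      using mildE[OF U] by blast
    have Uam[measurable]: "U a \<in> borel_measurable borel" using jU by (rule jointly_measurable_section)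
    \<comment> \<open>The iterates keep the values of \<open>U\<close> up to time \<open>a\<close>,
      so they are functions on the whole time axis to which the Duhamel lemmas apply. Starting from
      zero after \<open>a\<close> makes the first increment at most \<open>R\<close>.\<close>
    define vs where "vs = rec_nat (\<lambda>t z. if t \<le> a then U t z else 0)
      (\<lambda>n v t z. if t \<le> a then U t z else S (t - a) (U a) z + duhamel a t t (source v) z)"
    have vs0: "vs 0 = (\<lambda>t z. if t \<le> a then U t z else 0)"
      and vsS: "vs (Suc n) = (\<lambda>t z. if t \<le> a then U t z else S (t - a) (U a) z + duhamel a t t (source (vs n)) z)" for n
      unfolding vs_def by simp_all
    have vsU: "vs n t = U t" if "t \<le> a" for n t
      using that by (cases n) (auto simp: vs0 vsS)
    have jU': "(\<lambda>x. U (fst x) (snd x)) \<in> borel_measurable (borel \<Otimes>\<^sub>M borel)"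
      using jU by (simp add: case_prod_unfold)
    have W: "(\<lambda>x. S (fst x - a) (U a) (snd x)) \<in> borel_measurable (borel \<Otimes>\<^sub>M borel)"
      by (rule measurable_S) measurable
    have jvs: "jointly_measurable (vs n)" for n
    proof (induction n)
      case 0
      show ?case unfolding vs0 case_prod_unfold using jU' by measurable
    next
      case (Suc n)
      have "(\<lambda>x. duhamel a (fst x) (fst x) (source (vs n)) (snd x)) \<in> borel_measurable (borel \<Otimes>\<^sub>M borel)"
        using measurable_duhamel[OF jointly_measurable_source[OF Suc], of a] by (simp add: case_prod_unfold)
      then show ?case unfolding vsS case_prod_unfold using jU' W by measurable
    qed
    have Wle: "Lp_le q (S (t - a) (U a)) A" if "a < t" for t
      using S_Lp[OF _ Ua exponents(1), of "t - a"] that by simp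
    \<comment> \<open>The uniform bound after \<open>a\<close> is rewritten as a multiple of t powr
      -\<alpha>, at the price of the factor (a + h) powr \<alpha>.\<close>
    have bound: "\<exists>M'. \<forall>t\<in>{0<..a + h}. Lp_le q (v t) (M' * t powr - \<alpha>)"
      if v: "\<And>t. t \<le> a \<Longrightarrow> v t = U t" "\<And>t. a < t \<Longrightarrow> t \<le> a + h \<Longrightarrow> Lp_le q (v t) R" for v
    proof (intro exI ballI)
      fix t assume t: "t \<in> {0<..a + h}"
      let ?M = "max M (R * (a + h) powr \<alpha>)"
      show "Lp_le q (v t) (?M * t powr - \<alpha>)"
      proof (cases "t \<le> a")
        case True
        have "M * t powr - \<alpha> \<le> ?M * t powr - \<alpha>" by (intro mult_right_mono) auto
        then show ?thesis using M[of t] True t v(1) exponents(3) by (auto intro: Lp_le_mono)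
      next
        case False
        have "t powr \<alpha> \<le> (a + h) powr \<alpha>" using t exponents by (intro powr_mono2) auto
        then have "1 \<le> (a + h) powr \<alpha> * t powr - \<alpha>" using t by (simp add: powr_minus field_simps)
        then have "R * 1 \<le> R * ((a + h) powr \<alpha> * t powr - \<alpha>)" using R by (intro mult_left_mono) auto
        also have "\<dots> = (R * (a + h) powr \<alpha>) * t powr - \<alpha>" by simp
        also have "\<dots> \<le> ?M * t powr - \<alpha>" by (intro mult_right_mono) auto
        finally show ?thesis using v(2)[of t] t False exponents(3) by (auto intro: Lp_le_mono)
      qed
    qed
    have sing: "singular_source t (source v)"
      if v: "jointly_measurable v" "\<And>t. t \<le> a \<Longrightarrow> v t = U t" "\<And>t. a < t \<Longrightarrow> t \<le> a + h \<Longrightarrow> Lp_le q (v t) R" "t \<le> a + h" for v t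
    proof -
      obtain M' where M': "\<And>t. 0 < t \<Longrightarrow> t \<le> a + h \<Longrightarrow> Lp_le q (v t) (M' * t powr - \<alpha>)"
        using bound[OF v(2,3)] by (meson greaterThanAtMost_iff)
      show ?thesis
        using bounded_singular_source[OF v(1) M'] v(4) by (rule singular_source_mono)
    qed
    have vsR: "Lp_le q (vs n t) R" if "a < t" "t \<le> a + h" for n t
      using that
    proof (induction n arbitrary: t)
      case 0
      then have "vs 0 t = (\<lambda>z. 0)" by (simp add: vs0)
      moreover have "Lp_le q (\<lambda>z::'a. 0) 0" using exponents(3) by (simp add: Lp_le_0_iff)
      ultimately show ?case using R exponents(3) by (auto elim: Lp_le_mono)
    next
      case (Suc n)
      let ?X = "(t - a) powr (1 - \<alpha>) / (1 - \<alpha>)"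
      have "Lp_le q (duhamel a t t (source (vs n))) (smoothing_const * (R powr \<rho>) * ?X)"
        using Suc by (intro duhamel_bounded_le jointly_measurable_source jvs source_Lp) auto
      \<comment> \<open>The contraction factor also controls the size: R powr \<rho> is at most
        \<rho> (R + R) powr (\<rho> - 1) times R, so the term is at most R / 2 = A.\<close>
      moreover have "smoothing_const * (R powr \<rho>) * ?X \<le> A"
      proof -
        have "R powr \<rho> = R powr (\<rho> - 1) * R" using R by (simp add: powr_diff)
        also have "\<dots> \<le> \<rho> * (R + R) powr (\<rho> - 1) * R"
        proof (rule mult_right_mono)
          have "1 * R powr (\<rho> - 1) \<le> \<rho> * (R + R) powr (\<rho> - 1)"
            using R rho by (intro mult_mono powr_mono2) auto
          then show "R powr (\<rho> - 1) \<le> \<rho> * (R + R) powr (\<rho> - 1)" by simp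
        qed (use R in simp)
        finally have "smoothing_const * (R powr \<rho>) * ?X \<le> smoothing_const * (\<rho> * (R + R) powr (\<rho> - 1) * R) * ?X"
          using exponents by (intro mult_right_mono mult_left_mono) auto
        also have "\<dots> = contraction_factor R (t - a) * R" by (simp add: contraction_factor_def)
        also have "\<dots> \<le> 1 / 2 * R" using Suc.prems R by (intro mult_right_mono h(2)) auto
        finally show ?thesis by (simp add: R_def)
      qed
      ultimately have "Lp_le q (duhamel a t t (source (vs n))) A" using exponents(3) by (auto elim: Lp_le_mono)
      from Lp_le_add[OF Wle[OF Suc.prems(1)] this exponents(1)]
      show ?case using Suc.prems by (simp add: vsS R_def)
    qed
    have vsd: "Lp_le q (\<lambda>z. vs (Suc n) t z - vs n t z) (R * (1 / 2) ^ n)" if "a < t" "t \<le> a + h" for n t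
      using that
    proof (induction n arbitrary: t)
      case 0
      have "(\<lambda>z. vs (Suc 0) t z - vs 0 t z) = vs (Suc 0) t" using 0 by (simp add: vs0)
      then show ?case using vsR[OF 0, of "Suc 0"] by simp
    next
      case (Suc n)
      have "Lp_le q (\<lambda>z. duhamel a t t (source (vs (Suc n))) z - duhamel a t t (source (vs n)) z) (contraction_factor R (t - a) * (R * (1 / 2) ^ n))"
        using Suc.prems a by (intro duhamel_contract sing jvs vsU vsR Suc.IH) auto
      moreover have "(\<lambda>z. duhamel a t t (source (vs (Suc n))) z - duhamel a t t (source (vs n)) z) = (\<lambda>z. vs (Suc (Suc n)) t z - vs (Suc n) t z)"
        using Suc.prems by (simp add: vsS[of "Suc n"] vsS[of n])
      moreover have "contraction_factor R (t - a) * (R * (1 / 2) ^ n) \<le> 1 / 2 * (R * (1 / 2) ^ n)"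
        using Suc.prems R by (intro mult_right_mono h(2)) auto
      ultimately show ?case using exponents(3) by (auto elim: Lp_le_mono)
    qed
    define V where "V = (\<lambda>t z. lim (\<lambda>n. vs n t z))"
    have VU: "V t = U t" if "t \<le> a" for t
      using that by (simp add: V_def vsU)
    have jV: "jointly_measurable V"
      unfolding V_def case_prod_unfold using jvs by (intro borel_measurable_lim_metric) (simp add: case_prod_unfold)
    have vsm: "vs n t \<in> borel_measurable borel" for n t using jvs by (rule jointly_measurable_section)
    have Vvs: "Lp_le q (\<lambda>z. V t z - vs n t z) (2 * R * (1 / 2) ^ n)" if "a < t" "t \<le> a + h" for n t
      unfolding V_def by (rule Lp_fast_Cauchy(2)[OF vsd[OF that] exponents(1) vsm])
    have VR: "Lp_le q (V t) R" if "a < t" "t \<le> a + h" for t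
    proof (rule Lp_le_Fatou[OF vsR[OF that]])
      show "AE z in lborel. (\<lambda>n. vs n t z) \<longlonglongrightarrow> V t z"
        unfolding V_def by (rule Lp_fast_Cauchy(1)[OF vsd[OF that] exponents(1) vsm])
    qed (use jV exponents(3) in \<open>auto intro: jointly_measurable_section\<close>)
    have fixpoint: "AE z in lborel. V t z = S (t - a) (U a) z + duhamel a t t (source V) z" if t: "a < t" "t \<le> a + h" for t
    proof -
      \<comment> \<open>Passing through the iterate n + 1 costs R (1 / 2) ^ n twice; the constant 4
        leaves some slack.\<close>
      have le: "Lp_le q (\<lambda>z. (S (t - a) (U a) z + duhamel a t t (source V) z) - V t z) (4 * R * (1 / 2) ^ n)" for n
      proof -
        have "Lp_le q (\<lambda>z. duhamel a t t (source V) z - duhamel a t t (source (vs n)) z) (contraction_factor R (t - a) * (2 * R * (1 / 2) ^ n))"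
          using t a by (intro duhamel_contract sing jvs jV VU vsU vsR VR Vvs) auto
        moreover have "contraction_factor R (t - a) * (2 * R * (1 / 2) ^ n) \<le> 1 / 2 * (2 * R * (1 / 2) ^ n)"
          using t R by (intro mult_right_mono h(2)) auto
        ultimately have "Lp_le q (\<lambda>z. duhamel a t t (source V) z - duhamel a t t (source (vs n)) z) (1 / 2 * (2 * R * (1 / 2) ^ n))"
          using exponents(3) by (auto elim: Lp_le_mono)
        moreover have "(\<lambda>z. duhamel a t t (source V) z - duhamel a t t (source (vs n)) z) = (\<lambda>z. (S (t - a) (U a) z + duhamel a t t (source V) z) - vs (Suc n) t z)"
          using t by (simp add: vsS)
        ultimately have 1: "Lp_le q (\<lambda>z. (S (t - a) (U a) z + duhamel a t t (source V) z) - vs (Suc n) t z) (1 / 2 * (2 * R * (1 / 2) ^ n))"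
          by simp
        have "Lp_le q (\<lambda>z. vs (Suc n) t z - V t z) (2 * R * (1 / 2) ^ Suc n)"
          by (rule Lp_le_uminus_commute[OF Vvs[OF t] exponents(1)])
        from Lp_le_triangle[OF 1 this exponents(1)] show ?thesis
          by (rule Lp_le_mono) (use R exponents(3) in auto)
      qed
      have "(\<lambda>n. 4 * R * (1 / 2) ^ n) \<longlonglongrightarrow> 4 * R * 0"
        by (intro tendsto_intros LIMSEQ_realpow_zero) auto
      then have lim: "(\<lambda>n. 4 * R * (1 / 2) ^ n) \<longlonglongrightarrow> 0" by simp
      have "Lp_le q (\<lambda>z. (S (t - a) (U a) z + duhamel a t t (source V) z) - V t z) 0"
        by (rule Lp_le_tendsto_bound[OF le lim exponents(3)])
      then have "AE z in lborel. (S (t - a) (U a) z + duhamel a t t (source V) z) - V t z = 0"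
        using exponents(3) by (simp add: Lp_le_0_iff)
      then show ?thesis by eventually_elim simp
    qed
    have eqn: "AE z in lborel. V t z = S t u0 z + duhamel 0 t t (source V) z" if t: "0 < t" "t \<le> a + h" for t
    proof (cases "t \<le> a")
      case True
      then have "AE z in lborel. U t z = S t u0 z + duhamel 0 t t (source U) z"
        using U t by (auto simp: mild_def)
      moreover have "duhamel 0 t t (source V) = duhamel 0 t t (source U)"
        using True by (intro duhamel_cong) (simp add: VU)
      ultimately show ?thesis using True by (simp add: VU)
    next
      case False
      then have at: "a < t" by simp
      have "AE z in lborel. U a z = S a u0 z + duhamel 0 a a (source U) z"
        using U a by (auto simp: mild_def)
      \<comment> \<open>The free evolution of \<open>U a\<close> is that of \<open>u0\<close> plus
        the past of the source, which turns the restarted equation back into the one from time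
        zero.\<close>
      note R = restart_source[OF u0 mild_singular_source[OF U] a at Uam this]
      have "duhamel 0 a t (source V) = duhamel 0 a t (source U)"
        by (intro duhamel_cong) (simp add: VU)
      moreover have "singular_source t (source V)" using t by (intro sing jV VU VR)
      from duhamel_split[OF this a at]
      have "AE z in lborel. duhamel 0 t t (source V) z = duhamel 0 a t (source V) z + duhamel a t t (source V) z" .
      ultimately show ?thesis using fixpoint[OF at t(2)] by (auto simp: R)
    qed
    have "mild u0 (a + h) V"
      unfolding mild_def using jV bound[OF VU VR] eqn by auto
    then show ?thesis using VU by auto
  qed
  then show ?thesis using h(1) by blast
qed

end

section \<open>Integrals of paths in Lebesgue spaces\<close>

lemma Lp_norm_cong_AE:
  assumes "AE x in lborel. f x = g x" "f \<in> borel_measurable borel" "g \<in> borel_measurable borel"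
  shows "Lp_norm p f = Lp_norm p g"
  unfolding Lp_norm_def using assms by (intro arg_cong[where f="\<lambda>x. x powr (1 / p)"] integral_cong_AE) (auto elim!: eventually_mono)

lemma Lp_norm_minus_commute: "Lp_norm p (\<lambda>x. f x - g x) = Lp_norm p (\<lambda>x. g x - f x)"
  by (simp add: Lp_norm_def abs_minus_commute)

lemma eLp_norm_Lp_le: "Lp_le p f a \<Longrightarrow> 0 < p \<Longrightarrow> eLp_norm p f \<le> ennreal a"
  by (simp add: Lp_le_iff eLp_norm_def ennreal_leI)

lemma eLp_norm_tendsto_0D:
  assumes lim: "(\<lambda>n. eLp_norm p (w n)) \<longlonglongrightarrow> 0" and p: "0 < p"
  shows "\<exists>N b. (\<forall>n\<ge>N. Lp_le p (w n) (b n)) \<and> b \<longlonglongrightarrow> 0"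
proof -
  have "eventually (\<lambda>n. eLp_norm p (w n) < 1) sequentially"
    using lim by (intro order_tendstoD(2)) auto
  then obtain N where N: "\<And>n. N \<le> n \<Longrightarrow> eLp_norm p (w n) < 1" by (auto simp: eventually_sequentially)
  have "Lp_le p (w n) (enn2real (eLp_norm p (w n)))" if "N \<le> n" for n
    using N[OF that] p by (auto simp: eLp_norm_def Lp_le_iff Lp_norm_nonneg split: if_splits)
  moreover have "(\<lambda>n. enn2real (eLp_norm p (w n))) \<longlonglongrightarrow> 0"
    using tendsto_enn2real[OF lim[folded ennreal_0]] by simp
  ultimately show ?thesis
    by (intro exI[of _ N] exI[of _ "\<lambda>n. enn2real (eLp_norm p (w n))"]) auto
qed

abbreviation time_measure :: "real \<Rightarrow> real measure" where
  "time_measure t \<equiv> restrict_space lborel {0..t}"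

lemma AE_time_measure:
  assumes "\<And>s. 0 < s \<Longrightarrow> s < t \<Longrightarrow> P s"
  shows "AE s in time_measure t. P s"
proof -
  have "AE s in lborel. s \<in> {0..t} \<longrightarrow> P s"
    using AE_lborel_singleton[of 0] AE_lborel_singleton[of t]
    by eventually_elim (use assms in auto)
  then show ?thesis by (subst AE_restrict_space_iff) auto
qed

lemma nn_integral_time_measure:
  "(\<integral>\<^sup>+s. f s \<partial>time_measure t) = (\<integral>\<^sup>+s. f s * indicator {0<..<t} s \<partial>lborel)"
proof -
  have "(\<integral>\<^sup>+s. f s \<partial>time_measure t) = (\<integral>\<^sup>+s. f s * indicator {0..t} s \<partial>lborel)"
    by (rule nn_integral_restrict_space) simp
  also have "\<dots> = (\<integral>\<^sup>+s. f s * indicator {0<..<t} s \<partial>lborel)"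
    by (rule nn_integral_cong_AE, use AE_lborel_singleton[of 0] AE_lborel_singleton[of t] in eventually_elim)
       (auto split: split_indicator)
  finally show ?thesis .
qed

text \<open>Replacing [0, t] by (0, t) changes null sets only and matches the interval in
  \<open>duhamel\<close>.\<close>

lemma
  assumes \<sigma>: "Lp_simple (time_measure t) p \<sigma>"
  shows simple_fun_measurable: "jointly_measurable (simple_fun \<sigma>)"
    and simple_fun_integrable: "integrable lborel (\<lambda>s. indicator {0<..<t} s * simple_fun \<sigma> s z)"
    and simple_fun_integral: "(\<integral>s. indicator {0<..<t} s * simple_fun \<sigma> s z \<partial>lborel) = simple_integral (time_measure t) \<sigma> z"
proof -
  have "jointly_measurable (simple_fun \<sigma>) \<and> integrable lborel (\<lambda>s. indicator {0<..<t} s * simple_fun \<sigma> s z)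
     \<and> (\<integral>s. indicator {0<..<t} s * simple_fun \<sigma> s z \<partial>lborel) = simple_integral (time_measure t) \<sigma> z"
    using \<sigma>
  proof (induction \<sigma>)
    case Nil
    then show ?case by (simp add: simple_fun_def simple_integral_def case_prod_unfold)
  next
    case (Cons a \<sigma>)
    obtain A g where a: "a = (A, g)" by (cases a)
    have "Lp_simple (time_measure t) p \<sigma>" using Cons.prems by (simp add: Lp_simple_def)
    note IH = Cons.IH[OF this]
    have A: "A \<in> sets (time_measure t)" "g \<in> Lp p" using Cons.prems by (auto simp: Lp_simple_def a)
    then have A': "A \<in> sets borel" "A \<subseteq> {0..t}" by (auto simp: sets_restrict_space_iff)
    have [measurable]: "A \<in> sets borel" "g \<in> borel_measurable borel" using A A' by (auto simp: Lp_def)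
    have eq: "simple_fun (a # \<sigma>) s z = indicator A s * g z + simple_fun \<sigma> s z" for s z
      by (simp add: simple_fun_def a)
    have 1: "(\<lambda>x. simple_fun \<sigma> (fst x) (snd x)) \<in> borel_measurable (borel \<Otimes>\<^sub>M borel)"
      using IH by (simp add: case_prod_unfold)
    have 2: "jointly_measurable (simple_fun (a # \<sigma>))"
      unfolding eq case_prod_unfold using 1 by measurable
    have fin: "emeasure lborel ({0<..<t} \<inter> A) < \<infinity>"
      by (rule le_less_trans[OF emeasure_mono[of _ "{0..t}"]]) (auto simp: emeasure_lborel_Icc_eq)
    have ind: "indicator {0<..<t} s * indicator A s = (indicator ({0<..<t} \<inter> A) s :: real)" for s
      by (simp add: indicator_inter_arith)
    have 3: "integrable lborel (\<lambda>s. indicator {0<..<t} s * (indicator A s * g z))"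
      unfolding mult.assoc[symmetric] ind using fin by (intro integrable_mult_left integrable_real_indicator) auto
    have "measure lborel ({0<..<t} \<inter> A) = measure (time_measure t) A"
    proof -
      have "measure (time_measure t) A = measure lborel A"
        using A' by (intro measure_restrict_space) auto
      also have "\<dots> = measure lborel ({0<..<t} \<inter> A)"
      proof (rule measure_eq_AE)
        show "AE s in lborel. s \<in> A \<longleftrightarrow> s \<in> {0<..<t} \<inter> A"
          using AE_lborel_singleton[of 0] AE_lborel_singleton[of t] by eventually_elim (use A' in force)
      qed auto
      finally show ?thesis by simp
    qed
    then have 4: "(\<integral>s. indicator {0<..<t} s * (indicator A s * g z) \<partial>lborel) = measure (time_measure t) A * g z"
      unfolding mult.assoc[symmetric] ind by simp
    show ?case
    proof (intro conjI)
      show "jointly_measurable (simple_fun (a # \<sigma>))" by (rule 2)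
      show "integrable lborel (\<lambda>s. indicator {0<..<t} s * simple_fun (a # \<sigma>) s z)"
        unfolding eq using 3 IH by (simp add: distrib_left)
      show "(\<integral>s. indicator {0<..<t} s * simple_fun (a # \<sigma>) s z \<partial>lborel) = simple_integral (time_measure t) (a # \<sigma>) z"
        unfolding eq using 3 4 IH by (simp add: distrib_left simple_integral_def a)
    qed
  qed
  then show "jointly_measurable (simple_fun \<sigma>)" "integrable lborel (\<lambda>s. indicator {0<..<t} s * simple_fun \<sigma> s z)"
    "(\<integral>s. indicator {0<..<t} s * simple_fun \<sigma> s z \<partial>lborel) = simple_integral (time_measure t) \<sigma> z" by auto
qed

lemma Lp_norm_measurable:
  assumes "jointly_measurable d"
  shows "(\<lambda>s. Lp_norm p (d s)) \<in> borel_measurable borel"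
proof -
  have "(\<lambda>(s, z). \<bar>d s z\<bar> powr p) \<in> borel_measurable (borel \<Otimes>\<^sub>M lborel)"
    using assms by (simp add: case_prod_unfold)
  from lborel.borel_measurable_lebesgue_integral[OF this] show ?thesis
    unfolding Lp_norm_def by measurable
qed

text \<open>Minkowski's integral inequality for \<open>h\<close> minus the simple function. It lets
  the Bochner approximation error control the distance to the pointwise time integral.\<close>

lemma integral_simple_approx:
  assumes h: "jointly_measurable h" and h0: "\<And>s. \<not> (0 < s \<and> s < t) \<Longrightarrow> h s = (\<lambda>z. 0)"
    and \<sigma>: "Lp_simple (time_measure t) p \<sigma>" and p: "1 \<le> p"
    and d: "AE s in lborel. 0 < s \<and> s < t \<longrightarrow> (\<lambda>z. h s z - simple_fun \<sigma> s z) \<in> Lp p"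
    and m: "integrable lborel (\<lambda>s. indicator {0<..<t} s * Lp_norm p (\<lambda>z. h s z - simple_fun \<sigma> s z))"
  shows "Lp_le p (\<lambda>z. (\<integral>s. h s z \<partial>lborel) - simple_integral (time_measure t) \<sigma> z)
     (\<integral>s. indicator {0<..<t} s * Lp_norm p (\<lambda>z. h s z - simple_fun \<sigma> s z) \<partial>lborel)"
proof -
  let ?d = "\<lambda>s z. h s z - indicator {0<..<t} s * simple_fun \<sigma> s z"
  let ?m = "\<lambda>s. indicator {0<..<t} s * Lp_norm p (\<lambda>z. h s z - simple_fun \<sigma> s z)"
  have h': "(\<lambda>x. h (fst x) (snd x)) \<in> borel_measurable (borel \<Otimes>\<^sub>M borel)"
    using h by (simp add: case_prod_unfold)
  have s': "(\<lambda>x. simple_fun \<sigma> (fst x) (snd x)) \<in> borel_measurable (borel \<Otimes>\<^sub>M borel)"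
    using simple_fun_measurable[OF \<sigma>] by (simp add: case_prod_unfold)
  have jd: "jointly_measurable ?d" unfolding case_prod_unfold using h' s' by measurable
  have ae: "AE s in lborel. Lp_le p (?d s) (?m s)"
    using d
  proof eventually_elim
    case (elim s)
    show ?case
    proof (cases "0 < s \<and> s < t")
      case True
      then show ?thesis using elim p by (simp add: Lp_le_Lp_norm)
    next
      case False
      then show ?thesis using h0 p by (simp add: Lp_le_0_iff)
    qed
  qed
  note M = minkowski_integral[OF p jd m ae]
  have hm: "h s \<in> borel_measurable borel" for s using h by (rule jointly_measurable_section)
  have hi: "(\<lambda>z. \<integral>s. h s z \<partial>lborel) \<in> borel_measurable borel"
    using measurable_compose[OF measurable_pair_swap' h]
    by (intro lborel.borel_measurable_lebesgue_integral) (simp add: case_prod_unfold)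
  have si: "simple_integral (time_measure t) \<sigma> \<in> borel_measurable borel"
  proof -
    have "(\<lambda>z. \<integral>s. indicator {0<..<t} s * simple_fun \<sigma> s z \<partial>lborel) \<in> borel_measurable borel"
      using measurable_compose[OF measurable_pair_swap' simple_fun_measurable[OF \<sigma>]]
      by (intro lborel.borel_measurable_lebesgue_integral) (simp add: case_prod_unfold)
    then show ?thesis by (simp add: simple_fun_integral[OF \<sigma>])
  qed
  have "AE z in lborel. (\<integral>s. h s z \<partial>lborel) - simple_integral (time_measure t) \<sigma> z = (\<integral>s. ?d s z \<partial>lborel)"
    using M(1)
  proof eventually_elim
    case (elim z)
    have "integrable lborel (\<lambda>s. ?d s z + indicator {0<..<t} s * simple_fun \<sigma> s z)"
      using elim simple_fun_integrable[OF \<sigma>] by (rule Bochner_Integration.integrable_add)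
    then have "integrable lborel (\<lambda>s. h s z)" by simp
    then show ?case using simple_fun_integrable[OF \<sigma>, of z] by (simp add: simple_fun_integral[OF \<sigma>])
  qed
  with M(2) show ?thesis
    by (rule Lp_le_cong_AE) (use hi si p in auto)
qed

text \<open>The Bochner integral and the pointwise integral are L^p limits of the same simple
  integrals. Once the error integral \<open>E n\<close> is finite, the norm of the error is the
  integrable majorant that Minkowski's inequality needs.\<close>

lemma has_Lp_integral_unique:
  assumes I: "has_Lp_integral (time_measure t) p f I" and p: "1 \<le> p"
    and h: "jointly_measurable h" and h0: "\<And>s. \<not> (0 < s \<and> s < t) \<Longrightarrow> h s = (\<lambda>z. 0)"
    and fh: "\<And>s. 0 < s \<Longrightarrow> s < t \<Longrightarrow> f s = h s"
  shows "AE z in lborel. I z = (\<integral>s. h s z \<partial>lborel)"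
proof -
  let ?M = "time_measure t"
  obtain \<sigma> where \<sigma>: "\<And>n. Lp_simple ?M p (\<sigma> n)"
    and lim: "(\<lambda>n. \<integral>\<^sup>+s. eLp_norm p (\<lambda>z. f s z - simple_fun (\<sigma> n) s z) \<partial>?M) \<longlonglongrightarrow> 0"
    and limI: "(\<lambda>n. eLp_norm p (\<lambda>z. I z - simple_integral ?M (\<sigma> n) z)) \<longlonglongrightarrow> 0"
    using I by (auto simp: has_Lp_integral_def)
  define d where "d = (\<lambda>n s z. h s z - simple_fun (\<sigma> n) s z)"
  define E where "E = (\<lambda>n. \<integral>\<^sup>+s. eLp_norm p (d n s) * indicator {0<..<t} s \<partial>lborel)"
  have E: "(\<integral>\<^sup>+s. eLp_norm p (\<lambda>z. f s z - simple_fun (\<sigma> n) s z) \<partial>?M) = E n" for n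
    unfolding nn_integral_time_measure E_def d_def
    by (intro nn_integral_cong) (auto split: split_indicator simp: fh)
  have E0: "E \<longlonglongrightarrow> 0" using lim unfolding E .
  obtain N1 b where b: "\<And>n. N1 \<le> n \<Longrightarrow> Lp_le p (\<lambda>z. I z - simple_integral ?M (\<sigma> n) z) (b n)" "b \<longlonglongrightarrow> 0"
    using eLp_norm_tendsto_0D[OF limI] p by auto
  have "eventually (\<lambda>n. E n < 1) sequentially" using E0 by (intro order_tendstoD(2)) auto
  then obtain N2 where N2: "\<And>n. N2 \<le> n \<Longrightarrow> E n < 1" by (auto simp: eventually_sequentially)
  have jd: "jointly_measurable (d n)" for n
    unfolding d_def using borel_measurable_diff[OF h simple_fun_measurable[OF \<sigma>[of n]]]
    by (simp add: case_prod_unfold)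
  have approx: "Lp_le p (\<lambda>z. (\<integral>s. h s z \<partial>lborel) - simple_integral ?M (\<sigma> n) z) (enn2real (E n))" if n: "N2 \<le> n" for n
  proof -
    let ?m = "\<lambda>s. indicator {0<..<t} s * Lp_norm p (d n s)"
    have [measurable]: "(\<lambda>s. Lp_norm p (d n s)) \<in> borel_measurable borel"
      by (rule Lp_norm_measurable[OF jd])
    have [measurable]: "(\<lambda>s. eLp_norm p (d n s)) \<in> borel_measurable borel"
    proof -
      have nn: "(\<lambda>s. \<integral>\<^sup>+z. ennreal (\<bar>d n s z\<bar> powr p) \<partial>lborel) \<in> borel_measurable borel"
        using jd[of n] by (intro lborel.borel_measurable_nn_integral) (simp add: case_prod_unfold)
      \<comment> \<open>Membership in \<open>Lp p\<close> is finiteness of a nonnegative integral,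
        hence a measurable condition on \<open>s\<close>.\<close>
      have "d n s \<in> Lp p \<longleftrightarrow> (\<integral>\<^sup>+z. ennreal (\<bar>d n s z\<bar> powr p) \<partial>lborel) < \<infinity>" for s
        using jointly_measurable_section[OF jd[of n], of s] by (simp add: Lp_def integrable_iff_bounded)
      then show ?thesis unfolding eLp_norm_def using nn by simp
    qed
    have fin: "E n < \<infinity>" using N2[OF n] by (auto intro: less_trans)
    then have "AE s in lborel. eLp_norm p (d n s) * indicator {0<..<t} s \<noteq> \<infinity>"
      unfolding E_def by (intro nn_integral_PInf_AE) auto
    then have ae: "AE s in lborel. 0 < s \<and> s < t \<longrightarrow> d n s \<in> Lp p"
      by eventually_elim (auto simp: eLp_norm_def split: if_splits)
    have nn: "(\<integral>\<^sup>+s. ennreal (?m s) \<partial>lborel) = E n"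
      unfolding E_def
      by (rule nn_integral_cong_AE, use ae in eventually_elim) (auto simp: eLp_norm_def split: split_indicator)
    have m: "integrable lborel ?m"
      using fin nn by (intro integrableI_nonneg) (auto simp: Lp_norm_nonneg)
    have "(\<integral>s. ?m s \<partial>lborel) = enn2real (E n)"
      unfolding nn[symmetric] by (rule integral_eq_nn_integral) (auto simp: Lp_norm_nonneg)
    then show ?thesis
      using integral_simple_approx[OF h h0 \<sigma> p ae[unfolded d_def] m[unfolded d_def]] by (simp add: d_def)
  qed
  let ?N = "max N1 N2"
  have "Lp_le p (\<lambda>z. I z - (\<integral>s. h s z \<partial>lborel)) (b (n + ?N) + enn2real (E (n + ?N)))" for n
    by (rule Lp_le_triangle[OF b(1) Lp_le_uminus_commute[OF approx p] p]) auto
  moreover have "(\<lambda>n. b (n + ?N) + enn2real (E (n + ?N))) \<longlonglongrightarrow> 0 + 0"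
    using tendsto_enn2real[OF E0[folded ennreal_0]]
    by (intro tendsto_add LIMSEQ_ignore_initial_segment[where f=b] LIMSEQ_ignore_initial_segment[where f="\<lambda>n. enn2real (E n)"] b(2)) auto
  ultimately have "Lp_le p (\<lambda>z. I z - (\<integral>s. h s z \<partial>lborel)) (0 + 0)"
    by (rule Lp_le_tendsto_bound) (use p in simp)
  then show ?thesis using p by (simp add: Lp_le_0_iff)
qed

text \<open>A continuous path with a decreasing integrable bound is approximated by its values at the
  right end points of a uniform partition; these satisfy the same bound.\<close>

lemma has_Lp_integral_continuous_path:
  assumes t: "0 < t" and p: "1 \<le> p"
    and h: "jointly_measurable h" and h0: "\<And>s. \<not> (0 < s \<and> s < t) \<Longrightarrow> h s = (\<lambda>z. 0)"
    and fh: "\<And>s. 0 < s \<Longrightarrow> s < t \<Longrightarrow> f s = h s"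
    and le: "\<And>s. 0 < s \<Longrightarrow> s < t \<Longrightarrow> Lp_le p (h s) (m s)"
    and m: "integrable lborel (\<lambda>s. indicator {0<..<t} s * m s)"
    and mono: "\<And>s s'. 0 < s \<Longrightarrow> s \<le> s' \<Longrightarrow> s' < t \<Longrightarrow> m s' \<le> m s"
    and cont: "\<And>s x. 0 < s \<Longrightarrow> s < t \<Longrightarrow> (\<And>n. 0 < x n) \<Longrightarrow> (\<And>n. x n < t) \<Longrightarrow> x \<longlonglongrightarrow> s \<Longrightarrow>
      (\<lambda>n. Lp_norm p (\<lambda>z. h (x n) z - h s z)) \<longlonglongrightarrow> 0"
  shows "has_Lp_integral (time_measure t) p f (\<lambda>z. \<integral>s. h s z \<partial>lborel)"
proof -
  let ?M = "time_measure t"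
  \<comment> \<open>Of the n + 1 cells only the first n are used: the right end point of the last
    one is \<open>t\<close>, where neither the bound nor continuity is available.\<close>
  define x where "x = (\<lambda>n j. real j * t / real (Suc n))"
  define A where "A = (\<lambda>n j. {x n j<..x n (Suc j)})"
  define \<sigma> where "\<sigma> = (\<lambda>n. map (\<lambda>j. (A n j, h (x n (Suc j)))) [0..<n])"
  have x: "0 \<le> x n j" "x n j < x n (Suc j)" for n j
    using t by (auto simp: x_def divide_strict_right_mono)
  have xt: "x n (Suc j) < t" if "j < n" for n j
  proof -
    have "real (Suc j) * t < real (Suc n) * t" using that t by (intro mult_strict_right_mono) auto
    then show ?thesis by (simp add: x_def pos_divide_less_eq mult.commute)
  qed
  have x0: "0 < x n (Suc j)" for n j using x[of n j] by linarith
  have hLp: "h s \<in> Lp p" if "0 < s" "s < t" for s using le[OF that] p by (simp add: Lp_le_iff)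
  have \<sigma>: "Lp_simple ?M p (\<sigma> n)" for n
  proof -
    have "A n j \<in> sets ?M \<and> emeasure ?M (A n j) < \<infinity> \<and> h (x n (Suc j)) \<in> Lp p" if j: "j < n" for j
    proof -
      have sub: "A n j \<subseteq> {0..t}" using x[of n j] xt[OF j] by (auto simp: A_def)
      have "emeasure ?M (A n j) = emeasure lborel (A n j)"
        using sub by (intro emeasure_restrict_space) auto
      also have "\<dots> < \<infinity>" using x(2)[of n j] by (simp add: A_def)
      finally show ?thesis using sub hLp[OF x0 xt[OF j]] by (auto simp: sets_restrict_space_iff A_def)
    qed
    then show ?thesis by (auto simp: Lp_simple_def \<sigma>_def)
  qed
  have sf: "simple_fun (\<sigma> n) s z = (\<Sum>j<n. indicator (A n j) s * h (x n (Suc j)) z)" for n s z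
    by (simp add: simple_fun_def \<sigma>_def o_def interv_sum_list_conv_sum_set_nat atLeast0LessThan)
  have cell: "(\<exists>j<n. s \<in> A n j \<and> simple_fun (\<sigma> n) s = h (x n (Suc j))) \<or> (x n n < s \<and> simple_fun (\<sigma> n) s = (\<lambda>z. 0))" if s: "0 < s" for n s
  proof -
    have xmono: "x n i \<le> x n j" if "i \<le> j" for i j
      using that t by (auto simp: x_def intro!: divide_right_mono mult_right_mono)
    \<comment> \<open>The index of the cell containing \<open>s\<close>; the cells are closed on the
      right, hence the ceiling minus one.\<close>
    define J where "J = nat (\<lceil>s * real (Suc n) / t\<rceil> - 1)"
    have pos: "0 < s * real (Suc n) / t" using s t by simp
    have J: "real J < s * real (Suc n) / t" "s * real (Suc n) / t \<le> real (Suc J)"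
      using pos unfolding J_def by (auto simp: of_nat_nat le_of_int_ceiling) linarith+
    have sA: "s \<in> A n J"
      using J t by (simp add: A_def x_def field_simps)
    have out: "s \<notin> A n j" if "j \<noteq> J" for j
    proof (cases "j < J")
      case True
      then show ?thesis using xmono[of "Suc j" J] sA by (auto simp: A_def)
    next
      case False
      then show ?thesis using that xmono[of "Suc J" j] sA by (auto simp: A_def)
    qed
    show ?thesis
    proof (cases "J < n")
      case True
      have "simple_fun (\<sigma> n) s z = h (x n (Suc J)) z" for z
      proof -
        have "simple_fun (\<sigma> n) s z = (\<Sum>j\<in>{J}. indicator (A n j) s * h (x n (Suc j)) z)"
          unfolding sf using True out by (intro sum.mono_neutral_right) (auto simp: indicator_def)
        then show ?thesis using sA by simp
      qed
      then show ?thesis using True sA by blast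
    next
      case False
      have "simple_fun (\<sigma> n) s z = 0" for z
        unfolding sf using False out by (intro sum.neutral) (auto simp: indicator_def)
      moreover have "x n n < s" using xmono[of n J] False sA by (auto simp: A_def)
      ultimately show ?thesis by blast
    qed
  qed
  have m0: "0 \<le> m s" if "0 < s" "s < t" for s using le[OF that] by (rule Lp_le_nonneg)
  define D where "D = (\<lambda>n s. Lp_norm p (\<lambda>z. h s z - simple_fun (\<sigma> n) s z))"
  \<comment> \<open>The sample lies to the right of \<open>s\<close> and \<open>m\<close> decreases,
    so its norm is again at most \<open>m s\<close>.\<close>
  have sle: "Lp_le p (\<lambda>z. h s z - simple_fun (\<sigma> n) s z) (2 * m s)" if s: "0 < s" "s < t" for n s
    using cell[OF s(1), of n]
  proof
    assume "\<exists>j<n. s \<in> A n j \<and> simple_fun (\<sigma> n) s = h (x n (Suc j))"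
    then obtain j where j: "j < n" "s \<in> A n j" "simple_fun (\<sigma> n) s = h (x n (Suc j))" by blast
    have "Lp_le p (\<lambda>z. h s z - h (x n (Suc j)) z) (m s + m (x n (Suc j)))"
      using s j x0 xt by (intro Lp_le_diff le p) auto
    moreover have "m (x n (Suc j)) \<le> m s" using j s xt by (intro mono) (auto simp: A_def)
    ultimately show ?thesis using j p by (auto elim: Lp_le_mono)
  next
    assume "x n n < s \<and> simple_fun (\<sigma> n) s = (\<lambda>z. 0)"
    then show ?thesis using le[OF s] m0[OF s] p by (auto elim: Lp_le_mono)
  qed
  have Dle: "D n s \<le> 2 * m s" if "0 < s" "s < t" for n s
    using sle[OF that] p by (auto simp: D_def Lp_le_iff)
  have D0: "(\<lambda>n. D n s) \<longlonglongrightarrow> 0" if s: "0 < s" "s < t" for s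
  proof -
    \<comment> \<open>The sampling time, or \<open>s\<close> itself when no used cell contains it,
      so that the sequence stays in (0, t) for all n as \<open>cont\<close> requires. From some n
      on, \<open>s\<close> lies in a used cell.\<close>
    define y where "y = (\<lambda>n. if \<exists>j<n. s \<in> A n j \<and> simple_fun (\<sigma> n) s = h (x n (Suc j))
      then x n (Suc (SOME j. j < n \<and> s \<in> A n j \<and> simple_fun (\<sigma> n) s = h (x n (Suc j)))) else s)"
    have y: "0 < y n \<and> y n < t \<and> s \<le> y n \<and> y n \<le> s + t / real (Suc n) \<and>
      ((\<exists>j<n. s \<in> A n j \<and> simple_fun (\<sigma> n) s = h (x n (Suc j))) \<longrightarrow> simple_fun (\<sigma> n) s = h (y n))" for n
    proof (cases "\<exists>j<n. s \<in> A n j \<and> simple_fun (\<sigma> n) s = h (x n (Suc j))")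
      case True
      define j where "j = (SOME j. j < n \<and> s \<in> A n j \<and> simple_fun (\<sigma> n) s = h (x n (Suc j)))"
      have j: "j < n" "s \<in> A n j" "simple_fun (\<sigma> n) s = h (x n (Suc j))"
        using someI_ex[OF True] unfolding j_def by auto
      have yn: "y n = x n (Suc j)" using True by (simp add: y_def j_def)
      have "x n (Suc j) = x n j + t / real (Suc n)" by (simp add: x_def add_divide_distrib algebra_simps)
      then show ?thesis using j(2,3) x0[of n j] xt[OF j(1)] unfolding yn by (auto simp: A_def)
    next
      case False
      then have "y n = s" by (auto simp: y_def)
      then show ?thesis using s t False by auto
    qed
    have lim: "(\<lambda>n. s + t / real (Suc n)) \<longlonglongrightarrow> s + 0"
      by (intro tendsto_add tendsto_const) (use LIMSEQ_Suc[OF lim_const_over_n[of t]] in simp)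
    have "y \<longlonglongrightarrow> s"
      by (rule tendsto_sandwich[OF _ _ tendsto_const lim[simplified add_0_right]]) (use y in \<open>auto intro!: always_eventually\<close>)
    then have "(\<lambda>n. Lp_norm p (\<lambda>z. h (y n) z - h s z)) \<longlonglongrightarrow> 0"
      using y by (intro cont s) auto
    moreover have "eventually (\<lambda>n. Lp_norm p (\<lambda>z. h (y n) z - h s z) = D n s) sequentially"
    proof -
      have "(\<lambda>n. t - t / real (Suc n)) \<longlonglongrightarrow> t - 0"
        by (intro tendsto_diff tendsto_const) (use LIMSEQ_Suc[OF lim_const_over_n[of t]] in simp)
      then have "eventually (\<lambda>n. s < t - t / real (Suc n)) sequentially"
        using s by (intro order_tendstoD(1)) auto
      then show ?thesis
      proof eventually_elim
        case (elim n)
        have "x n n = t - t / real (Suc n)" by (simp add: x_def field_simps)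
        then have "simple_fun (\<sigma> n) s = h (y n)" using cell[OF s(1), of n] y[of n] elim by auto
        then show ?case by (simp add: D_def Lp_norm_minus_commute)
      qed
    qed
    ultimately show ?thesis by (rule Lim_transform_eventually)
  qed
  have jd: "jointly_measurable (\<lambda>s z. h s z - simple_fun (\<sigma> n) s z)" for n
    using borel_measurable_diff[OF h simple_fun_measurable[OF \<sigma>[of n]]] by (simp add: case_prod_unfold)
  have [measurable]: "D n \<in> borel_measurable borel" for n
    unfolding D_def by (rule Lp_norm_measurable[OF jd])
  have Dnn: "0 \<le> D n s" for n s by (simp add: D_def Lp_norm_nonneg)
  have m2: "integrable lborel (\<lambda>s. indicator {0<..<t} s * (2 * m s))"
    using integrable_mult_right[OF m, of 2] by (simp add: mult.left_commute)
  have Dm: "norm (indicator {0<..<t} s * D n s) \<le> indicator {0<..<t} s * (2 * m s)" for n s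
    using Dle Dnn by (auto split: split_indicator)
  have Di: "integrable lborel (\<lambda>s. indicator {0<..<t} s * D n s)" for n
    by (rule Bochner_Integration.integrable_bound[OF m2]) (measurable, rule AE_I2, rule order_trans[OF Dm], simp)
  have Dlim: "(\<lambda>n. \<integral>s. indicator {0<..<t} s * D n s \<partial>lborel) \<longlonglongrightarrow> 0"
  proof -
    have "(\<lambda>n. \<integral>s. indicator {0<..<t} s * D n s \<partial>lborel) \<longlonglongrightarrow> integral\<^sup>L lborel (\<lambda>s::real. 0::real)"
    proof (rule integral_dominated_convergence[OF _ _ m2])
      show "AE s in lborel. (\<lambda>n. indicator {0<..<t} s * D n s) \<longlonglongrightarrow> 0"
        using D0 by (auto intro!: AE_I2 split: split_indicator)
    qed (use Dm in auto)
    then show ?thesis by simp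
  qed
  have eD: "eLp_norm p (\<lambda>z. f s z - simple_fun (\<sigma> n) s z) = ennreal (D n s)" if "0 < s" "s < t" for n s
    using sle[OF that, of n] p by (simp add: fh[OF that] eLp_norm_def D_def Lp_le_iff)
  have e0: "(\<lambda>n. ennreal (a n)) \<longlonglongrightarrow> 0" if "a \<longlonglongrightarrow> 0" for a :: "nat \<Rightarrow> real"
    using tendsto_ennrealI[OF that] by simp
  have i1: "AE s in ?M. (\<lambda>n. eLp_norm p (\<lambda>z. f s z - simple_fun (\<sigma> n) s z)) \<longlonglongrightarrow> 0"
    by (rule AE_time_measure) (simp add: eD e0[OF D0])
  have "(\<integral>\<^sup>+s. eLp_norm p (\<lambda>z. f s z - simple_fun (\<sigma> n) s z) \<partial>?M) = ennreal (\<integral>s. indicator {0<..<t} s * D n s \<partial>lborel)" for n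
  proof -
    have "(\<integral>\<^sup>+s. eLp_norm p (\<lambda>z. f s z - simple_fun (\<sigma> n) s z) \<partial>?M) = (\<integral>\<^sup>+s. ennreal (indicator {0<..<t} s * D n s) \<partial>lborel)"
      unfolding nn_integral_time_measure by (intro nn_integral_cong) (auto split: split_indicator simp: eD)
    then show ?thesis using Di Dnn by (simp add: nn_integral_eq_integral)
  qed
  then have i2: "(\<lambda>n. \<integral>\<^sup>+s. eLp_norm p (\<lambda>z. f s z - simple_fun (\<sigma> n) s z) \<partial>?M) \<longlonglongrightarrow> 0"
    using e0[OF Dlim] by simp
  have approx: "Lp_le p (\<lambda>z. (\<integral>s. h s z \<partial>lborel) - simple_integral ?M (\<sigma> n) z) (\<integral>s. indicator {0<..<t} s * D n s \<partial>lborel)" for n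
    unfolding D_def
  proof (rule integral_simple_approx[OF h h0 \<sigma> p])
    show "AE s in lborel. 0 < s \<and> s < t \<longrightarrow> (\<lambda>z. h s z - simple_fun (\<sigma> n) s z) \<in> Lp p"
      using sle p by (auto intro!: AE_I2 simp: Lp_le_iff)
    show "integrable lborel (\<lambda>s. indicator {0<..<t} s * Lp_norm p (\<lambda>z. h s z - simple_fun (\<sigma> n) s z))"
      using Di unfolding D_def .
  qed
  have i3: "(\<lambda>n. eLp_norm p (\<lambda>z. (\<integral>s. h s z \<partial>lborel) - simple_integral ?M (\<sigma> n) z)) \<longlonglongrightarrow> 0"
    by (rule tendsto_sandwich[OF _ _ tendsto_const e0[OF Dlim]])
       (use eLp_norm_Lp_le[OF approx] p in \<open>auto intro!: always_eventually\<close>)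
  have "AE s in lborel. Lp_le p (h s) (indicator {0<..<t} s * m s)"
    using le h0 p by (auto intro!: AE_I2 simp: Lp_le_0_iff split: split_indicator)
  from minkowski_integral(2)[OF p h m this] have "(\<lambda>z. \<integral>s. h s z \<partial>lborel) \<in> Lp p"
    using p by (simp add: Lp_le_iff)
  then show ?thesis
    unfolding has_Lp_integral_def using \<sigma> i1 i2 i3 by blast
qed

section \<open>The Grushin semigroup\<close>

definition grushin_const :: "'n::finite itself \<Rightarrow> 'k::finite itself \<Rightarrow> real" where
  "grushin_const _ _ = 1 / (2 * pi) powr (real (CARD('n) + 2 * CARD('k)) / 2)"

definition grushin_K :: "real \<Rightarrow> (real^'n) \<times> (real^'k) \<Rightarrow> (real^'n) \<times> (real^'k) \<Rightarrow> real" where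
  "grushin_K t z v = grushin_const TYPE('n) TYPE('k) * grushin_cos t (fst z) (fst v) (snd z - snd v)"

definition grushin_bound :: "'n::finite itself \<Rightarrow> 'k::finite itself \<Rightarrow> real" where
  "grushin_bound _ _ = grushin_const TYPE('n) TYPE('k) * (2 powr (real CARD('n) / 2) *
     (\<integral>\<xi>. exp (- (real CARD('n) / 4) * norm \<xi>) \<partial>(lborel :: (real^'k) measure)))"

lemma grushin_const_pos: "0 < grushin_const TYPE('n::finite) TYPE('k::finite)"
  by (simp add: grushin_const_def)

lemma grushin_const_normalises:
  "grushin_const TYPE('n::finite) TYPE('k::finite) * ((2 * pi) ^ CARD('k) * (2 * pi) powr (real CARD('n) / 2)) = 1"
proof -
  have "(2 * pi) ^ CARD('k) * (2 * pi) powr (real CARD('n) / 2) = (2 * pi) powr (real CARD('k) + real CARD('n) / 2)"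
    by (simp add: powr_add powr_realpow)
  also have "real CARD('k) + real CARD('n) / 2 = real (CARD('n) + 2 * CARD('k)) / 2" by simp
  finally show ?thesis by (simp add: grushin_const_def)
qed

text \<open>The symbol is real, so taking the real part of the Fourier integral leaves its cosine
  transform.\<close>

lemma grushin_kernel_eq:
  fixes x w :: "real^'n" and y :: "real^'k"
  assumes t: "0 < t"
  shows "grushin_kernel x w y t = grushin_const TYPE('n) TYPE('k) * grushin_cos t x w y"
proof -
  have eq: "grushin_integrand x w y t \<xi> = of_real (grushin_symbol t x w \<xi>) * exp (\<i> * of_real (\<xi> \<bullet> y))" for \<xi>
  proof -
    have e: "exp (\<i> * of_real a - of_real b) = complex_of_real (exp (- b)) * exp (\<i> * of_real a)" for a b :: real
      by (simp add: mult_exp_exp flip: exp_of_real)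
    have D: "real DIM(real^'n) = real CARD('n)" by simp
    show ?thesis
      unfolding grushin_integrand_def grushin_symbol_def mehler_def e D by (simp only: of_real_mult mult.assoc)
  qed
  have int: "integrable lborel (grushin_integrand x w y t)"
  proof (rule Bochner_Integration.integrable_bound[OF grushin_symbol_integrable[OF t, of x w]])
    show "grushin_integrand x w y t \<in> borel_measurable lborel" unfolding eq by measurable
    show "AE \<xi> in lborel. norm (grushin_integrand x w y t \<xi>) \<le> norm (grushin_symbol t x w \<xi>)"
      by (simp add: eq norm_mult)
  qed
  have Re: "Re (grushin_integrand x w y t \<xi>) = grushin_symbol t x w \<xi> * cos (\<xi> \<bullet> y)" for \<xi>
    by (simp add: eq Re_exp)
  have "Re (\<integral>\<xi>. grushin_integrand x w y t \<xi> \<partial>lborel) = grushin_cos t x w y"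
    unfolding grushin_cos_def Re[symmetric] using int by (rule integral_Re[symmetric])
  moreover have "Re (of_real c * z) = c * Re z" for c z by simp
  ultimately show ?thesis
    unfolding grushin_kernel_def grushin_const_def by (simp only:)
qed

lemma nn_integral_lborel_pair:
  fixes f :: "'a::euclidean_space \<times> 'b::euclidean_space \<Rightarrow> ennreal"
  assumes [measurable]: "f \<in> borel_measurable borel"
  shows "(\<integral>\<^sup>+v. f v \<partial>lborel) = (\<integral>\<^sup>+w. \<integral>\<^sup>+z. f (w, z) \<partial>lborel \<partial>lborel)"
  by (subst lborel_prod[symmetric], rule lborel.nn_integral_fst[symmetric]) (simp add: lborel_prod)

lemma grushin_K_measurable:
  fixes g h :: "'x \<Rightarrow> (real^'n) \<times> (real^'k)"
  assumes [measurable]: "f \<in> borel_measurable M" and g: "g \<in> borel_measurable M" and h: "h \<in> borel_measurable M"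
  shows "(\<lambda>p. grushin_K (f p) (g p) (h p)) \<in> borel_measurable M"
proof -
  have *: "(fst :: (real^'n) \<times> (real^'k) \<Rightarrow> _) \<in> borel_measurable borel" "(snd :: (real^'n) \<times> (real^'k) \<Rightarrow> _) \<in> borel_measurable borel"
    by (intro borel_measurable_continuous_onI continuous_intros)+
  note [measurable] = measurable_compose[OF g *(1)] measurable_compose[OF g *(2)]
    measurable_compose[OF h *(1)] measurable_compose[OF h *(2)]
  show ?thesis unfolding grushin_K_def by measurable
qed

lemma grushin_heat_kernel_space:
  "heat_kernel_space (grushin_K :: real \<Rightarrow> (real^'n) \<times> (real^'k) \<Rightarrow> _)
     (real CARD('n) / 2 + real CARD('k)) (grushin_bound TYPE('n) TYPE('k))"
proof
  let ?c = "grushin_const TYPE('n) TYPE('k)"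
  let ?K = "grushin_K :: real \<Rightarrow> (real^'n) \<times> (real^'k) \<Rightarrow> _"
  have c: "0 < ?c" by (rule grushin_const_pos)
  note [measurable] = grushin_K_measurable
  show "(\<lambda>(t, z, v). ?K t z v) \<in> borel_measurable (borel \<Otimes>\<^sub>M borel \<Otimes>\<^sub>M borel)" by measurable
  show "0 < real CARD('n) / 2 + real CARD('k)" by (intro add_pos_pos) auto
  fix t :: real and z v :: "(real^'n) \<times> (real^'k)" assume t: "0 < t"
  show "0 \<le> ?K t z v" using c t by (simp add: grushin_K_def grushin_cos_nonneg)
  show "?K t z v = ?K t v z"
    unfolding grushin_K_def by (subst grushin_cos_commute) simp
  show "?K t z v \<le> grushin_bound TYPE('n) TYPE('k) * t powr - (real CARD('n) / 2 + real CARD('k))"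
    using mult_left_mono[OF grushin_cos_le[OF t, of "fst z" "fst v" "snd z - snd v"], of ?c] c
    by (simp add: grushin_K_def grushin_bound_def mult.assoc)
  show "(\<lambda>n. ?K (f n) z v) \<longlonglongrightarrow> ?K t z v" if "f \<longlonglongrightarrow> t" for f
    unfolding grushin_K_def by (intro tendsto_mult tendsto_const grushin_cos_continuous t that)
  show "(\<integral>\<^sup>+v. ennreal (?K t z v) \<partial>lborel) = 1"
  proof -
    \<comment> \<open>The change of variable from y to \<open>snd z\<close> - y leaves the mass in
      the last argument, a heat kernel in the first component; its mass in \<open>w\<close> then
      cancels the normalising constant.\<close>
    have in1: "(\<integral>\<^sup>+y. ennreal (?K t z (w, y)) \<partial>lborel) = ennreal (?c * (2 * pi) ^ CARD('k)) * ennreal (heat_kernel t (fst z) w)" for w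
    proof -
      have "(\<integral>\<^sup>+y. ennreal (?K t z (w, y)) \<partial>lborel) = (\<integral>\<^sup>+y. ennreal ?c * ennreal (grushin_cos t (fst z) w (snd z + (- 1) *\<^sub>R y)) \<partial>lborel)"
        using c t by (intro nn_integral_cong) (simp add: grushin_K_def ennreal_mult grushin_cos_nonneg)
      also have "\<dots> = ennreal ?c * (\<integral>\<^sup>+y. ennreal (grushin_cos t (fst z) w (snd z + (- 1) *\<^sub>R y)) \<partial>lborel)"
        by (intro nn_integral_cmult) measurable
      also have "(\<integral>\<^sup>+y. ennreal (grushin_cos t (fst z) w (snd z + (- 1) *\<^sub>R y)) \<partial>lborel) = (\<integral>\<^sup>+y. ennreal (grushin_cos t (fst z) w (y :: real^'k)) \<partial>lborel)"
        using nn_integral_lborel_affine[of "\<lambda>y. ennreal (grushin_cos t (fst z) w y)" "- 1" "snd z"] by simp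
      also have "\<dots> = ennreal ((2 * pi) ^ CARD('k) * heat_kernel t (fst z) w)"
        using grushin_cos_mass_y[OF t, of "fst z" w, where 'b="real^'k"] by simp
      finally show ?thesis
        using c by (simp add: heat_kernel_def mult.assoc flip: ennreal_mult)
    qed
    have "(\<integral>\<^sup>+v. ennreal (?K t z v) \<partial>lborel) = (\<integral>\<^sup>+w. ennreal (?c * (2 * pi) ^ CARD('k)) * ennreal (heat_kernel t (fst z) w) \<partial>lborel)"
      by (subst nn_integral_lborel_pair) (measurable, simp only: in1)
    also have "\<dots> = ennreal (?c * (2 * pi) ^ CARD('k)) * (\<integral>\<^sup>+w. ennreal (heat_kernel t (fst z) w) \<partial>lborel)"
      unfolding heat_kernel_def by (intro nn_integral_cmult) measurable
    also have "\<dots> = ennreal (?c * (2 * pi) ^ CARD('k)) * ennreal ((2 * pi) powr (real CARD('n) / 2))"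
      by (simp add: heat_kernel_mass[OF t])
    also have "\<dots> = ennreal (?c * ((2 * pi) ^ CARD('k) * (2 * pi) powr (real CARD('n) / 2)))"
      using c by (simp add: mult.assoc flip: ennreal_mult)
    finally show ?thesis unfolding grushin_const_normalises ennreal_1 .
  qed
  fix s :: real and z' :: "(real^'n) \<times> (real^'k)" assume s: "0 < s"
  show "(\<integral>\<^sup>+v. ennreal (?K t z v * ?K s v z') \<partial>lborel) = ennreal (?K (t + s) z z')"
  proof -
    let ?g = "\<lambda>w y. grushin_cos t (fst z) w ((snd z - snd z') - y) * grushin_cos s w (fst z') y"
    have g0: "0 \<le> ?g w y" for w y using t s by (simp add: grushin_cos_nonneg)
    \<comment> \<open>Translation by \<open>snd z'\<close> brings the integral into the form of the
      Chapman-Kolmogorov equation with Y = \<open>snd z - snd z'\<close>.\<close>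
    have in1: "(\<integral>\<^sup>+y. ennreal (?K t z (w, y) * ?K s (w, y) z') \<partial>lborel) = ennreal (?c * ?c) * (\<integral>\<^sup>+y. ennreal (?g w y) \<partial>lborel)" for w
    proof -
      have "(\<integral>\<^sup>+y. ennreal (?K t z (w, y) * ?K s (w, y) z') \<partial>lborel) = (\<integral>\<^sup>+y. ennreal (?K t z (w, snd z' + 1 *\<^sub>R y) * ?K s (w, snd z' + 1 *\<^sub>R y) z') \<partial>lborel)"
      proof -
        have "(\<lambda>y. ennreal (?K t z (w, y) * ?K s (w, y) z')) \<in> borel_measurable borel" by measurable
        from nn_integral_lborel_affine[OF this, of 1 "snd z'"] show ?thesis
          by (simp only: abs_one power_one ennreal_1 mult_1_left one_neq_zero not_False_eq_True)
      qed
      also have "\<dots> = (\<integral>\<^sup>+y. ennreal (?c * ?c) * ennreal (?g w y) \<partial>lborel)"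
      proof (rule nn_integral_cong)
        fix y
        have eq: "?K t z (w, snd z' + 1 *\<^sub>R y) * ?K s (w, snd z' + 1 *\<^sub>R y) z' = (?c * ?c) * ?g w y"
          unfolding grushin_K_def by (simp add: diff_diff_eq)
        show "ennreal (?K t z (w, snd z' + 1 *\<^sub>R y) * ?K s (w, snd z' + 1 *\<^sub>R y) z') = ennreal (?c * ?c) * ennreal (?g w y)"
          unfolding eq by (intro ennreal_mult mult_nonneg_nonneg g0 less_imp_le[OF c])
      qed
      also have "\<dots> = ennreal (?c * ?c) * (\<integral>\<^sup>+y. ennreal (?g w y) \<partial>lborel)"
        by (intro nn_integral_cmult) measurable
      finally show ?thesis .
    qed
    have "(\<integral>\<^sup>+v. ennreal (?K t z v * ?K s v z') \<partial>lborel) = (\<integral>\<^sup>+w. ennreal (?c * ?c) * (\<integral>\<^sup>+y. ennreal (?g w y) \<partial>lborel) \<partial>lborel)"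
      by (subst nn_integral_lborel_pair) (measurable, simp only: in1)
    also have "\<dots> = ennreal (?c * ?c) * (\<integral>\<^sup>+w. (\<integral>\<^sup>+y. ennreal (?g w y) \<partial>lborel) \<partial>lborel)"
      by (intro nn_integral_cmult) measurable
    also have "\<dots> = ennreal (?c * ?c) * ennreal ((2 * pi) ^ CARD('k) * (2 * pi) powr (real CARD('n) / 2) * grushin_cos (t + s) (fst z) (fst z') (snd z - snd z'))"
      by (simp add: grushin_cos_chapman_kolmogorov[OF t s])
    also have "\<dots> = ennreal ((?c * ?c) * ((2 * pi) ^ CARD('k) * (2 * pi) powr (real CARD('n) / 2) * grushin_cos (t + s) (fst z) (fst z') (snd z - snd z')))"
      using c t s by (intro ennreal_mult[symmetric]) (auto simp: grushin_cos_nonneg)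
    also have "(?c * ?c) * ((2 * pi) ^ CARD('k) * (2 * pi) powr (real CARD('n) / 2) * grushin_cos (t + s) (fst z) (fst z') (snd z - snd z')) =
       (?c * ((2 * pi) ^ CARD('k) * (2 * pi) powr (real CARD('n) / 2))) * (?c * grushin_cos (t + s) (fst z) (fst z') (snd z - snd z'))"
      by (simp only: mult_ac)
    also have "\<dots> = ?K (t + s) z z'" unfolding grushin_const_normalises by (simp add: grushin_K_def)
    finally show ?thesis .
  qed
qed

text \<open>The difference splits into the semigroup applied to the increment of the source, handled
  by contraction and the Lipschitz bound, and the increment of the semigroup on the fixed source at
  \<open>s\<close>. This continuity makes the mild integrand Bochner integrable.\<close>

lemma (in semilinear_heat) mild_integrand_tendsto:
  assumes U: "mild u0 \<tau> U" and u0: "Lp_le p u0 c" and s: "0 < s" "s < t" "t \<le> \<tau>"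
    and x: "\<And>n. 0 < x n" "\<And>n. x n < t" "x \<longlonglongrightarrow> s"
  shows "(\<lambda>n. Lp_norm p (\<lambda>z. S (t - x n) (source U (x n)) z - S (t - s) (source U s) z)) \<longlonglongrightarrow> 0"
proof -
  obtain R where R: "0 < R" "\<And>r. s / 2 \<le> r \<Longrightarrow> r \<le> \<tau> \<Longrightarrow> Lp_le q (U r) R"
    using mild_bound[OF U, of "s / 2"] s by auto
  define D where "D = (\<lambda>n. Lp_norm q (\<lambda>z. U (x n) z - U s z))"
  have D: "D \<longlonglongrightarrow> 0"
    unfolding D_def using s x by (intro mild_tendsto_q[OF U u0]) (auto intro: less_imp_le less_le_trans)
  have lim: "(\<lambda>n. t - x n) \<longlonglongrightarrow> t - s" by (intro tendsto_intros x)
  have gs: "Lp_le p (source U s) (R powr \<rho>)" using s by (intro source_Lp R) auto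
  have ts: "0 < t - s" using s by simp
  have tx: "0 < t - x n" for n using x(2)[of n] by simp
  obtain b where b: "\<And>n. Lp_le p (\<lambda>z. S (t - x n) (source U s) z - S (t - s) (source U s) z) (b n)" "b \<longlonglongrightarrow> 0"
    using S_tendsto[OF ts lim tx gs p] by blast
  have "eventually (\<lambda>n. s / 2 < x n) sequentially" using s by (intro order_tendstoD(1)[OF x(3)]) auto
  then have ev: "eventually (\<lambda>n. Lp_norm p (\<lambda>z. S (t - x n) (source U (x n)) z - S (t - s) (source U s) z) \<le> \<rho> * ((R + R) powr (\<rho> - 1) * D n) + b n) sequentially"
  proof eventually_elim
    case (elim n)
    have xn: "x n \<le> \<tau>" using x(2)[of n] s by simp
    have Ux: "Lp_le q (U (x n)) R" using elim xn by (intro R) auto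
    have Us: "Lp_le q (U s) R" using s by (intro R) auto
    have Ud: "Lp_le q (\<lambda>z. U (x n) z - U s z) (D n)"
      using Lp_le_imp_Lp(1)[OF Lp_le_diff[OF Ux Us exponents(1)] exponents(3)] exponents(3)
      unfolding D_def by (rule Lp_le_Lp_norm)
    have gd: "Lp_le p (\<lambda>z. source U (x n) z - source U s z) (\<rho> * ((R + R) powr (\<rho> - 1) * D n))"
      using Lp_le_signed_powr_diff[OF Ux[unfolded q_def] Us[unfolded q_def] Ud[unfolded q_def] rho p] .
    have "S (t - x n) (\<lambda>z. source U (x n) z - source U s z) = (\<lambda>z. S (t - x n) (source U (x n)) z - S (t - x n) (source U s) z)"
      using S_diff[OF tx source_Lp[OF Ux] gs p] by (intro ext)
    with S_Lp[OF tx[of n] gd p] have "Lp_le p (\<lambda>z. S (t - x n) (source U (x n)) z - S (t - x n) (source U s) z) (\<rho> * ((R + R) powr (\<rho> - 1) * D n))"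
      by simp
    from Lp_le_triangle[OF this b(1) p] show ?case using p by (simp add: Lp_le_iff)
  qed
  have "(\<lambda>n. \<rho> * ((R + R) powr (\<rho> - 1) * D n) + b n) \<longlonglongrightarrow> \<rho> * ((R + R) powr (\<rho> - 1) * 0) + 0"
    by (intro tendsto_intros D b)
  then have lim': "(\<lambda>n. \<rho> * ((R + R) powr (\<rho> - 1) * D n) + b n) \<longlonglongrightarrow> 0" by simp
  show ?thesis
    by (rule tendsto_sandwich[OF _ ev tendsto_const lim']) (simp add: Lp_norm_nonneg)
qed

section \<open>The Grushin heat equation\<close>

locale grushin_problem =
  fixes \<rho> p :: real and u0 :: "(real^'n) \<times> (real^'k) \<Rightarrow> real"
  assumes rho: "1 < \<rho>" and p: "1 \<le> p"
    and subcritical: "real (CARD('n) + 2 * CARD('k)) / 2 * (\<rho> - 1) < p"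
    and initial: "u0 \<in> Lp p"

sublocale grushin_problem \<subseteq> heat: semilinear_heat "grushin_K :: real \<Rightarrow> (real^'n) \<times> (real^'k) \<Rightarrow> _"
  "real CARD('n) / 2 + real CARD('k)" "grushin_bound TYPE('n) TYPE('k)" \<rho> p
proof (rule semilinear_heat.intro[OF grushin_heat_kernel_space], unfold_locales)
  show "1 < \<rho>" "1 \<le> p" using rho p by auto
  have "real CARD('n) / 2 + real CARD('k) = real (CARD('n) + 2 * CARD('k)) / 2" by simp
  then show "(real CARD('n) / 2 + real CARD('k)) * (\<rho> - 1) < p" using subcritical by (simp only:)
qed

context grushin_problem
begin

lemma initial_le: "Lp_le p u0 (Lp_norm p u0)"
  using initial p by (intro Lp_le_Lp_norm) auto

lemma p_pos: "0 < p" using p by simp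

section \<open>From Bochner integrals to pointwise integrals and back\<close>

lemma grushin_semigroup_eq:
  fixes \<phi> :: "(real^'n) \<times> (real^'k) \<Rightarrow> real"
  shows "0 < t \<Longrightarrow> grushin_semigroup t \<phi> = heat.S t \<phi>"
  by (auto simp: grushin_semigroup_def heat.S_def grushin_kernel_eq grushin_K_def fun_eq_iff case_prod_unfold)

lemma grushin_alpha_eq: "grushin_alpha CARD('n) CARD('k) \<rho> p = heat.\<alpha>"
proof -
  have "2 * D / (2 * \<rho> * p) * (\<rho> - 1) = D * (\<rho> - 1) / p / \<rho>" for D
    using rho p by (simp add: field_simps)
  moreover have "real (CARD('n) + 2 * CARD('k)) = 2 * (real CARD('n) / 2 + real CARD('k))" by simp
  ultimately show ?thesis unfolding grushin_alpha_def heat.\<alpha>_def heat.\<beta>_def by (simp only:)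
qed

lemma q_eq: "\<rho> * p = heat.q" by (simp add: heat.q_def)

lemma grushin_source_eq: "(\<lambda>x. \<bar>v x\<bar> powr (\<rho> - 1) * v x) = (\<lambda>x. signed_powr \<rho> (v x))"
  by (simp add: signed_powr_def)

text \<open>Continuity in L^p on [0, \<tau>] provides a jointly measurable version, along which the
  Bochner integral in the equation is the pointwise Duhamel term. The initial value is read off from
  the equation on the null interval [0, 0].\<close>

lemma XE_solution_imp_mild:
  assumes u: "XE_solution \<rho> p u0 \<tau> u" and \<tau>: "0 < \<tau>"
  shows "\<exists>U. heat.mild u0 \<tau> U \<and> (\<forall>t\<in>{0<..\<tau>}. AE z in lborel. u t z = U t z)"
    "AE z in lborel. u 0 z = u0 z"
proof -
  have cont: "Lp_continuous_on {0..\<tau>} p u"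
    and eqn: "\<And>t. t \<in> {0..\<tau>} \<Longrightarrow> \<exists>I. has_Lp_integral (time_measure t) p (\<lambda>s. grushin_semigroup (t - s) (\<lambda>x. signed_powr \<rho> (u s x))) I \<and>
        (AE z in lborel. u t z = grushin_semigroup t u0 z + I z)"
    and contq: "Lp_continuous_on {0<..\<tau>} heat.q u" and X: "X_norm \<rho> p \<tau> u < \<infinity>"
    using u by (auto simp: XE_solution_def mild_solution_def X_space_def grushin_source_eq q_eq)
  obtain U where jU: "jointly_measurable U" and U: "\<And>t. t \<in> {0..\<tau>} \<Longrightarrow> AE z in lborel. U t z = u t z"
    using Lp_path_joint_version[OF cont p] by blast
  have um: "u t \<in> borel_measurable borel" if "t \<in> {0..\<tau>}" for t
    using cont that by (auto simp: Lp_continuous_on_def Lp_def)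
  have Um: "U t \<in> borel_measurable borel" for t using jU by (rule jointly_measurable_section)
  have bound: "Lp_le heat.q (U t) (enn2real (X_norm \<rho> p \<tau> u) * t powr - heat.\<alpha>)" if t: "t \<in> {0<..\<tau>}" for t
  proof -
    have uq: "u t \<in> Lp heat.q" using contq t by (auto simp: Lp_continuous_on_def)
    have "ennreal (t powr heat.\<alpha>) * eLp_norm heat.q (u t) \<le> X_norm \<rho> p \<tau> u"
      unfolding X_norm_def grushin_alpha_eq q_eq using t by (intro SUP_upper)
    then have "ennreal (t powr heat.\<alpha> * Lp_norm heat.q (u t)) \<le> ennreal (enn2real (X_norm \<rho> p \<tau> u))"
      using uq X by (simp add: eLp_norm_def ennreal_mult Lp_norm_nonneg)
    then have "t powr heat.\<alpha> * Lp_norm heat.q (u t) \<le> enn2real (X_norm \<rho> p \<tau> u)"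
      by (simp add: ennreal_le_iff)
    then have "Lp_norm heat.q (u t) \<le> enn2real (X_norm \<rho> p \<tau> u) * t powr - heat.\<alpha>"
      using t by (simp add: powr_minus field_simps)
    then have "Lp_le heat.q (u t) (enn2real (X_norm \<rho> p \<tau> u) * t powr - heat.\<alpha>)"
      using uq heat.exponents(3) by (simp add: Lp_le_iff)
    then show ?thesis
      by (rule Lp_le_cong_AE) (use U t Um heat.exponents(3) in auto)
  qed
  have mild: "AE z in lborel. U t z = heat.S t u0 z + heat.duhamel 0 t t (heat.source U) z" if t: "t \<in> {0<..\<tau>}" for t
  proof -
    obtain I where I: "has_Lp_integral (time_measure t) p (\<lambda>s. grushin_semigroup (t - s) (\<lambda>x. signed_powr \<rho> (u s x))) I"
      "AE z in lborel. u t z = grushin_semigroup t u0 z + I z"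
      using eqn[of t] t by auto
    let ?h = "\<lambda>s z. indicator {0<..<t} s * heat.S (t - s) (heat.source U s) z"
    have "AE z in lborel. I z = (\<integral>s. ?h s z \<partial>lborel)"
    proof (rule has_Lp_integral_unique[OF I(1) p])
      show "jointly_measurable ?h" by (intro heat.jointly_measurable_S heat.jointly_measurable_source jU)
      show "?h s = (\<lambda>z. 0)" if "\<not> (0 < s \<and> s < t)" for s using that by auto
      fix s assume s: "0 < s" "s < t"
      have st: "s \<in> {0..\<tau>}" using s t by auto
      have meas: "(\<lambda>x. signed_powr \<rho> (v x)) \<in> borel_measurable borel" if "v \<in> borel_measurable borel" for v :: "(real^'n) \<times> (real^'k) \<Rightarrow> real"
        by (rule measurable_compose[OF that signed_powr_measurable])
      have "AE x in lborel. signed_powr \<rho> (u s x) = heat.source U s x"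
        using U[OF st] by eventually_elim simp
      then have "heat.S (t - s) (\<lambda>x. signed_powr \<rho> (u s x)) z = heat.S (t - s) (heat.source U s) z" for z
        by (rule heat.S_cong_AE) (intro meas um[OF st] Um)+
      then show "grushin_semigroup (t - s) (\<lambda>x. signed_powr \<rho> (u s x)) = ?h s"
        using s by (simp add: grushin_semigroup_eq fun_eq_iff)
    qed
    moreover have "t \<in> {0..\<tau>}" using t by simp
    note U[OF this]
    ultimately show ?thesis
      using I(2) t by (auto simp: grushin_semigroup_eq heat.duhamel_def elim!: eventually_elim2)
  qed
  have "heat.mild u0 \<tau> U"
    unfolding heat.mild_def using jU bound mild by blast
  moreover have "AE z in lborel. u t z = U t z" if "t \<in> {0<..\<tau>}" for t
    by (rule eventually_mono[OF U[of t]]) (use that in simp_all)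
  ultimately show "\<exists>U. heat.mild u0 \<tau> U \<and> (\<forall>t\<in>{0<..\<tau>}. AE z in lborel. u t z = U t z)" by blast
  obtain I where I: "has_Lp_integral (time_measure 0) p (\<lambda>s. grushin_semigroup (0 - s) (\<lambda>x. signed_powr \<rho> (u s x))) I"
    "AE z in lborel. u 0 z = grushin_semigroup 0 u0 z + I z"
    using eqn[of 0] \<tau> by auto
  have "AE z in lborel. I z = 0"
    using has_Lp_integral_unique[OF I(1) p, of "\<lambda>s z. 0"] by (simp add: case_prod_unfold)
  with I(2) show "AE z in lborel. u 0 z = u0 z"
    by eventually_elim (simp add: grushin_semigroup_def)
qed

text \<open>Continuity at time \<open>0\<close> is inherited from a given solution; at positive times it follows from
  the equation.\<close>

lemma mild_imp_XE_solution:
  assumes U: "heat.mild u0 \<tau> U" and \<tau>: "0 < \<tau>"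
    and wm: "\<And>t. t \<in> {0..\<tau>} \<Longrightarrow> w t \<in> borel_measurable borel"
    and wU: "\<And>t. t \<in> {0<..\<tau>} \<Longrightarrow> AE z in lborel. w t z = U t z"
    and u: "XE_solution \<rho> p u0 T u" and T: "0 < T" and wu: "\<And>t. t \<in> {0..T} \<Longrightarrow> t \<le> \<tau> \<Longrightarrow> w t = u t"
  shows "XE_solution \<rho> p u0 \<tau> w"
proof -
  obtain M where jU: "jointly_measurable U" and M: "\<And>t. 0 < t \<Longrightarrow> t \<le> \<tau> \<Longrightarrow> Lp_le heat.q (U t) (M * t powr - heat.\<alpha>)"
    using heat.mildE[OF U] by blast
  have Um: "U t \<in> borel_measurable borel" for t using jU by (rule jointly_measurable_section)
  have ucont: "Lp_continuous_on {0..T} p u" using u by (simp add: XE_solution_def mild_solution_def)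
  have normeq: "Lp_norm r (\<lambda>z. w s z - w t z) = Lp_norm r (\<lambda>z. U s z - U t z)"
    if "s \<in> {0<..\<tau>}" "t \<in> {0<..\<tau>}" for r s t
  proof (rule Lp_norm_cong_AE)
    show "AE z in lborel. w s z - w t z = U s z - U t z"
      using wU[OF that(1)] wU[OF that(2)] by eventually_elim simp
  qed (use wm[of s] wm[of t] Um that in auto)
  have wq: "Lp_le heat.q (w t) (M * t powr - heat.\<alpha>)" if "t \<in> {0<..\<tau>}" for t
    using M[of t] that wU[OF that] wm[of t] heat.exponents(3) by (auto intro: Lp_le_cong_AE)
  have contq: "Lp_continuous_on {0<..\<tau>} (\<rho> * p) w"
    unfolding Lp_continuous_on_def q_eq
  proof (intro conjI ballI)
    fix t assume t: "t \<in> {0<..\<tau>}"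
    show "w t \<in> Lp heat.q" using wq[OF t] heat.exponents(3) by (rule Lp_le_imp_Lp(1))
    show "((\<lambda>s. Lp_norm heat.q (\<lambda>x. w s x - w t x)) \<longlongrightarrow> 0) (at t within {0<..\<tau>})"
      unfolding tendsto_at_iff_sequentially o_def
    proof (intro allI impI)
      fix X :: "nat \<Rightarrow> real" assume X: "\<forall>i. X i \<in> {0<..\<tau>} - {t}" "X \<longlonglongrightarrow> t"
      have "(\<lambda>n. Lp_norm heat.q (\<lambda>x. U (X n) x - U t x)) \<longlonglongrightarrow> 0"
        using X t by (intro heat.mild_tendsto_q[OF U initial_le]) auto
      moreover have "Lp_norm heat.q (\<lambda>x. w (X n) x - w t x) = Lp_norm heat.q (\<lambda>x. U (X n) x - U t x)" for n
        using X t by (intro normeq) auto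
      ultimately show "(\<lambda>n. Lp_norm heat.q (\<lambda>x. w (X n) x - w t x)) \<longlonglongrightarrow> 0" by simp
    qed
  qed
  have cont: "Lp_continuous_on {0..\<tau>} p w"
    unfolding Lp_continuous_on_def
  proof (intro conjI ballI)
    fix t assume t: "t \<in> {0..\<tau>}"
    have w0: "w 0 = u 0" using wu[of 0] T \<tau> by simp
    show "w t \<in> Lp p"
    proof (cases "t = 0")
      case True
      then show ?thesis using ucont T w0 by (auto simp: Lp_continuous_on_def)
    next
      case False
      obtain c where "Lp_le p (U t) c"
        using heat.mild_Lp[OF U _ _ initial_le, of t] t False by auto
      then have "Lp_le p (w t) c"
        by (rule Lp_le_cong_AE) (use wU[of t] wm[of t] t False p_pos in auto)
      then show ?thesis using p_pos by (rule Lp_le_imp_Lp(1))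
    qed
    show "((\<lambda>s. Lp_norm p (\<lambda>x. w s x - w t x)) \<longlongrightarrow> 0) (at t within {0..\<tau>})"
      unfolding tendsto_at_iff_sequentially o_def
    proof (intro allI impI)
      fix X :: "nat \<Rightarrow> real" assume X: "\<forall>i. X i \<in> {0..\<tau>} - {t}" "X \<longlonglongrightarrow> t"
      show "(\<lambda>n. Lp_norm p (\<lambda>x. w (X n) x - w t x)) \<longlonglongrightarrow> 0"
      proof (cases "t = 0")
        case True
        \<comment> \<open>Eventually X n < T, where \<open>w\<close> is \<open>u\<close>; the
          default keeps \<open>f\<close> inside [0, T], where \<open>u\<close> is known to be
          continuous.\<close>
        define f where "f = (\<lambda>n. if X n \<le> T then X n else 0)"
        have ev: "eventually (\<lambda>n. X n < T) sequentially" using X(2) T True by (intro order_tendstoD(2)) auto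
        have f: "f \<longlonglongrightarrow> 0"
          using X(2) unfolding True by (rule Lim_transform_eventually) (use ev in \<open>auto elim!: eventually_mono simp: f_def\<close>)
        have "(\<lambda>n. Lp_norm p (\<lambda>x. u (f n) x - u 0 x)) \<longlonglongrightarrow> 0"
          using X T by (intro Lp_continuous_on_sequentially[OF ucont _ _ f p_pos]) (auto simp: f_def)
        then show ?thesis
        proof (rule Lim_transform_eventually)
          show "eventually (\<lambda>n. Lp_norm p (\<lambda>x. u (f n) x - u 0 x) = Lp_norm p (\<lambda>x. w (X n) x - w t x)) sequentially"
            using ev
          proof eventually_elim
            case (elim n)
            have "w (X n) = u (X n)" using X elim by (intro wu) auto
            then show ?case using elim True w0 by (simp add: f_def)
          qed
        qed
      next
        case False
        then have t0: "t \<in> {0<..\<tau>}" using t by auto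
        define f where "f = (\<lambda>n. if 0 < X n then X n else t)"
        have ev: "eventually (\<lambda>n. 0 < X n) sequentially" using X(2) t0 by (intro order_tendstoD(1)) auto
        have f: "f \<longlonglongrightarrow> t"
          using X(2) by (rule Lim_transform_eventually) (use ev in \<open>auto elim!: eventually_mono simp: f_def\<close>)
        have "(\<lambda>n. Lp_norm p (\<lambda>x. U (f n) x - U t x)) \<longlonglongrightarrow> 0"
          using X t0 f by (intro heat.mild_tendsto_p[OF U initial_le]) (auto simp: f_def)
        then show ?thesis
        proof (rule Lim_transform_eventually)
          show "eventually (\<lambda>n. Lp_norm p (\<lambda>x. U (f n) x - U t x) = Lp_norm p (\<lambda>x. w (X n) x - w t x)) sequentially"
            using ev
          proof eventually_elim
            case (elim n)
            then show ?case using X t0 by (subst normeq) (auto simp: f_def)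
          qed
        qed
      qed
    qed
  qed
  have X: "X_norm \<rho> p \<tau> w < \<infinity>"
  proof -
    have "X_norm \<rho> p \<tau> w \<le> ennreal M"
      unfolding X_norm_def grushin_alpha_eq q_eq
    proof (rule SUP_least)
      fix t assume t: "t \<in> {0<..\<tau>}"
      have "ennreal (t powr heat.\<alpha>) * eLp_norm heat.q (w t) \<le> ennreal (t powr heat.\<alpha>) * ennreal (M * t powr - heat.\<alpha>)"
        using eLp_norm_Lp_le[OF wq[OF t] heat.exponents(3)] by (intro mult_left_mono) auto
      also have "\<dots> = ennreal (t powr heat.\<alpha> * (M * t powr - heat.\<alpha>))"
        using Lp_le_nonneg[OF wq[OF t]] by (intro ennreal_mult[symmetric]) auto
      also have "t powr heat.\<alpha> * (M * t powr - heat.\<alpha>) = M"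
        using t by (simp add: powr_minus)
      finally show "ennreal (t powr heat.\<alpha>) * eLp_norm heat.q (w t) \<le> ennreal M" .
    qed
    then show ?thesis by (rule le_less_trans) simp
  qed
  have "\<exists>I. has_Lp_integral (time_measure t) p (\<lambda>s. grushin_semigroup (t - s) (\<lambda>x. signed_powr \<rho> (w s x))) I \<and>
      (AE z in lborel. w t z = grushin_semigroup t u0 z + I z)" if t: "t \<in> {0..\<tau>}" for t
  proof (cases "t = 0")
    case True
    have "AE z in lborel. u 0 z = u0 z" by (rule XE_solution_imp_mild(2)[OF u T])
    moreover have "w 0 = u 0" using wu[of 0] T \<tau> by simp
    \<comment> \<open>Over a null interval the empty simple function approximates any
      integrand.\<close>
    moreover have "has_Lp_integral (time_measure 0) p f (\<lambda>z. 0)" for f :: "real \<Rightarrow> (real^'n) \<times> (real^'k) \<Rightarrow> real"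
    proof -
      have "(\<lambda>z::(real^'n) \<times> (real^'k). 0) \<in> Lp p" "eLp_norm p (\<lambda>z::(real^'n) \<times> (real^'k). 0) = 0"
        using p_pos by (auto simp: Lp_def eLp_norm_def Lp_norm_def)
      then show ?thesis
        unfolding has_Lp_integral_def nn_integral_time_measure
        by (intro conjI exI[of _ "\<lambda>n. []"]) (auto simp: Lp_simple_def simple_fun_def simple_integral_def intro!: AE_time_measure)
    qed
    ultimately show ?thesis using True by (intro exI[of _ "\<lambda>z. 0"]) (auto simp: grushin_semigroup_def)
  next
    case False
    then have t0: "0 < t" "t \<le> \<tau>" using t by auto
    let ?h = "\<lambda>s z. indicator {0<..<t} s * heat.S (t - s) (heat.source U s) z"
    have sing: "heat.singular_source t (heat.source U)"
      by (rule heat.singular_source_mono[OF heat.mild_singular_source[OF U] t0(2)])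
    obtain N where N: "\<And>s. 0 < s \<Longrightarrow> s < t \<Longrightarrow> Lp_le p (heat.source U s) (N * s powr - heat.\<beta>)"
      using heat.singular_sourceE[OF sing] by blast
    \<comment> \<open>Nonnegativity of \<open>N\<close> makes the majorant N s powr -\<beta>
      decreasing in s.\<close>
    have N0: "0 \<le> N"
      using Lp_le_nonneg[OF N[of "t / 2"]] t0 by (simp add: zero_le_mult_iff)
    have "has_Lp_integral (time_measure t) p (\<lambda>s. grushin_semigroup (t - s) (\<lambda>x. signed_powr \<rho> (w s x))) (\<lambda>z. \<integral>s. ?h s z \<partial>lborel)"
    proof (rule has_Lp_integral_continuous_path[OF t0(1) p, where m="\<lambda>s. N * s powr - heat.\<beta>"])
      show "jointly_measurable ?h" by (intro heat.jointly_measurable_S heat.jointly_measurable_source jU)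
      show "?h s = (\<lambda>z. 0)" if "\<not> (0 < s \<and> s < t)" for s using that by auto
      show "grushin_semigroup (t - s) (\<lambda>x. signed_powr \<rho> (w s x)) = ?h s" if s: "0 < s" "s < t" for s
      proof -
        have meas: "(\<lambda>x. signed_powr \<rho> (v x)) \<in> borel_measurable borel" if "v \<in> borel_measurable borel" for v :: "(real^'n) \<times> (real^'k) \<Rightarrow> real"
          by (rule measurable_compose[OF that signed_powr_measurable])
        have "AE x in lborel. signed_powr \<rho> (w s x) = heat.source U s x"
          using wU[of s] s t0 by (auto elim!: eventually_mono)
        then have "heat.S (t - s) (\<lambda>x. signed_powr \<rho> (w s x)) z = heat.S (t - s) (heat.source U s) z" for z
          by (rule heat.S_cong_AE[OF _ meas[OF wm] meas[OF Um]]) (use s t0 in auto)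
        then show ?thesis using s by (simp add: grushin_semigroup_eq fun_eq_iff)
      qed
      show "Lp_le p (?h s) (N * s powr - heat.\<beta>)" if "0 < s" "s < t" for s
        using heat.S_Lp[OF _ N[OF that] p, of "t - s"] that by simp
      have "integrable lborel (\<lambda>s. N * (indicator {0<..<t} s * s powr - heat.\<beta>))"
        using integrable_powr_kernel(3)[OF heat.exponents(5), of 0 t] t0 by (intro integrable_mult_right) auto
      then show "integrable lborel (\<lambda>s. indicator {0<..<t} s * (N * s powr - heat.\<beta>))"
        by (simp add: mult.left_commute)
      show "N * s' powr - heat.\<beta> \<le> N * s powr - heat.\<beta>" if "0 < s" "s \<le> s'" "s' < t" for s s'
        using that N0 heat.exponents(4) by (intro mult_left_mono powr_mono2') auto
      show "(\<lambda>n. Lp_norm p (\<lambda>z. ?h (x n) z - ?h s z)) \<longlonglongrightarrow> 0"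
        if "0 < s" "s < t" "\<And>n. 0 < x n" "\<And>n. x n < t" "x \<longlonglongrightarrow> s" for s x
        using heat.mild_integrand_tendsto[OF U initial_le that(1,2) t0(2) that(3-5)] that by simp
    qed
    moreover have "AE z in lborel. w t z = grushin_semigroup t u0 z + (\<integral>s. ?h s z \<partial>lborel)"
    proof -
      have "AE z in lborel. U t z = heat.S t u0 z + heat.duhamel 0 t t (heat.source U) z"
        using U t0 by (auto simp: heat.mild_def)
      moreover have "t \<in> {0<..\<tau>}" using t0 by simp
      note wU[OF this]
      ultimately show ?thesis
        using t0 by (auto simp: grushin_semigroup_eq heat.duhamel_def elim!: eventually_elim2)
    qed
    ultimately show ?thesis by blast
  qed
  then have "mild_solution \<rho> p u0 \<tau> w"
    unfolding mild_solution_def grushin_source_eq using cont by blast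
  then show ?thesis
    using contq X cont by (simp add: XE_solution_def X_space_def E_space_def)
qed

end

section \<open>Continuation and blow-up\<close>

locale grushin_solution = grushin_problem \<rho> p u0
  for \<rho> p :: real and u0 :: "(real^'n) \<times> (real^'k) \<Rightarrow> real" +
  fixes T :: real and u :: "real \<Rightarrow> (real^'n) \<times> (real^'k) \<Rightarrow> real"
  assumes T: "0 < T" and u: "XE_solution \<rho> p u0 T u"
begin

text \<open>Extensions are treated as integral solutions that agree almost everywhere with
  \<open>u\<close> on (0, T]. This common piece is the starting interval of the uniqueness lemma, so
  any two extensions agree as long as both live.\<close>

definition extends :: "real \<Rightarrow> (real \<Rightarrow> (real^'n) \<times> (real^'k) \<Rightarrow> real) \<Rightarrow> bool" where
  "extends \<tau> V \<longleftrightarrow> T \<le> \<tau> \<and> heat.mild u0 \<tau> V \<and> (\<forall>t\<in>{0<..T}. AE z in lborel. V t z = u t z)"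

lemma extends_T: "\<exists>V. extends T V"
proof -
  obtain V where V: "heat.mild u0 T V" "\<forall>t\<in>{0<..T}. AE z in lborel. u t z = V t z"
    using XE_solution_imp_mild(1)[OF u T] by blast
  have "AE z in lborel. V t z = u t z" if "t \<in> {0<..T}" for t
    using V(2)[rule_format, OF that] by eventually_elim simp
  then show ?thesis using V(1) by (auto simp: extends_def)
qed

lemma extends_unique:
  assumes V: "extends \<tau> V" and W: "extends \<sigma> W" and t: "0 < t" "t \<le> \<tau>" "t \<le> \<sigma>"
  shows "AE z in lborel. V t z = W t z"
proof (rule heat.mild_unique[OF _ _ initial_le T _ t(1) order_refl])
  show "heat.mild u0 t V" "heat.mild u0 t W"
    using V W t by (auto simp: extends_def intro: heat.mild_mono)
  fix s assume s: "0 < s" "s \<le> T"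
  have "AE z in lborel. V s z = u s z" "AE z in lborel. W s z = u s z"
    using V W s by (auto simp: extends_def)
  then show "AE z in lborel. V s z = W s z" by eventually_elim simp
qed

lemma extends_step:
  assumes "0 < A"
  shows "\<exists>h>0. \<forall>\<tau> V. extends \<tau> V \<longrightarrow> Lp_le heat.q (V \<tau>) A \<longrightarrow> (\<exists>W. extends (\<tau> + h) W)"
proof -
  obtain h where h: "0 < h" "\<And>\<tau> V. 0 < \<tau> \<Longrightarrow> heat.mild u0 \<tau> V \<Longrightarrow> Lp_le heat.q (V \<tau>) A \<Longrightarrow>
      \<exists>W. heat.mild u0 (\<tau> + h) W \<and> (\<forall>t\<in>{0<..\<tau>}. W t = V t)"
    using heat.mild_extend[OF initial_le assms] by blast
  have "\<exists>W. extends (\<tau> + h) W" if V: "extends \<tau> V" "Lp_le heat.q (V \<tau>) A" for \<tau> V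
  proof -
    obtain W where W: "heat.mild u0 (\<tau> + h) W" "\<forall>t\<in>{0<..\<tau>}. W t = V t"
      using h(2)[of \<tau> V] V T by (auto simp: extends_def)
    have "extends (\<tau> + h) W"
      using V W h(1) by (auto simp: extends_def)
    then show ?thesis by blast
  qed
  then show ?thesis using h(1) by blast
qed

text \<open>The L^q norm at the final time of an extension is finite, so a further step of positive
  length is always possible.\<close>

lemma extends_longer:
  assumes V: "extends \<tau> V"
  shows "\<exists>\<sigma>>\<tau>. \<exists>W. extends \<sigma> W"
proof -
  have \<tau>: "0 < \<tau>" "heat.mild u0 \<tau> V" using V T by (auto simp: extends_def)
  obtain R where "0 < R" "Lp_le heat.q (V \<tau>) R"
    using heat.mild_bound[OF \<tau>(2,1)] by auto
  then obtain h W where "0 < h" "extends (\<tau> + h) W" using extends_step V by blast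
  then show ?thesis by (intro exI[of _ "\<tau> + h"]) auto
qed

lemma XE_solution_extends:
  assumes v: "XE_solution \<rho> p u0 \<tau> v" and \<tau>: "T \<le> \<tau>" and vu: "agree_on {0..T} v u"
  shows "\<exists>V. extends \<tau> V \<and> (\<forall>t\<in>{0<..\<tau>}. AE z in lborel. v t z = V t z)"
proof -
  have "0 < \<tau>" using T \<tau> by simp
  then obtain V where V: "heat.mild u0 \<tau> V" "\<forall>t\<in>{0<..\<tau>}. AE z in lborel. v t z = V t z"
    using XE_solution_imp_mild(1)[OF v] by blast
  have "AE z in lborel. V t z = u t z" if "t \<in> {0<..T}" for t
  proof -
    have "AE z in lborel. v t z = V t z" "AE z in lborel. v t z = u t z"
      using V(2) vu that \<tau> by (auto simp: agree_on_def)
    then show ?thesis by eventually_elim simp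
  qed
  then show ?thesis using V \<tau> by (auto simp: extends_def)
qed

lemma u_measurable: "t \<in> {0..T} \<Longrightarrow> u t \<in> borel_measurable borel"
  using u by (auto simp: XE_solution_def mild_solution_def Lp_continuous_on_def Lp_def)

text \<open>On [0, T] the function \<open>w\<close> is exactly \<open>u\<close>, from which it takes
  its continuity at time zero; later it may differ from \<open>V\<close> by a null set at each
  time.\<close>

lemma extends_XE_solution:
  assumes V: "extends \<tau> V" and \<sigma>: "0 < \<sigma>" "\<sigma> \<le> \<tau>"
    and w: "\<And>t. t \<in> {0..T} \<Longrightarrow> w t = u t"
      "\<And>t. t \<in> {0..\<sigma>} \<Longrightarrow> w t \<in> borel_measurable borel"
      "\<And>t. T < t \<Longrightarrow> t \<le> \<sigma> \<Longrightarrow> AE z in lborel. w t z = V t z"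
  shows "XE_solution \<rho> p u0 \<sigma> w"
proof (rule mild_imp_XE_solution[OF _ \<sigma>(1) w(2) _ u T w(1)])
  show "heat.mild u0 \<sigma> V" using V \<sigma> by (auto simp: extends_def intro: heat.mild_mono)
  fix t assume t: "t \<in> {0<..\<sigma>}"
  show "AE z in lborel. w t z = V t z"
  proof (cases "t \<le> T")
    case True
    then have "AE z in lborel. V t z = u t z" using V t by (auto simp: extends_def)
    then show ?thesis using w(1)[of t] True t by (auto elim!: eventually_mono)
  qed (use w(3) t in auto)
qed auto

lemma extends_measurable: "extends \<tau> V \<Longrightarrow> V t \<in> borel_measurable borel"
  by (auto simp: extends_def heat.mild_def intro: jointly_measurable_section)

text \<open>The continuation is literally \<open>u\<close> on [0, T] and an integral solution after
  that. A competitor in the class has an integral solution as a version, to which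
  \<open>extends_unique\<close> applies; at time zero both sides agree with
  \<open>u\<close>.\<close>

lemma unique_continuation:
  "\<exists>T'>T. \<exists>u'. continuation \<rho> p u0 T u T' u' \<and> u' \<in> X_space \<rho> p T' \<inter> E_space p T' \<and>
     (\<forall>v. continuation \<rho> p u0 T u T' v \<and> v \<in> X_space \<rho> p T' \<inter> E_space p T' \<longrightarrow> agree_on {0..T'} v u')"
proof -
  obtain T' V where T': "T < T'" and V: "extends T' V"
    using extends_longer extends_T by blast
  define u' where "u' = (\<lambda>t. if t \<le> T then u t else V t)"
  have XE: "XE_solution \<rho> p u0 T' u'"
    by (rule extends_XE_solution[OF V])
       (use T T' u_measurable extends_measurable[OF V] in \<open>auto simp: u'_def\<close>)
  have u'V: "AE z in lborel. u' t z = V t z" if "t \<in> {0<..T'}" for t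
  proof (cases "t \<le> T")
    case True
    then have "AE z in lborel. V t z = u t z" using V that by (auto simp: extends_def)
    then show ?thesis using True by (auto simp: u'_def elim!: eventually_mono)
  qed (simp add: u'_def)
  have agree: "agree_on {0..T} u' u" by (simp add: agree_on_def u'_def)
  have "agree_on {0..T'} v u'"
    if v: "continuation \<rho> p u0 T u T' v" "v \<in> X_space \<rho> p T' \<inter> E_space p T'" for v
  proof -
    have vu: "agree_on {0..T} v u" using v by (simp add: continuation_def)
    have "XE_solution \<rho> p u0 T' v" using v by (simp add: continuation_def XE_solution_def)
    then obtain W where W: "extends T' W" "\<forall>t\<in>{0<..T'}. AE z in lborel. v t z = W t z"
      using XE_solution_extends[OF _ less_imp_le[OF T'] vu] by blast
    have "AE z in lborel. v t z = u' t z" if t: "t \<in> {0..T'}" for t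
    proof (cases "t = 0")
      case True
      then show ?thesis using vu T by (simp add: agree_on_def u'_def)
    next
      case False
      then have t': "t \<in> {0<..T'}" using t by simp
      have "AE z in lborel. W t z = V t z" using t' by (intro extends_unique[OF W(1) V]) auto
      with W(2)[rule_format, OF t'] u'V[OF t'] show ?thesis by eventually_elim simp
    qed
    then show ?thesis by (simp add: agree_on_def)
  qed
  then show ?thesis
    using T' XE agree by (intro exI[of _ T'] conjI exI[of _ u']) (auto simp: continuation_def XE_solution_def)
qed

section \<open>Maximal time of existence and blow-up\<close>

definition maximal_time :: ereal where
  "maximal_time = (SUP \<tau>\<in>{\<tau>. \<exists>V. extends \<tau> V}. ereal \<tau>)"

lemma extends_le_maximal_time: "extends \<tau> V \<Longrightarrow> ereal \<tau> \<le> maximal_time"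
  unfolding maximal_time_def by (rule SUP_upper) blast

lemma T_less_maximal_time: "ereal T < maximal_time"
proof -
  obtain T' V where "T < T'" "extends T' V" using extends_longer extends_T by blast
  then have "ereal T < ereal T'" "ereal T' \<le> maximal_time" by (simp_all add: extends_le_maximal_time)
  then show ?thesis by (rule less_le_trans)
qed

lemma less_maximal_timeE:
  assumes "ereal t < maximal_time"
  shows "\<exists>\<tau> V. t < \<tau> \<and> extends \<tau> V"
  using assms unfolding maximal_time_def less_SUP_iff by auto

text \<open>Beyond \<open>T\<close> each time receives the value of some extension living strictly
  longer; by \<open>extends_unique\<close> the choice matters only up to null sets. Since joint
  measurability is demanded of the extensions alone, choosing separately at each time does no harm.
  The zero function past the maximal time is a default.\<close>

definition max_extension :: "real \<Rightarrow> (real^'n) \<times> (real^'k) \<Rightarrow> real" where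
  "max_extension t = (if t \<le> T then u t
     else if ereal t < maximal_time then (SOME v. \<exists>\<tau> V. t < \<tau> \<and> extends \<tau> V \<and> v = V t) else (\<lambda>z. 0))"

lemma max_extension_cases:
  assumes "T < t" "ereal t < maximal_time"
  shows "\<exists>\<tau> V. t < \<tau> \<and> extends \<tau> V \<and> max_extension t = V t"
proof -
  have "\<exists>v. \<exists>\<tau> V. t < \<tau> \<and> extends \<tau> V \<and> v = V t" using less_maximal_timeE[OF assms(2)] by blast
  from someI_ex[OF this] show ?thesis using assms by (simp add: max_extension_def)
qed

lemma max_extension_eq:
  assumes V: "extends \<tau> V" and t: "0 < t" "t \<le> \<tau>" "ereal t < maximal_time"
  shows "AE z in lborel. max_extension t z = V t z"
proof (cases "t \<le> T")
  case True
  then have "AE z in lborel. V t z = u t z" using V t by (auto simp: extends_def)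
  then show ?thesis using True by (auto simp: max_extension_def elim!: eventually_mono)
next
  case False
  then obtain \<sigma> W where W: "t < \<sigma>" "extends \<sigma> W" "max_extension t = W t"
    using max_extension_cases[of t] t by auto
  show ?thesis unfolding W(3) using W t by (intro extends_unique[OF W(2) V]) auto
qed

lemma max_extension_measurable: "0 \<le> t \<Longrightarrow> max_extension t \<in> borel_measurable borel"
proof (cases "T < t \<and> ereal t < maximal_time")
  case True
  then obtain \<sigma> W where "extends \<sigma> W" "max_extension t = W t"
    using max_extension_cases[of t] by auto
  then show ?thesis using extends_measurable by simp
next
  case False
  assume "0 \<le> t"
  then show ?thesis using False u_measurable[of t] by (auto simp: max_extension_def)
qed

text \<open>A solution reaching the maximal time would itself give an extension, and
  \<open>extends_longer\<close> would then produce one that outlives the supremum.\<close>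

lemma max_extension_maximal: "maximal_solution \<rho> p u0 maximal_time max_extension"
  unfolding maximal_solution_def
proof (intro conjI allI impI notI)
  show "0 < maximal_time" using T T_less_maximal_time by (metis ereal_less(2) less_trans)
next
  fix T' assume T': "0 < T'" "ereal T' < maximal_time"
  obtain \<tau> V where V: "T' < \<tau>" "extends \<tau> V" using less_maximal_timeE[OF T'(2)] by blast
  show "XE_solution \<rho> p u0 T' max_extension"
  proof (rule extends_XE_solution[OF V(2) T'(1)])
    show "T' \<le> \<tau>" using V by simp
    show "max_extension t = u t" if "t \<in> {0..T}" for t using that by (simp add: max_extension_def)
    show "max_extension t \<in> borel_measurable borel" if "t \<in> {0..T'}" for t
      using that by (intro max_extension_measurable) auto
    show "AE z in lborel. max_extension t z = V t z" if t: "T < t" "t \<le> T'" for t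
    proof (rule max_extension_eq[OF V(2)])
      show "ereal t < maximal_time" using t T'(2) by (metis ereal_less_eq(3) le_less_trans)
    qed (use t T V in auto)
  qed
next
  assume "\<exists>T' v. maximal_time \<le> ereal T' \<and> XE_solution \<rho> p u0 T' v \<and>
     agree_on {t. 0 \<le> t \<and> ereal t < maximal_time} v max_extension"
  then obtain T' v where T': "maximal_time \<le> ereal T'" and v: "XE_solution \<rho> p u0 T' v"
    and agree: "agree_on {t. 0 \<le> t \<and> ereal t < maximal_time} v max_extension" by blast
  have "ereal T < ereal T'" using T_less_maximal_time T' by (rule less_le_trans)
  then have TT': "T < T'" by simp
  have "agree_on {0..T} v u"
    unfolding agree_on_def
  proof
    fix t assume t: "t \<in> {0..T}"
    then have "ereal t < maximal_time" using T_less_maximal_time by (metis atLeastAtMost_iff ereal_less_eq(3) le_less_trans)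
    then have "AE z in lborel. v t z = max_extension t z" using agree t by (auto simp: agree_on_def)
    then show "AE z in lborel. v t z = u t z" using t by (simp add: max_extension_def)
  qed
  then obtain V where "extends T' V" using XE_solution_extends[OF v less_imp_le[OF TT']] by blast
  then obtain \<sigma> W where "T' < \<sigma>" "extends \<sigma> W" using extends_longer by blast
  then have "ereal \<sigma> \<le> ereal T'" using extends_le_maximal_time T' by (blast intro: order_trans)
  then show False using \<open>T' < \<sigma>\<close> by simp
qed

text \<open>A bounded \<open>L\<^sup>q\<close> norm at a time close to the maximal time would allow a time step beyond it.\<close>

lemma max_extension_blowup:
  assumes "maximal_time < \<infinity>"
  shows "filterlim (\<lambda>t. Lp_norm (\<rho> * p) (max_extension t)) at_top (at_left (real_of_ereal maximal_time))"
proof -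
  obtain r where r: "maximal_time = ereal r"
    using assms T_less_maximal_time by (cases maximal_time) auto
  have Tr: "T < r" using T_less_maximal_time by (simp add: r)
  show ?thesis
    unfolding filterlim_at_top r real_of_ereal.simps q_eq
  proof
    fix Z :: real
    \<comment> \<open>The step length is available for positive norm bounds only, while Z is
      arbitrary.\<close>
    define A where "A = max Z 1"
    have "0 < A" by (simp add: A_def)
    then obtain h where h: "0 < h" "\<And>\<tau> V. extends \<tau> V \<Longrightarrow> Lp_le heat.q (V \<tau>) A \<Longrightarrow> \<exists>W. extends (\<tau> + h) W"
      using extends_step by blast
    have "Z \<le> Lp_norm heat.q (max_extension t)" if t: "max T (r - h) < t" "t < r" for t
    proof (rule ccontr)
      assume "\<not> Z \<le> Lp_norm heat.q (max_extension t)"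
      then have small: "Lp_norm heat.q (max_extension t) \<le> A" by (simp add: A_def)
      have tm: "ereal t < maximal_time" using t by (simp add: r)
      obtain \<tau> V where V: "t < \<tau>" "extends \<tau> V" "max_extension t = V t"
        using max_extension_cases[of t] t tm by auto
      have Vt: "extends t V" using V t by (auto simp: extends_def intro: heat.mild_mono)
      have "heat.mild u0 t V" using Vt by (simp add: extends_def)
      moreover have "0 < t" using t T by simp
      ultimately obtain a where "Lp_le heat.q (V t) a" using heat.mildE by blast
      then have "Lp_le heat.q (V t) A"
        using small heat.exponents(3) by (simp add: Lp_le_iff V(3))
      then obtain W where "extends (t + h) W" using h(2)[OF Vt] by blast
      then have "t + h \<le> r" using extends_le_maximal_time[of "t + h" W] by (simp add: r)
      then show False using t by simp
    qed
    then show "eventually (\<lambda>t. Z \<le> Lp_norm heat.q (max_extension t)) (at_left r)"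
      unfolding eventually_at_left_field using Tr h(1) by (intro exI[of _ "max T (r - h)"]) auto
  qed
qed

end

theorem theorem3p4:
  fixes \<rho> p T :: real
    and u0 :: "(real^'n) \<times> (real^'k) \<Rightarrow> real"
    and u :: "real \<Rightarrow> (real^'n) \<times> (real^'k) \<Rightarrow> real"
  assumes "\<rho> > 1" and "p \<ge> 1"
    and "p > real (CARD('n) + 2 * CARD('k)) / 2 * (\<rho> - 1)"
    and "u0 \<in> Lp p"
    and "T > 0" and "XE_solution \<rho> p u0 T u"
  shows "(\<exists>T'>T. \<exists>u'.
            continuation \<rho> p u0 T u T' u' \<and> u' \<in> X_space \<rho> p T' \<inter> E_space p T' \<and>
            (\<forall>v. continuation \<rho> p u0 T u T' v \<and> v \<in> X_space \<rho> p T' \<inter> E_space p T' \<longrightarrow>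
                 agree_on {0..T'} v u')) \<and>
         (\<exists>Tm um. ereal T < Tm \<and> maximal_solution \<rho> p u0 Tm um \<and> agree_on {0..T} um u \<and>
            (Tm < \<infinity> \<longrightarrow>
               filterlim (\<lambda>t. Lp_norm (\<rho> * p) (um t)) at_top (at_left (real_of_ereal Tm))))"
proof -
  interpret grushin_solution \<rho> p u0 T u
    using assms by unfold_locales auto
  have "agree_on {0..T} max_extension u" by (simp add: agree_on_def max_extension_def)
  then show ?thesis
    using unique_continuation T_less_maximal_time max_extension_maximal max_extension_blowup by blast
qed

end
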